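(* Let $\kappa>0$, $\lambda\ge0$, $\varepsilon>0$ and $d_{HV}=d_{HV(\kappa,\lambda,\varepsilon)}$. The metric space $(L^2(0,1),d_{HV})$ is complete.
   Context: Let $\mathcal V=L^2((0,1),H^2(0,1)\cap H^1_0(0,1))$ (time in the outer interval, space in the inner one). For $f_0,f_1\in L^2(0,1)$ the set of admissible paths $\mathcal A(f_0,f_1)$ consists of all triples $(f,v,z)$ of functions of $(x,t)\in(0,1)\times(0,1)$ with $f\in L^2((0,1),L^2(0,1))\cap C([0,1],H^{-1}(0,1))$, $v\in\mathcal V$, $z\in L^2((0,1),L^2(0,1))$, $f(\cdot,0)=f_0$, $f(\cdot,1)=f_1$, and $\partial_t f+\partial_x f\cdot v=z$ weakly, i.e. for every $\phi\in C^\infty([0,1]^2)$, $$-\int_0^1\!\!\int_0^1 f\,\partial_t\phi\,dx\,dt+\int_0^1 f_1(x)\phi(x,1)\,dx-\int_0^1 f_0(x)\phi(x,0)\,dx=\int_0^1\!\!\int_0^1 f\phi\,\partial_x v\,dx\,dt+\int_0^1\!\!\int_0^1 f\,\partial_x\phi\, v\,dx\,dt+\int_0^1\!\!\int_0^1\phi z\,dx\,dt.$$ The HV distance (which is a metric on $L^2(0,1)$) is $$d_{HV(\kappa,\lambda,\varepsilon)}(f_0,f_1)=\inf_{(f,v,z)\in\mathcal A(f_0,f_1)}\int_0^1\sqrt{\tfrac12\int_0^1 \kappa v^2+\lambda v_x^2+\varepsilon v_{xx}^2+z^2\,dx}\;dt.$$ *)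

theory Defs
  imports "HOL-Analysis.Analysis"
begin

abbreviation I01 :: "real measure" where
  "I01 \<equiv> lebesgue_on {0<..<1}"

section \<open>Function spaces on the unit interval\<close>

text \<open>The spaces below consist of representatives: \<open>f :: real \<Rightarrow> real\<close> is only looked at on
  \<open>(0,1)\<close>, up to null sets. Genuine equivalence classes are formed at the very end.\<close>

definition L2 :: "(real \<Rightarrow> real) set" where
  "L2 = {f \<in> borel_measurable I01. integrable I01 (\<lambda>x. (f x)\<^sup>2)}"

definition L2_norm :: "(real \<Rightarrow> real) \<Rightarrow> real" where
  "L2_norm f = sqrt (\<integral>x. (f x)\<^sup>2 \<partial>I01)"

text \<open>\<open>C\<^sub>c\<^sup>\<infinity>(0,1)\<close>, its elements being extended by zero to the real line.\<close>

definition test_funs :: "(real \<Rightarrow> real) set" where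
  "test_funs = {\<phi>. (\<forall>n x. ((deriv ^^ n) \<phi>) differentiable (at x)) \<and>
                   (\<exists>K. compact K \<and> K \<subseteq> {0<..<1} \<and> (\<forall>x. x \<notin> K \<longrightarrow> \<phi> x = 0))}"

definition weak_deriv :: "(real \<Rightarrow> real) \<Rightarrow> (real \<Rightarrow> real) \<Rightarrow> bool" where
  "weak_deriv f g \<longleftrightarrow>
     (\<forall>\<phi>\<in>test_funs. (\<integral>x. f x * deriv \<phi> x \<partial>I01) = - (\<integral>x. g x * \<phi> x \<partial>I01))"

definition H1 :: "(real \<Rightarrow> real) set" where
  "H1 = {f \<in> L2. \<exists>g\<in>L2. weak_deriv f g}"

text \<open>For \<open>f \<in> H1\<close> this is a representative of the weak derivative, which is unique up to null
  sets; it is meaningless for other \<open>f\<close>.\<close>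

definition wderiv :: "(real \<Rightarrow> real) \<Rightarrow> real \<Rightarrow> real" where
  "wderiv f = (SOME g. g \<in> L2 \<and> weak_deriv f g)"

definition H1_norm :: "(real \<Rightarrow> real) \<Rightarrow> real" where
  "H1_norm f = sqrt ((L2_norm f)\<^sup>2 + (L2_norm (wderiv f))\<^sup>2)"

text \<open>The closure of \<open>C\<^sub>c\<^sup>\<infinity>(0,1)\<close> in \<open>H\<^sup>1(0,1)\<close>.\<close>

definition H10 :: "(real \<Rightarrow> real) set" where
  "H10 = {f \<in> H1. \<exists>\<phi>. (\<forall>n::nat. \<phi> n \<in> test_funs) \<and>
                       (\<lambda>n. H1_norm (\<lambda>x. \<phi> n x - f x)) \<longlonglongrightarrow> 0}"

definition H2 :: "(real \<Rightarrow> real) set" where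
  "H2 = {f \<in> H1. wderiv f \<in> H1}"

definition H2_norm :: "(real \<Rightarrow> real) \<Rightarrow> real" where
  "H2_norm f =
     sqrt ((L2_norm f)\<^sup>2 + (L2_norm (wderiv f))\<^sup>2 + (L2_norm (wderiv (wderiv f)))\<^sup>2)"

text \<open>\<open>H\<^sup>-\<^sup>1(0,1)\<close> is the dual of \<open>H\<^sup>1\<^sub>0(0,1)\<close>. Functionals are only looked at on \<open>H10\<close>; being bounded,
  they do not distinguish functions that agree almost everywhere.\<close>

definition Hm1 :: "((real \<Rightarrow> real) \<Rightarrow> real) set" where
  "Hm1 = {F. (\<forall>g\<in>H10. \<forall>h\<in>H10. \<forall>a b. F (\<lambda>x. a * g x + b * h x) = a * F g + b * F h) \<and>
             (\<exists>C. \<forall>g\<in>H10. \<bar>F g\<bar> \<le> C * H1_norm g)}"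

definition Hm1_norm :: "((real \<Rightarrow> real) \<Rightarrow> real) \<Rightarrow> real" where
  "Hm1_norm F = Sup {\<bar>F g\<bar> | g. g \<in> H10 \<and> H1_norm g \<le> 1}"

text \<open>The functional \<open>F\<close> is the image of the function \<open>f\<close> under \<open>L\<^sup>2 \<subseteq> H\<^sup>-\<^sup>1\<close>.\<close>

definition represents_Hm1 :: "((real \<Rightarrow> real) \<Rightarrow> real) \<Rightarrow> (real \<Rightarrow> real) \<Rightarrow> bool" where
  "represents_Hm1 F f \<longleftrightarrow> (\<forall>g\<in>H10. F g = (\<integral>x. f x * g x \<partial>I01))"

definition continuous_Hm1 :: "(real \<Rightarrow> (real \<Rightarrow> real) \<Rightarrow> real) \<Rightarrow> bool" where
  "continuous_Hm1 F \<longleftrightarrow> (\<forall>t\<in>{0..1}. F t \<in> Hm1 \<and>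
     ((\<lambda>s. Hm1_norm (\<lambda>g. F s g - F t g)) \<longlongrightarrow> 0) (at t within {0..1}))"

section \<open>Bochner spaces\<close>

text \<open>A function \<open>u\<close> of time and space is curried with time first, so that \<open>u t\<close> is the spatial
  function \<open>u(\<cdot>,t)\<close>. Given a space \<open>X\<close> of spatial functions with norm \<open>N\<close>, the next two definitions
  are Bochner (strong) measurability of \<open>t \<mapsto> u t \<in> X\<close> and the space \<open>L\<^sup>2((0,1),X)\<close>.\<close>

definition bochner_measurable ::
  "(real \<Rightarrow> real) set \<Rightarrow> ((real \<Rightarrow> real) \<Rightarrow> real) \<Rightarrow> (real \<Rightarrow> real \<Rightarrow> real) \<Rightarrow> bool" where
  "bochner_measurable X N u \<longleftrightarrow> (AE t in I01. u t \<in> X) \<and>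
     (\<exists>s. (\<forall>n::nat. simple_function I01 (s n) \<and> (\<forall>t\<in>{0<..<1}. s n t \<in> X)) \<and>
          (AE t in I01. (\<lambda>n. N (\<lambda>x. s n t x - u t x)) \<longlonglongrightarrow> 0))"

definition bochner_L2 ::
  "(real \<Rightarrow> real) set \<Rightarrow> ((real \<Rightarrow> real) \<Rightarrow> real) \<Rightarrow> (real \<Rightarrow> real \<Rightarrow> real) set" where
  "bochner_L2 X N = {u. bochner_measurable X N u \<and> integrable I01 (\<lambda>t. (N (u t))\<^sup>2)}"

section \<open>Smooth functions on the closed unit square\<close>

text \<open>All partial derivatives up to the given order exist (one-sided on the boundary) and are
  continuous on the closed square.\<close>

primrec Ck_square :: "nat \<Rightarrow> (real \<Rightarrow> real \<Rightarrow> real) \<Rightarrow> bool" where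
  "Ck_square 0 \<phi> \<longleftrightarrow> continuous_on ({0..1} \<times> {0..1}) (\<lambda>(t, x). \<phi> t x)"
| "Ck_square (Suc k) \<phi> \<longleftrightarrow> continuous_on ({0..1} \<times> {0..1}) (\<lambda>(t, x). \<phi> t x) \<and>
     (\<exists>\<phi>t \<phi>x. (\<forall>t\<in>{0..1}. \<forall>x\<in>{0..1}.
          ((\<lambda>s. \<phi> s x) has_real_derivative \<phi>t t x) (at t within {0..1}) \<and>
          ((\<lambda>y. \<phi> t y) has_real_derivative \<phi>x t x) (at x within {0..1})) \<and>
        Ck_square k \<phi>t \<and> Ck_square k \<phi>x)"

definition smooth_square :: "(real \<Rightarrow> real \<Rightarrow> real) set" where
  "smooth_square = {\<phi>. \<forall>k. Ck_square k \<phi>}"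

section \<open>The HV distance\<close>

definition weak_solution ::
  "(real \<Rightarrow> real) \<Rightarrow> (real \<Rightarrow> real) \<Rightarrow>
   (real \<Rightarrow> real \<Rightarrow> real) \<Rightarrow> (real \<Rightarrow> real \<Rightarrow> real) \<Rightarrow> (real \<Rightarrow> real \<Rightarrow> real) \<Rightarrow> bool" where
  "weak_solution f0 f1 f v z \<longleftrightarrow> (\<forall>\<phi>\<in>smooth_square.
     - (\<integral>t. (\<integral>x. f t x * deriv (\<lambda>s. \<phi> s x) t \<partial>I01) \<partial>I01)
       + (\<integral>x. f1 x * \<phi> 1 x \<partial>I01) - (\<integral>x. f0 x * \<phi> 0 x \<partial>I01)
     = (\<integral>t. (\<integral>x. f t x * \<phi> t x * wderiv (v t) x \<partial>I01) \<partial>I01)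
       + (\<integral>t. (\<integral>x. f t x * deriv (\<lambda>y. \<phi> t y) x * v t x \<partial>I01) \<partial>I01)
       + (\<integral>t. (\<integral>x. \<phi> t x * z t x \<partial>I01) \<partial>I01))"

text \<open>The curve \<open>F\<close> is the \<open>H\<^sup>-\<^sup>1\<close>-continuous version of \<open>f\<close>; the end point conditions on \<open>f\<close>
  are conditions on this version.\<close>

definition admissible ::
  "(real \<Rightarrow> real) \<Rightarrow> (real \<Rightarrow> real) \<Rightarrow>
   ((real \<Rightarrow> real \<Rightarrow> real) \<times> (real \<Rightarrow> real \<Rightarrow> real) \<times> (real \<Rightarrow> real \<Rightarrow> real)) set" where
  "admissible f0 f1 = {(f, v, z).
     f \<in> bochner_L2 L2 L2_norm \<and>
     (\<exists>F. continuous_Hm1 F \<and> (AE t in I01. represents_Hm1 (F t) (f t)) \<and>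
          represents_Hm1 (F 0) f0 \<and> represents_Hm1 (F 1) f1) \<and>
     v \<in> bochner_L2 (H2 \<inter> H10) H2_norm \<and>
     z \<in> bochner_L2 L2 L2_norm \<and>
     weak_solution f0 f1 f v z}"

definition HV_length ::
  "real \<Rightarrow> real \<Rightarrow> real \<Rightarrow> (real \<Rightarrow> real \<Rightarrow> real) \<Rightarrow> (real \<Rightarrow> real \<Rightarrow> real) \<Rightarrow> real" where
  "HV_length \<kappa> l \<epsilon> v z =
     (\<integral>t. sqrt (1/2 * (\<integral>x. \<kappa> * (v t x)\<^sup>2 + l * (wderiv (v t) x)\<^sup>2
                           + \<epsilon> * (wderiv (wderiv (v t)) x)\<^sup>2 + (z t x)\<^sup>2 \<partial>I01)) \<partial>I01)"

definition d_HV ::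
  "real \<Rightarrow> real \<Rightarrow> real \<Rightarrow> (real \<Rightarrow> real) \<Rightarrow> (real \<Rightarrow> real) \<Rightarrow> real" where
  "d_HV \<kappa> l \<epsilon> f0 f1 = (INF (f, v, z) \<in> admissible f0 f1. HV_length \<kappa> l \<epsilon> v z)"

section \<open>The metric space of classes\<close>

definition L2_class :: "(real \<Rightarrow> real) \<Rightarrow> (real \<Rightarrow> real) set" where
  "L2_class f = {g \<in> L2. AE x in I01. g x = f x}"

definition L2_space :: "(real \<Rightarrow> real) set set" where
  "L2_space = L2_class ` L2"

text \<open>The value 0 off the carrier is only there because the locale \<open>Metric_space\<close> requires
  nonnegativity and symmetry for all arguments.\<close>

definition dist_HV ::
  "real \<Rightarrow> real \<Rightarrow> real \<Rightarrow> (real \<Rightarrow> real) set \<Rightarrow> (real \<Rightarrow> real) set \<Rightarrow> real" where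
  "dist_HV \<kappa> l \<epsilon> A B =
     (if A \<in> L2_space \<and> B \<in> L2_space
      then d_HV \<kappa> l \<epsilon> (SOME f0. f0 \<in> A) (SOME f1. f1 \<in> B) else 0)"

text \<open>The choice of representatives does not matter.\<close>

lemma integral_mult_cong_AE:
  fixes f g h :: "real \<Rightarrow> real"
  assumes "AE x in I01. f x = g x" "f \<in> L2" "g \<in> L2" "h \<in> borel_measurable I01"
  shows "(\<integral>x. f x * h x \<partial>I01) = (\<integral>x. g x * h x \<partial>I01)"
proof (rule integral_cong_AE)
  have [measurable]: "f \<in> borel_measurable I01" "g \<in> borel_measurable I01"
      "h \<in> borel_measurable I01"
    using assms by (auto simp: L2_def)
  show "(\<lambda>x. f x * h x) \<in> borel_measurable I01" "(\<lambda>x. g x * h x) \<in> borel_measurable I01"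
    by measurable
  show "AE x in I01. f x * h x = g x * h x"
    using assms(1) by eventually_elim simp
qed

lemma smooth_square_slice_measurable:
  assumes "\<phi> \<in> smooth_square" "t \<in> {0..1}"
  shows "\<phi> t \<in> borel_measurable I01"
proof -
  have "Ck_square 0 \<phi>"
    using assms(1) unfolding smooth_square_def by blast
  then have c: "continuous_on ({0..1} \<times> {0..1}) (\<lambda>(t, x). \<phi> t x)"
    by simp
  have "continuous_on {0<..<1} ((\<lambda>(t, x). \<phi> t x) \<circ> (\<lambda>x. (t, x)))"
  proof (rule continuous_on_compose)
    show "continuous_on {0<..<1} (\<lambda>x. (t, x))"
      by (intro continuous_intros)
    show "continuous_on ((\<lambda>x. (t, x)) ` {0<..<1}) (\<lambda>(t, x). \<phi> t x)"
      by (rule continuous_on_subset[OF c]) (use assms(2) in auto)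
  qed
  then have "continuous_on {0<..<1} (\<phi> t)"
    by (simp add: o_def)
  then show ?thesis
    by (rule continuous_imp_measurable_on_sets_lebesgue) simp
qed

lemma represents_Hm1_cong:
  assumes "AE x in I01. f x = g x" "f \<in> L2" "g \<in> L2"
  shows "represents_Hm1 F f \<longleftrightarrow> represents_Hm1 F g"
proof -
  have "(\<integral>x. f x * h x \<partial>I01) = (\<integral>x. g x * h x \<partial>I01)" if "h \<in> H10" for h
    using integral_mult_cong_AE[OF assms] that by (auto simp: H10_def H1_def L2_def)
  then show ?thesis
    by (simp add: represents_Hm1_def)
qed

lemma admissible_cong:
  assumes "AE x in I01. f0 x = g0 x" "f0 \<in> L2" "g0 \<in> L2"
    and "AE x in I01. f1 x = g1 x" "f1 \<in> L2" "g1 \<in> L2"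
  shows "admissible f0 f1 = admissible g0 g1"
proof -
  have "(\<integral>x. f0 x * \<phi> 0 x \<partial>I01) = (\<integral>x. g0 x * \<phi> 0 x \<partial>I01)"
       "(\<integral>x. f1 x * \<phi> 1 x \<partial>I01) = (\<integral>x. g1 x * \<phi> 1 x \<partial>I01)"
    if "\<phi> \<in> smooth_square" for \<phi>
    using integral_mult_cong_AE[OF assms(1-3)] integral_mult_cong_AE[OF assms(4-6)]
      smooth_square_slice_measurable[OF that] by auto
  then have "weak_solution f0 f1 = weak_solution g0 g1"
    by (simp add: weak_solution_def fun_eq_iff)
  then show ?thesis
    using represents_Hm1_cong[OF assms(1-3)] represents_Hm1_cong[OF assms(4-6)]
    by (simp add: admissible_def)
qed

lemma dist_HV_L2_class:
  assumes "f0 \<in> L2" "f1 \<in> L2"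
  shows "dist_HV \<kappa> l \<epsilon> (L2_class f0) (L2_class f1) = d_HV \<kappa> l \<epsilon> f0 f1"
proof -
  have *: "(SOME g. g \<in> L2_class f) \<in> L2 \<and> (AE x in I01. (SOME g. g \<in> L2_class f) x = f x)"
    if "f \<in> L2" for f
    using someI[of "\<lambda>g. g \<in> L2_class f" f] that by (simp add: L2_class_def)
  have "admissible (SOME g. g \<in> L2_class f0) (SOME g. g \<in> L2_class f1) = admissible f0 f1"
    using *[OF assms(1)] *[OF assms(2)] assms by (intro admissible_cong) auto
  then show ?thesis
    using assms by (simp add: dist_HV_def L2_space_def d_HV_def)
qed

end

theory Submission
  imports Defs "HOL-Computational_Algebra.Polynomial"
begin

text \<open>For \<open>u = (1 - s\<^sup>2 \<partial>\<^sub>x\<^sup>2)\<^sup>-\<^sup>1 f\<close> with Neumann boundary conditions, the energy \<open>Q\<^sub>s f = \<langle>f, u\<rangle>\<close> changes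
  along an admissible path at most at the rate \<open>6 \<parallel>v\<^sub>x\<^sub>x\<parallel> Q\<^sub>s f + 2 \<parallel>z\<parallel> (Q\<^sub>s f)\<^sup>1\<^sup>/\<^sup>2\<close>, uniformly in \<open>s\<close>: moving
  the derivative onto \<open>u\<close>, all terms of the commutator of \<open>v \<partial>\<^sub>x\<close> with the smoothing are controlled by
  \<open>\<parallel>u\<parallel>\<^sup>2 + s\<^sup>2 \<parallel>u\<^sub>x\<parallel>\<^sup>2 = Q\<^sub>s f\<close>, because \<open>v\<close> vanishes at the end points. For \<open>s \<rightarrow> 0\<close> this bounds the \<open>L\<^sup>2\<close>
  norm on small \<open>d\<^sub>H\<^sub>V\<close>-balls. Since \<open>\<parallel>f\<parallel>\<^sup>2 - Q\<^sub>s f\<close> dominates half the energy of \<open>f\<close> in frequencies above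
  \<open>1/s\<close>, the high frequencies of a \<open>d\<^sub>H\<^sub>V\<close>-Cauchy sequence are uniformly small. Each single Fourier
  coefficient is Lipschitz for \<open>d\<^sub>H\<^sub>V\<close> on bounded sets, so \<open>d\<^sub>H\<^sub>V\<close> separates points and the sequence is Cauchy
  in \<open>L\<^sup>2\<close>. Its \<open>L\<^sup>2\<close> limit is a \<open>d\<^sub>H\<^sub>V\<close> limit, as the straight path with \<open>v = 0\<close> shows that
  \<open>d\<^sub>H\<^sub>V(f, g) \<le> \<parallel>f - g\<parallel>\<close>.\<close>

section \<open>Square-integrable functions on the unit interval\<close>

text \<open>Two obstacles shape the argument. On bounded sets the L2 distance is not bounded by a
  multiple of the HV distance: a velocity of size 1/n moves an oscillation of frequency n by a
  fraction of its period, at a length of order 1/n but with an L2 change of order one. What the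
  length controls directly is scalar: single Fourier coefficients, and energies. Secondly, the
  equation holds only against smooth test functions, so the smoothing of f cannot be inserted as it
  is. The energy is therefore truncated to N cosine modes. The truncation defect carries a factor
  1/s, but for fixed s it tends to 0 as N grows, by dominated convergence in time; only afterwards
  may s tend to 0. Neumann conditions are the natural ones: test functions need not vanish at x = 0
  and x = 1, so cosines are allowed, and the derivative of v, which need not vanish there either,
  leaves a boundary term that only u' = 0 removes. Uniformity in s is the crux: through it the small
  high-frequency energy of one member of a Cauchy sequence bounds that of all later ones.\<close>

lemma emeasure_I01: "emeasure I01 (space I01) = 1"
  by (simp add: emeasure_restrict_space)

interpretation I01: finite_measure I01
  by standard (simp add: emeasure_restrict_space)

lemma measure_I01 [simp]: "measure I01 {0<..<1} = 1"
  using emeasure_I01 by (simp add: measure_def)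

lemma integrable_bounded_I01:
  fixes g :: "real \<Rightarrow> real"
  assumes "g \<in> borel_measurable I01" "\<And>x. x \<in> {0<..<1} \<Longrightarrow> \<bar>g x\<bar> \<le> B"
  shows "integrable I01 g"
  by (rule I01.integrable_const_bound[where B=B]) (use assms in \<open>auto intro!: AE_I2\<close>)

lemma L2_measurable [measurable_dest]: "f \<in> L2 \<Longrightarrow> f \<in> borel_measurable I01"
  by (simp add: L2_def)

lemma L2_square_integrable: "f \<in> L2 \<Longrightarrow> integrable I01 (\<lambda>x. (f x)\<^sup>2)"
  by (simp add: L2_def)

lemma L2_mult_integrable:
  assumes "f \<in> L2" "g \<in> L2"
  shows "integrable I01 (\<lambda>x. f x * g x)"
proof (rule Bochner_Integration.integrable_bound)
  show "integrable I01 (\<lambda>x. (f x)\<^sup>2 + (g x)\<^sup>2)"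
    using assms by (simp add: L2_square_integrable)
  show "(\<lambda>x. f x * g x) \<in> borel_measurable I01"
    using assms by measurable
  have "norm (f x * g x) \<le> norm ((f x)\<^sup>2 + (g x)\<^sup>2)" for x
  proof -
    have "0 \<le> (\<bar>f x\<bar> - \<bar>g x\<bar>)\<^sup>2 + \<bar>f x\<bar> * \<bar>g x\<bar>" by simp
    then have "\<bar>f x\<bar> * \<bar>g x\<bar> \<le> (f x)\<^sup>2 + (g x)\<^sup>2"
      by (simp add: power2_diff)
    then show ?thesis by (simp add: abs_mult)
  qed
  then show "AE x in I01. norm (f x * g x) \<le> norm ((f x)\<^sup>2 + (g x)\<^sup>2)"
    by simp
qed

lemma L2I_bounded_mult:
  assumes "f \<in> L2" "g \<in> borel_measurable I01" "\<And>x. x \<in> {0<..<1} \<Longrightarrow> \<bar>g x\<bar> \<le> B"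
  shows "(\<lambda>x. f x * g x) \<in> L2"
proof -
  have [measurable]: "f \<in> borel_measurable I01" "g \<in> borel_measurable I01"
    using assms by auto
  have "integrable I01 (\<lambda>x. (f x * g x)\<^sup>2)"
  proof (rule Bochner_Integration.integrable_bound)
    show "integrable I01 (\<lambda>x. B\<^sup>2 * (f x)\<^sup>2)"
      using assms by (simp add: L2_square_integrable)
    show "AE x in I01. norm ((f x * g x)\<^sup>2) \<le> norm (B\<^sup>2 * (f x)\<^sup>2)"
    proof (rule AE_I2)
      fix x assume "x \<in> space I01"
      then have "\<bar>g x\<bar>\<^sup>2 \<le> B\<^sup>2"
        by (intro power_mono assms(3)) auto
      then show "norm ((f x * g x)\<^sup>2) \<le> norm (B\<^sup>2 * (f x)\<^sup>2)"
        by (simp add: power_mult_distrib mult.commute[of "(f x)\<^sup>2"] mult_right_mono)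
    qed
  qed simp
  then show ?thesis by (simp add: L2_def)
qed

lemma L2_const [simp, intro]: "(\<lambda>x. c) \<in> L2"
  by (simp add: L2_def)

lemma L2_bounded:
  assumes "g \<in> borel_measurable I01" "\<And>x. x \<in> {0<..<1} \<Longrightarrow> \<bar>g x\<bar> \<le> B"
  shows "g \<in> L2"
  using L2I_bounded_mult[OF L2_const[of 1] assms] by simp

lemma L2_add [intro]:
  assumes "f \<in> L2" "g \<in> L2" shows "(\<lambda>x. f x + g x) \<in> L2"
proof -
  have "integrable I01 (\<lambda>x. (f x)\<^sup>2 + (g x)\<^sup>2 + 2 * (f x * g x))"
    using assms by (intro Bochner_Integration.integrable_add L2_square_integrable integrable_mult_right L2_mult_integrable)
  then show ?thesis
    using assms[THEN L2_measurable] by (simp add: L2_def power2_sum mult.assoc borel_measurable_add)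
qed

lemma L2_cmult [intro]: "f \<in> L2 \<Longrightarrow> (\<lambda>x. c * f x) \<in> L2"
  by (simp add: L2_def power_mult_distrib borel_measurable_times)

lemma L2_diff [intro]:
  assumes "f \<in> L2" "g \<in> L2" shows "(\<lambda>x. f x - g x) \<in> L2"
  using L2_add[OF assms(1) L2_cmult[OF assms(2), of "-1"]] by simp

lemma L2_sum [intro]:
  "(\<And>i. i \<in> A \<Longrightarrow> f i \<in> L2) \<Longrightarrow> (\<lambda>x. \<Sum>i\<in>A. f i x) \<in> L2"
  by (induction A rule: infinite_finite_induct) auto

lemma L2_continuous:
  assumes "continuous_on {0..1} g" shows "g \<in> L2"
proof -
  have "bounded (g ` {0..1})"
    by (intro compact_imp_bounded compact_continuous_image assms) auto
  then obtain B where B: "\<And>x. x \<in> {0..1} \<Longrightarrow> \<bar>g x\<bar> \<le> B"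
    unfolding bounded_iff by fastforce
  show ?thesis
  proof (rule L2_bounded)
    show "g \<in> borel_measurable I01"
      by (rule continuous_imp_measurable_on_sets_lebesgue)
        (auto intro: continuous_on_subset[OF assms])
    show "\<bar>g x\<bar> \<le> B" if "x \<in> {0<..<1}" for x using B[of x] that by auto
  qed
qed

lemma L2_integrable: "f \<in> L2 \<Longrightarrow> integrable I01 f"
  using L2_mult_integrable[of f "\<lambda>_. 1"] by simp

lemma L2_AE_cong:
  assumes "f \<in> L2" "AE x in I01. f x = g x" "g \<in> borel_measurable I01"
  shows "g \<in> L2"
proof -
  have "integrable I01 (\<lambda>x. (f x)\<^sup>2) \<longleftrightarrow> integrable I01 (\<lambda>x. (g x)\<^sup>2)"
    by (rule integrable_cong_AE) (use assms in \<open>auto simp: L2_def\<close>)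
  then show ?thesis using assms by (simp add: L2_def)
qed

lemma L2_norm_nonneg [simp]: "0 \<le> L2_norm f"
  by (simp add: L2_norm_def)

lemma L2_norm_sq: "(L2_norm f)\<^sup>2 = (\<integral>x. (f x)\<^sup>2 \<partial>I01)"
  by (simp add: L2_norm_def)

lemma L2_norm_cong_AE:
  assumes "AE x in I01. f x = g x" "f \<in> borel_measurable I01" "g \<in> borel_measurable I01"
  shows "L2_norm f = L2_norm g"
proof -
  have "(\<integral>x. (f x)\<^sup>2 \<partial>I01) = (\<integral>x. (g x)\<^sup>2 \<partial>I01)"
    by (rule integral_cong_AE) (use assms in auto)
  then show ?thesis by (simp add: L2_norm_def)
qed

lemma L2_norm_cmult [simp]: "L2_norm (\<lambda>x. c * f x) = \<bar>c\<bar> * L2_norm f"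
  by (simp add: L2_norm_def power_mult_distrib real_sqrt_mult)

lemma L2_norm_minus [simp]: "L2_norm (\<lambda>x. - f x) = L2_norm f"
  by (simp add: L2_norm_def)

lemma L2_norm_diff_commute: "L2_norm (\<lambda>x. f x - g x) = L2_norm (\<lambda>x. g x - f x)"
  by (simp add: L2_norm_def power2_commute)

lemma L2_norm_const [simp]: "L2_norm (\<lambda>x. c) = \<bar>c\<bar>"
  by (simp add: L2_norm_def)

lemma L2_norm_eq_0_iff:
  assumes "f \<in> L2" shows "L2_norm f = 0 \<longleftrightarrow> (AE x in I01. f x = 0)"
proof -
  have "L2_norm f = 0 \<longleftrightarrow> (\<integral>x. (f x)\<^sup>2 \<partial>I01) = 0" by (simp add: L2_norm_def)
  also have "\<dots> \<longleftrightarrow> (AE x in I01. (f x)\<^sup>2 = 0)"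
    by (rule integral_nonneg_eq_0_iff_AE) (use L2_square_integrable[OF assms] in auto)
  finally show ?thesis by simp
qed

lemma L2_add_sq:
  assumes "f \<in> L2" "g \<in> L2"
  shows "(L2_norm (\<lambda>x. f x + g x))\<^sup>2 = (L2_norm f)\<^sup>2 + 2 * (\<integral>x. f x * g x \<partial>I01) + (L2_norm g)\<^sup>2"
proof -
  have "(\<integral>x. (f x + g x)\<^sup>2 \<partial>I01) = (\<integral>x. (f x)\<^sup>2 + 2 * (f x * g x) + (g x)\<^sup>2 \<partial>I01)"
    by (simp add: power2_sum algebra_simps)
  also have "\<dots> = (\<integral>x. (f x)\<^sup>2 \<partial>I01) + 2 * (\<integral>x. f x * g x \<partial>I01) + (\<integral>x. (g x)\<^sup>2 \<partial>I01)"
    using assms by (simp add: L2_square_integrable L2_mult_integrable)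
  finally show ?thesis by (simp add: L2_norm_sq)
qed

lemma L2_Cauchy_Schwarz:
  assumes "f \<in> L2" "g \<in> L2"
  shows "\<bar>\<integral>x. f x * g x \<partial>I01\<bar> \<le> L2_norm f * L2_norm g"
proof -
  let ?i = "\<integral>x. f x * g x \<partial>I01"
  \<comment> \<open>The quadratic polynomial s -> |f + s g|^2 is nonnegative. Its minimum is at s =
    - \<open>?i\<close> / |g|^2; for |g| = 0 it is affine, and a slope other than zero would make it
    -1 at the point chosen below.\<close>
  have key: "0 \<le> (L2_norm f)\<^sup>2 + 2 * s * ?i + s\<^sup>2 * (L2_norm g)\<^sup>2" for s
  proof -
    have "(L2_norm (\<lambda>x. f x + s * g x))\<^sup>2 = (L2_norm f)\<^sup>2 + 2 * (\<integral>x. f x * (s * g x) \<partial>I01) + (L2_norm (\<lambda>x. s * g x))\<^sup>2"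
      by (rule L2_add_sq) (use assms in auto)
    then have "(L2_norm (\<lambda>x. f x + s * g x))\<^sup>2 = (L2_norm f)\<^sup>2 + 2 * s * ?i + s\<^sup>2 * (L2_norm g)\<^sup>2"
      by (simp add: mult.left_commute power_mult_distrib)
    then show ?thesis by (metis zero_le_power2)
  qed
  have "?i\<^sup>2 \<le> (L2_norm f)\<^sup>2 * (L2_norm g)\<^sup>2"
  proof (cases "L2_norm g = 0")
    case True
    have "?i = 0"
    proof (rule ccontr)
      assume "?i \<noteq> 0"
      have "2 * (- ((L2_norm f)\<^sup>2 + 1) / (2 * ?i)) * ?i = - ((L2_norm f)\<^sup>2 + 1)"
        using \<open>?i \<noteq> 0\<close> by (simp add: field_simps)
      with key[of "- ((L2_norm f)\<^sup>2 + 1) / (2 * ?i)"] True show False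
        by simp
    qed
    then show ?thesis by simp
  next
    case False
    then have "(L2_norm g)\<^sup>2 > 0" by simp
    have "2 * (- i / G) * i + (- i / G)\<^sup>2 * G = - (i\<^sup>2 / G)" if "G > 0" for i G :: real
      using that by (simp add: power_divide) (simp add: power2_eq_square)
    from this[of "(L2_norm g)\<^sup>2" ?i]
    have "2 * (- ?i / (L2_norm g)\<^sup>2) * ?i + (- ?i / (L2_norm g)\<^sup>2)\<^sup>2 * (L2_norm g)\<^sup>2 = - ((?i)\<^sup>2 / (L2_norm g)\<^sup>2)"
      using \<open>(L2_norm g)\<^sup>2 > 0\<close> by blast
    then have "(?i)\<^sup>2 / (L2_norm g)\<^sup>2 \<le> (L2_norm f)\<^sup>2"
      using key[of "- ?i / (L2_norm g)\<^sup>2"] by linarith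
    then show ?thesis
      using \<open>(L2_norm g)\<^sup>2 > 0\<close> pos_divide_le_eq by blast
  qed
  then show ?thesis
    by (metis L2_norm_nonneg abs_le_square_iff abs_of_nonneg mult_nonneg_nonneg power_mult_distrib)
qed

lemma L2_norm_triangle:
  assumes "f \<in> L2" "g \<in> L2"
  shows "L2_norm (\<lambda>x. f x + g x) \<le> L2_norm f + L2_norm g"
proof (rule power2_le_imp_le)
  show "(L2_norm (\<lambda>x. f x + g x))\<^sup>2 \<le> (L2_norm f + L2_norm g)\<^sup>2"
    using L2_add_sq[OF assms] L2_Cauchy_Schwarz[OF assms]
    by (simp add: power2_sum)
qed simp

lemma L2_norm_triangle_diff:
  assumes "f \<in> L2" "g \<in> L2"
  shows "L2_norm f \<le> L2_norm g + L2_norm (\<lambda>x. f x - g x)"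
  using L2_norm_triangle[of g "\<lambda>x. f x - g x"] assms by (simp add: L2_diff)

lemma L2_norm_triangle3:
  assumes "f \<in> L2" "g \<in> L2" "h \<in> L2"
  shows "L2_norm (\<lambda>x. f x - h x) \<le> L2_norm (\<lambda>x. f x - g x) + L2_norm (\<lambda>x. g x - h x)"
  using L2_norm_triangle[of "\<lambda>x. f x - g x" "\<lambda>x. g x - h x"] assms by (simp add: L2_diff)

lemma integral_abs_le_L2_norm:
  assumes "f \<in> L2" shows "(\<integral>x. \<bar>f x\<bar> \<partial>I01) \<le> L2_norm f"
proof -
  have "(\<lambda>x. \<bar>f x\<bar>) \<in> L2" using assms by (simp add: L2_def borel_measurable_abs)
  from L2_Cauchy_Schwarz[OF this L2_const[of 1]] show ?thesis
    by (simp add: L2_norm_def)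
qed

lemma L2_norm_mono:
  assumes "f \<in> L2" "g \<in> L2" "\<And>x. x \<in> {0<..<1} \<Longrightarrow> \<bar>f x\<bar> \<le> \<bar>g x\<bar>"
  shows "L2_norm f \<le> L2_norm g"
  unfolding L2_norm_def real_sqrt_le_iff
  using assms by (intro integral_mono L2_square_integrable) (auto simp flip: abs_le_square_iff)

lemma L2_norm_mult_bounded:
  assumes "f \<in> L2" "g \<in> borel_measurable I01" "\<And>x. x \<in> {0<..<1} \<Longrightarrow> \<bar>g x\<bar> \<le> B" "0 \<le> B"
  shows "L2_norm (\<lambda>x. f x * g x) \<le> B * L2_norm f"
proof -
  have "L2_norm (\<lambda>x. f x * g x) \<le> L2_norm (\<lambda>x. B * f x)"
  proof (rule L2_norm_mono)
    show "(\<lambda>x. f x * g x) \<in> L2" by (rule L2I_bounded_mult[OF assms(1-3)])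
    show "\<bar>f x * g x\<bar> \<le> \<bar>B * f x\<bar>" if "x \<in> {0<..<1}" for x
      using assms(3)[OF that] assms(4) by (simp add: abs_mult mult.commute[of "\<bar>f x\<bar>"] mult_right_mono)
  qed (use assms in auto)
  then show ?thesis using assms by simp
qed

lemma L2_norm_bounded:
  assumes "g \<in> borel_measurable I01" "\<And>x. x \<in> {0<..<1} \<Longrightarrow> \<bar>g x\<bar> \<le> B" "0 \<le> B"
  shows "L2_norm g \<le> B"
  using L2_norm_mult_bounded[OF L2_const[of 1] assms] by simp

text \<open>Riesz-Fischer. A Cauchy sequence in L2 is Cauchy in L1, hence a subsequence converges
  almost everywhere; Fatou's lemma turns the Cauchy bound into a bound on the distance to that
  limit, for the whole sequence.\<close>

theorem L2_complete:
  assumes f: "\<And>n. f n \<in> L2"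
    and Cauchy: "\<And>e. 0 < e \<Longrightarrow> \<exists>N. \<forall>m\<ge>N. \<forall>n\<ge>N. L2_norm (\<lambda>x. f m x - f n x) < e"
  obtains g where "g \<in> L2" "(\<lambda>n. L2_norm (\<lambda>x. f n x - g x)) \<longlonglongrightarrow> 0"
proof -
  have fm [measurable]: "f n \<in> borel_measurable I01" for n using f by measurable
  obtain r where r: "strict_mono r" "AE x in I01. Cauchy (\<lambda>i. f (r i) x)"
  proof (rule cauchy_L1_AE_cauchy_subseq[of I01 f])
    show "integrable I01 (f n)" for n by (rule L2_integrable[OF f])
    fix e :: real assume "0 < e"
    from Cauchy[OF this] obtain N where N: "\<forall>m\<ge>N. \<forall>n\<ge>N. L2_norm (\<lambda>x. f m x - f n x) < e" ..
    have "(\<integral>x. norm (f i x - f j x) \<partial>I01) < e" if "i \<ge> N" "j \<ge> N" for i j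
      using N that integral_abs_le_L2_norm[OF L2_diff[OF f f], of i j] by fastforce
    then show "\<exists>N. \<forall>i\<ge>N. \<forall>j\<ge>N. (\<integral>x. norm (f i x - f j x) \<partial>I01) < e" by blast
  qed
  \<comment> \<open>Where the subsequence diverges, \<open>lim\<close> is an unspecified value. This
    happens on a null set, and the function is measurable nevertheless.\<close>
  define g where "g x = lim (\<lambda>i. f (r i) x)" for x
  have g [measurable]: "g \<in> borel_measurable I01"
    unfolding g_def by measurable
  have lim: "AE x in I01. (\<lambda>i. f (r i) x) \<longlonglongrightarrow> g x"
    using r(2) by eventually_elim (auto simp: g_def Cauchy_convergent_iff convergent_LIMSEQ_iff)
  have fatou: "(\<integral>\<^sup>+x. ennreal ((f n x - g x)\<^sup>2) \<partial>I01) \<le> ennreal (e\<^sup>2)"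
    if N: "\<forall>m\<ge>N. \<forall>n\<ge>N. L2_norm (\<lambda>x. f m x - f n x) < e" and "n \<ge> N" for n N e
  proof -
    have "(\<integral>\<^sup>+x. ennreal ((f n x - g x)\<^sup>2) \<partial>I01) =
        (\<integral>\<^sup>+x. liminf (\<lambda>i. ennreal ((f n x - f (r i) x)\<^sup>2)) \<partial>I01)"
    proof (rule nn_integral_cong_AE)
      show "AE x in I01. ennreal ((f n x - g x)\<^sup>2) = liminf (\<lambda>i. ennreal ((f n x - f (r i) x)\<^sup>2))"
        using lim
      proof eventually_elim
        case (elim x)
        then have "(\<lambda>i. ennreal ((f n x - f (r i) x)\<^sup>2)) \<longlonglongrightarrow> ennreal ((f n x - g x)\<^sup>2)"
          by (intro tendsto_intros)
        then show ?case
          by (intro lim_imp_Liminf[symmetric]) auto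
      qed
    qed
    also have "\<dots> \<le> liminf (\<lambda>i. \<integral>\<^sup>+x. ennreal ((f n x - f (r i) x)\<^sup>2) \<partial>I01)"
      by (rule nn_integral_liminf) measurable
    also have "\<dots> \<le> ennreal (e\<^sup>2)"
    proof -
      have "eventually (\<lambda>i. (\<integral>\<^sup>+x. ennreal ((f n x - f (r i) x)\<^sup>2) \<partial>I01) \<le> ennreal (e\<^sup>2)) sequentially"
        unfolding eventually_sequentially
      proof (intro exI[of _ N] allI impI)
        fix i assume "N \<le> i"
        then have "r i \<ge> N" using seq_suble[OF r(1), of i] by simp
        then have "L2_norm (\<lambda>x. f n x - f (r i) x) < e" using N that by auto
        then have "(L2_norm (\<lambda>x. f n x - f (r i) x))\<^sup>2 \<le> e\<^sup>2"
          by (intro power_mono) auto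
        moreover have "(\<integral>\<^sup>+x. ennreal ((f n x - f (r i) x)\<^sup>2) \<partial>I01) = ennreal ((L2_norm (\<lambda>x. f n x - f (r i) x))\<^sup>2)"
          unfolding L2_norm_sq
          by (rule nn_integral_eq_integral) (auto intro: L2_square_integrable[OF L2_diff[OF f f]])
        ultimately show "(\<integral>\<^sup>+x. ennreal ((f n x - f (r i) x)\<^sup>2) \<partial>I01) \<le> ennreal (e\<^sup>2)"
          by (simp add: ennreal_leI)
      qed
      from Liminf_mono[OF this] show ?thesis
        unfolding Liminf_const[OF sequentially_bot] .
    qed
    finally show ?thesis .
  qed
  have diff: "(\<lambda>x. f n x - g x) \<in> L2 \<and> L2_norm (\<lambda>x. f n x - g x) \<le> e"
    if N: "\<forall>m\<ge>N. \<forall>n\<ge>N. L2_norm (\<lambda>x. f m x - f n x) < e" and "n \<ge> N" "0 < e" for n N e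
  proof -
    have i: "integrable I01 (\<lambda>x. (f n x - g x)\<^sup>2)"
    proof (rule integrableI_bounded)
      have "(\<integral>\<^sup>+x. ennreal (norm ((f n x - g x)\<^sup>2)) \<partial>I01) \<le> ennreal (e\<^sup>2)"
        using fatou[OF that(1,2)] by simp
      then show "(\<integral>\<^sup>+x. ennreal (norm ((f n x - g x)\<^sup>2)) \<partial>I01) < \<infinity>"
        by (rule le_less_trans) simp
    qed simp
    then have "(\<lambda>x. f n x - g x) \<in> L2" by (simp add: L2_def)
    moreover have "ennreal ((L2_norm (\<lambda>x. f n x - g x))\<^sup>2) \<le> ennreal (e\<^sup>2)"
      using fatou[OF that(1,2)] unfolding L2_norm_sq
      by (subst nn_integral_eq_integral[symmetric]) (auto intro: i)
    then have "(L2_norm (\<lambda>x. f n x - g x))\<^sup>2 \<le> e\<^sup>2" by simp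
    then have "L2_norm (\<lambda>x. f n x - g x) \<le> e"
      by (rule power2_le_imp_le) (use \<open>0 < e\<close> in simp)
    ultimately show ?thesis by simp
  qed
  obtain N where N: "\<forall>m\<ge>N. \<forall>n\<ge>N. L2_norm (\<lambda>x. f m x - f n x) < 1" using Cauchy[of 1] by auto
  have "(\<lambda>x. f N x - (f N x - g x)) \<in> L2" using L2_diff[OF f[of N] conjunct1[OF diff[OF N order_refl]]] by simp
  then have "g \<in> L2" by simp
  moreover have "(\<lambda>n. L2_norm (\<lambda>x. f n x - g x)) \<longlonglongrightarrow> 0"
  proof (rule LIMSEQ_I)
    fix e :: real assume "0 < e"
    with Cauchy[of "e/2"] obtain N where N: "\<forall>m\<ge>N. \<forall>n\<ge>N. L2_norm (\<lambda>x. f m x - f n x) < e/2" by auto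
    have "L2_norm (\<lambda>x. f n x - g x) < e" if "n \<ge> N" for n
      using diff[OF N that] \<open>0 < e\<close> by linarith
    then show "\<exists>no. \<forall>n\<ge>no. norm (L2_norm (\<lambda>x. f n x - g x) - 0) < e"
      by auto
  qed
  ultimately show ?thesis by (rule that)
qed

lemma L2_dominated_convergence:
  assumes [measurable]: "f \<in> borel_measurable I01" "\<And>i. s i \<in> borel_measurable I01"
    and lim: "AE x in I01. (\<lambda>i. s i x) \<longlonglongrightarrow> f x"
    and w: "w \<in> L2" and bound: "\<And>i. AE x in I01. \<bar>s i x\<bar> \<le> w x"
  shows "f \<in> L2" "(\<lambda>i. L2_norm (\<lambda>x. s i x - f x)) \<longlonglongrightarrow> 0"
proof -
  have wm [measurable]: "w \<in> borel_measurable I01" using w by measurable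
  have "AE x in I01. \<forall>i. \<bar>s i x\<bar> \<le> w x"
    using bound by (simp add: AE_all_countable)
  with lim have f: "AE x in I01. \<bar>f x\<bar> \<le> w x"
  proof eventually_elim
    case (elim x)
    then have "(\<lambda>i. \<bar>s i x\<bar>) \<longlonglongrightarrow> \<bar>f x\<bar>" by (intro tendsto_intros)
    then show ?case using elim by (intro LIMSEQ_le_const2) auto
  qed
  have "integrable I01 (\<lambda>x. (f x)\<^sup>2)"
  proof (rule Bochner_Integration.integrable_bound[OF L2_square_integrable[OF w]])
    show "AE x in I01. norm ((f x)\<^sup>2) \<le> norm ((w x)\<^sup>2)"
      using f by eventually_elim (simp add: abs_le_square_iff[symmetric])
  qed simp
  then show "f \<in> L2" by (simp add: L2_def)
  have "(\<lambda>i. \<integral>x. (s i x - f x)\<^sup>2 \<partial>I01) \<longlonglongrightarrow> (\<integral>x. 0 \<partial>I01)"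
  proof (rule integral_dominated_convergence[where w = "\<lambda>x. (2 * w x)\<^sup>2"])
    show "integrable I01 (\<lambda>x. (2 * w x)\<^sup>2)"
      by (rule L2_square_integrable[OF L2_cmult[OF w]])
    show "AE x in I01. (\<lambda>i. (s i x - f x)\<^sup>2) \<longlonglongrightarrow> 0"
      using lim
    proof eventually_elim
      case (elim x)
      then have "(\<lambda>i. (s i x - f x)\<^sup>2) \<longlonglongrightarrow> (f x - f x)\<^sup>2" by (intro tendsto_intros)
      then show ?case by simp
    qed
    show "AE x in I01. norm ((s i x - f x)\<^sup>2) \<le> (2 * w x)\<^sup>2" for i
      using f bound[of i]
    proof eventually_elim
      case (elim x)
      then have "\<bar>s i x - f x\<bar> \<le> \<bar>2 * w x\<bar>" by linarith
      then show ?case by (metis abs_le_square_iff norm_power power2_abs real_norm_def)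
    qed
  qed measurable
  then have "(\<lambda>i. sqrt (\<integral>x. (s i x - f x)\<^sup>2 \<partial>I01)) \<longlonglongrightarrow> sqrt 0"
    by (intro tendsto_real_sqrt) simp
  then show "(\<lambda>i. L2_norm (\<lambda>x. s i x - f x)) \<longlonglongrightarrow> 0"
    by (simp add: L2_norm_def)
qed

section \<open>Closures of subspaces and a density criterion\<close>

definition L2_closure :: "(real \<Rightarrow> real) set \<Rightarrow> (real \<Rightarrow> real) set" where
  "L2_closure P = {f \<in> L2. \<forall>e>0. \<exists>p\<in>P. L2_norm (\<lambda>x. f x - p x) < e}"

definition L2_subspace :: "(real \<Rightarrow> real) set \<Rightarrow> bool" where
  "L2_subspace P \<longleftrightarrow> P \<subseteq> L2 \<and> (\<forall>f\<in>P. \<forall>g\<in>P. \<forall>a b. (\<lambda>x. a * f x + b * g x) \<in> P) \<and> (\<lambda>_. 0) \<in> P"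

lemma L2_subspace_lin:
  "L2_subspace P \<Longrightarrow> f \<in> P \<Longrightarrow> g \<in> P \<Longrightarrow> (\<lambda>x. a * f x + b * g x) \<in> P"
  by (simp add: L2_subspace_def)

text \<open>Covers a change of representative as well: a constant sequence will do if its value
  agrees with f almost everywhere. Indicators of sets that differ by a null set are treated in this
  way.\<close>

lemma L2_closureI:
  assumes P: "P \<subseteq> L2" and f: "f \<in> L2"
    and s: "\<And>i. s i \<in> L2_closure P" "(\<lambda>i. L2_norm (\<lambda>x. s i x - f x)) \<longlonglongrightarrow> 0"
  shows "f \<in> L2_closure P"
proof -
  have "\<exists>p\<in>P. L2_norm (\<lambda>x. f x - p x) < e" if "e > 0" for e
  proof -
    from LIMSEQ_D[OF s(2), of "e/2"] that obtain i where i: "L2_norm (\<lambda>x. s i x - f x) < e/2" by force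
    moreover obtain p where p: "p \<in> P" "L2_norm (\<lambda>x. s i x - p x) < e/2"
      using s(1)[of i] half_gt_zero[of e] \<open>0 < e\<close> unfolding L2_closure_def by blast
    moreover have "L2_norm (\<lambda>x. f x - p x) \<le> L2_norm (\<lambda>x. f x - s i x) + L2_norm (\<lambda>x. s i x - p x)"
      using f s(1)[of i] p(1) P by (intro L2_norm_triangle3) (auto simp: L2_closure_def)
    ultimately show ?thesis using L2_norm_diff_commute[of f "s i"] by (intro bexI[of _ p]) auto
  qed
  then show ?thesis using f by (simp add: L2_closure_def)
qed

lemma L2_subspace_closure:
  assumes "L2_subspace P" shows "L2_subspace (L2_closure P)" "P \<subseteq> L2_closure P"
proof -
  have PL: "P \<subseteq> L2" and lin: "\<And>f g a b. f \<in> P \<Longrightarrow> g \<in> P \<Longrightarrow> (\<lambda>x. a * f x + b * g x) \<in> P" and z: "(\<lambda>_. 0) \<in> P"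
    using assms by (auto simp: L2_subspace_def)
  show sub: "P \<subseteq> L2_closure P"
  proof
    fix f assume "f \<in> P"
    then show "f \<in> L2_closure P" using PL
      by (auto simp: L2_closure_def intro!: bexI[of _ f])
  qed
  have "(\<lambda>x. a * f x + b * g x) \<in> L2_closure P" if f: "f \<in> L2_closure P" and g: "g \<in> L2_closure P" for f g a b
  proof -
    have fL: "f \<in> L2" and gL: "g \<in> L2" using f g by (auto simp: L2_closure_def)
    have "\<exists>p\<in>P. L2_norm (\<lambda>x. a * f x + b * g x - p x) < e" if "e > 0" for e
    proof -
      define d where "d = e / (2 * (1 + \<bar>a\<bar> + \<bar>b\<bar>))"
      have "d > 0" using that by (simp add: d_def add_pos_nonneg)
      obtain p where p: "p \<in> P" "L2_norm (\<lambda>x. f x - p x) < d" using f \<open>d > 0\<close> by (auto simp: L2_closure_def)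
      obtain q where q: "q \<in> P" "L2_norm (\<lambda>x. g x - q x) < d" using g \<open>d > 0\<close> by (auto simp: L2_closure_def)
      have pL: "p \<in> L2" "q \<in> L2" using p q PL by auto
      have "L2_norm (\<lambda>x. a * (f x - p x) + b * (g x - q x)) \<le> L2_norm (\<lambda>x. a * (f x - p x)) + L2_norm (\<lambda>x. b * (g x - q x))"
        using fL gL pL by (intro L2_norm_triangle L2_cmult L2_diff)
      also have "\<dots> \<le> \<bar>a\<bar> * d + \<bar>b\<bar> * d"
        using p q by (auto intro!: add_mono mult_left_mono)
      also have "\<dots> < (2 * (1 + \<bar>a\<bar> + \<bar>b\<bar>)) * d"
        using \<open>d > 0\<close> by (simp add: algebra_simps add_nonneg_pos)
      also have "\<dots> = e" by (simp add: d_def add_pos_nonneg pos_add_strict)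
      finally show ?thesis
        by (intro bexI[of _ "\<lambda>x. a * p x + b * q x"] lin p q) (simp add: algebra_simps)
    qed
    then show ?thesis using fL gL by (simp add: L2_closure_def L2_add L2_cmult)
  qed
  then show "L2_subspace (L2_closure P)"
    using sub z by (auto simp: L2_subspace_def) (auto simp: L2_closure_def)
qed

lemma L2_subspace_sum:
  assumes P: "L2_subspace P" and "finite A" "\<And>i. i \<in> A \<Longrightarrow> f i \<in> P"
  shows "(\<lambda>x. \<Sum>i\<in>A. c i * f i x) \<in> P"
  using assms(2,3)
proof (induction A rule: finite_induct)
  case empty then show ?case using P by (simp add: L2_subspace_def)
next
  case (insert i A)
  then have "(\<lambda>x. c i * f i x + 1 * (\<Sum>i\<in>A. c i * f i x)) \<in> P"
    by (intro L2_subspace_lin[OF P]) auto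
  then show ?case using insert by simp
qed

lemma borel_measurable_I01_id [measurable]: "(\<lambda>x. x) \<in> borel_measurable I01"
  by (rule continuous_imp_measurable_on_sets_lebesgue) auto

lemma L2_indicator: "(\<lambda>x. indicator A x :: real) \<in> borel_measurable I01 \<Longrightarrow> (\<lambda>x. indicator A x) \<in> L2"
  by (rule L2_bounded[where B=1]) (auto simp: indicator_def)

text \<open>Dynkin's theorem: half-lines are stable under intersection and generate the Borel sets,
  and the sets whose indicator lies in the closure admit complements and countable disjoint
  unions.\<close>

lemma indicator_borel_in_closure:
  assumes P: "L2_subspace P" and ind: "\<And>x. (\<lambda>y. indicator {..x} y) \<in> L2_closure P"
    and A: "A \<in> sets (borel :: real measure)"
  shows "(\<lambda>y. indicator A y) \<in> L2_closure P"
proof -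
  note Pc = L2_subspace_closure(1)[OF P]
  have PL: "P \<subseteq> L2" using P by (simp add: L2_subspace_def)
  have lin: "\<And>f g a b. f \<in> L2_closure P \<Longrightarrow> g \<in> L2_closure P \<Longrightarrow> (\<lambda>x. a * f x + b * g x) \<in> L2_closure P"
    using Pc by (simp add: L2_subspace_def)
  have cong: "g \<in> L2_closure P" if f: "f \<in> L2_closure P" and fg: "\<And>x. x \<in> {0<..<1} \<Longrightarrow> f x = g x" for f g
  proof -
    have fL: "f \<in> L2" using f by (simp add: L2_closure_def)
    have "g \<in> borel_measurable I01"
      using L2_measurable[OF fL] fg by (subst measurable_cong[of _ g f]) auto
    then have gL: "g \<in> L2" by (intro L2_AE_cong[OF fL]) (auto intro!: AE_I2 fg)
    have "L2_norm (\<lambda>x. f x - g x) = 0"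
      using fg by (subst L2_norm_eq_0_iff[OF L2_diff[OF fL gL]]) (auto intro!: AE_I2)
    then show ?thesis by (intro L2_closureI[OF PL gL, of "\<lambda>_. f"]) (auto simp: f)
  qed
  have "Int_stable (range (atMost :: real \<Rightarrow> _))"
    by (auto simp: Int_stable_def)
  moreover have "range (atMost :: real \<Rightarrow> _) \<subseteq> Pow UNIV" by simp
  moreover have "A \<in> sigma_sets UNIV (range atMost)"
    using A by (simp add: borel_eq_atMost)
  ultimately show ?thesis
  proof (induction rule: sigma_sets_induct_disjoint)
    case (basic A) then show ?case using ind by auto
  next
    case empty
    then show ?case using Pc by (simp add: L2_subspace_def)
  next
    case (compl A)
    \<comment> \<open>On (0,1) the half-line \<open>{..1}\<close> is everything, so its indicator
      serves as the constant 1.\<close>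
    have "(\<lambda>x. 1 * indicator {..1} x + (-1) * indicator A x) \<in> L2_closure P"
      by (rule lin[OF ind compl.IH])
    then show ?case by (rule cong) (auto simp: indicator_def)
  next
    case (union A)
    have [measurable]: "A i \<in> sets borel" for i using union.hyps(2) by (auto simp: borel_eq_atMost)
    define s :: "nat \<Rightarrow> real \<Rightarrow> real" where "s i x = (\<Sum>j<i. 1 * indicator (A j) x)" for i x
    have s_eq: "s i x = indicator (\<Union>j<i. A j) x" for i x
      unfolding s_def using union.hyps(1)
      by (subst indicator_UN_disjoint) (auto simp: disjoint_family_on_def)
    show ?case
    proof (rule L2_closureI[OF PL])
      show "(\<lambda>y. indicator (\<Union> (range A)) y) \<in> L2" by (rule L2_indicator) simp
      show "s i \<in> L2_closure P" for i
        unfolding s_def[abs_def] by (rule L2_subspace_sum[OF Pc]) (auto intro: union.IH)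
      show "(\<lambda>i. L2_norm (\<lambda>x. s i x - indicator (\<Union> (range A)) x)) \<longlonglongrightarrow> 0"
      proof (rule L2_dominated_convergence(2)[where w="\<lambda>_. 1"])
        show "AE x in I01. (\<lambda>i. s i x) \<longlonglongrightarrow> indicator (\<Union> (range A)) x"
          unfolding s_eq by (intro AE_I2 LIMSEQ_indicator_UN)
      qed (auto simp: s_eq indicator_def)
    qed
  qed
qed

text \<open>From half-lines to Borel sets, from there to Lebesgue sets by discarding a null set,
  then to simple functions, and to f by dominated convergence. Density is thereby reduced to
  approximating the indicators of half-lines.\<close>

theorem L2_closure_eq_L2:
  assumes P: "L2_subspace P" and ind: "\<And>x. (\<lambda>y. indicator {..x} y) \<in> L2_closure P"
    and f: "f \<in> L2"
  shows "f \<in> L2_closure P"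
proof -
  note Pc = L2_subspace_closure(1)[OF P]
  have PL: "P \<subseteq> L2" using P by (simp add: L2_subspace_def)
  have *: "(\<lambda>y. indicator A y) \<in> L2_closure P" if A: "A \<in> sets I01" for A
  proof -
    have "A \<in> sets lebesgue" using A by (auto simp: sets_restrict_space)
    \<comment> \<open>A Lebesgue set is a Borel set up to a null set, and the closure does not see
      null sets.\<close>
    then obtain S N N' where SN: "A = S \<union> N" "N \<subseteq> N'" "N' \<in> null_sets lborel" "S \<in> sets lborel"
      by (auto elim: sets_completionE)
    have N': "N' \<in> null_sets lebesgue" using SN(3) by (simp add: null_sets_completionI)
    have ae: "AE x in I01. x \<notin> N'"
      using AE_not_in[OF N'] by (auto simp: AE_restrict_space_iff)
    have S: "(\<lambda>y. indicator S y) \<in> L2_closure P"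
      using SN by (intro indicator_borel_in_closure[OF P ind]) auto
    have AL: "(\<lambda>y. indicator A y :: real) \<in> L2"
      using A by (intro L2_indicator) auto
    have SL: "(\<lambda>y. indicator S y :: real) \<in> L2" using S by (simp add: L2_closure_def)
    have "AE x in I01. (indicator S x :: real) - indicator A x = 0"
      using ae by eventually_elim (use SN in \<open>auto simp: indicator_def\<close>)
    then have "L2_norm (\<lambda>x. indicator S x - indicator A x) = 0"
      by (subst L2_norm_eq_0_iff[OF L2_diff[OF SL AL]])
    then show ?thesis by (intro L2_closureI[OF PL AL, of "\<lambda>_ y. indicator S y"]) (auto simp: S)
  qed
  have fm: "f \<in> borel_measurable I01" using f by measurable
  obtain s where s: "\<And>i. simple_function I01 (s i)" "\<And>x. x \<in> space I01 \<Longrightarrow> (\<lambda>i. s i x) \<longlonglongrightarrow> f x"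
      "\<And>i x. x \<in> space I01 \<Longrightarrow> norm (s i x) \<le> 2 * norm (f x)"
    using borel_measurable_implies_sequence_metric[OF fm, of 0] unfolding dist_real_def diff_zero real_norm_def by metis
  show ?thesis
  proof (rule L2_closureI[OF PL f])
    show "(\<lambda>i. L2_norm (\<lambda>x. s i x - f x)) \<longlonglongrightarrow> 0"
    proof (rule L2_dominated_convergence(2))
      show "(\<lambda>x. 2 * \<bar>f x\<bar>) \<in> L2"
        using f by (intro L2_cmult) (simp add: L2_def borel_measurable_abs)
    qed (use s fm in \<open>auto intro: borel_measurable_simple_function AE_I2\<close>)
    fix i
    have fin: "finite (s i ` space I01)" using s(1) by (rule simple_functionD)
    have "(\<lambda>x. \<Sum>y\<in>s i ` space I01. y * indicator (s i -` {y} \<inter> space I01) x) \<in> L2_closure P"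
      by (rule L2_subspace_sum[OF Pc fin]) (intro * simple_functionD(2)[OF s(1)])
    moreover have "(\<Sum>y\<in>s i ` space I01. y * indicator (s i -` {y} \<inter> space I01) x) = s i x" if "x \<in> space I01" for x
      using that fin by (simp add: indicator_def if_distrib[of "\<lambda>z. _ * z"] sum.If_cases Int_def cong: conj_cong) 
    ultimately have g: "(\<lambda>x. \<Sum>y\<in>s i ` space I01. y * indicator (s i -` {y} \<inter> space I01) x) \<in> L2_closure P"
        "\<And>x. x \<in> space I01 \<Longrightarrow> (\<Sum>y\<in>s i ` space I01. y * indicator (s i -` {y} \<inter> space I01) x) = s i x" by auto
    have sL: "s i \<in> L2"
      by (rule L2_AE_cong[where f="\<lambda>x. \<Sum>y\<in>s i ` space I01. y * indicator (s i -` {y} \<inter> space I01) x"])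
        (use g s in \<open>auto simp: L2_closure_def intro: AE_I2 borel_measurable_simple_function\<close>)
    show "s i \<in> L2_closure P"
    proof (rule L2_closureI[OF PL sL])
      show "(\<lambda>x. \<Sum>y\<in>s i ` space I01. y * indicator (s i -` {y} \<inter> space I01) x) \<in> L2_closure P" by (rule g)
      have "L2_norm (\<lambda>x. (\<Sum>y\<in>s i ` space I01. y * indicator (s i -` {y} \<inter> space I01) x) - s i x) = 0"
        using g sL by (subst L2_norm_eq_0_iff) (auto simp: L2_closure_def intro!: L2_diff AE_I2)
      then show "(\<lambda>_. L2_norm (\<lambda>x. (\<Sum>y\<in>s i ` space I01. y * indicator (s i -` {y} \<inter> space I01) x) - s i x)) \<longlonglongrightarrow> 0"
        by simp
    qed
  qed
qed

section \<open>Primitives and integration by parts\<close>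

text \<open>An integral over the whole interval against an indicator: no orientation is involved,
  and the primitive is a total function, 0 to the left of 0 and constant to the right of 1. In
  particular \<open>prim g 1\<close> is the integral of g.\<close>

definition prim :: "(real \<Rightarrow> real) \<Rightarrow> real \<Rightarrow> real" where
  "prim g x = (\<integral>y. g y * indicator {..x} y \<partial>I01)"

lemma AE_I01_neq: "AE y in I01. y \<noteq> (x::real)"
proof -
  have "{x} \<in> null_sets lebesgue"
    by (rule negligible_iff_null_sets[THEN iffD1, OF negligible_sing])
  then have "AE y in lebesgue. y \<notin> {x}" by (rule AE_not_in)
  then have "AE y in lebesgue. y \<in> {0<..<1} \<longrightarrow> y \<noteq> x"
    by (rule eventually_mono) blast
  moreover have "{0<..<1} \<inter> space lebesgue \<in> sets (lebesgue :: real measure)" by simp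
  ultimately show ?thesis by (simp only: AE_restrict_space_iff)
qed

lemma integrable_mult_indicator_I01:
  fixes g :: "real \<Rightarrow> real"
  assumes g: "integrable I01 g" and A: "A \<in> sets borel"
  shows "integrable I01 (\<lambda>y. g y * indicator A y)"
proof (rule Bochner_Integration.integrable_bound[OF g])
  have [measurable]: "g \<in> borel_measurable I01" using g by measurable
  note [measurable] = A
  show "(\<lambda>y. g y * indicator A y) \<in> borel_measurable I01" by measurable
qed (auto simp: indicator_def)

lemma prim_le_0: "x \<le> 0 \<Longrightarrow> prim g x = 0"
  unfolding prim_def by (subst Bochner_Integration.integral_cong[OF refl, where g="\<lambda>_. 0"]) (auto simp: indicator_def)

lemma prim_ge_1: "1 \<le> x \<Longrightarrow> prim g x = (\<integral>y. g y \<partial>I01)"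
  unfolding prim_def by (rule Bochner_Integration.integral_cong[OF refl]) (auto simp: indicator_def)

lemma prim_add:
  assumes "integrable I01 f" "integrable I01 g"
  shows "prim (\<lambda>x. f x + g x) t = prim f t + prim g t"
  using assms by (simp add: prim_def distrib_right integrable_mult_indicator_I01)

lemma prim_diff:
  assumes "integrable I01 f" "integrable I01 g"
  shows "prim (\<lambda>x. f x - g x) t = prim f t - prim g t"
  using assms by (simp add: prim_def left_diff_distrib integrable_mult_indicator_I01)

lemma prim_cmult: "prim (\<lambda>x. c * f x) t = c * prim f t"
  by (simp add: prim_def mult.assoc)

lemma prim_cong_AE:
  assumes "AE x in I01. f x = g x" "f \<in> borel_measurable I01" "g \<in> borel_measurable I01"
  shows "prim f t = prim g t"
proof -
  have [measurable]: "f \<in> borel_measurable I01" "g \<in> borel_measurable I01" by fact+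
  show ?thesis unfolding prim_def
    by (rule integral_cong_AE) (use assms(1) in \<open>measurable, auto\<close>)
qed

lemma prim_abs_le:
  assumes "integrable I01 g"
  shows "\<bar>prim g x\<bar> \<le> (\<integral>y. \<bar>g y\<bar> \<partial>I01)"
proof -
  have "\<bar>prim g x\<bar> \<le> (\<integral>y. \<bar>g y * indicator {..x} y\<bar> \<partial>I01)"
    unfolding prim_def by (rule integral_abs_bound)
  also have "\<dots> \<le> (\<integral>y. \<bar>g y\<bar> \<partial>I01)"
  proof (rule integral_mono)
    show "integrable I01 (\<lambda>y. \<bar>g y * indicator {..x} y\<bar>)"
      by (intro integrable_abs integrable_mult_indicator_I01 assms) simp
  qed (use assms in \<open>auto simp: indicator_def\<close>)
  finally show ?thesis .
qed

lemma prim_abs_le_L2: "g \<in> L2 \<Longrightarrow> \<bar>prim g x\<bar> \<le> L2_norm g"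
  using prim_abs_le[OF L2_integrable] integral_abs_le_L2_norm order_trans by blast

lemma prim_continuous:
  assumes g: "integrable I01 g"
  shows "continuous_on A (prim g)"
proof -
  have [measurable]: "g \<in> borel_measurable I01" using g by measurable
  have "isCont (prim g) x" for x
    unfolding continuous_at_sequentially
  proof (intro allI impI)
    fix s assume s: "s \<longlonglongrightarrow> x"
    show "(prim g \<circ> s) \<longlonglongrightarrow> prim g x"
      unfolding o_def prim_def
    proof (rule integral_dominated_convergence[where w="\<lambda>y. \<bar>g y\<bar>"])
      \<comment> \<open>Convergence can fail only at y = x, where the indicator jumps.\<close>
      show "AE y in I01. (\<lambda>i. g y * indicator {..s i} y) \<longlonglongrightarrow> g y * indicator {..x} y"
        using AE_I01_neq[of x]
      proof eventually_elim
        case (elim y)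
        have "eventually (\<lambda>i. indicator {..s i} y = (indicator {..x} y :: real)) sequentially"
        proof (cases "y < x")
          case True
          show ?thesis using order_tendstoD(1)[OF s True]
            by eventually_elim (use True in \<open>auto simp: indicator_def\<close>)
        next
          case False
          with elim have "x < y" by simp
          show ?thesis using order_tendstoD(2)[OF s \<open>x < y\<close>]
            by eventually_elim (use \<open>x < y\<close> in \<open>auto simp: indicator_def\<close>)
        qed
        then show ?case by (intro tendsto_mult tendsto_const tendsto_eventually) 
      qed
    qed (auto intro!: AE_I2 integrable_abs g simp: indicator_def)
  qed
  then show ?thesis by (simp add: continuous_at_imp_continuous_on)
qed

lemma prim_measurable [measurable]:
  "integrable I01 g \<Longrightarrow> prim g \<in> borel_measurable I01"
  by (rule continuous_imp_measurable_on_sets_lebesgue) (auto intro: prim_continuous)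

interpretation I01_pair: pair_sigma_finite I01 I01 ..

lemma integrable_mult_bounded_I01:
  fixes f g :: "real \<Rightarrow> real"
  assumes f: "integrable I01 f" and g: "g \<in> borel_measurable I01" and B: "\<And>x. x \<in> {0<..<1} \<Longrightarrow> \<bar>g x\<bar> \<le> B"
  shows "integrable I01 (\<lambda>x. f x * g x)"
proof (rule Bochner_Integration.integrable_bound[OF integrable_mult_right[OF f, of B]])
  have [measurable]: "f \<in> borel_measurable I01" "g \<in> borel_measurable I01" using f g by measurable
  show "(\<lambda>x. f x * g x) \<in> borel_measurable I01" by measurable
  show "AE x in I01. norm (f x * g x) \<le> norm (B * f x)"
  proof (rule AE_I2)
    fix x assume "x \<in> space I01"
    then have "\<bar>g x\<bar> \<le> \<bar>B\<bar>" using B[of x] by auto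
    then show "norm (f x * g x) \<le> norm (B * f x)"
      by (simp add: abs_mult mult.commute[of "\<bar>f x\<bar>"] mult_right_mono)
  qed
qed

text \<open>Fubini on the unit square: \<open>f x * prim g x\<close> collects the pairs with y \<le>
  x, and \<open>prim f y * g y\<close> those with x \<le> y. The two triangles make up the square
  and overlap only on the diagonal, a null set.\<close>

lemma prim_by_parts_full:
  assumes f: "integrable I01 f" and g: "integrable I01 g"
  shows "(\<integral>x. f x * prim g x + prim f x * g x \<partial>I01) = (\<integral>x. f x \<partial>I01) * (\<integral>x. g x \<partial>I01)"
proof -
  have [measurable]: "f \<in> borel_measurable I01" "g \<in> borel_measurable I01" using f g by measurable
  have prod: "integrable (I01 \<Otimes>\<^sub>M I01) (\<lambda>(x, y). f x * g y)"
  proof (rule I01_pair.Fubini_integrable)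
    show "(\<lambda>(x, y). f x * g y) \<in> borel_measurable (I01 \<Otimes>\<^sub>M I01)" by measurable
    show "integrable I01 (\<lambda>x. \<integral>y. norm (case (x, y) of (x, y) \<Rightarrow> f x * g y) \<partial>I01)"
      using f by (simp add: abs_mult)
    show "AE x in I01. integrable I01 (\<lambda>y. case (x, y) of (x, y) \<Rightarrow> f x * g y)"
      using g by simp
  qed
  have int: "integrable (I01 \<Otimes>\<^sub>M I01) (\<lambda>(x, y). f x * g y * indicator {..y} x)"
  proof (rule Bochner_Integration.integrable_bound[OF prod])
    have [measurable]: "(\<lambda>p. fst p) \<in> borel_measurable (I01 \<Otimes>\<^sub>M I01)" "(\<lambda>p. snd p) \<in> borel_measurable (I01 \<Otimes>\<^sub>M I01)"
      using measurable_compose[OF measurable_fst borel_measurable_I01_id]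
        measurable_compose[OF measurable_snd borel_measurable_I01_id] by auto
    have "(\<lambda>p. f (fst p) * g (snd p) * (if fst p \<le> snd p then 1 else 0)) \<in> borel_measurable (I01 \<Otimes>\<^sub>M I01)"
      by measurable
    then show "(\<lambda>(x, y). f x * g y * indicator {..y} x) \<in> borel_measurable (I01 \<Otimes>\<^sub>M I01)"
      by (simp add: indicator_def split_beta' of_bool_def)
  qed (simp add: split_beta' indicator_def)
  have "prim f y * g y = (\<integral>x. f x * g y * indicator {..y} x \<partial>I01)" for y
  proof -
    have "(\<integral>x. f x * g y * indicator {..y} x \<partial>I01) = (\<integral>x. (f x * indicator {..y} x) * g y \<partial>I01)"
      by (simp only: mult_ac)
    then show ?thesis by (simp only: prim_def integral_mult_left_zero)
  qed
  then have "(\<integral>y. prim f y * g y \<partial>I01) = (\<integral>y. (\<integral>x. f x * g y * indicator {..y} x \<partial>I01) \<partial>I01)"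
    by simp
  also have "\<dots> = (\<integral>x. (\<integral>y. f x * g y * indicator {..y} x \<partial>I01) \<partial>I01)"
    by (rule I01_pair.Fubini_integral[OF int])
  finally have 1: "(\<integral>y. prim f y * g y \<partial>I01) = (\<integral>x. (\<integral>y. f x * g y * indicator {..y} x \<partial>I01) \<partial>I01)" .
  have i1: "integrable I01 (\<lambda>x. f x * prim g x)"
    by (rule integrable_mult_bounded_I01[OF f]) (use g in \<open>auto intro: prim_abs_le\<close>)
  have i2: "integrable I01 (\<lambda>x. prim f x * g x)"
    using integrable_mult_bounded_I01[OF g prim_measurable[OF f] prim_abs_le[OF f]] by (simp add: mult.commute)
  have ind: "indicator {..y} x = (indicator {x..} y :: real)" for x y :: real
    by (simp add: indicator_def)
  have eq: "f x * prim g x + (\<integral>y. f x * g y * indicator {..y} x \<partial>I01) = f x * (\<integral>y. g y \<partial>I01)" for x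
  proof -
    have "f x * prim g x + (\<integral>y. f x * g y * indicator {..y} x \<partial>I01) =
       (\<integral>y. f x * (g y * indicator {..x} y) \<partial>I01) + (\<integral>y. f x * (g y * indicator {x..} y) \<partial>I01)"
      unfolding prim_def ind mult.assoc by (simp only: integral_mult_right_zero)
    also have "\<dots> = (\<integral>y. f x * (g y * indicator {..x} y) + f x * (g y * indicator {x..} y) \<partial>I01)"
      by (rule Bochner_Integration.integral_add[symmetric]) (auto intro!: integrable_mult_indicator_I01 integrable_mult_right g)
    also have "\<dots> = (\<integral>y. f x * g y \<partial>I01)"
    proof (rule integral_cong_AE)
      show "AE y in I01. f x * (g y * indicator {..x} y) + f x * (g y * indicator {x..} y) = f x * g y"
        using AE_I01_neq[of x] by eventually_elim (auto simp: indicator_def)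
    qed measurable
    finally show ?thesis by simp
  qed
  have i3: "integrable I01 (\<lambda>x. \<integral>y. f x * g y * indicator {..y} x \<partial>I01)"
  proof -
    have "integrable I01 (\<lambda>x. f x * (\<integral>y. g y \<partial>I01) - f x * prim g x)" using f i1 by simp
    moreover have "(\<integral>y. f x * g y * indicator {..y} x \<partial>I01) = f x * (\<integral>y. g y \<partial>I01) - f x * prim g x" for x
      using eq[of x] by linarith
    ultimately show ?thesis by (simp only:)
  qed
  have "(\<integral>x. f x * prim g x + prim f x * g x \<partial>I01) = (\<integral>x. f x * prim g x \<partial>I01) + (\<integral>x. prim f x * g x \<partial>I01)"
    using i1 i2 by (rule Bochner_Integration.integral_add)
  also have "\<dots> = (\<integral>x. f x * prim g x + (\<integral>y. f x * g y * indicator {..y} x \<partial>I01) \<partial>I01)"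
    unfolding 1 using i1 i3 by (rule Bochner_Integration.integral_add[symmetric])
  also have "\<dots> = (\<integral>x. f x \<partial>I01) * (\<integral>x. g x \<partial>I01)"
    unfolding eq by simp
  finally show ?thesis .
qed

lemma prim_prim_cut:
  "x \<le> t \<Longrightarrow> prim (\<lambda>y. g y * indicator {..t} y) x = prim g x"
  unfolding prim_def by (rule Bochner_Integration.integral_cong) (auto simp: indicator_def)

text \<open>A general upper limit is reduced to the full interval by cutting f and g off at t. The
  constants a and b are the values at 0 of the two absolutely continuous factors.\<close>

lemma prim_by_parts:
  assumes f: "integrable I01 f" and g: "integrable I01 g"
  shows "prim (\<lambda>x. f x * (b + prim g x) + (a + prim f x) * g x) t = (a + prim f t) * (b + prim g t) - a * b"
proof -
  have [measurable]: "f \<in> borel_measurable I01" "g \<in> borel_measurable I01" using f g by measurable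
  let ?f = "\<lambda>x. f x * indicator {..t} x" and ?g = "\<lambda>x. g x * indicator {..t} x"
  have i: "integrable I01 ?f" "integrable I01 ?g"
    using f g by (auto intro: integrable_mult_indicator_I01)
  have i1: "integrable I01 (\<lambda>x. f x * prim g x)"
    by (rule integrable_mult_bounded_I01[OF f]) (use g in \<open>auto intro: prim_abs_le\<close>)
  have i2: "integrable I01 (\<lambda>x. prim f x * g x)"
    using integrable_mult_bounded_I01[OF g prim_measurable[OF f] prim_abs_le[OF f]] by (simp add: mult.commute)
  have "prim (\<lambda>x. f x * prim g x + prim f x * g x) t = (\<integral>x. ?f x * prim ?g x + prim ?f x * ?g x \<partial>I01)"
    unfolding prim_def[of _ t] by (rule Bochner_Integration.integral_cong) (auto simp: prim_prim_cut split: split_indicator)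
  also have "\<dots> = prim f t * prim g t"
    unfolding prim_by_parts_full[OF i] by (simp add: prim_def)
  finally have 1: "prim (\<lambda>x. f x * prim g x + prim f x * g x) t = prim f t * prim g t" .
  have "prim (\<lambda>x. f x * (b + prim g x) + (a + prim f x) * g x) t =
      prim (\<lambda>x. (f x * prim g x + prim f x * g x) + (b * f x + a * g x)) t"
    by (simp add: algebra_simps)
  also have "\<dots> = prim f t * prim g t + (b * prim f t + a * prim g t)"
    using f g i1 i2 by (simp add: prim_add prim_cmult 1)
  finally show ?thesis by (simp add: algebra_simps)
qed

text \<open>The link to the Henstock-Kurzweil integral, and through it to the fundamental theorem of
  calculus.\<close>

lemma prim_eq_integral:
  assumes w: "continuous_on {0..1} w" and x: "x \<in> {0..1}"
  shows "prim w x = integral {0..x} w"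
proof -
  have i: "integrable I01 w" by (rule L2_integrable[OF L2_continuous[OF w]])
  have "((\<lambda>y. w y * indicator {..x} y) has_integral prim w x) {0<..<1}"
    unfolding prim_def by (rule has_integral_integral_lebesgue_on) (auto intro: integrable_mult_indicator_I01 i)
  then have "((\<lambda>y. w y * indicator {..x} y) has_integral prim w x) {0..1}"
    by (simp add: has_integral_Icc_iff_Ioo)
  moreover have "(w has_integral integral {0..x} w) {0..x}"
    using x by (intro integrable_integral integrable_continuous_real continuous_on_subset[OF w]) auto
  then have "((\<lambda>y. if y \<in> {0..x} then w y else 0) has_integral integral {0..x} w) {0..1}"
    using x by (subst has_integral_restrict) auto
  then have "((\<lambda>y. w y * indicator {..x} y) has_integral integral {0..x} w) {0..1}"
    by (rule has_integral_eq[rotated]) (auto simp: indicator_def)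
  ultimately show ?thesis by (rule has_integral_unique)
qed

lemma prim_deriv:
  assumes w': "continuous_on {0..1} w'"
    and w: "\<And>x. x \<in> {0..1} \<Longrightarrow> (w has_real_derivative w' x) (at x within {0..1})"
    and x: "x \<in> {0..1}"
  shows "w x = w 0 + prim w' x"
proof -
  have "(w' has_integral w x - w 0) {0..x}"
  proof (rule fundamental_theorem_of_calculus)
    fix y assume "y \<in> {0..x}"
    then show "(w has_vector_derivative w' y) (at y within {0..x})"
      using x by (intro has_vector_derivative_within_subset[OF w[unfolded has_real_derivative_iff_has_vector_derivative]]) auto
  qed (use x in auto)
  then show ?thesis using prim_eq_integral[OF w' x] by (simp add: integral_unique)
qed

lemma prim_has_derivative:
  assumes "continuous_on {0..1} w" "x \<in> {0<..<1}"
  shows "(prim w has_real_derivative w x) (at x)"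
proof -
  have "((\<lambda>x. integral {0..x} w) has_real_derivative w x) (at x within {0..1})"
    using assms by (intro integral_has_real_derivative) auto
  then have "((\<lambda>x. integral {0..x} w) has_real_derivative w x) (at x)"
    using assms by (simp add: at_within_Icc_at)
  then show ?thesis
    by (rule has_field_derivative_transform_within_open[of _ _ _ "{0<..<1}"])
      (use assms prim_eq_integral[OF assms(1)] in auto)
qed

text \<open>The factor F is only a measurable representative of the absolutely continuous a +
  \<open>prim f\<close>, and its boundary values are those of that function; the factor w is C1 up
  to the boundary. It is applied in space, with v or its derivative for F, and in time, with the
  continuous version of a Fourier coefficient.\<close>

lemma by_parts_C1:
  assumes f: "integrable I01 f" and F: "AE x in I01. F x = a + prim f x" "F \<in> borel_measurable I01"
    and w': "continuous_on {0..1} w'"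
    and w: "\<And>x. x \<in> {0..1} \<Longrightarrow> (w has_real_derivative w' x) (at x within {0..1})"
  shows "(\<integral>x. F x * w' x \<partial>I01) + (\<integral>x. f x * w x \<partial>I01) = (a + prim f 1) * w 1 - a * w 0"
proof -
  have w'm [measurable]: "w' \<in> borel_measurable I01" by (rule L2_measurable[OF L2_continuous[OF w']])
  have wc: "continuous_on {0..1} w" using w
    by (intro DERIV_continuous_on)
  have wm [measurable]: "w \<in> borel_measurable I01" by (rule L2_measurable[OF L2_continuous[OF wc]])
  have [measurable]: "f \<in> borel_measurable I01" "F \<in> borel_measurable I01" using f F by measurable
  have w'i: "integrable I01 w'" by (rule L2_integrable[OF L2_continuous[OF w']])
  obtain B where B: "\<And>x. x \<in> {0..1} \<Longrightarrow> \<bar>w x\<bar> \<le> B"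
    using compact_imp_bounded[OF compact_continuous_image[OF wc compact_Icc]] unfolding bounded_iff by fastforce
  have pm [measurable]: "prim f \<in> borel_measurable I01" by (rule prim_measurable[OF f])
  have i1: "integrable I01 (\<lambda>x. f x * w x)"
    by (rule integrable_mult_bounded_I01[OF f wm, of B]) (use B in auto)
  have i2: "integrable I01 (\<lambda>x. (a + prim f x) * w' x)"
  proof -
    have "integrable I01 (\<lambda>x. w' x * (a + prim f x))"
    proof (rule integrable_mult_bounded_I01[OF w'i])
      show "\<bar>a + prim f x\<bar> \<le> \<bar>a\<bar> + (\<integral>y. \<bar>f y\<bar> \<partial>I01)" for x
        using prim_abs_le[OF f, of x] by linarith
    qed measurable
    then show ?thesis by (simp add: mult.commute)
  qed
  have weq: "w 0 + prim w' x = w x" if "x \<in> {0..1}" for x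
    by (rule prim_deriv[OF w' w that, symmetric])
  have "(\<integral>x. F x * w' x \<partial>I01) = (\<integral>x. (a + prim f x) * w' x \<partial>I01)"
    by (rule integral_cong_AE) (use F(1) in \<open>measurable, auto\<close>)
  then have "(\<integral>x. F x * w' x \<partial>I01) + (\<integral>x. f x * w x \<partial>I01) = (\<integral>x. f x * w x + (a + prim f x) * w' x \<partial>I01)"
    using i1 i2 by simp
  also have "\<dots> = prim (\<lambda>x. f x * (w 0 + prim w' x) + (a + prim f x) * w' x) 1"
    unfolding prim_ge_1[OF order_refl] by (intro Bochner_Integration.integral_cong) (auto simp: weq)
  also have "\<dots> = (a + prim f 1) * w 1 - a * w 0"
    unfolding prim_by_parts[OF f w'i] by (simp add: weq)
  finally show ?thesis .
qed

section \<open>Test functions and weak derivatives\<close>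

text \<open>Smoothness without a formula for the n-th derivative: it is enough to place f in a
  family of differentiable functions that is closed under \<open>deriv\<close>.\<close>

lemma differentiable_iterates:
  assumes S: "\<And>g. g \<in> S \<Longrightarrow> (\<forall>x. g differentiable (at x)) \<and> deriv g \<in> S" and f: "f \<in> S"
  shows "((deriv ^^ n) f) differentiable (at (x :: real))"
proof -
  have "(deriv ^^ n) f \<in> S" by (induction n) (use f S in auto)
  then show ?thesis using S by blast
qed

text \<open>Closed under differentiation, with a new polynomial and \<open>k\<close> raised by 2; this is what makes bump functions smooth.\<close>

definition bump_fam :: "real \<Rightarrow> real \<Rightarrow> real \<Rightarrow> real poly \<Rightarrow> nat \<Rightarrow> real \<Rightarrow> real" where
  "bump_fam a c \<beta> p k x =
     (if a < x \<and> x < c then poly p x / ((x - a) * (c - x)) ^ k * exp (- \<beta> / ((x - a) * (c - x))) else 0)"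

text \<open>Meant for the two ends of the support of a bump, where its definition by cases
  changes.\<close>

lemma DERIV_zero_quadratic:
  assumes "\<And>x. \<bar>f x\<bar> \<le> C * (x - a)\<^sup>2"
  shows "(f has_real_derivative 0) (at a)"
proof -
  have [simp]: "f a = 0" using assms[of a] by simp
  have "((\<lambda>y. (f y - f a) / (y - a)) \<longlongrightarrow> 0) (at a)"
  proof (rule Lim_null_comparison)
    show "eventually (\<lambda>y. norm ((f y - f a) / (y - a)) \<le> C * \<bar>y - a\<bar>) (at a)"
      unfolding eventually_at_filter
    proof (rule always_eventually, intro allI impI)
      fix y assume "y \<noteq> a"
      then have "\<bar>f y\<bar> / \<bar>y - a\<bar> \<le> C * \<bar>y - a\<bar>"
        using assms[of y] by (simp add: divide_le_eq power2_eq_square mult.assoc abs_mult[symmetric])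
      then show "norm ((f y - f a) / (y - a)) \<le> C * \<bar>y - a\<bar>" by simp
    qed
    have "((\<lambda>y. C * \<bar>y - a\<bar>) \<longlongrightarrow> C * \<bar>a - a\<bar>) (at a)"
      by (intro tendsto_intros)
    then show "((\<lambda>y. C * \<bar>y - a\<bar>) \<longlongrightarrow> 0) (at a)" by simp
  qed
  then show ?thesis by (simp add: has_field_derivative_iff)
qed

text \<open>The exponential beats every power: exp y \<ge> (1 + y / m)^m for y = \<beta> / w, where
  w = (x - a) (c - x) is small near either end.\<close>

lemma bump_fam_bound:
  assumes "a < c" "0 < \<beta>"
  obtains C where "\<And>x. \<bar>bump_fam a c \<beta> p k x\<bar> \<le> C * (x - a)\<^sup>2" "\<And>x. \<bar>bump_fam a c \<beta> p k x\<bar> \<le> C * (x - c)\<^sup>2"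
proof -
  obtain B where B: "\<And>x. x \<in> {a..c} \<Longrightarrow> \<bar>poly p x\<bar> \<le> B"
    using compact_imp_bounded[OF compact_continuous_image[of "{a..c}" "poly p"]]
    unfolding bounded_iff by (fastforce intro: continuous_intros)
  have B0: "0 \<le> B" using B[of a] assms(1) by force
  \<comment> \<open>Of these powers, k cancel the denominator of the bump, and the other two give
    the quadratic decay.\<close>
  define m where "m = k + 2"
  define D where "D = B * (real m / \<beta>) ^ m"
  have D0: "0 \<le> D" using B0 assms by (simp add: D_def)
  have main: "\<bar>bump_fam a c \<beta> p k x\<bar> \<le> D * ((x - a) * (c - x))\<^sup>2" if x: "a < x" "x < c" for x
  proof -
    define w where "w = (x - a) * (c - x)"
    have w: "w > 0" using x by (simp add: w_def)
    have "(\<beta> / w / real m) ^ m \<le> (1 + \<beta> / w / real m) ^ m"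
      using w assms by (intro power_mono) auto
    also have "\<dots> \<le> exp (\<beta> / w)"
      using w assms(2) by (intro exp_ge_one_plus_x_over_n_power_n) (auto simp: m_def intro: order_trans[of _ 0])
    finally have "inverse (exp (\<beta> / w)) \<le> inverse ((\<beta> / w / real m) ^ m)"
      using w assms(2) by (intro le_imp_inverse_le) (auto simp: m_def)
    then have "exp (- \<beta> / w) \<le> (w * (real m / \<beta>)) ^ m"
      by (simp add: exp_minus power_inverse[symmetric] field_simps)
    then have "exp (- \<beta> / w) / w ^ k \<le> (w * (real m / \<beta>)) ^ m / w ^ k"
      using w by (intro divide_right_mono) auto
    also have "\<dots> = w\<^sup>2 * (real m / \<beta>) ^ m"
    proof -
      have "w ^ m / w ^ k = w\<^sup>2" using w by (simp add: m_def power_add power2_eq_square)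
      then show ?thesis by (simp only: power_mult_distrib times_divide_eq_left[symmetric])
    qed
    finally have e: "exp (- \<beta> / w) / w ^ k \<le> w\<^sup>2 * (real m / \<beta>) ^ m" .
    have "\<bar>bump_fam a c \<beta> p k x\<bar> = \<bar>poly p x\<bar> * (exp (- \<beta> / w) / w ^ k)"
      using x w by (simp add: bump_fam_def w_def[symmetric] abs_mult)
    also have "\<dots> \<le> B * (w\<^sup>2 * (real m / \<beta>) ^ m)"
      using x w e B[of x] B0 by (intro mult_mono) auto
    finally show ?thesis by (simp add: D_def w_def mult_ac)
  qed
  have s: "((x - a) * (c - x))\<^sup>2 \<le> (c - a)\<^sup>2 * (x - a)\<^sup>2 \<and> ((x - a) * (c - x))\<^sup>2 \<le> (c - a)\<^sup>2 * (x - c)\<^sup>2"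
    if x: "a < x" "x < c" for x
  proof -
    have "(c - x)\<^sup>2 \<le> (c - a)\<^sup>2" "(x - a)\<^sup>2 \<le> (c - a)\<^sup>2" using x by (auto intro!: power_mono)
    then show ?thesis
      by (auto simp: power_mult_distrib power2_commute[of c x] mult.commute[of "(c - a)\<^sup>2"] intro: mult_left_mono)
        (metis mult.commute mult_left_mono zero_le_power2)
  qed
  have "\<bar>bump_fam a c \<beta> p k x\<bar> \<le> (D * (c - a)\<^sup>2) * (x - a)\<^sup>2 \<and> \<bar>bump_fam a c \<beta> p k x\<bar> \<le> (D * (c - a)\<^sup>2) * (x - c)\<^sup>2" for x
  proof (cases "a < x \<and> x < c")
    case True
    then have "D * ((x - a) * (c - x))\<^sup>2 \<le> D * ((c - a)\<^sup>2 * (x - a)\<^sup>2)" "D * ((x - a) * (c - x))\<^sup>2 \<le> D * ((c - a)\<^sup>2 * (x - c)\<^sup>2)"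
      using s[of x] D0 by (auto intro: mult_left_mono)
    with main[of x] True show ?thesis by (auto simp: mult.assoc)
  next
    case False
    have "bump_fam a c \<beta> p k x = 0" using False by (auto simp: bump_fam_def)
    then show ?thesis using D0 by simp
  qed
  then show ?thesis by (intro that) blast+
qed

lemma bump_fam_has_derivative:
  assumes "a < c" "0 < \<beta>"
  obtains q l where "\<And>x. (bump_fam a c \<beta> p k has_real_derivative bump_fam a c \<beta> q l x) (at x)"
proof -
  define W :: "real poly" where "W = [:- (a * c), a + c, -1:]"
  have W: "poly W x = (x - a) * (c - x)" for x by (simp add: W_def algebra_simps)
  \<comment> \<open>The numerator of the derivative of p W^(-k) exp (- \<beta> / W) over the common
    denominator W^(k + 2).\<close>
  define q where "q = pderiv p * W ^ 2 - smult (real k) (p * pderiv W * W) + smult \<beta> (p * pderiv W)"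
  have "(bump_fam a c \<beta> p k has_real_derivative bump_fam a c \<beta> q (k + 2) x) (at x)" for x
  proof (cases "a < x \<and> x < c")
    case True
    then have w: "poly W x > 0" by (simp add: W)
    have "((\<lambda>x. poly p x / poly W x ^ k * exp (- \<beta> / poly W x)) has_real_derivative
        (poly (pderiv p) x * poly W x ^ k - poly p x * (real k * poly W x ^ (k - 1) * poly (pderiv W) x)) / (poly W x ^ k * poly W x ^ k) * exp (- \<beta> / poly W x)
        + (exp (- \<beta> / poly W x) * (\<beta> * poly (pderiv W) x / (poly W x * poly W x))) * (poly p x / poly W x ^ k)) (at x)"
      using w by (auto intro!: derivative_eq_intros poly_DERIV) (simp add: field_simps)
    also have "(poly (pderiv p) x * poly W x ^ k - poly p x * (real k * poly W x ^ (k - 1) * poly (pderiv W) x)) / (poly W x ^ k * poly W x ^ k) * exp (- \<beta> / poly W x)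
        + (exp (- \<beta> / poly W x) * (\<beta> * poly (pderiv W) x / (poly W x * poly W x))) * (poly p x / poly W x ^ k)
       = poly q x / poly W x ^ (k + 2) * exp (- \<beta> / poly W x)"
    proof -
      have kk: "real k * W' ^ (k - 1) = real k * W' ^ k / W'" if "W' > 0" for W' :: real
        using that by (cases k) auto
      have alg: "(P' * X - P * (K * X / V * V')) / (X * X) * E + E * (\<beta> * V' / (V * V)) * (P / X)
         = (P' * V\<^sup>2 - K * (P * V' * V) + \<beta> * (P * V')) / (X * V\<^sup>2) * E"
        if "X > 0" "V > 0" for P P' X K V V' E :: real
        using that by (simp add: field_simps power2_eq_square)
      show ?thesis
        unfolding kk[OF w] using alg[of "poly W x ^ k" "poly W x" "poly (pderiv p) x" "poly p x" "real k" "poly (pderiv W) x" "exp (- \<beta> / poly W x)"] w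
        by (simp add: q_def power_add power2_eq_square mult_ac)
    qed
    finally have "((\<lambda>x. poly p x / poly W x ^ k * exp (- \<beta> / poly W x)) has_real_derivative bump_fam a c \<beta> q (k + 2) x) (at x)"
      using True by (simp add: bump_fam_def W)
    then show ?thesis
      by (rule has_field_derivative_transform_within_open[of _ _ _ "{a<..<c}"])
        (use True in \<open>auto simp: bump_fam_def W\<close>)
  next
    case False
    then have z: "bump_fam a c \<beta> q (k + 2) x = 0" by (auto simp: bump_fam_def)
    obtain C where C: "\<And>x. \<bar>bump_fam a c \<beta> p k x\<bar> \<le> C * (x - a)\<^sup>2" "\<And>x. \<bar>bump_fam a c \<beta> p k x\<bar> \<le> C * (x - c)\<^sup>2"
      using bump_fam_bound[OF assms] by metis
    consider "x = a" | "x = c" | "x < a" | "x > c" using False by linarith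
    then show ?thesis
    proof cases
      case 1 then show ?thesis unfolding z using DERIV_zero_quadratic[OF C(1)] by simp
    next
      case 2 then show ?thesis unfolding z using DERIV_zero_quadratic[OF C(2)] by simp
    next
      case 3 show ?thesis unfolding z
        by (rule has_field_derivative_transform_within_open[OF DERIV_const, of "{..<a}"])
          (use 3 in \<open>auto simp: bump_fam_def\<close>)
    next
      case 4 show ?thesis unfolding z
        by (rule has_field_derivative_transform_within_open[OF DERIV_const, of "{c<..}"])
          (use 4 in \<open>auto simp: bump_fam_def\<close>)
    qed
  qed
  then show ?thesis by (rule that)
qed

lemma bump_in_test_funs:
  assumes "0 < a" "a < c" "c < 1" "0 < \<beta>"
  shows "bump_fam a c \<beta> 1 0 \<in> test_funs"
proof -
  have "((deriv ^^ n) (bump_fam a c \<beta> 1 0)) differentiable (at x)" for n x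
  proof (rule differentiable_iterates[where S="{bump_fam a c \<beta> p k | p k. True}"])
    fix g assume "g \<in> {bump_fam a c \<beta> p k | p k. True}"
    then obtain p k where g: "g = bump_fam a c \<beta> p k" by blast
    obtain q l where d: "\<And>x. (g has_real_derivative bump_fam a c \<beta> q l x) (at x)"
      using bump_fam_has_derivative[OF assms(2,4)] g by metis
    then have "deriv g = bump_fam a c \<beta> q l" by (intro ext DERIV_imp_deriv)
    then show "(\<forall>x. g differentiable (at x)) \<and> deriv g \<in> {bump_fam a c \<beta> p k | p k. True}"
      using d by (auto simp: real_differentiable_def)
  qed blast
  moreover have "compact {a..c}" "{a..c} \<subseteq> {0<..<1}" "\<forall>x. x \<notin> {a..c} \<longrightarrow> bump_fam a c \<beta> 1 0 x = 0"
    using assms by (auto simp: bump_fam_def)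
  ultimately show ?thesis unfolding test_funs_def by blast
qed

section \<open>Test functions and their density\<close>

lemma test_fun_DERIV: "\<phi> \<in> test_funs \<Longrightarrow> (\<phi> has_real_derivative deriv \<phi> x) (at x)"
  unfolding test_funs_def by (auto simp: DERIV_deriv_iff_real_differentiable dest: spec[of _ 0])

lemma test_fun_deriv_differentiable: "\<phi> \<in> test_funs \<Longrightarrow> deriv \<phi> differentiable (at x)"
proof -
  assume "\<phi> \<in> test_funs"
  then have "((deriv ^^ 1) \<phi>) differentiable (at x)" unfolding test_funs_def by blast
  then show ?thesis by simp
qed

lemma test_fun_continuous: "\<phi> \<in> test_funs \<Longrightarrow> continuous_on A \<phi>"
  by (intro continuous_at_imp_continuous_on ballI DERIV_isCont[OF test_fun_DERIV])

lemma test_fun_deriv_continuous: "\<phi> \<in> test_funs \<Longrightarrow> continuous_on A (deriv \<phi>)"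
  by (intro continuous_at_imp_continuous_on ballI differentiable_imp_continuous_within test_fun_deriv_differentiable)

lemma test_fun_L2: "\<phi> \<in> test_funs \<Longrightarrow> \<phi> \<in> L2"
  by (intro L2_continuous test_fun_continuous)

lemma test_fun_deriv_L2: "\<phi> \<in> test_funs \<Longrightarrow> deriv \<phi> \<in> L2"
  by (intro L2_continuous test_fun_deriv_continuous)

lemma test_fun_support:
  assumes "\<phi> \<in> test_funs"
  obtains a c where "0 < a" "a < c" "c < 1" "\<And>x. x \<notin> {a..c} \<Longrightarrow> \<phi> x = 0"
proof -
  obtain K where K: "compact K" "K \<subseteq> {0<..<1}" "\<And>x. x \<notin> K \<Longrightarrow> \<phi> x = 0"
    using assms unfolding test_funs_def by blast
  show ?thesis
  proof (cases "K = {}")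
    case True
    then show ?thesis using K by (intro that[of "1/4" "1/2"]) auto
  next
    case False
    obtain l where l: "l \<in> K" "\<And>x. x \<in> K \<Longrightarrow> l \<le> x" using compact_attains_inf[OF K(1) False] by blast
    obtain u where u: "u \<in> K" "\<And>x. x \<in> K \<Longrightarrow> x \<le> u" using compact_attains_sup[OF K(1) False] by blast
    have "0 < l" "u < 1" "l \<le> u" using l u K by auto
    \<comment> \<open>Going half the way from K towards 0 and 1 keeps the interval nondegenerate
      even if K is a single point.\<close>
    moreover have "\<phi> x = 0" if "x \<notin> {l/2..(u+1)/2}" for x
    proof (rule K(3), rule notI)
      assume "x \<in> K"
      with l(2)[of x] u(2)[of x] \<open>0 < l\<close> \<open>u < 1\<close> that show False by auto
    qed
    ultimately show ?thesis by (intro that[of "l/2" "(u+1)/2"]) auto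
  qed
qed

lemma test_fun_outside:
  assumes "\<phi> \<in> test_funs" "x \<le> 0 \<or> 1 \<le> x" shows "\<phi> x = 0"
proof -
  obtain a c where "0 < a" "a < c" "c < 1" "\<And>x. x \<notin> {a..c} \<Longrightarrow> \<phi> x = 0"
    by (rule test_fun_support[OF assms(1)]) blast
  then show ?thesis using assms(2) by auto
qed

lemma test_fun_prim: "\<phi> \<in> test_funs \<Longrightarrow> x \<in> {0..1} \<Longrightarrow> prim (deriv \<phi>) x = \<phi> x"
  using prim_deriv[OF test_fun_deriv_continuous DERIV_subset[OF test_fun_DERIV subset_UNIV], of \<phi> x] test_fun_outside[of \<phi> 0]
  by simp

lemma test_funs_lin:
  assumes "\<phi> \<in> test_funs" "\<psi> \<in> test_funs"
  shows "(\<lambda>x. \<alpha> * \<phi> x + \<beta> * \<psi> x) \<in> test_funs"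
proof -
  let ?sm = "\<lambda>\<phi>. \<forall>n x. ((deriv ^^ n) \<phi>) differentiable (at (x::real))"
  \<comment> \<open>Combinations of arbitrary smooth functions: unlike the one combination at hand,
    this family is closed under \<open>deriv\<close>.\<close>
  let ?S = "{(\<lambda>x::real. \<alpha> * \<phi> x + \<beta> * \<psi> x :: real) | \<phi> \<psi>. ?sm \<phi> \<and> ?sm \<psi>}"
  have "((deriv ^^ n) (\<lambda>x. \<alpha> * \<phi> x + \<beta> * \<psi> x)) differentiable (at x)" for n x
  proof (rule differentiable_iterates[where S="?S"])
    fix g assume "g \<in> ?S"
    then obtain \<phi> \<psi> where g: "g = (\<lambda>x. \<alpha> * \<phi> x + \<beta> * \<psi> x)" and s: "?sm \<phi>" "?sm \<psi>" by blast
    have d: "(\<phi> has_real_derivative deriv \<phi> x) (at x)" "(\<psi> has_real_derivative deriv \<psi> x) (at x)" for x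
      using s[THEN spec, of 0] by (auto simp: DERIV_deriv_iff_real_differentiable)
    have dg: "(g has_real_derivative \<alpha> * deriv \<phi> x + \<beta> * deriv \<psi> x) (at x)" for x
      unfolding g by (intro derivative_intros) (auto intro!: derivative_eq_intros d)
    then have "deriv g = (\<lambda>x. \<alpha> * deriv \<phi> x + \<beta> * deriv \<psi> x)" by (intro ext DERIV_imp_deriv)
    moreover have sm: "?sm (deriv \<phi>)" if "?sm \<phi>" for \<phi>
      using spec[OF that, of "Suc _"] by (simp add: funpow_swap1)
    note sm[OF s(1)] sm[OF s(2)]
    ultimately have "deriv g \<in> ?S" by blast
    then show "(\<forall>x. g differentiable (at x)) \<and> deriv g \<in> ?S"
      using dg real_differentiable_def by blast
  next
    show "(\<lambda>x. \<alpha> * \<phi> x + \<beta> * \<psi> x) \<in> ?S" using assms unfolding test_funs_def by blast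
  qed
  moreover obtain K L where "compact K" "K \<subseteq> {0<..<1}" "\<forall>x. x \<notin> K \<longrightarrow> \<phi> x = 0"
     "compact L" "L \<subseteq> {0<..<1}" "\<forall>x. x \<notin> L \<longrightarrow> \<psi> x = 0"
    using assms unfolding test_funs_def by blast
  then have "compact (K \<union> L) \<and> K \<union> L \<subseteq> {0<..<1} \<and> (\<forall>x. x \<notin> K \<union> L \<longrightarrow> \<alpha> * \<phi> x + \<beta> * \<psi> x = 0)"
    by (auto intro: compact_Un)
  ultimately show ?thesis unfolding test_funs_def by blast
qed

lemma bump_zero_test_funs: "(\<lambda>_. 0) \<in> test_funs"
  using test_funs_lin[OF bump_in_test_funs[of "1/4" "1/2" 1] bump_in_test_funs[of "1/4" "1/2" 1], of 0 0] by simp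

lemma L2_subspace_test_funs: "L2_subspace test_funs"
  using test_fun_L2 test_funs_lin bump_zero_test_funs by (auto simp: L2_subspace_def)

text \<open>Inside (0,1) the half-line is (0,c) up to its end point, with c the truncation of x to
  [0,1]. Bumps on intervals that grow to (0,c) are bounded by 1, and they converge to 1 there if
  \<beta> tends to 0 at the same time.\<close>

lemma indicator_in_closure_test_funs: "(\<lambda>y. indicator {..x} y) \<in> L2_closure test_funs"
proof -
  define c where "c = max 0 (min x 1)"
  have c: "0 \<le> c" "c \<le> 1" by (auto simp: c_def)
  \<comment> \<open>The shift by 3 keeps each margin at most c / 3, so the two end points stay in
    order and inside (0,1). The same kind of null sequence, without the factor c, serves as
    \<beta>.\<close>
  define s where "s n = (if c = 0 then (\<lambda>_. 0) else bump_fam (c / (real n + 3)) (c - c / (real n + 3)) (1 / (real n + 3)) 1 0)" for n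
  have s: "s n \<in> test_funs" for n
  proof (cases "c = 0")
    case False
    then have c0: "0 < c" using c by simp
    have "c / (real n + 3) \<le> c / 3" using c0 by (intro divide_left_mono) auto
    moreover have "0 < c / (real n + 3)" using c0 by simp
    ultimately have "0 < c / (real n + 3)" "c / (real n + 3) < c - c / (real n + 3)" "c - c / (real n + 3) < 1"
      using c0 c by linarith+
    then show ?thesis using False by (simp add: s_def bump_in_test_funs)
  qed (simp add: s_def bump_zero_test_funs)
  have lim0: "(\<lambda>n. 1 / (real n + 3)) \<longlonglongrightarrow> 0"
    using LIMSEQ_ignore_initial_segment[OF lim_1_over_n, of 3] by (simp add: add.commute)
  show ?thesis
  proof (rule L2_closureI)
    show "test_funs \<subseteq> L2" using test_fun_L2 by blast
    show "(\<lambda>y. indicator {..x} y :: real) \<in> L2" by (rule L2_indicator) simp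
    show "s n \<in> L2_closure test_funs" for n using L2_subspace_closure(2)[OF L2_subspace_test_funs] s by blast
    show "(\<lambda>n. L2_norm (\<lambda>y. s n y - indicator {..x} y)) \<longlonglongrightarrow> 0"
    proof (rule L2_dominated_convergence(2)[where w="\<lambda>_. 1"])
      show "s n \<in> borel_measurable I01" for n using test_fun_L2[OF s] by measurable
      show "AE y in I01. \<bar>s n y\<bar> \<le> 1" for n
        using c by (intro AE_I2) (auto simp: s_def bump_fam_def)
      show "AE y in I01. (\<lambda>n. s n y) \<longlonglongrightarrow> indicator {..x} y"
        using AE_I01_neq[of x] AE_space[of I01]
      proof (eventually_elim, goal_cases)
        case (1 y)
        show ?case
        proof (cases "0 < y \<and> y < c")
          case True
          then have "c \<noteq> 0" by auto
          have i: "indicator {..x} y = (1::real)" using True by (auto simp: c_def)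
          have l1: "(\<lambda>n. c * (1 / (real n + 3))) \<longlonglongrightarrow> c * 0" by (rule tendsto_mult[OF tendsto_const lim0])
          have "(\<lambda>n. exp (- (1 / (real n + 3)) / ((y - c * (1 / (real n + 3))) * ((c - c * (1 / (real n + 3))) - y)))) \<longlonglongrightarrow> exp (- 0 / ((y - c * 0) * ((c - c * 0) - y)))"
            using True by (intro tendsto_exp tendsto_divide tendsto_minus lim0 tendsto_mult tendsto_diff tendsto_const l1) auto
          then have L: "(\<lambda>n. exp (- (1 / (real n + 3)) / ((y - c * (1 / (real n + 3))) * ((c - c * (1 / (real n + 3))) - y)))) \<longlonglongrightarrow> 1"
            by simp
          have "eventually (\<lambda>n. c * (1 / (real n + 3)) < y) sequentially"
            using order_tendstoD(2)[OF l1, of y] True by simp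
          moreover have "eventually (\<lambda>n. c * (1 / (real n + 3)) < c - y) sequentially"
            using order_tendstoD(2)[OF l1, of "c - y"] True by simp
          ultimately have "eventually (\<lambda>n. exp (- (1 / (real n + 3)) / ((y - c * (1 / (real n + 3))) * ((c - c * (1 / (real n + 3))) - y))) = s n y) sequentially"
            by eventually_elim (use \<open>c \<noteq> 0\<close> in \<open>auto simp: s_def bump_fam_def\<close>)
          from Lim_transform_eventually[OF L this] show ?thesis unfolding i .
        next
          case False
          have "s n y = 0" for n
          proof (cases "c = 0")
            case f: False
            have "0 \<le> c / (real n + 3)" using c by simp
            then show ?thesis using False f by (auto simp: s_def bump_fam_def)
          qed (simp add: s_def)
          moreover have "indicator {..x} y = (0::real)"
            using False 1 by (auto simp: c_def indicator_def max_def min_def split: if_splits)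
          ultimately show ?thesis by simp
        qed
      qed
    qed auto
  qed
qed

lemma L2_closure_test_funs: "f \<in> L2 \<Longrightarrow> f \<in> L2_closure test_funs"
  by (rule L2_closure_eq_L2[OF L2_subspace_test_funs indicator_in_closure_test_funs])

section \<open>The du Bois-Reymond lemma\<close>

lemma L2_orthogonal_imp_zero:
  assumes P: "P \<subseteq> L2" and h: "h \<in> L2_closure P" and orth: "\<And>p. p \<in> P \<Longrightarrow> (\<integral>x. h x * p x \<partial>I01) = 0"
  shows "AE x in I01. h x = 0"
proof -
  have hL: "h \<in> L2" using h by (simp add: L2_closure_def)
  have "L2_norm h \<le> 0 + e" if "e > 0" for e
  proof -
    obtain p where p: "p \<in> P" "L2_norm (\<lambda>x. h x - p x) < e"
      using h \<open>e > 0\<close> unfolding L2_closure_def by blast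
    have pL: "p \<in> L2" using p P by auto
    \<comment> \<open>Since p is orthogonal to h, the square of the norm is the pairing of h with h
      - p, and h - p is as small as desired.\<close>
    have "(L2_norm h)\<^sup>2 = (\<integral>x. h x * h x \<partial>I01) - (\<integral>x. h x * p x \<partial>I01)"
      unfolding L2_norm_sq orth[OF p(1)] by (simp add: power2_eq_square)
    also have "\<dots> = (\<integral>x. h x * (h x - p x) \<partial>I01)"
      using hL pL by (simp add: right_diff_distrib L2_mult_integrable)
    also have "\<dots> \<le> L2_norm h * L2_norm (\<lambda>x. h x - p x)"
      using L2_Cauchy_Schwarz[OF hL L2_diff[OF hL pL]] by linarith
    also have "\<dots> \<le> L2_norm h * e"
      using p(2) by (intro mult_left_mono) auto
    finally have "L2_norm h * L2_norm h \<le> L2_norm h * e" by (simp add: power2_eq_square)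
    then show ?thesis using \<open>e > 0\<close> L2_norm_nonneg[of h]
      by (cases "L2_norm h = 0") (auto simp: mult_le_cancel_left)
  qed
  then have "L2_norm h \<le> 0" by (rule field_le_epsilon)
  then have "L2_norm h = 0" using L2_norm_nonneg[of h] by linarith
  then show ?thesis using L2_norm_eq_0_iff[OF hL] by blast
qed

lemma test_funs_orthogonal:
  assumes "h \<in> L2" "\<And>\<phi>. \<phi> \<in> test_funs \<Longrightarrow> (\<integral>x. h x * \<phi> x \<partial>I01) = 0"
  shows "AE x in I01. h x = 0"
  using L2_orthogonal_imp_zero[OF _ L2_closure_test_funs[OF assms(1)]] assms(2) test_fun_L2 by blast

text \<open>The vanishing integral is what brings the primitive back to 0 on the right of the
  support. Test functions of mean zero are therefore derivatives of test functions.\<close>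

lemma test_funs_prim:
  assumes z: "\<zeta> \<in> test_funs" and "(\<integral>x. \<zeta> x \<partial>I01) = 0"
  shows "prim \<zeta> \<in> test_funs" "deriv (prim \<zeta>) = \<zeta>"
proof -
  obtain a c where ac: "0 < a" "a < c" "c < 1" "\<And>x. x \<notin> {a..c} \<Longrightarrow> \<zeta> x = 0"
    by (rule test_fun_support[OF z]) blast
  have out: "prim \<zeta> x = 0" if "x \<notin> {a..c}" for x
  proof (cases "x < a")
    case True
    have "(\<lambda>y. \<zeta> y * indicator {..x} y) = (\<lambda>_. 0)"
      by (rule ext) (use ac(4) True in \<open>force simp: indicator_def\<close>)
    then show ?thesis by (simp add: prim_def)
  next
    case False
    then have "x > c" using that by auto
    have "(\<lambda>y. \<zeta> y * indicator {..x} y) = \<zeta>"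
      by (rule ext) (use \<open>x > c\<close> ac(4) in \<open>force simp: indicator_def\<close>)
    then show ?thesis using assms(2) by (simp add: prim_def)
  qed
  have d: "(prim \<zeta> has_real_derivative \<zeta> x) (at x)" for x
  proof (cases "x \<in> {0<..<1}")
    case True
    then show ?thesis by (rule prim_has_derivative[OF test_fun_continuous[OF z]])
  next
    case False
    have "\<zeta> x = 0" using False ac by auto
    moreover have "(prim \<zeta> has_real_derivative 0) (at x)"
      by (rule has_field_derivative_transform_within_open[OF DERIV_const, of "- {a..c}"])
        (use False ac out in auto)
    ultimately show ?thesis by simp
  qed
  then show e: "deriv (prim \<zeta>) = \<zeta>" by (intro ext DERIV_imp_deriv)
  have "((deriv ^^ n) (prim \<zeta>)) differentiable (at x)" for n x
  proof (cases n)
    case 0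
    then show ?thesis using d real_differentiable_def by auto
  next
    case (Suc m)
    have "(deriv ^^ n) (prim \<zeta>) = (deriv ^^ m) \<zeta>" unfolding Suc funpow_Suc_right o_def e ..
    then show ?thesis using z unfolding test_funs_def by simp
  qed
  moreover have "compact {a..c}" "{a..c} \<subseteq> {0<..<1}" "\<forall>x. x \<notin> {a..c} \<longrightarrow> prim \<zeta> x = 0"
    using ac out by auto
  ultimately show "prim \<zeta> \<in> test_funs" unfolding test_funs_def by blast
qed

lemma prim_L2: "g \<in> L2 \<Longrightarrow> prim g \<in> L2"
  by (rule L2_continuous[OF prim_continuous[OF L2_integrable]])

text \<open>Du Bois-Reymond: D = f - \<open>prim g\<close> annihilates the derivatives of test
  functions, hence all test functions of mean zero. Any \<psi> becomes one of these after
  subtraction of a multiple of a fixed bump b, so D acts on \<psi> as a constant does.\<close>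

theorem weak_deriv_imp_prim:
  assumes f: "f \<in> L2" and g: "g \<in> L2" and fg: "weak_deriv f g"
  obtains c where "AE x in I01. f x = c + prim g x"
proof -
  note gi = L2_integrable[OF g]
  define D where "D x = f x - prim g x" for x
  have D: "D \<in> L2" unfolding D_def using f g by (intro L2_diff prim_L2)
  have D0: "(\<integral>x. D x * deriv \<phi> x \<partial>I01) = 0" if \<phi>: "\<phi> \<in> test_funs" for \<phi>
  proof -
    have "(\<integral>x. prim g x * deriv \<phi> x \<partial>I01) + (\<integral>x. g x * \<phi> x \<partial>I01) = (0 + prim g 1) * \<phi> 1 - 0 * \<phi> 0"
      by (rule by_parts_C1[OF gi]) (use \<phi> gi in \<open>auto intro: test_fun_deriv_continuous DERIV_subset[OF test_fun_DERIV]\<close>)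
    then have "(\<integral>x. prim g x * deriv \<phi> x \<partial>I01) = - (\<integral>x. g x * \<phi> x \<partial>I01)"
      using test_fun_outside[OF \<phi>, of 1] by simp
    moreover have "(\<integral>x. f x * deriv \<phi> x \<partial>I01) = - (\<integral>x. g x * \<phi> x \<partial>I01)"
      using fg \<phi> by (simp add: weak_deriv_def)
    moreover have "(\<integral>x. D x * deriv \<phi> x \<partial>I01) = (\<integral>x. f x * deriv \<phi> x \<partial>I01) - (\<integral>x. prim g x * deriv \<phi> x \<partial>I01)"
      unfolding D_def left_diff_distrib
      by (intro Bochner_Integration.integral_diff L2_mult_integrable f prim_L2 g test_fun_deriv_L2 \<phi>)
    ultimately show ?thesis by simp
  qed
  define b where "b = bump_fam (1/4) (1/2) 1 1 0"
  have b: "b \<in> test_funs" by (simp add: b_def bump_in_test_funs)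
  define B where "B = (\<integral>x. b x \<partial>I01)"
  \<comment> \<open>The bump is positive at 3/8, and a continuous nonnegative function with integral
    0 vanishes.\<close>
  have "B \<noteq> 0"
  proof
    assume "B = 0"
    then have "AE x in I01. b x = 0"
      unfolding B_def by (subst (asm) integral_nonneg_eq_0_iff_AE)
        (auto intro: L2_integrable[OF test_fun_L2[OF b]] intro!: AE_I2, simp add: b_def bump_fam_def)
    then have "prim b (1/2) = prim (\<lambda>_. 0) (1/2)"
      by (intro prim_cong_AE) (use test_fun_L2[OF b] in auto)
    then have p0: "prim b (1/2) = 0" by (simp add: prim_def)
    have "prim b (1/2) = integral {0..1/2} b" by (rule prim_eq_integral[OF test_fun_continuous[OF b]]) simp
    then have "integral (cbox 0 (1/2)) b = 0" using p0 by (simp add: cbox_interval)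
    moreover have "b (3/8) > 0" by (simp add: b_def bump_fam_def)
    moreover have "integral (cbox 0 (1/2)) b = 0 \<longleftrightarrow> (\<forall>x\<in>cbox 0 (1/2). b x = 0)"
      by (rule integral_cbox_eq_0_iff) (auto intro: test_fun_continuous[OF b], auto simp: b_def bump_fam_def)
    ultimately show False by (auto dest: bspec[of _ _ "3/8"])
  qed
  \<comment> \<open>The mean of D with respect to the weight b / B.\<close>
  define c where "c = (\<integral>x. D x * b x \<partial>I01) / B"
  have "AE x in I01. D x - c = 0"
  proof (rule test_funs_orthogonal)
    show "(\<lambda>x. D x - c) \<in> L2" using D by auto
    fix \<psi> assume \<psi>: "\<psi> \<in> test_funs"
    define m where "m = (\<integral>x. \<psi> x \<partial>I01)"
    define \<zeta> where "\<zeta> = (\<lambda>x. 1 * \<psi> x + (- m / B) * b x)"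
    have \<zeta>: "\<zeta> \<in> test_funs" unfolding \<zeta>_def by (rule test_funs_lin[OF \<psi> b])
    have "(\<integral>x. \<zeta> x \<partial>I01) = m + (- m / B) * B"
      unfolding \<zeta>_def m_def B_def using L2_integrable[OF test_fun_L2[OF \<psi>]] L2_integrable[OF test_fun_L2[OF b]] by simp
    then have "(\<integral>x. \<zeta> x \<partial>I01) = 0" using \<open>B \<noteq> 0\<close> by simp
    note P = test_funs_prim[OF \<zeta> this]
    have "0 = (\<integral>x. D x * \<zeta> x \<partial>I01)" using D0[OF P(1)] P(2) by simp
    also have "\<dots> = (\<integral>x. D x * \<psi> x + (- m / B) * (D x * b x) \<partial>I01)"
      by (simp add: \<zeta>_def algebra_simps)
    also have "\<dots> = (\<integral>x. D x * \<psi> x \<partial>I01) + (- m / B) * (\<integral>x. D x * b x \<partial>I01)"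
      using L2_mult_integrable[OF D test_fun_L2[OF \<psi>]] L2_mult_integrable[OF D test_fun_L2[OF b]] by simp
    also have "\<dots> = (\<integral>x. D x * \<psi> x \<partial>I01) - c * m"
      by (simp add: c_def)
    also have "\<dots> = (\<integral>x. (D x - c) * \<psi> x \<partial>I01)"
      unfolding m_def left_diff_distrib using L2_mult_integrable[OF D test_fun_L2[OF \<psi>]] L2_integrable[OF test_fun_L2[OF \<psi>]] by simp
    finally show "(\<integral>x. (D x - c) * \<psi> x \<partial>I01) = 0" by simp
  qed
  then have "AE x in I01. f x = c + prim g x"
    by eventually_elim (simp add: D_def)
  then show ?thesis by (rule that)
qed

lemma prim_imp_weak_deriv:
  assumes f: "f \<in> L2" and g: "g \<in> L2" and "AE x in I01. f x = c + prim g x"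
  shows "weak_deriv f g"
  unfolding weak_deriv_def
proof
  fix \<phi> assume \<phi>: "\<phi> \<in> test_funs"
  have "(\<integral>x. f x * deriv \<phi> x \<partial>I01) + (\<integral>x. g x * \<phi> x \<partial>I01) = (c + prim g 1) * \<phi> 1 - c * \<phi> 0"
    by (rule by_parts_C1[OF L2_integrable[OF g]]) (use \<phi> f assms in \<open>auto intro: test_fun_deriv_continuous DERIV_subset[OF test_fun_DERIV]\<close>)
  then show "(\<integral>x. f x * deriv \<phi> x \<partial>I01) = - (\<integral>x. g x * \<phi> x \<partial>I01)"
    using test_fun_outside[OF \<phi>] by simp
qed

lemma weak_deriv_unique:
  assumes "g \<in> L2" "h \<in> L2" "weak_deriv f g" "weak_deriv f h"
  shows "AE x in I01. g x = h x"
proof -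
  have "AE x in I01. g x - h x = 0"
  proof (rule test_funs_orthogonal)
    fix \<phi> assume \<phi>: "\<phi> \<in> test_funs"
    have "(\<integral>x. g x * \<phi> x \<partial>I01) = (\<integral>x. h x * \<phi> x \<partial>I01)"
      using bspec[OF assms(3)[unfolded weak_deriv_def] \<phi>] bspec[OF assms(4)[unfolded weak_deriv_def] \<phi>] by linarith
    then show "(\<integral>x. (g x - h x) * \<phi> x \<partial>I01) = 0"
      using assms \<phi> by (simp add: left_diff_distrib L2_mult_integrable test_fun_L2)
  qed (use assms in auto)
  then show ?thesis by eventually_elim simp
qed

section \<open>Calculus in H1, H10 and H2 up to null sets\<close>

lemma wderiv_H1:
  assumes "f \<in> H1" shows "f \<in> L2" "wderiv f \<in> L2" "weak_deriv f (wderiv f)"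
proof -
  have "\<exists>g. g \<in> L2 \<and> weak_deriv f g" using assms by (auto simp: H1_def)
  then have "wderiv f \<in> L2 \<and> weak_deriv f (wderiv f)" unfolding wderiv_def by (rule someI_ex)
  then show "f \<in> L2" "wderiv f \<in> L2" "weak_deriv f (wderiv f)" using assms by (auto simp: H1_def)
qed

lemma H1I:
  assumes "f \<in> L2" "g \<in> L2" "weak_deriv f g"
  shows "f \<in> H1" "AE x in I01. wderiv f x = g x"
proof -
  show f: "f \<in> H1" using assms by (auto simp: H1_def)
  show "AE x in I01. wderiv f x = g x"
    using weak_deriv_unique[OF wderiv_H1(2)[OF f] assms(2) wderiv_H1(3)[OF f] assms(3)] .
qed

lemma H1_lin:
  assumes f: "f \<in> H1" and g: "g \<in> H1"
  shows "(\<lambda>x. a * f x + b * g x) \<in> H1" "AE x in I01. wderiv (\<lambda>x. a * f x + b * g x) x = a * wderiv f x + b * wderiv g x"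
proof -
  have "weak_deriv (\<lambda>x. a * f x + b * g x) (\<lambda>x. a * wderiv f x + b * wderiv g x)"
    unfolding weak_deriv_def
  proof
    fix \<phi> assume \<phi>: "\<phi> \<in> test_funs"
    have "(\<integral>x. (a * f x + b * g x) * deriv \<phi> x \<partial>I01) = a * (\<integral>x. f x * deriv \<phi> x \<partial>I01) + b * (\<integral>x. g x * deriv \<phi> x \<partial>I01)"
      using L2_mult_integrable[OF wderiv_H1(1)[OF f] test_fun_deriv_L2[OF \<phi>]] L2_mult_integrable[OF wderiv_H1(1)[OF g] test_fun_deriv_L2[OF \<phi>]]
      by (simp add: distrib_right mult.assoc)
    also have "\<dots> = a * - (\<integral>x. wderiv f x * \<phi> x \<partial>I01) + b * - (\<integral>x. wderiv g x * \<phi> x \<partial>I01)"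
      using wderiv_H1(3)[OF f] wderiv_H1(3)[OF g] \<phi> by (simp add: weak_deriv_def)
    also have "\<dots> = - (\<integral>x. (a * wderiv f x + b * wderiv g x) * \<phi> x \<partial>I01)"
      using L2_mult_integrable[OF wderiv_H1(2)[OF f] test_fun_L2[OF \<phi>]] L2_mult_integrable[OF wderiv_H1(2)[OF g] test_fun_L2[OF \<phi>]]
      by (simp add: distrib_right mult.assoc)
    finally show "(\<integral>x. (a * f x + b * g x) * deriv \<phi> x \<partial>I01) = - (\<integral>x. (a * wderiv f x + b * wderiv g x) * \<phi> x \<partial>I01)" .
  qed
  moreover have "(\<lambda>x. a * f x + b * g x) \<in> L2" "(\<lambda>x. a * wderiv f x + b * wderiv g x) \<in> L2"
    by (intro L2_add L2_cmult wderiv_H1 f g)+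
  ultimately show "(\<lambda>x. a * f x + b * g x) \<in> H1" "AE x in I01. wderiv (\<lambda>x. a * f x + b * g x) x = a * wderiv f x + b * wderiv g x"
    by (auto dest: H1I)
qed

lemma weak_deriv_cong:
  assumes "AE x in I01. f x = g x" "f \<in> L2" "g \<in> L2"
  shows "weak_deriv f h \<longleftrightarrow> weak_deriv g h"
proof -
  have "(\<integral>x. f x * deriv \<phi> x \<partial>I01) = (\<integral>x. g x * deriv \<phi> x \<partial>I01)" if "\<phi> \<in> test_funs" for \<phi>
    by (rule integral_mult_cong_AE[OF assms L2_measurable[OF test_fun_deriv_L2[OF that]]])
  then show ?thesis by (auto simp: weak_deriv_def)
qed

text \<open>\<open>wderiv\<close> is a choice of representative, so its values at functions that are
  equal almost everywhere are only known to agree almost everywhere. The rules for second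
  derivatives need this to replace \<open>wderiv\<close> of a combination by the combination of the
  two \<open>wderiv\<close>.\<close>

lemma H1_cong:
  assumes "AE x in I01. f x = g x" "f \<in> L2" "g \<in> H1"
  shows "f \<in> H1" "AE x in I01. wderiv f x = wderiv g x"
proof -
  have "weak_deriv f (wderiv g)"
    using weak_deriv_cong[OF assms(1,2) wderiv_H1(1)[OF assms(3)]] wderiv_H1(3)[OF assms(3)] by simp
  from H1I[OF assms(2) wderiv_H1(2)[OF assms(3)] this]
  show "f \<in> H1" "AE x in I01. wderiv f x = wderiv g x" .
qed

lemma H2_lin:
  assumes f: "f \<in> H2" and g: "g \<in> H2"
  shows "(\<lambda>x. a * f x + b * g x) \<in> H2"
    "AE x in I01. wderiv (wderiv (\<lambda>x. a * f x + b * g x)) x = a * wderiv (wderiv f) x + b * wderiv (wderiv g) x"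
proof -
  have fg: "f \<in> H1" "g \<in> H1" "wderiv f \<in> H1" "wderiv g \<in> H1" using f g by (auto simp: H2_def)
  note l = H1_lin[OF fg(1,2), of a b] and l' = H1_lin[OF fg(3,4), of a b]
  note c = H1_cong[OF l(2) wderiv_H1(2)[OF l(1)] l'(1)]
  show "(\<lambda>x. a * f x + b * g x) \<in> H2" using l(1) c(1) by (simp add: H2_def)
  show "AE x in I01. wderiv (wderiv (\<lambda>x. a * f x + b * g x)) x = a * wderiv (wderiv f) x + b * wderiv (wderiv g) x"
    using c(2) l'(2) by eventually_elim simp
qed

lemma H2_diff:
  assumes f: "f \<in> H2" and g: "g \<in> H2"
  shows "(\<lambda>x. f x - g x) \<in> H2"
    "AE x in I01. wderiv (\<lambda>x. f x - g x) x = wderiv f x - wderiv g x"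
    "AE x in I01. wderiv (wderiv (\<lambda>x. f x - g x)) x = wderiv (wderiv f) x - wderiv (wderiv g) x"
  using H2_lin[OF assms, of 1 "-1"] H1_lin[of f g 1 "-1"] assms by (auto simp: H2_def)

lemma H2_L2:
  assumes "f \<in> H2"
  shows "f \<in> L2" "wderiv f \<in> L2" "wderiv (wderiv f) \<in> L2"
  using assms wderiv_H1 by (auto simp: H2_def)

lemma H2_norm_ge:
  shows "L2_norm f \<le> H2_norm f" "L2_norm (wderiv f) \<le> H2_norm f" "L2_norm (wderiv (wderiv f)) \<le> H2_norm f"
  unfolding H2_norm_def by (rule real_le_rsqrt, simp)+

lemma H1_norm_ge:
  shows "L2_norm f \<le> H1_norm f" "L2_norm (wderiv f) \<le> H1_norm f"
  unfolding H1_norm_def by (rule real_le_rsqrt, simp)+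

lemma zero_H1: "(\<lambda>_. 0) \<in> H1" "AE x in I01. wderiv (\<lambda>_. 0) x = 0"
  using H1I[of "\<lambda>_. 0" "\<lambda>_. 0"] by (auto simp: weak_deriv_def)

lemma H1_cmult:
  assumes f: "f \<in> H1"
  shows "(\<lambda>x. c * f x) \<in> H1" "AE x in I01. wderiv (\<lambda>x. c * f x) x = c * wderiv f x"
  using H1_lin[OF f f, of c 0] by auto

lemma H2_cmult:
  assumes f: "f \<in> H2"
  shows "(\<lambda>x. c * f x) \<in> H2" "AE x in I01. wderiv (\<lambda>x. c * f x) x = c * wderiv f x"
    "AE x in I01. wderiv (wderiv (\<lambda>x. c * f x)) x = c * wderiv (wderiv f) x"
  using H2_lin[OF f f, of c 0] H1_cmult[of f c] f by (auto simp: H2_def)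

lemma H1_norm_cmult:
  assumes "f \<in> H1" shows "H1_norm (\<lambda>x. c * f x) = \<bar>c\<bar> * H1_norm f"
proof -
  have "L2_norm (wderiv (\<lambda>x. c * f x)) = L2_norm (\<lambda>x. c * wderiv f x)"
    by (rule L2_norm_cong_AE[OF H1_cmult(2)[OF assms]])
      (intro L2_measurable L2_cmult wderiv_H1 H1_cmult assms)+
  moreover have "(\<bar>c\<bar> * r)\<^sup>2 + (\<bar>c\<bar> * s)\<^sup>2 = c\<^sup>2 * (r\<^sup>2 + s\<^sup>2)" for r s :: real
    by (simp add: power_mult_distrib distrib_left)
  ultimately show ?thesis
    by (simp add: H1_norm_def real_sqrt_mult)
qed

lemma H2_norm_cmult:
  assumes f: "f \<in> H2" shows "H2_norm (\<lambda>x. c * f x) = \<bar>c\<bar> * H2_norm f"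
proof -
  have "L2_norm (wderiv (\<lambda>x. c * f x)) = L2_norm (\<lambda>x. c * wderiv f x)"
    "L2_norm (wderiv (wderiv (\<lambda>x. c * f x))) = L2_norm (\<lambda>x. c * wderiv (wderiv f) x)"
    by (intro L2_norm_cong_AE H2_cmult f L2_measurable L2_cmult H2_L2)+
  moreover have "(\<bar>c\<bar> * r)\<^sup>2 + (\<bar>c\<bar> * s)\<^sup>2 + (\<bar>c\<bar> * u)\<^sup>2 = c\<^sup>2 * (r\<^sup>2 + s\<^sup>2 + u\<^sup>2)" for r s u :: real
    by (simp add: power_mult_distrib distrib_left)
  ultimately show ?thesis
    by (simp add: H2_norm_def real_sqrt_mult)
qed

lemma test_fun_H1:
  assumes \<phi>: "\<phi> \<in> test_funs" shows "\<phi> \<in> H1" "AE x in I01. wderiv \<phi> x = deriv \<phi> x"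
proof -
  have "AE x in I01. \<phi> x = 0 + prim (deriv \<phi>) x"
    using test_fun_prim[OF \<phi>] by (intro AE_I2) simp
  from H1I[OF test_fun_L2[OF \<phi>] test_fun_deriv_L2[OF \<phi>] prim_imp_weak_deriv[OF test_fun_L2[OF \<phi>] test_fun_deriv_L2[OF \<phi>] this]]
  show "\<phi> \<in> H1" "AE x in I01. wderiv \<phi> x = deriv \<phi> x" .
qed

lemma H10_cmult:
  assumes f: "f \<in> H10" shows "(\<lambda>x. c * f x) \<in> H10"
proof -
  obtain \<phi> where \<phi>: "\<And>n::nat. \<phi> n \<in> test_funs" "(\<lambda>n. H1_norm (\<lambda>x. \<phi> n x - f x)) \<longlonglongrightarrow> 0" and f1: "f \<in> H1"
    using f unfolding H10_def by blast
  have t: "\<phi> n \<in> H1" for n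
    by (rule test_fun_H1[OF \<phi>(1)])
  have "(\<lambda>x. \<phi> n x - f x) \<in> H1" for n using H1_lin(1)[OF t f1, of 1 n "-1"] by simp
  then have "H1_norm (\<lambda>x. c * \<phi> n x - c * f x) = \<bar>c\<bar> * H1_norm (\<lambda>x. \<phi> n x - f x)" for n
    using H1_norm_cmult[of "\<lambda>x. \<phi> n x - f x" c] by (simp add: right_diff_distrib)
  moreover have "(\<lambda>n. \<bar>c\<bar> * H1_norm (\<lambda>x. \<phi> n x - f x)) \<longlonglongrightarrow> \<bar>c\<bar> * 0" by (intro tendsto_mult \<phi> tendsto_const)
  ultimately have "(\<lambda>n. H1_norm (\<lambda>x. c * \<phi> n x - c * f x)) \<longlonglongrightarrow> 0" by simp
  moreover have "(\<lambda>x. c * \<phi> n x) \<in> test_funs" for n using test_funs_lin[OF \<phi>(1) \<phi>(1), of c n 0 n] by simp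
  ultimately show ?thesis using H1_cmult(1)[OF f1, of c] unfolding H10_def mem_Collect_eq
    by (intro conjI exI[of _ "\<lambda>n x. c * \<phi> n x"]) auto
qed

text \<open>Even for the zero function \<open>wderiv\<close> is only known to be zero almost
  everywhere; hence the detour over \<open>H1_cong\<close> for the second derivative.\<close>

lemma zero_H2_H10: "(\<lambda>_. 0) \<in> H2 \<inter> H10"
proof -
  have "wderiv (\<lambda>_. 0) \<in> H1" using H1_cong(1)[OF zero_H1(2) wderiv_H1(2)[OF zero_H1(1)] zero_H1(1)] .
  moreover have "H1_norm (\<lambda>_. 0) = 0"
    using zero_H1(2) L2_norm_eq_0_iff[OF wderiv_H1(2)[OF zero_H1(1)]] by (simp add: H1_norm_def)
  ultimately show ?thesis using zero_H1(1) bump_zero_test_funs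
    by (auto simp: H2_def H10_def intro!: exI[of _ "\<lambda>_ _. 0"])
qed

text \<open>Zero boundary values at both ends. For test functions the constant of integration and
  the total integral of the derivative vanish, and both facts survive convergence in H1, because the
  supremum of a primitive is bounded by the L2 norm of its integrand.\<close>

lemma H10_representation:
  assumes v: "v \<in> H10"
  shows "AE x in I01. v x = prim (wderiv v) x" "prim (wderiv v) 1 = 0"
proof -
  define d where "d = wderiv v"
  obtain \<phi> where \<phi>: "\<And>n::nat. \<phi> n \<in> test_funs" "(\<lambda>n. H1_norm (\<lambda>x. \<phi> n x - v x)) \<longlonglongrightarrow> 0" and v1: "v \<in> H1"
    using v unfolding H10_def by blast
  have vL: "v \<in> L2" and dL: "d \<in> L2" and wd: "weak_deriv v d" using wderiv_H1[OF v1] by (auto simp: d_def)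
  obtain c where c: "AE x in I01. v x = c + prim d x" by (rule weak_deriv_imp_prim[OF vL dL wd])
  have t: "\<phi> n \<in> H1" "AE x in I01. wderiv (\<phi> n) x = deriv (\<phi> n) x" for n
    by (rule test_fun_H1[OF \<phi>(1)])+
  have dd: "L2_norm (\<lambda>x. deriv (\<phi> n) x - d x) \<le> H1_norm (\<lambda>x. \<phi> n x - v x)" for n
  proof -
    have "AE x in I01. wderiv (\<lambda>x. \<phi> n x - v x) x = deriv (\<phi> n) x - d x"
      using H1_lin(2)[OF t(1) v1, of 1 n "-1"] t(2)[of n] by eventually_elim (simp add: d_def)
    moreover have "(\<lambda>x. \<phi> n x - v x) \<in> H1" using H1_lin(1)[OF t(1) v1, of 1 n "-1"] by simp
    ultimately have "L2_norm (wderiv (\<lambda>x. \<phi> n x - v x)) = L2_norm (\<lambda>x. deriv (\<phi> n) x - d x)"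
      by (intro L2_norm_cong_AE L2_measurable[OF wderiv_H1(2)] L2_measurable[OF L2_diff[OF test_fun_deriv_L2[OF \<phi>(1)] dL]])
    then show ?thesis using H1_norm_ge(2)[of "\<lambda>x. \<phi> n x - v x"] by simp
  qed
  have lim: "(\<lambda>n. L2_norm (\<lambda>x. deriv (\<phi> n) x - d x)) \<longlonglongrightarrow> 0"
    by (rule tendsto_sandwich[OF _ _ tendsto_const \<phi>(2)]) (auto intro!: always_eventually dd)
  have pd: "\<bar>\<phi> n x - prim d x\<bar> \<le> L2_norm (\<lambda>x. deriv (\<phi> n) x - d x)" if "x \<in> {0..1}" for n x
  proof -
    have "\<phi> n x - prim d x = prim (\<lambda>x. deriv (\<phi> n) x - d x) x"
      using test_fun_prim[OF \<phi>(1) that, of n] by (subst prim_diff) (auto intro: L2_integrable dL test_fun_deriv_L2 \<phi>)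
    then show ?thesis using prim_abs_le_L2[of "\<lambda>x. deriv (\<phi> n) x - d x" x] dL test_fun_deriv_L2[OF \<phi>(1), of n] by auto
  qed
  have "\<bar>prim d 1\<bar> \<le> L2_norm (\<lambda>x. deriv (\<phi> n) x - d x)" for n
    using pd[of 1 n] test_fun_outside[OF \<phi>(1), of 1 n] by simp
  then have "\<bar>prim d 1\<bar> \<le> 0" by (intro LIMSEQ_le_const[OF lim]) auto
  then show "prim (wderiv v) 1 = 0" by (simp add: d_def)
  \<comment> \<open>The modulus of c is the L2 norm of a constant function; as v -
    \<open>prim d\<close> is that constant, it can be split through the test function.\<close>
  have "\<bar>c\<bar> \<le> H1_norm (\<lambda>x. \<phi> n x - v x) + L2_norm (\<lambda>x. deriv (\<phi> n) x - d x)" for n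
  proof -
    have pdL: "(\<lambda>x. \<phi> n x - prim d x) \<in> L2" by (rule L2_diff[OF test_fun_L2[OF \<phi>(1)] prim_L2[OF dL]])
    have "\<bar>c\<bar> = L2_norm (\<lambda>x. c)" by simp
    also have "\<dots> = L2_norm (\<lambda>x. - (\<phi> n x - v x) + (\<phi> n x - prim d x))"
    proof (rule L2_norm_cong_AE)
      show "AE x in I01. c = - (\<phi> n x - v x) + (\<phi> n x - prim d x)"
        using c by eventually_elim simp
      show "(\<lambda>x. - (\<phi> n x - v x) + (\<phi> n x - prim d x)) \<in> borel_measurable I01"
        using L2_measurable[OF vL] L2_measurable[OF prim_L2[OF dL]] L2_measurable[OF test_fun_L2[OF \<phi>(1)], of n] by measurable
    qed simp
    also have "\<dots> \<le> L2_norm (\<lambda>x. - (\<phi> n x - v x)) + L2_norm (\<lambda>x. \<phi> n x - prim d x)"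
      using L2_cmult[OF L2_diff[OF test_fun_L2[OF \<phi>(1)] vL], of "-1" n]
      by (intro L2_norm_triangle pdL) auto
    also have "L2_norm (\<lambda>x. - (\<phi> n x - v x)) \<le> H1_norm (\<lambda>x. \<phi> n x - v x)"
      unfolding L2_norm_minus by (rule H1_norm_ge)
    also have "L2_norm (\<lambda>x. \<phi> n x - prim d x) \<le> L2_norm (\<lambda>x. deriv (\<phi> n) x - d x)"
      by (rule L2_norm_bounded[OF L2_measurable[OF pdL]]) (auto intro!: pd)
    finally show ?thesis by simp
  qed
  moreover have "(\<lambda>n. H1_norm (\<lambda>x. \<phi> n x - v x) + L2_norm (\<lambda>x. deriv (\<phi> n) x - d x)) \<longlonglongrightarrow> 0 + 0"
    by (intro tendsto_add \<phi> lim)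
  ultimately have "\<bar>c\<bar> \<le> 0 + 0" by (intro LIMSEQ_le_const) auto
  then show "AE x in I01. v x = prim (wderiv v) x" using c by (simp add: d_def)
qed

lemma prim_diff_le:
  assumes g: "g \<in> L2" shows "\<bar>prim g x - prim g y\<bar> \<le> L2_norm g"
proof -
  note gi = L2_integrable[OF g]
  have "prim g x - prim g y = (\<integral>u. g u * indicator {..x} u - g u * indicator {..y} u \<partial>I01)"
    unfolding prim_def by (rule Bochner_Integration.integral_diff[symmetric]) (auto intro: integrable_mult_indicator_I01 gi)
  also have "\<bar>\<dots>\<bar> \<le> (\<integral>u. \<bar>g u * indicator {..x} u - g u * indicator {..y} u\<bar> \<partial>I01)"
    by (rule integral_abs_bound)
  also have "\<dots> \<le> (\<integral>u. \<bar>g u\<bar> \<partial>I01)"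
  proof (rule integral_mono)
    show "integrable I01 (\<lambda>u. \<bar>g u * indicator {..x} u - g u * indicator {..y} u\<bar>)"
      by (intro integrable_abs Bochner_Integration.integrable_diff integrable_mult_indicator_I01 gi) auto
  qed (use gi in \<open>auto simp: indicator_def\<close>)
  also have "\<dots> \<le> L2_norm g" by (rule integral_abs_le_L2_norm[OF g])
  finally show ?thesis .
qed

text \<open>The derivative of \<open>v \<in> H\<^sup>2 \<inter> H\<^sup>1\<^sub>0\<close> has mean zero, so that the second derivative alone controls everything.\<close>

lemma H2_H10_bounds:
  assumes v: "v \<in> H2 \<inter> H10"
  shows "AE x in I01. \<bar>v x\<bar> \<le> L2_norm (wderiv (wderiv v))" "AE x in I01. \<bar>wderiv v x\<bar> \<le> L2_norm (wderiv (wderiv v))"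
proof -
  define d where "d = wderiv v" define g where "g = wderiv d"
  have dL: "d \<in> L2" and gL: "g \<in> L2" and wd: "weak_deriv d g" using v wderiv_H1 by (auto simp: H2_def d_def g_def)
  obtain c where c: "AE x in I01. d x = c + prim g x" by (rule weak_deriv_imp_prim[OF dL gL wd])
  have pi: "integrable I01 (prim g)" by (rule L2_integrable[OF prim_L2[OF gL]])
  have "0 = (\<integral>x. d x \<partial>I01)" using H10_representation(2)[of v] v by (simp add: prim_ge_1 d_def)
  also have "\<dots> = (\<integral>x. c + prim g x \<partial>I01)"
    by (rule integral_cong_AE) (use c pi L2_measurable[OF dL] in auto)
  also have "\<dots> = c + (\<integral>x. prim g x \<partial>I01)" using pi by simp
  finally have ceq: "c = - (\<integral>y. prim g y \<partial>I01)" by simp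
  have "\<bar>c + prim g x\<bar> \<le> L2_norm g" for x
  proof -
    \<comment> \<open>With the constant fixed by the zero mean, the derivative at x is the average
      over y of \<open>prim g x - prim g y\<close>.\<close>
    have "c + prim g x = (\<integral>y. prim g x - prim g y \<partial>I01)" using pi ceq by simp
    also have "\<bar>\<dots>\<bar> \<le> (\<integral>y. \<bar>prim g x - prim g y\<bar> \<partial>I01)" by (rule integral_abs_bound)
    also have "\<dots> \<le> (\<integral>y. L2_norm g \<partial>I01)"
      by (rule integral_mono) (use pi prim_diff_le[OF gL] in auto)
    finally show ?thesis by simp
  qed
  then have bd: "AE x in I01. \<bar>d x\<bar> \<le> L2_norm g"
    using c by (auto elim!: eventually_mono)
  then show "AE x in I01. \<bar>wderiv v x\<bar> \<le> L2_norm (wderiv (wderiv v))" by (simp add: d_def g_def)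
  have "(\<integral>y. \<bar>d y\<bar> \<partial>I01) \<le> (\<integral>y. L2_norm g \<partial>I01)"
    by (rule integral_mono_AE) (use bd L2_integrable[OF dL] in auto)
  then have "\<bar>prim d x\<bar> \<le> L2_norm g" for x using prim_abs_le[OF L2_integrable[OF dL], of x] by simp
  then show "AE x in I01. \<bar>v x\<bar> \<le> L2_norm (wderiv (wderiv v))"
    using H10_representation(1)[of v] v by (auto simp: d_def g_def elim: eventually_mono)
qed

section \<open>The cosine basis\<close>

definition cos_factor :: "nat \<Rightarrow> real" where "cos_factor k = (if k = 0 then 1 else sqrt 2)"

text \<open>Eigenfunctions of the second derivative under Neumann conditions, with eigenvalue - (k
  \<pi>)^2. They are smooth on the closed interval, hence allowed as spatial test functions, which
  need not vanish at the ends. The same system is used once more in the time variable.\<close>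

definition cos_basis :: "nat \<Rightarrow> real \<Rightarrow> real" where "cos_basis k x = cos_factor k * cos (real k * pi * x)"

definition cos_basis_deriv :: "nat \<Rightarrow> real \<Rightarrow> real" where "cos_basis_deriv k x = - (cos_factor k * (real k * pi) * sin (real k * pi * x))"

lemma cos_basis_DERIV: "(cos_basis k has_real_derivative cos_basis_deriv k x) (at x within A)"
  unfolding cos_basis_def[abs_def] cos_basis_deriv_def by (auto intro!: derivative_eq_intros)

lemma cos_basis_deriv_DERIV: "(cos_basis_deriv k has_real_derivative - ((real k * pi)\<^sup>2) * cos_basis k x) (at x within A)"
  unfolding cos_basis_def cos_basis_deriv_def[abs_def] by (auto intro!: derivative_eq_intros simp: power2_eq_square)

lemma cos_basis_continuous [continuous_intros]: "continuous_on A (cos_basis k)"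
  unfolding cos_basis_def[abs_def] by (intro continuous_intros)

lemma cos_basis_deriv_continuous [continuous_intros]: "continuous_on A (cos_basis_deriv k)"
  unfolding cos_basis_deriv_def[abs_def] by (intro continuous_intros)

lemma cos_basis_L2: "cos_basis k \<in> L2" and cos_basis_deriv_L2: "cos_basis_deriv k \<in> L2"
  by (intro L2_continuous continuous_intros)+

lemma cos_basis_deriv_0_1: "cos_basis_deriv k 0 = 0" "cos_basis_deriv k 1 = 0"
  by (simp_all add: cos_basis_deriv_def sin_npi)

lemma integral_cos_I01: "(\<integral>x. cos (real m * pi * x) \<partial>I01) = (if m = 0 then 1 else 0)"
proof (cases "m = 0")
  case False
  have "sin (real m * pi * 1) / (real m * pi) = sin (real m * pi * 0) / (real m * pi) + prim (\<lambda>x. cos (real m * pi * x)) 1"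
    by (rule prim_deriv[where w="\<lambda>x. sin (real m * pi * x) / (real m * pi)"])
      (use False in \<open>auto intro!: continuous_intros derivative_eq_intros\<close>)
  then show ?thesis using False by (simp add: prim_ge_1 sin_npi)
qed simp

lemma cos_basis_orthonormal: "(\<integral>x. cos_basis j x * cos_basis k x \<partial>I01) = (if j = k then 1 else 0)"
proof -
  \<comment> \<open>For k \<le> j the subtraction of naturals in j - k is a true difference; the
    other case follows by symmetry.\<close>
  have main: "(\<integral>x. cos_basis j x * cos_basis k x \<partial>I01) = (if j = k then 1 else 0)" if "k \<le> j" for j k
  proof -
    have i: "integrable I01 (\<lambda>x. cos (real m * pi * x))" for m
      by (intro L2_integrable L2_continuous continuous_intros)
    have "cos_basis j x * cos_basis k x = cos_factor j * cos_factor k / 2 * (cos (real (j - k) * pi * x) + cos (real (j + k) * pi * x))" for x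
      using that by (simp add: cos_basis_def cos_times_cos of_nat_diff algebra_simps)
    then have "(\<integral>x. cos_basis j x * cos_basis k x \<partial>I01) = cos_factor j * cos_factor k / 2 * ((\<integral>x. cos (real (j - k) * pi * x) \<partial>I01) + (\<integral>x. cos (real (j + k) * pi * x) \<partial>I01))"
      by (simp only: integral_mult_right_zero Bochner_Integration.integral_add[OF i i])
    also have "\<dots> = (if j = k then 1 else 0)"
      using that unfolding integral_cos_I01 by (auto simp: cos_factor_def)
    finally show ?thesis .
  qed
  show ?thesis
  proof (cases "k \<le> j")
    case False
    then show ?thesis using main[of j k] by (simp add: mult.commute)
  qed (rule main)
qed

text \<open>Left unnormalised, the product of two generators is half the sum of two generators, so
  that the span is an algebra.\<close>

inductive_set cos_span :: "(real \<Rightarrow> real) set" where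
  base: "(\<lambda>x. cos (real k * pi * x)) \<in> cos_span"
| lin: "f \<in> cos_span \<Longrightarrow> g \<in> cos_span \<Longrightarrow> (\<lambda>x. a * f x + b * g x) \<in> cos_span"

lemma cos_span_continuous: "f \<in> cos_span \<Longrightarrow> continuous_on A f"
  by (induction rule: cos_span.induct) (intro continuous_intros | assumption)+

lemma cos_span_const: "(\<lambda>x. c) \<in> cos_span"
  using cos_span.lin[OF cos_span.base[of 0] cos_span.base[of 0], of c 0] by simp

lemma cos_span_mult:
  assumes f: "f \<in> cos_span" and g: "g \<in> cos_span"
  shows "(\<lambda>x. f x * g x) \<in> cos_span"
  using f
proof (induction rule: cos_span.induct)
  case (base j)
  show ?case using g
  proof (induction rule: cos_span.induct)
    case (base k)
    have main: "(\<lambda>x. cos (real j * pi * x) * cos (real k * pi * x)) \<in> cos_span" if "k \<le> j" for j k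
    proof -
      have "(\<lambda>x. 1/2 * cos (real (j - k) * pi * x) + 1/2 * cos (real (j + k) * pi * x)) \<in> cos_span"
        by (intro cos_span.intros)
      moreover have "(\<lambda>x. cos (real j * pi * x) * cos (real k * pi * x)) = (\<lambda>x. 1/2 * cos (real (j - k) * pi * x) + 1/2 * cos (real (j + k) * pi * x))"
        using that by (intro ext) (simp add: cos_times_cos of_nat_diff algebra_simps)
      ultimately show ?thesis by simp
    qed
    show ?case
    proof (cases "k \<le> j")
      case False
      then show ?thesis using main[of j k] by (simp add: mult.commute)
    qed (rule main)
  next
    case (lin f g a b)
    from cos_span.lin[OF lin.IH, of a b] show ?case by (simp add: algebra_simps)
  qed
next
  case (lin f h a b)
  from cos_span.lin[OF lin.IH, of a b] show ?case by (simp add: algebra_simps)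
qed

text \<open>Stone-Weierstrass; the single function cos (\<pi> x) separates points, being injective
  on [0,1].\<close>

lemma cos_span_dense_continuous:
  assumes "continuous_on {0..1} g" "e > 0"
  obtains p where "p \<in> cos_span" "\<And>x. x \<in> {0..1} \<Longrightarrow> \<bar>g x - p x\<bar> < e"
proof -
  interpret function_ring_on cos_span "{0..1 :: real}"
  proof
    show "compact {0..1 :: real}" by simp
    show "continuous_on {0..1} f" if "f \<in> cos_span" for f by (rule cos_span_continuous[OF that])
    show "(\<lambda>x. f x + g x) \<in> cos_span" if "f \<in> cos_span" "g \<in> cos_span" for f g
      using cos_span.lin[OF that, of 1 1] by simp
    show "(\<lambda>x. f x * g x) \<in> cos_span" if "f \<in> cos_span" "g \<in> cos_span" for f g
      by (rule cos_span_mult[OF that])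
    show "(\<lambda>_. c) \<in> cos_span" for c by (rule cos_span_const)
    show "\<exists>f\<in>cos_span. f x \<noteq> f y" if "x \<in> {0..1}" "y \<in> {0..1}" "x \<noteq> y" for x y :: real
    proof (rule bexI[OF _ cos_span.base[of 1]])
      show "cos (real 1 * pi * x) \<noteq> cos (real 1 * pi * y)"
        using that cos_inj_pi[of "pi * x" "pi * y"] by auto
    qed
  qed
  show ?thesis using Stone_Weierstrass_basic[OF assms] that by blast
qed

lemma L2_closure_cos_span:
  assumes f: "f \<in> L2" shows "f \<in> L2_closure cos_span"
proof -
  have PL: "cos_span \<subseteq> L2" using L2_continuous[OF cos_span_continuous] by blast
  have t: "\<phi> \<in> L2_closure cos_span" if \<phi>: "\<phi> \<in> test_funs" for \<phi>
    unfolding L2_closure_def mem_Collect_eq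
  proof (intro conjI allI impI)
    show pL: "\<phi> \<in> L2" by (rule test_fun_L2[OF \<phi>])
    fix e :: real assume "e > 0"
    obtain p where p: "p \<in> cos_span" "\<And>x. x \<in> {0..1} \<Longrightarrow> \<bar>\<phi> x - p x\<bar> < e/2"
      by (rule cos_span_dense_continuous[OF test_fun_continuous[OF \<phi>], of "e/2"]) (use \<open>e > 0\<close> in auto)
    have "L2_norm (\<lambda>x. \<phi> x - p x) \<le> e/2"
    proof (rule L2_norm_bounded)
      show "(\<lambda>x. \<phi> x - p x) \<in> borel_measurable I01"
        by (intro L2_measurable L2_diff pL subsetD[OF PL p(1)])
      show "\<bar>\<phi> x - p x\<bar> \<le> e/2" if "x \<in> {0<..<1}" for x using p(2)[of x] that by auto
    qed (use \<open>e > 0\<close> in simp)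
    then show "\<exists>p\<in>cos_span. L2_norm (\<lambda>x. \<phi> x - p x) < e"
      using p(1) \<open>e > 0\<close> by (intro bexI[of _ p]) auto
  qed
  have "\<exists>\<phi>. \<phi> \<in> test_funs \<and> L2_norm (\<lambda>x. f x - \<phi> x) < 1 / real (Suc n)" for n
    using L2_closure_test_funs[OF f] unfolding L2_closure_def mem_Collect_eq
    by (metis of_nat_0_less_iff zero_less_Suc zero_less_divide_1_iff)
  then obtain \<phi> where \<phi>: "\<And>n. \<phi> n \<in> test_funs" "\<And>n. L2_norm (\<lambda>x. f x - \<phi> n x) < 1 / real (Suc n)"
    by metis
  show ?thesis
  proof (rule L2_closureI[OF PL f t[OF \<phi>(1)]])
    show "(\<lambda>n. L2_norm (\<lambda>x. \<phi> n x - f x)) \<longlonglongrightarrow> 0"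
    proof (rule tendsto_sandwich[OF _ _ tendsto_const LIMSEQ_inverse_real_of_nat])
      show "eventually (\<lambda>n. L2_norm (\<lambda>x. \<phi> n x - f x) \<le> inverse (real (Suc n))) sequentially"
        using \<phi>(2) by (intro always_eventually allI) (simp add: L2_norm_diff_commute[of "\<phi> _"] inverse_eq_divide less_imp_le)
    qed simp
  qed
qed

section \<open>Fourier coefficients, Bessel and Parseval\<close>

definition coef :: "nat \<Rightarrow> (real \<Rightarrow> real) \<Rightarrow> real" where
  "coef k f = (\<integral>x. f x * cos_basis k x \<partial>I01)"

definition partial :: "nat \<Rightarrow> (real \<Rightarrow> real) \<Rightarrow> real \<Rightarrow> real" where
  "partial N f x = (\<Sum>k<N. coef k f * cos_basis k x)"

lemma coef_lin:
  assumes "f \<in> L2" "g \<in> L2"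
  shows "coef k (\<lambda>x. a * f x + b * g x) = a * coef k f + b * coef k g"
  unfolding coef_def using L2_mult_integrable[OF assms(1) cos_basis_L2[of k]] L2_mult_integrable[OF assms(2) cos_basis_L2[of k]]
  by (simp add: distrib_right mult.assoc)

lemma coef_diff: "f \<in> L2 \<Longrightarrow> g \<in> L2 \<Longrightarrow> coef k (\<lambda>x. f x - g x) = coef k f - coef k g"
  using coef_lin[of f g k 1 "-1"] by simp

lemma sum_cos_basis_L2: "(\<lambda>x. \<Sum>k\<in>A. c k * cos_basis k x) \<in> L2"
  by (intro L2_sum L2_cmult cos_basis_L2)

lemma partial_L2: "partial N f \<in> L2"
  unfolding partial_def[abs_def] by (rule sum_cos_basis_L2)

lemma integral_mult_sum_cos_basis:
  assumes "f \<in> L2" shows "(\<integral>x. f x * (\<Sum>k\<in>A. c k * cos_basis k x) \<partial>I01) = (\<Sum>k\<in>A. c k * coef k f)"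
proof -
  have "(\<integral>x. f x * (\<Sum>k\<in>A. c k * cos_basis k x) \<partial>I01) = (\<integral>x. (\<Sum>k\<in>A. c k * (f x * cos_basis k x)) \<partial>I01)"
    by (simp add: sum_distrib_left mult_ac)
  also have "\<dots> = (\<Sum>k\<in>A. (\<integral>x. c k * (f x * cos_basis k x) \<partial>I01))"
    by (rule Bochner_Integration.integral_sum) (intro integrable_mult_right L2_mult_integrable assms cos_basis_L2)
  finally show ?thesis by (simp add: coef_def)
qed

lemma coef_sum_cos_basis: "finite A \<Longrightarrow> coef j (\<lambda>x. \<Sum>k\<in>A. c k * cos_basis k x) = (if j \<in> A then c j else 0)"
  using integral_mult_sum_cos_basis[OF cos_basis_L2, of j c A] by (simp add: coef_def mult.commute cos_basis_orthonormal if_distrib cong: if_cong)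

lemma L2_norm_sum_cos_basis: "finite A \<Longrightarrow> (L2_norm (\<lambda>x. \<Sum>k\<in>A. c k * cos_basis k x))\<^sup>2 = (\<Sum>k\<in>A. (c k)\<^sup>2)"
  using integral_mult_sum_cos_basis[OF sum_cos_basis_L2, of c A c A] unfolding L2_norm_sq
  by (simp add: coef_sum_cos_basis power2_eq_square)

lemma pythagoras:
  assumes "f \<in> L2" shows "(L2_norm (\<lambda>x. f x - partial N f x))\<^sup>2 = (L2_norm f)\<^sup>2 - (\<Sum>k<N. (coef k f)\<^sup>2)"
proof -
  have "(L2_norm f)\<^sup>2 = (L2_norm (\<lambda>x. (f x - partial N f x) + partial N f x))\<^sup>2" by simp
  also have "\<dots> = (L2_norm (\<lambda>x. f x - partial N f x))\<^sup>2 + 2 * (\<integral>x. (f x - partial N f x) * partial N f x \<partial>I01) + (L2_norm (partial N f))\<^sup>2"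
    by (rule L2_add_sq) (intro L2_diff assms partial_L2)+
  also have "(\<integral>x. (f x - partial N f x) * partial N f x \<partial>I01) = (\<Sum>k<N. coef k f * coef k (\<lambda>x. f x - partial N f x))"
    unfolding partial_def[of N f] by (rule integral_mult_sum_cos_basis) (intro L2_diff assms sum_cos_basis_L2)
  also have "\<dots> = 0"
  proof (rule sum.neutral, rule ballI)
    fix k assume k: "k \<in> {..<N}"
    have "coef k (partial N f) = coef k f" using k coef_sum_cos_basis[of "{..<N}" k "\<lambda>k. coef k f"] by (simp add: partial_def[abs_def])
    then show "coef k f * coef k (\<lambda>x. f x - partial N f x) = 0" by (simp add: coef_diff assms partial_L2)
  qed
  also have "(L2_norm (partial N f))\<^sup>2 = (\<Sum>k<N. (coef k f)\<^sup>2)"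
    unfolding partial_def[abs_def] by (rule L2_norm_sum_cos_basis) simp
  finally show ?thesis by simp
qed

lemma bessel: "f \<in> L2 \<Longrightarrow> (\<Sum>k<N. (coef k f)\<^sup>2) \<le> (L2_norm f)\<^sup>2"
  using pythagoras[of f N] zero_le_power2[of "L2_norm (\<lambda>x. f x - partial N f x)"] by linarith

lemma L2_norm_minus_partial_le: "f \<in> L2 \<Longrightarrow> L2_norm (\<lambda>x. f x - partial N f x) \<le> L2_norm f"
proof (rule power2_le_imp_le)
  assume "f \<in> L2"
  moreover have "0 \<le> (\<Sum>k<N. (coef k f)\<^sup>2)" by (intro sum_nonneg) simp
  ultimately show "(L2_norm (\<lambda>x. f x - partial N f x))\<^sup>2 \<le> (L2_norm f)\<^sup>2"
    using pythagoras[of f N] by linarith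
qed simp

lemma partial_cos_span:
  assumes "p \<in> cos_span" obtains n where "\<And>N x. N \<ge> n \<Longrightarrow> partial N p x = p x"
proof -
  have "\<exists>n. \<forall>N\<ge>n. \<forall>x. partial N p x = p x" using assms
  proof (induction rule: cos_span.induct)
    case (base j)
    have c: "coef k (\<lambda>x. cos (real j * pi * x)) = (if k = j then 1 / cos_factor j else 0)" for k
    proof -
      have "cos (real j * pi * x) = (1 / cos_factor j) * cos_basis j x" for x by (simp add: cos_basis_def cos_factor_def)
      then have "coef k (\<lambda>x. cos (real j * pi * x)) = 1 / cos_factor j * (\<integral>x. cos_basis j x * cos_basis k x \<partial>I01)"
        unfolding coef_def by (simp only: mult.assoc integral_mult_right_zero)
      then show ?thesis by (auto simp: cos_basis_orthonormal)
    qed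
    have "partial N (\<lambda>x. cos (real j * pi * x)) x = cos (real j * pi * x)" if "N \<ge> Suc j" for N x
    proof -
      have "partial N (\<lambda>x. cos (real j * pi * x)) x = (\<Sum>k<N. if k = j then 1 / cos_factor j * cos_basis j x else 0)"
        unfolding partial_def c by (intro sum.cong) auto
      also have "\<dots> = cos (real j * pi * x)" using that by (simp add: cos_basis_def cos_factor_def)
      finally show ?thesis .
    qed
    then show ?case by blast
  next
    case (lin f g a b)
    then obtain n m where nm: "\<forall>N\<ge>n. \<forall>x. partial N f x = f x" "\<forall>N\<ge>m. \<forall>x. partial N g x = g x" by blast
    have fg: "f \<in> L2" "g \<in> L2" using lin.hyps cos_span_continuous L2_continuous by blast+
    have "partial N (\<lambda>x. a * f x + b * g x) x = a * partial N f x + b * partial N g x" for N x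
      by (simp add: partial_def coef_lin[OF fg] distrib_right sum.distrib sum_distrib_left mult.assoc)
    then show ?case using nm by (intro exI[of _ "max n m"]) auto
  qed
  then show ?thesis using that by blast
qed

text \<open>For p in the span and N large, \<open>partial N\<close> fixes p. Then f and f - p have
  the same remainder, and taking the remainder does not increase the norm.\<close>

lemma partial_tendsto:
  assumes f: "f \<in> L2" shows "(\<lambda>N. L2_norm (\<lambda>x. f x - partial N f x)) \<longlonglongrightarrow> 0"
proof (rule LIMSEQ_I)
  fix e :: real assume "e > 0"
  obtain p where p: "p \<in> cos_span" "L2_norm (\<lambda>x. f x - p x) < e"
    using L2_closure_cos_span[OF f] \<open>e > 0\<close> unfolding L2_closure_def by blast
  have pL: "p \<in> L2" by (rule L2_continuous[OF cos_span_continuous[OF p(1)]])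
  obtain n where n: "\<And>N x. N \<ge> n \<Longrightarrow> partial N p x = p x" by (rule partial_cos_span[OF p(1)]) blast
  have "L2_norm (\<lambda>x. f x - partial N f x) < e" if "N \<ge> n" for N
  proof -
    have "partial N (\<lambda>x. f x - p x) x = partial N f x - p x" for x
      unfolding n[OF that, of x, symmetric] by (simp add: partial_def coef_diff[OF f pL] left_diff_distrib sum_subtractf)
    then have "(\<lambda>x. f x - partial N f x) = (\<lambda>x. (f x - p x) - partial N (\<lambda>x. f x - p x) x)"
      by (simp add: fun_eq_iff)
    then have "L2_norm (\<lambda>x. f x - partial N f x) \<le> L2_norm (\<lambda>x. f x - p x)"
      using L2_norm_minus_partial_le[OF L2_diff[OF f pL], of N] by simp
    then show ?thesis using p(2) by simp
  qed
  then show "\<exists>no. \<forall>N\<ge>no. norm (L2_norm (\<lambda>x. f x - partial N f x) - 0) < e" by auto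
qed

lemma parseval:
  assumes f: "f \<in> L2" shows "(\<lambda>k. (coef k f)\<^sup>2) sums (L2_norm f)\<^sup>2"
proof -
  have "(\<lambda>N. (L2_norm f)\<^sup>2 - (L2_norm (\<lambda>x. f x - partial N f x))\<^sup>2) \<longlonglongrightarrow> (L2_norm f)\<^sup>2 - 0\<^sup>2"
    by (intro tendsto_diff tendsto_const tendsto_power partial_tendsto f)
  then show ?thesis by (simp add: sums_def pythagoras[OF f])
qed

section \<open>The transport commutator\<close>

lemma L2_mult_AE_bounded:
  assumes f: "f \<in> L2" and g: "g \<in> L2" and B: "AE x in I01. \<bar>g x\<bar> \<le> B" "0 \<le> B"
  shows "(\<lambda>x. f x * g x) \<in> L2" "L2_norm (\<lambda>x. f x * g x) \<le> B * L2_norm f"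
proof -
  \<comment> \<open>Truncation at B changes g only on a null set and turns the bound into one that
    holds at every point.\<close>
  define h where "h x = max (- B) (min B (g x))" for x
  have hm: "h \<in> borel_measurable I01" unfolding h_def using L2_measurable[OF g] by measurable
  have hB: "\<bar>h x\<bar> \<le> B" for x using B(2) by (auto simp: h_def)
  have ae: "AE x in I01. f x * h x = f x * g x"
    using B(1) by eventually_elim (auto simp: h_def)
  have m: "(\<lambda>x. f x * g x) \<in> borel_measurable I01" "(\<lambda>x. f x * h x) \<in> borel_measurable I01"
    using L2_measurable[OF f] L2_measurable[OF g] hm by measurable
  show "(\<lambda>x. f x * g x) \<in> L2" by (rule L2_AE_cong[OF L2I_bounded_mult[OF f hm hB] ae m(1)])
  show "L2_norm (\<lambda>x. f x * g x) \<le> B * L2_norm f"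
    using L2_norm_mult_bounded[OF f hm hB B(2)] L2_norm_cong_AE[OF ae m(2,1)] by simp
qed

lemma L2_mult_continuous:
  assumes f: "f \<in> L2" and g: "continuous_on {0..1} g"
  shows "(\<lambda>x. f x * g x) \<in> L2"
proof -
  obtain B where B: "\<And>x. x \<in> {0..1} \<Longrightarrow> \<bar>g x\<bar> \<le> B"
    using compact_imp_bounded[OF compact_continuous_image[OF g compact_Icc]] unfolding bounded_iff by fastforce
  show ?thesis by (rule L2I_bounded_mult[OF f L2_measurable[OF L2_continuous[OF g]], of B]) (use B in auto)
qed

lemma integral_mult_sq_le:
  assumes g: "g \<in> L2" and B: "AE x in I01. \<bar>g x\<bar> \<le> B" "0 \<le> B" and u: "continuous_on {0..1} u"
  shows "\<bar>\<integral>x. g x * (u x)\<^sup>2 \<partial>I01\<bar> \<le> B * (L2_norm u)\<^sup>2"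
proof -
  have uL: "u \<in> L2" by (rule L2_continuous[OF u])
  have "\<bar>\<integral>x. u x * (u x * g x) \<partial>I01\<bar> \<le> L2_norm u * L2_norm (\<lambda>x. u x * g x)"
    by (rule L2_Cauchy_Schwarz[OF uL L2_mult_AE_bounded(1)[OF uL g B]])
  also have "\<dots> \<le> L2_norm u * (B * L2_norm u)"
    by (rule mult_left_mono[OF L2_mult_AE_bounded(2)[OF uL g B]]) simp
  finally show ?thesis by (simp add: power2_eq_square mult_ac)
qed

text \<open>At any two points the moduli of u differ by at most the norm of u'; averaging over the
  second point gives the norm of u.\<close>

lemma sup_norm_le_H1:
  assumes u: "\<And>x. (u has_real_derivative u' x) (at x)" and u': "continuous_on {0..1} u'" and x: "x \<in> {0..1}"
  shows "\<bar>u x\<bar> \<le> L2_norm u + L2_norm u'"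
proof -
  have uc: "continuous_on {0..1} u" by (intro continuous_at_imp_continuous_on ballI DERIV_isCont[OF u])
  note uL = L2_continuous[OF uc] and u'L = L2_continuous[OF u']
  have rep: "u y = u 0 + prim u' y" if "y \<in> {0..1}" for y
    by (rule prim_deriv[OF u' DERIV_subset[OF u subset_UNIV] that])
  have "\<bar>u x\<bar> - L2_norm u' \<le> \<bar>u y\<bar>" if "y \<in> {0..1}" for y
    using rep[OF x] rep[OF that] prim_diff_le[OF u'L, of x y] by linarith
  then have "(\<integral>y. \<bar>u x\<bar> - L2_norm u' \<partial>I01) \<le> (\<integral>y. \<bar>u y\<bar> \<partial>I01)"
    by (intro integral_mono) (auto intro: L2_integrable[OF uL])
  then show ?thesis using integral_abs_le_L2_norm[OF uL] by simp
qed

text \<open>For the density \<open>u - s\<^sup>2 u''\<close>, tested with \<open>u\<close> subject to the Neumann condition, all terms are controlled by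
  \<open>\<parallel>u\<parallel>\<^sup>2 + s\<^sup>2 \<parallel>u'\<parallel>\<^sup>2\<close> uniformly in \<open>s\<close>, although the density itself is not.\<close>

lemma transport_commutator:
  assumes v: "v \<in> H2 \<inter> H10"
    and u: "\<And>x. (u has_real_derivative u' x) (at x)" "\<And>x. (u' has_real_derivative u'' x) (at x)"
    and u'': "continuous_on {0..1} u''" and bc: "u' 0 = 0" "u' 1 = 0" and s: "0 < s" "s \<le> 1"
  shows "\<bar>\<integral>x. (u x - s\<^sup>2 * u'' x) * (u x * wderiv v x + u' x * v x) \<partial>I01\<bar>
    \<le> 3 * L2_norm (wderiv (wderiv v)) * ((L2_norm u)\<^sup>2 + s\<^sup>2 * (L2_norm u')\<^sup>2)"
proof -
  define d where "d = wderiv v"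
  define g where "g = wderiv d"
  define W where "W = L2_norm g"
  have vL: "v \<in> L2" and dL: "d \<in> L2" and gL: "g \<in> L2" using H2_L2[of v] v by (auto simp: d_def g_def)
  have vB: "AE x in I01. \<bar>v x\<bar> \<le> W" and dB: "AE x in I01. \<bar>d x\<bar> \<le> W"
    using H2_H10_bounds[OF v] by (simp_all add: W_def d_def g_def)
  have W0: "0 \<le> W" by (simp add: W_def)
  have v10: "v \<in> H10" using v by simp
  have vrep: "AE x in I01. v x = 0 + prim d x" and p1: "prim d 1 = 0"
    using H10_representation[OF v10] by (simp_all add: d_def)
  have dH: "d \<in> H1" using v by (simp add: H2_def d_def)
  obtain c where drep: "AE x in I01. d x = c + prim g x"
    using weak_deriv_imp_prim[OF dL gL] wderiv_H1(3)[OF dH] unfolding g_def by blast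
  have uc: "continuous_on {0..1} u"
    by (intro continuous_at_imp_continuous_on ballI DERIV_isCont[OF u(1)])
  have u'c: "continuous_on {0..1} u'"
    by (intro continuous_at_imp_continuous_on ballI DERIV_isCont[OF u(2)])
  note uL = L2_continuous[OF uc] and u'L = L2_continuous[OF u'c]
  have I: "integrable I01 (\<lambda>x. h x * w x)" if "h \<in> L2" "continuous_on {0..1} w" for h w
    by (rule L2_mult_integrable[OF that(1) L2_continuous[OF that(2)]])
  \<comment> \<open>Neither \<open>P1\<close> nor \<open>P2\<close> has boundary terms, since v
    vanishes at both ends.\<close>
  have P1: "(\<integral>x. v x * (2 * u x * u' x) \<partial>I01) + (\<integral>x. d x * (u x)\<^sup>2 \<partial>I01) = (0 + prim d 1) * (u 1)\<^sup>2 - 0 * (u 0)\<^sup>2"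
    by (rule by_parts_C1[OF L2_integrable[OF dL] vrep L2_measurable[OF vL]])
      (auto intro!: continuous_intros uc u'c derivative_eq_intros DERIV_subset[OF u(1)])
  have P2: "(\<integral>x. v x * (2 * u' x * u'' x) \<partial>I01) + (\<integral>x. d x * (u' x)\<^sup>2 \<partial>I01) = (0 + prim d 1) * (u' 1)\<^sup>2 - 0 * (u' 0)\<^sup>2"
    by (rule by_parts_C1[OF L2_integrable[OF dL] vrep L2_measurable[OF vL]])
      (auto intro!: continuous_intros u'' u'c derivative_eq_intros DERIV_subset[OF u(2)])
  \<comment> \<open>The derivative of v need not vanish at the ends; here it is the Neumann
    condition on u that removes the boundary term.\<close>
  have P3: "(\<integral>x. d x * (u' x * u' x + u x * u'' x) \<partial>I01) + (\<integral>x. g x * (u x * u' x) \<partial>I01) = (c + prim g 1) * (u 1 * u' 1) - c * (u 0 * u' 0)"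
    by (rule by_parts_C1[OF L2_integrable[OF gL] drep L2_measurable[OF dL]])
      (auto intro!: continuous_intros uc u'' u'c derivative_eq_intros DERIV_subset[OF u(1)] DERIV_subset[OF u(2)])
  define A where "A = (\<integral>x. d x * (u x)\<^sup>2 \<partial>I01)"
  define B where "B = (\<integral>x. d x * (u' x)\<^sup>2 \<partial>I01)"
  define C where "C = (\<integral>x. g x * (u x * u' x) \<partial>I01)"
  define D where "D = (\<integral>x. v x * (u x * u' x) \<partial>I01)"
  define E where "E = (\<integral>x. v x * (u' x * u'' x) \<partial>I01)"
  define F where "F = (\<integral>x. d x * (u x * u'' x) \<partial>I01)"
  have "(\<integral>x. v x * (2 * u x * u' x) \<partial>I01) = (\<integral>x. 2 * (v x * (u x * u' x)) \<partial>I01)" by (simp add: mult_ac)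
  then have Q1: "2 * D + A = 0" using P1 p1 by (simp add: A_def D_def)
  have "(\<integral>x. v x * (2 * u' x * u'' x) \<partial>I01) = (\<integral>x. 2 * (v x * (u' x * u'' x)) \<partial>I01)" by (simp add: mult_ac)
  then have Q2: "2 * E + B = 0" using P2 p1 by (simp add: B_def E_def)
  have "(\<integral>x. d x * (u' x * u' x + u x * u'' x) \<partial>I01) = (\<integral>x. d x * (u' x)\<^sup>2 + d x * (u x * u'' x) \<partial>I01)"
    by (simp add: distrib_left power2_eq_square)
  also have "\<dots> = B + F" unfolding B_def F_def
    by (intro Bochner_Integration.integral_add I dL continuous_intros uc u'c u'')
  finally have Q3: "B + F + C = 0" using P3 bc by (simp add: C_def)
  have "(\<integral>x. (u x - s\<^sup>2 * u'' x) * (u x * d x + u' x * v x) \<partial>I01)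
      = (\<integral>x. (d x * (u x)\<^sup>2 + v x * (u x * u' x)) - s\<^sup>2 * (d x * (u x * u'' x) + v x * (u' x * u'' x)) \<partial>I01)"
    by (simp add: algebra_simps power2_eq_square)
  also have "\<dots> = (A + D) - s\<^sup>2 * (F + E)"
  proof -
    have i: "integrable I01 (\<lambda>x. d x * (u x)\<^sup>2)" "integrable I01 (\<lambda>x. v x * (u x * u' x))"
      "integrable I01 (\<lambda>x. d x * (u x * u'' x))" "integrable I01 (\<lambda>x. v x * (u' x * u'' x))"
      by (intro I dL vL continuous_intros uc u'c u'')+
    then show ?thesis unfolding A_def D_def F_def E_def by simp
  qed
  also have "\<dots> = A / 2 + s\<^sup>2 * (3 / 2 * B + C)"
  proof -
    \<comment> \<open>Solving for D, E and F eliminates u'', which the energy does not control: A, B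
      and C contain at most first derivatives of u.\<close>
    have DEF: "D = - A / 2" "E = - B / 2" "F = - B - C" using Q1 Q2 Q3 by linarith+
    show ?thesis unfolding DEF by (simp add: algebra_simps)
  qed
  finally have eq: "(\<integral>x. (u x - s\<^sup>2 * u'' x) * (u x * d x + u' x * v x) \<partial>I01) = A / 2 + s\<^sup>2 * (3 / 2 * B + C)" .
  define U where "U = L2_norm u" define V where "V = L2_norm u'"
  have UV: "0 \<le> U" "0 \<le> V" by (auto simp: U_def V_def)
  have A: "\<bar>A\<bar> \<le> W * U\<^sup>2" unfolding A_def U_def by (rule integral_mult_sq_le[OF dL dB W0 uc])
  have B: "\<bar>B\<bar> \<le> W * V\<^sup>2" unfolding B_def V_def by (rule integral_mult_sq_le[OF dL dB W0 u'c])
  \<comment> \<open>The second derivative g of v is merely square integrable, so one of the factors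
    u and u' is taken in the supremum norm.\<close>
  have C: "\<bar>C\<bar> \<le> W * ((U + V) * V)"
  proof -
    have m: "(\<lambda>x. u' x * u x) \<in> L2" by (intro L2_continuous continuous_intros uc u'c)
    have "L2_norm (\<lambda>x. u' x * u x) \<le> (U + V) * V"
      unfolding V_def U_def
      by (rule L2_norm_mult_bounded[OF u'L L2_measurable[OF uL]]) (auto intro: sup_norm_le_H1[OF u(1) u'c])
    moreover have "\<bar>\<integral>x. g x * (u' x * u x) \<partial>I01\<bar> \<le> W * L2_norm (\<lambda>x. u' x * u x)"
      unfolding W_def by (rule L2_Cauchy_Schwarz[OF gL m])
    moreover have "C = (\<integral>x. g x * (u' x * u x) \<partial>I01)" by (simp add: C_def mult.commute)
    ultimately show ?thesis using mult_left_mono[OF _ W0] by (auto intro: order_trans)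
  qed
  have "\<bar>A / 2 + s\<^sup>2 * (3 / 2 * B + C)\<bar> \<le> \<bar>A\<bar> / 2 + s\<^sup>2 * (3 / 2 * \<bar>B\<bar> + \<bar>C\<bar>)"
  proof -
    have "\<bar>s\<^sup>2 * (3 / 2 * B + C)\<bar> \<le> s\<^sup>2 * (3 / 2 * \<bar>B\<bar> + \<bar>C\<bar>)"
      unfolding abs_mult by (rule mult_mono) auto
    then show ?thesis
      by (intro order_trans[OF abs_triangle_ineq] add_mono) auto
  qed
  also have "\<dots> \<le> (W * U\<^sup>2) / 2 + s\<^sup>2 * (3 / 2 * (W * V\<^sup>2) + W * ((U + V) * V))"
    using A B C by (intro add_mono mult_left_mono divide_right_mono) auto
  also have "\<dots> = W * (U\<^sup>2 / 2 + 5 / 2 * (s\<^sup>2 * V\<^sup>2) + s\<^sup>2 * (U * V))"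
    by (simp add: algebra_simps power2_eq_square)
  also have "\<dots> \<le> W * (3 * (U\<^sup>2 + s\<^sup>2 * V\<^sup>2))"
  proof (rule mult_left_mono[OF _ W0])
    \<comment> \<open>By s \<le> 1, s^2 U V \<le> U (s V) \<le> (U^2 + s^2 V^2) / 2. The larger of
      the resulting coefficients, 5/2 + 1/2, is the 3 of the claim.\<close>
    have "s * (U * (s * V)) \<le> 1 * (U * (s * V))" using s UV by (intro mult_right_mono) auto
    moreover have "2 * (U * (s * V)) \<le> U\<^sup>2 + (s * V)\<^sup>2" using sum_squares_bound[of U "s * V"] by simp
    ultimately have "s\<^sup>2 * (U * V) \<le> U\<^sup>2 / 2 + (s\<^sup>2 * V\<^sup>2) / 2"
      by (simp add: power2_eq_square mult_ac)
    then show "U\<^sup>2 / 2 + 5 / 2 * (s\<^sup>2 * V\<^sup>2) + s\<^sup>2 * (U * V) \<le> 3 * (U\<^sup>2 + s\<^sup>2 * V\<^sup>2)"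
      using zero_le_power2[of U] unfolding distrib_left by linarith
  qed
  finally show ?thesis unfolding eq[unfolded d_def] by (simp add: W_def U_def V_def g_def d_def mult_ac distrib_left)
qed

text \<open>The right-hand side of the weak equation at a fixed time, tested with
  \<open>cos_basis k\<close>: along an admissible path this is the time derivative of the k-th
  coefficient.\<close>

definition flux :: "(real \<Rightarrow> real) \<Rightarrow> (real \<Rightarrow> real) \<Rightarrow> (real \<Rightarrow> real) \<Rightarrow> nat \<Rightarrow> real" where
  "flux f v z k = (\<integral>x. f x * cos_basis k x * wderiv v x \<partial>I01) + (\<integral>x. f x * cos_basis_deriv k x * v x \<partial>I01) + (\<integral>x. cos_basis k x * z x \<partial>I01)"

text \<open>The Fourier multiplier of the inverse of 1 - s^2 d^2/dx^2 under Neumann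
  conditions.\<close>

definition smooth_weight :: "real \<Rightarrow> nat \<Rightarrow> real" where
  "smooth_weight s k = 1 / (1 + s\<^sup>2 * (real k * pi)\<^sup>2)"

lemma smooth_weight_pos: "0 < smooth_weight s k" and smooth_weight_le_1: "smooth_weight s k \<le> 1"
  by (simp_all add: smooth_weight_def add_pos_nonneg divide_le_eq)

lemma L2_triple_integrable:
  assumes "f \<in> L2" "continuous_on {0..1} w" "g \<in> L2"
  shows "integrable I01 (\<lambda>x. f x * w x * g x)"
  by (rule L2_mult_integrable[OF L2_mult_continuous[OF assms(1,2)] assms(3)])

text \<open>The sum is half the rate of change of the energy q of the first N modes. The density
  splits into \<open>partial N f\<close>, for which \<open>transport_commutator\<close> is uniform
  in s, and a remainder that is estimated directly. The remainder costs the factor 2 / s, which is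
  harmless as long as N tends to infinity before s tends to 0.\<close>

theorem flux_estimate:
  fixes N :: nat
  assumes f: "f \<in> L2" and v: "v \<in> H2 \<inter> H10" and z: "z \<in> L2" and s: "0 < s" "s \<le> 1"
  defines "q \<equiv> (\<Sum>k<N. smooth_weight s k * (coef k f)\<^sup>2)" and "W \<equiv> L2_norm (wderiv (wderiv v))"
  shows "\<bar>\<Sum>k<N. smooth_weight s k * coef k f * flux f v z k\<bar>
    \<le> 3 * W * q + sqrt q * (L2_norm z + 2 / s * W * L2_norm (\<lambda>x. f x - partial N f x))"
proof -
  define a where "a k = smooth_weight s k * coef k f" for k
  define u where "u x = (\<Sum>k<N. a k * cos_basis k x)" for x
  define u' where "u' x = (\<Sum>k<N. a k * cos_basis_deriv k x)" for x
  define u'' where "u'' x = (\<Sum>k<N. (a k * (- ((real k * pi)\<^sup>2))) * cos_basis k x)" for x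
  define d where "d = wderiv v"
  define r where "r x = f x - partial N f x" for x
  have vL: "v \<in> L2" and dL: "d \<in> L2" using H2_L2[of v] v by (auto simp: d_def)
  have vB: "AE x in I01. \<bar>v x\<bar> \<le> W" and dB: "AE x in I01. \<bar>d x\<bar> \<le> W"
    using H2_H10_bounds[OF v] by (simp_all add: W_def d_def)
  have W0: "0 \<le> W" by (simp add: W_def)
  have u1: "(u has_real_derivative u' x) (at x)" for x
    unfolding u_def[abs_def] u'_def by (intro DERIV_sum DERIV_cmult cos_basis_DERIV)
  have u2: "(u' has_real_derivative u'' x) (at x)" for x
    unfolding u'_def[abs_def] u''_def mult.assoc by (intro DERIV_sum DERIV_cmult cos_basis_deriv_DERIV)
  have uc: "continuous_on {0..1} u" "continuous_on {0..1} u'" "continuous_on {0..1} u''"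
    unfolding u_def[abs_def] u'_def[abs_def] u''_def[abs_def] by (intro continuous_intros)+
  note uL = L2_continuous[OF uc(1)] L2_continuous[OF uc(2)] L2_continuous[OF uc(3)]
  have bc: "u' 0 = 0" "u' 1 = 0" by (simp_all add: u'_def cos_basis_deriv_0_1)
  have den: "1 + s\<^sup>2 * (real k * pi)\<^sup>2 > 0" for k by (simp add: add_pos_nonneg)
  \<comment> \<open>Mode by mode, u solves the elliptic equation u - s^2 u'' =
    \<open>partial N f\<close>.\<close>
  have part: "partial N f x = u x - s\<^sup>2 * u'' x" for x
  proof -
    have "coef k f * cos_basis k x = a k * cos_basis k x - s\<^sup>2 * ((a k * (- ((real k * pi)\<^sup>2))) * cos_basis k x)" for k
    proof -
      have "coef k f = a k * (1 + s\<^sup>2 * (real k * pi)\<^sup>2)"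
        using den[of k] by (simp add: a_def smooth_weight_def)
      then show ?thesis by (simp add: algebra_simps)
    qed
    then show ?thesis unfolding partial_def u_def u''_def sum_distrib_left sum_subtractf[symmetric]
      by (intro sum.cong refl)
  qed
  \<comment> \<open>The energy is the elliptic equation paired with u; the integration by parts
    leaves no boundary term because u' vanishes at the ends.\<close>
  have q: "(L2_norm u)\<^sup>2 + s\<^sup>2 * (L2_norm u')\<^sup>2 = q"
  proof -
    have n1: "(L2_norm u)\<^sup>2 = (\<Sum>k<N. (a k)\<^sup>2)" unfolding u_def[abs_def] by (rule L2_norm_sum_cos_basis) simp
    have "AE x in I01. u' x = 0 + prim u'' x"
      using prim_deriv[OF uc(3) DERIV_subset[OF u2 subset_UNIV]] bc by (intro AE_I2) simp
    then have "(\<integral>x. u' x * u' x \<partial>I01) + (\<integral>x. u'' x * u x \<partial>I01) = (0 + prim u'' 1) * u 1 - 0 * u 0"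
      by (rule by_parts_C1[OF L2_integrable[OF uL(3)] _ L2_measurable[OF uL(2)] uc(2) DERIV_subset[OF u1 subset_UNIV]])
    moreover have "prim u'' 1 = 0"
      using prim_deriv[OF uc(3) DERIV_subset[OF u2 subset_UNIV], of 1] bc by simp
    ultimately have "(L2_norm u')\<^sup>2 = - (\<integral>x. u'' x * u x \<partial>I01)"
      unfolding L2_norm_sq by (simp add: power2_eq_square)
    also have "(\<integral>x. u'' x * u x \<partial>I01) = (\<Sum>k<N. a k * coef k u'')"
      unfolding u_def by (rule integral_mult_sum_cos_basis[OF uL(3)])
    also have "\<dots> = (\<Sum>k<N. a k * (a k * (- ((real k * pi)\<^sup>2))))"
    proof (rule sum.cong[OF refl])
      fix k assume "k \<in> {..<N}"
      then show "a k * coef k u'' = a k * (a k * (- ((real k * pi)\<^sup>2)))"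
        unfolding u''_def[abs_def] coef_sum_cos_basis[OF finite_lessThan] by simp
    qed
    finally have n2: "(L2_norm u')\<^sup>2 = (\<Sum>k<N. (a k)\<^sup>2 * (real k * pi)\<^sup>2)"
      by (simp add: sum_negf power2_eq_square mult_ac)
    have "(a k)\<^sup>2 + s\<^sup>2 * ((a k)\<^sup>2 * (real k * pi)\<^sup>2) = smooth_weight s k * (coef k f)\<^sup>2" for k
    proof -
      have "(a k)\<^sup>2 + s\<^sup>2 * ((a k)\<^sup>2 * (real k * pi)\<^sup>2) = (a k)\<^sup>2 * (1 + s\<^sup>2 * (real k * pi)\<^sup>2)"
        by (simp add: algebra_simps)
      also have "\<dots> = smooth_weight s k * (coef k f)\<^sup>2 * (smooth_weight s k * (1 + s\<^sup>2 * (real k * pi)\<^sup>2))"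
        by (simp add: a_def power2_eq_square mult_ac)
      also have "smooth_weight s k * (1 + s\<^sup>2 * (real k * pi)\<^sup>2) = 1" using den[of k] by (simp add: smooth_weight_def)
      finally show ?thesis by simp
    qed
    then show ?thesis unfolding n1 n2 q_def by (simp add: sum_distrib_left flip: sum.distrib)
  qed
  have rL: "r \<in> L2" unfolding r_def by (intro L2_diff f partial_L2)
  \<comment> \<open>The derivative of the product u v: the transport parts of all fluxes together
    amount to testing f with h.\<close>
  define h where "h x = u x * d x + u' x * v x" for x
  have hL: "h \<in> L2" and hn: "L2_norm h \<le> W * (L2_norm u + L2_norm u')"
  proof -
    note m1 = L2_mult_AE_bounded[OF uL(1) dL dB W0] and m2 = L2_mult_AE_bounded[OF uL(2) vL vB W0]
    show "h \<in> L2" unfolding h_def by (intro L2_add m1 m2)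
    have "L2_norm h \<le> L2_norm (\<lambda>x. u x * d x) + L2_norm (\<lambda>x. u' x * v x)"
      unfolding h_def by (rule L2_norm_triangle[OF m1(1) m2(1)])
    then show "L2_norm h \<le> W * (L2_norm u + L2_norm u')"
      using m1(2) m2(2) by (simp add: distrib_left)
  qed
  have "(\<Sum>k<N. smooth_weight s k * coef k f * flux f v z k) = (\<integral>x. f x * h x \<partial>I01) + (\<integral>x. u x * z x \<partial>I01)"
  proof -
    have i: "integrable I01 (\<lambda>x. f x * cos_basis k x * d x)" "integrable I01 (\<lambda>x. f x * cos_basis_deriv k x * v x)" "integrable I01 (\<lambda>x. cos_basis k x * z x)" for k
      by (intro L2_triple_integrable L2_mult_integrable f dL vL z cos_basis_L2 cos_basis_continuous cos_basis_deriv_continuous)+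
    have "(\<Sum>k<N. smooth_weight s k * coef k f * flux f v z k) =
       (\<Sum>k<N. (\<integral>x. a k * (f x * cos_basis k x * d x) + a k * (f x * cos_basis_deriv k x * v x) + a k * (cos_basis k x * z x) \<partial>I01))"
      unfolding flux_def d_def[symmetric] a_def[symmetric] using i by (simp add: distrib_left)
    also have "\<dots> = (\<integral>x. (\<Sum>k<N. a k * (f x * cos_basis k x * d x) + a k * (f x * cos_basis_deriv k x * v x) + a k * (cos_basis k x * z x)) \<partial>I01)"
      using i by (intro Bochner_Integration.integral_sum[symmetric]) auto
    also have "\<dots> = (\<integral>x. f x * h x + u x * z x \<partial>I01)"
      by (rule arg_cong[where f="integral\<^sup>L I01"], rule ext)
        (simp add: h_def u_def u'_def sum.distrib sum_distrib_left sum_distrib_right distrib_left mult_ac)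
    also have "\<dots> = (\<integral>x. f x * h x \<partial>I01) + (\<integral>x. u x * z x \<partial>I01)"
      by (intro Bochner_Integration.integral_add L2_mult_integrable f hL uL z)
    finally show ?thesis .
  qed
  also have "(\<integral>x. f x * h x \<partial>I01) = (\<integral>x. partial N f x * h x \<partial>I01) + (\<integral>x. r x * h x \<partial>I01)"
    using L2_mult_integrable[OF rL hL] L2_mult_integrable[OF partial_L2 hL, of N f]
    by (subst Bochner_Integration.integral_add[symmetric]) (auto simp: r_def algebra_simps)
  finally have main: "(\<Sum>k<N. smooth_weight s k * coef k f * flux f v z k) =
     (\<integral>x. partial N f x * h x \<partial>I01) + (\<integral>x. r x * h x \<partial>I01) + (\<integral>x. u x * z x \<partial>I01)" .
  have q0: "0 \<le> q" using q by (metis add_nonneg_nonneg zero_le_mult_iff zero_le_power2)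
  have un: "L2_norm u \<le> sqrt q"
    using q by (intro real_le_rsqrt) (metis le_add_same_cancel1 zero_le_mult_iff zero_le_power2)
  have "s * L2_norm u' \<le> sqrt q"
    using q by (intro real_le_rsqrt) (metis le_add_same_cancel2 power_mult_distrib zero_le_power2)
  then have un': "L2_norm u' \<le> sqrt q / s" using s(1) by (simp add: field_simps)
  have t1: "\<bar>\<integral>x. partial N f x * h x \<partial>I01\<bar> \<le> 3 * W * q"
    using transport_commutator[OF v u1 u2 uc(3) bc s] unfolding part h_def q W_def d_def .
  have t2: "\<bar>\<integral>x. r x * h x \<partial>I01\<bar> \<le> sqrt q * (2 / s * W * L2_norm r)"
  proof -
    have "\<bar>\<integral>x. r x * h x \<partial>I01\<bar> \<le> L2_norm r * L2_norm h" by (rule L2_Cauchy_Schwarz[OF rL hL])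
    also have "\<dots> \<le> L2_norm r * (W * (sqrt q / s + sqrt q / s))"
    proof (rule mult_left_mono)
      have "sqrt q \<le> sqrt q / s" using s q0 by (simp add: le_divide_eq mult_left_le)
      then have "L2_norm u + L2_norm u' \<le> sqrt q / s + sqrt q / s" using un un' by linarith
      then show "L2_norm h \<le> W * (sqrt q / s + sqrt q / s)"
        using hn mult_left_mono[OF _ W0] order_trans by blast
    qed simp
    finally show ?thesis by (simp add: mult_ac)
  qed
  have t3: "\<bar>\<integral>x. u x * z x \<partial>I01\<bar> \<le> sqrt q * L2_norm z"
    using L2_Cauchy_Schwarz[OF uL(1) z] mult_right_mono[OF un L2_norm_nonneg[of z]] by linarith
  show ?thesis unfolding main using t1 t2 t3 by (simp add: r_def[abs_def] distrib_left)
qed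

text \<open>For a single mode crude bounds suffice: the cosine and its derivative are at most 2 (1 +
  k \<pi>), and v and its derivative are bounded almost everywhere by the L2 norm of the second
  derivative.\<close>

lemma flux_le:
  assumes f: "f \<in> L2" and v: "v \<in> H2 \<inter> H10" and z: "z \<in> L2"
  shows "\<bar>flux f v z k\<bar> \<le> 2 * (1 + real k * pi) * (2 * L2_norm (wderiv (wderiv v)) * L2_norm f + L2_norm z)"
proof -
  define W where "W = L2_norm (wderiv (wderiv v))"
  define C where "C = 2 * (1 + real k * pi)"
  have "1 \<le> sqrt (2::real)" "sqrt (2::real) \<le> 2" by (auto simp: real_le_lsqrt)
  then have c: "0 \<le> cos_factor k" "cos_factor k \<le> 2" by (auto simp: cos_factor_def)
  have e: "\<bar>cos_basis k x\<bar> \<le> C" "\<bar>cos_basis_deriv k x\<bar> \<le> C" for x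
  proof -
    have "\<bar>cos_basis k x\<bar> \<le> 2 * 1" unfolding cos_basis_def abs_mult using c by (intro mult_mono) auto
    moreover have "0 \<le> real k * pi" by simp
    ultimately show "\<bar>cos_basis k x\<bar> \<le> C" unfolding C_def distrib_left by linarith
    have "\<bar>cos_basis_deriv k x\<bar> \<le> 2 * (real k * pi) * 1" unfolding cos_basis_deriv_def abs_minus abs_mult using c by (intro mult_mono) auto
    then show "\<bar>cos_basis_deriv k x\<bar> \<le> C" unfolding C_def by (simp add: distrib_left)
  qed
  have C0: "0 \<le> C" by (simp add: C_def)
  have vL: "v \<in> L2" and dL: "wderiv v \<in> L2" using H2_L2[of v] v by auto
  have vB: "AE x in I01. \<bar>v x\<bar> \<le> W" and dB: "AE x in I01. \<bar>wderiv v x\<bar> \<le> W"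
    using H2_H10_bounds[OF v] by (simp_all add: W_def)
  have W0: "0 \<le> W" by (simp add: W_def)
  have b: "\<bar>\<integral>x. f x * w x * g x \<partial>I01\<bar> \<le> C * (W * L2_norm f)"
    if w: "continuous_on {0..1} w" "\<And>x. \<bar>w x\<bar> \<le> C" and g: "g \<in> L2" "AE x in I01. \<bar>g x\<bar> \<le> W" for w g
  proof -
    note m = L2_mult_AE_bounded[OF f g W0]
    have wL: "w \<in> L2" by (rule L2_continuous[OF w(1)])
    have "L2_norm w \<le> C" by (rule L2_norm_bounded[OF L2_measurable[OF wL]]) (use w C0 in auto)
    moreover have "\<bar>\<integral>x. w x * (f x * g x) \<partial>I01\<bar> \<le> L2_norm w * L2_norm (\<lambda>x. f x * g x)"
      by (rule L2_Cauchy_Schwarz[OF wL m(1)])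
    moreover have "\<dots> \<le> C * (W * L2_norm f)" using calculation(1) m(2) C0 by (intro mult_mono) auto
    ultimately have "\<bar>\<integral>x. w x * (f x * g x) \<partial>I01\<bar> \<le> C * (W * L2_norm f)" by linarith
    then show ?thesis by (simp add: mult_ac)
  qed
  have "L2_norm (cos_basis k) \<le> C" by (rule L2_norm_bounded[OF L2_measurable[OF cos_basis_L2]]) (use e C0 in auto)
  then have "\<bar>\<integral>x. cos_basis k x * z x \<partial>I01\<bar> \<le> C * L2_norm z"
    using L2_Cauchy_Schwarz[OF cos_basis_L2[of k] z] mult_right_mono[of "L2_norm (cos_basis k)" C "L2_norm z"] by simp
  moreover note b[OF cos_basis_continuous e(1) dL dB] b[OF cos_basis_deriv_continuous e(2) vL vB]
  ultimately have "\<bar>flux f v z k\<bar> \<le> C * (W * L2_norm f) + C * (W * L2_norm f) + C * L2_norm z"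
    unfolding flux_def by linarith
  also have "\<dots> = C * (2 * W * L2_norm f + L2_norm z)" by (simp add: algebra_simps)
  finally show ?thesis unfolding C_def W_def .
qed

section \<open>Curves of functions\<close>

text \<open>Rests on the completeness of Lebesgue measure; extension by 0 passes between
  \<open>I01\<close> and \<open>lebesgue\<close>.\<close>

lemma borel_measurable_I01_AE:
  fixes f g :: "real \<Rightarrow> real"
  assumes f: "f \<in> borel_measurable I01" and ae: "AE x in I01. f x = g x"
  shows "g \<in> borel_measurable I01"
proof -
  let ?e = "\<lambda>h x. if x \<in> {0<..<1} then h x else (0::real)"
  have s: "{0<..<1::real} \<in> sets lebesgue" by simp
  have "?e f \<in> borel_measurable lebesgue" using f borel_measurable_if[OF s, of f] by simp
  moreover have "AE x in lebesgue. ?e f x = ?e g x"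
    using ae by (subst (asm) AE_restrict_space_iff) (auto elim: eventually_mono)
  ultimately have "?e g \<in> borel_measurable lebesgue" by (rule borel_measurable_AE)
  then show ?thesis using borel_measurable_if[OF s, of g] by simp
qed

lemma borel_measurable_I01_LIMSEQ:
  fixes f :: "nat \<Rightarrow> real \<Rightarrow> real"
  assumes f: "\<And>n. f n \<in> borel_measurable I01" and lim: "AE t in I01. (\<lambda>n. f n t) \<longlonglongrightarrow> g t"
  shows "g \<in> borel_measurable I01"
proof (rule borel_measurable_I01_AE)
  show "(\<lambda>t. lim (\<lambda>n. f n t)) \<in> borel_measurable I01" using f by measurable
  show "AE t in I01. lim (\<lambda>n. f n t) = g t" using lim by eventually_elim (rule limI)
qed

definition L2_measurable_curve :: "(real \<Rightarrow> real \<Rightarrow> real) \<Rightarrow> bool" where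
  "L2_measurable_curve u \<longleftrightarrow> bochner_measurable L2 L2_norm u"

lemma L2_measurable_curve_AE_L2: "L2_measurable_curve u \<Longrightarrow> AE t in I01. u t \<in> L2"
  by (simp add: L2_measurable_curve_def bochner_measurable_def)

lemma L2_measurable_curveE:
  assumes "L2_measurable_curve u"
  obtains s where "\<And>n::nat. simple_function I01 (s n)" "\<And>n t. t \<in> {0<..<1} \<Longrightarrow> s n t \<in> L2"
    "AE t in I01. (\<lambda>n. L2_norm (\<lambda>x. s n t x - u t x)) \<longlonglongrightarrow> 0"
  using assms unfolding L2_measurable_curve_def bochner_measurable_def by blast

text \<open>A Lipschitz map carries simple approximations along. The bound compares
  \<open>D a - D b\<close> with \<open>a - b\<close> rather than asking D to be linear, since D is
  going to be \<open>wderiv\<close>, which is linear only almost everywhere.\<close>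

lemma bochner_measurable_map:
  assumes u: "bochner_measurable X N u"
    and D: "\<And>a. a \<in> X \<Longrightarrow> D a \<in> L2" and C: "\<And>a b. a \<in> X \<Longrightarrow> b \<in> X \<Longrightarrow> L2_norm (\<lambda>x. D a x - D b x) \<le> C * N (\<lambda>x. a x - b x)"
  shows "L2_measurable_curve (\<lambda>t. D (u t))"
proof -
  obtain s where s: "\<And>n::nat. simple_function I01 (s n)" "\<And>n t. t \<in> {0<..<1} \<Longrightarrow> s n t \<in> X"
    "AE t in I01. (\<lambda>n. N (\<lambda>x. s n t x - u t x)) \<longlonglongrightarrow> 0" and X: "AE t in I01. u t \<in> X"
    using u unfolding bochner_measurable_def by blast
  have "simple_function I01 (\<lambda>t. D (s n t))" for n
    using simple_function_compose[OF s(1)[of n], of D] by (simp add: o_def)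
  moreover have "AE t in I01. (\<lambda>n. L2_norm (\<lambda>x. D (s n t) x - D (u t) x)) \<longlonglongrightarrow> 0"
    using s(3) X AE_space[of I01]
  proof eventually_elim
    case (elim t)
    show ?case
    proof (rule tendsto_sandwich[OF _ _ tendsto_const])
      show "eventually (\<lambda>n. L2_norm (\<lambda>x. D (s n t) x - D (u t) x) \<le> C * N (\<lambda>x. s n t x - u t x)) sequentially"
        using C[OF s(2) elim(2)] elim(3) by (intro always_eventually allI) simp
      show "(\<lambda>n. C * N (\<lambda>x. s n t x - u t x)) \<longlonglongrightarrow> 0"
        using tendsto_mult_left[OF elim(1), of C] by simp
    qed simp
  qed
  moreover have "AE t in I01. D (u t) \<in> L2" using X by eventually_elim (rule D)
  ultimately show ?thesis unfolding L2_measurable_curve_def bochner_measurable_def using D s(2)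
    by (intro conjI exI[of _ "\<lambda>n t. D (s n t)"]) auto
qed

text \<open>The H2 norm dominates the norms of the function and of both derivatives, so each of the
  three maps is Lipschitz into L2 with constant 1.\<close>

lemma L2_measurable_curve_H2:
  assumes v: "bochner_measurable (H2 \<inter> H10) H2_norm v"
  shows "L2_measurable_curve v" "L2_measurable_curve (\<lambda>t. wderiv (v t))" "L2_measurable_curve (\<lambda>t. wderiv (wderiv (v t)))"
proof -
  show "L2_measurable_curve v"
    using bochner_measurable_map[OF v, of "\<lambda>a. a" 1] H2_L2(1) H2_norm_ge(1) by auto
  have 1: "L2_norm (\<lambda>x. wderiv a x - wderiv b x) \<le> 1 * H2_norm (\<lambda>x. a x - b x)" if "a \<in> H2 \<inter> H10" "b \<in> H2 \<inter> H10" for a b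
  proof -
    have ab: "a \<in> H2" "b \<in> H2" using that by auto
    have "L2_norm (wderiv (\<lambda>x. a x - b x)) = L2_norm (\<lambda>x. wderiv a x - wderiv b x)"
      by (rule L2_norm_cong_AE[OF H2_diff(2)[OF ab] L2_measurable[OF H2_L2(2)[OF H2_diff(1)[OF ab]]] L2_measurable[OF L2_diff[OF H2_L2(2)[OF ab(1)] H2_L2(2)[OF ab(2)]]]])
    then show ?thesis using H2_norm_ge(2)[of "\<lambda>x. a x - b x"] by simp
  qed
  show "L2_measurable_curve (\<lambda>t. wderiv (v t))"
    by (rule bochner_measurable_map[OF v _ 1]) (auto intro: H2_L2)
  have 2: "L2_norm (\<lambda>x. wderiv (wderiv a) x - wderiv (wderiv b) x) \<le> 1 * H2_norm (\<lambda>x. a x - b x)" if "a \<in> H2 \<inter> H10" "b \<in> H2 \<inter> H10" for a b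
  proof -
    have ab: "a \<in> H2" "b \<in> H2" using that by auto
    have "L2_norm (wderiv (wderiv (\<lambda>x. a x - b x))) = L2_norm (\<lambda>x. wderiv (wderiv a) x - wderiv (wderiv b) x)"
      by (rule L2_norm_cong_AE[OF H2_diff(3)[OF ab] L2_measurable[OF H2_L2(3)[OF H2_diff(1)[OF ab]]] L2_measurable[OF L2_diff[OF H2_L2(3)[OF ab(1)] H2_L2(3)[OF ab(2)]]]])
    then show ?thesis using H2_norm_ge(3)[of "\<lambda>x. a x - b x"] by simp
  qed
  show "L2_measurable_curve (\<lambda>t. wderiv (wderiv (v t)))"
    by (rule bochner_measurable_map[OF v _ 2]) (auto intro: H2_L2)
qed

section \<open>Pairing two curves against a continuous weight\<close>

abbreviation cont_square :: "(real \<Rightarrow> real \<Rightarrow> real) \<Rightarrow> bool" where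
  "cont_square \<phi> \<equiv> continuous_on ({0..1} \<times> {0..1}) (\<lambda>(t, x). \<phi> t x)"

lemma cont_square_bound:
  assumes "cont_square \<phi>"
  obtains B where "0 \<le> B" "\<And>t x. t \<in> {0..1} \<Longrightarrow> x \<in> {0..1} \<Longrightarrow> \<bar>\<phi> t x\<bar> \<le> B"
proof -
  have "bounded ((\<lambda>(t, x). \<phi> t x) ` ({0..1} \<times> {0..1}))"
    by (intro compact_imp_bounded compact_continuous_image assms compact_Times compact_Icc)
  then obtain B where B: "\<And>p. p \<in> {0..1} \<times> {0..1} \<Longrightarrow> norm ((\<lambda>(t, x). \<phi> t x) p) \<le> B"
    unfolding bounded_iff by blast
  have "\<bar>\<phi> t x\<bar> \<le> B" if "t \<in> {0..1}" "x \<in> {0..1}" for t x using B[of "(t, x)"] that by auto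
  moreover from this[of 0 0] have "0 \<le> B" by (auto intro: order_trans[OF abs_ge_zero])
  ultimately show ?thesis by (intro that)
qed

lemma cont_square_slice:
  assumes "cont_square \<phi>"
  shows "t \<in> {0..1} \<Longrightarrow> continuous_on {0..1} (\<phi> t)" "x \<in> {0..1} \<Longrightarrow> continuous_on {0..1} (\<lambda>t. \<phi> t x)"
proof -
  show "continuous_on {0..1} (\<phi> t)" if "t \<in> {0..1}"
  proof -
    have "continuous_on {0..1} ((\<lambda>(t, x). \<phi> t x) \<circ> (\<lambda>x. (t, x)))"
      by (rule continuous_on_compose, intro continuous_intros, rule continuous_on_subset[OF assms]) (use that in auto)
    then show ?thesis by (simp add: o_def)
  qed
  show "continuous_on {0..1} (\<lambda>t. \<phi> t x)" if "x \<in> {0..1}"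
  proof -
    have "continuous_on {0..1} ((\<lambda>(t, x). \<phi> t x) \<circ> (\<lambda>t. (t, x)))"
      by (rule continuous_on_compose, intro continuous_intros, rule continuous_on_subset[OF assms]) (use that in auto)
    then show ?thesis by (simp add: o_def)
  qed
qed

lemma triple_le:
  assumes f: "f \<in> L2" and g: "g \<in> L2" and w: "continuous_on {0..1} w" and B: "0 \<le> B" "\<And>x. x \<in> {0..1} \<Longrightarrow> \<bar>w x\<bar> \<le> B"
  shows "\<bar>\<integral>x. f x * w x * g x \<partial>I01\<bar> \<le> B * (L2_norm f * L2_norm g)"
proof -
  have "\<bar>\<integral>x. f x * w x * g x \<partial>I01\<bar> \<le> L2_norm (\<lambda>x. f x * w x) * L2_norm g"
    by (rule L2_Cauchy_Schwarz[OF L2_mult_continuous[OF f w] g])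
  also have "\<dots> \<le> (B * L2_norm f) * L2_norm g"
    by (intro mult_right_mono L2_norm_mult_bounded f L2_measurable[OF L2_continuous[OF w]] B) auto
  finally show ?thesis by (simp add: mult.assoc)
qed

text \<open>For constant f and w the integral is continuous in t. For simple curves measurability is
  checked value by value. The general case is a limit of these, by the bilinear splitting in
  \<open>le\<close>.\<close>

lemma triple_measurable:
  assumes f: "L2_measurable_curve f" and w: "L2_measurable_curve w" and \<phi>: "cont_square \<phi>"
  shows "(\<lambda>t. \<integral>x. f t x * \<phi> t x * w t x \<partial>I01) \<in> borel_measurable I01"
proof -
  obtain s where s: "\<And>n::nat. simple_function I01 (s n)" "\<And>n t. t \<in> {0<..<1} \<Longrightarrow> s n t \<in> L2"
    "AE t in I01. (\<lambda>n. L2_norm (\<lambda>x. s n t x - f t x)) \<longlonglongrightarrow> 0" by (rule L2_measurable_curveE[OF f]) blast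
  obtain r where r: "\<And>n::nat. simple_function I01 (r n)" "\<And>n t. t \<in> {0<..<1} \<Longrightarrow> r n t \<in> L2"
    "AE t in I01. (\<lambda>n. L2_norm (\<lambda>x. r n t x - w t x)) \<longlonglongrightarrow> 0" by (rule L2_measurable_curveE[OF w]) blast
  obtain B where B: "0 \<le> B" "\<And>t x. t \<in> {0..1} \<Longrightarrow> x \<in> {0..1} \<Longrightarrow> \<bar>\<phi> t x\<bar> \<le> B" by (rule cont_square_bound[OF \<phi>]) blast
  have fixed: "(\<lambda>t. \<integral>x. g x * \<phi> t x * h x \<partial>I01) \<in> borel_measurable I01" if g: "g \<in> L2" and h: "h \<in> L2" for g h
  proof (rule continuous_imp_measurable_on_sets_lebesgue)
    show "continuous_on {0<..<1} (\<lambda>t. \<integral>x. g x * \<phi> t x * h x \<partial>I01)"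
      unfolding continuous_on_sequentially
    proof (intro allI ballI impI)
      fix X t assume t: "t \<in> {0<..<1}" and X: "(\<forall>n. X n \<in> {0<..<1}) \<and> X \<longlonglongrightarrow> (t::real)"
      have gm [measurable]: "g \<in> borel_measurable I01" "h \<in> borel_measurable I01" using g h by measurable
      have sl [measurable]: "\<phi> u \<in> borel_measurable I01" if "u \<in> {0<..<1}" for u
        using that by (intro L2_measurable L2_continuous cont_square_slice(1)[OF \<phi>]) auto
      show "((\<lambda>t. \<integral>x. g x * \<phi> t x * h x \<partial>I01) \<circ> X) \<longlonglongrightarrow> (\<integral>x. g x * \<phi> t x * h x \<partial>I01)"
        unfolding o_def
      proof (rule integral_dominated_convergence[where w="\<lambda>x. B * \<bar>g x * h x\<bar>"])
        show "(\<lambda>x. g x * \<phi> t x * h x) \<in> borel_measurable I01" by (intro borel_measurable_times gm sl t)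
        show "(\<lambda>x. g x * \<phi> (X n) x * h x) \<in> borel_measurable I01" for n
          using X by (intro borel_measurable_times gm sl) auto
        show "integrable I01 (\<lambda>x. B * \<bar>g x * h x\<bar>)"
          by (intro integrable_mult_right integrable_abs L2_mult_integrable g h)
        show "AE x in I01. (\<lambda>n. g x * \<phi> (X n) x * h x) \<longlonglongrightarrow> g x * \<phi> t x * h x"
        proof (rule AE_I2)
          fix x :: real assume "x \<in> space I01"
          then have x: "x \<in> {0..1}" by auto
          have "(\<lambda>n. \<phi> (X n) x) \<longlonglongrightarrow> \<phi> t x"
            using cont_square_slice(2)[OF \<phi> x] X t unfolding continuous_on_sequentially o_def
            by (auto simp: less_imp_le)
          then show "(\<lambda>n. g x * \<phi> (X n) x * h x) \<longlonglongrightarrow> g x * \<phi> t x * h x"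
            by (rule tendsto_mult_right[OF tendsto_mult_left])
        qed
        show "AE x in I01. norm (g x * \<phi> (X n) x * h x) \<le> B * \<bar>g x * h x\<bar>" for n
        proof (rule AE_I2)
          fix x :: real assume "x \<in> space I01"
          then have "\<bar>\<phi> (X n) x\<bar> \<le> B" using X by (intro B(2)) (auto simp: less_imp_le)
          from mult_right_mono[OF this, of "\<bar>g x * h x\<bar>"]
          show "norm (g x * \<phi> (X n) x * h x) \<le> B * \<bar>g x * h x\<bar>" by (simp add: abs_mult mult_ac)
        qed
      qed
    qed
  qed simp
  have m: "(\<lambda>t. \<integral>x. s n t x * \<phi> t x * r n t x \<partial>I01) \<in> borel_measurable I01" for n
  proof -
    \<comment> \<open>The pair takes finitely many values, so it may be frozen while t still varies
      in the weight.\<close>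
    define p where "p t = (s n t, r n t)" for t
    have sp: "simple_function I01 p" unfolding p_def by (intro simple_function_Pair s r)
    then have pm: "p \<in> measurable I01 (count_space (p ` space I01))"
      unfolding measurable_count_space_eq2[OF simple_functionD(1)[OF sp]] using simple_functionD(2)[OF sp] by auto
    have "(\<lambda>t. (\<lambda>i t. \<integral>x. fst i x * \<phi> t x * snd i x \<partial>I01) (p t) t) \<in> borel_measurable I01"
    proof (rule measurable_compose_countable'[OF _ pm])
      fix i assume "i \<in> p ` space I01"
      then show "(\<lambda>t. \<integral>x. fst i x * \<phi> t x * snd i x \<partial>I01) \<in> borel_measurable I01"
        using s(2) r(2) by (intro fixed) (auto simp: p_def)
    qed (rule countable_finite[OF simple_functionD(1)[OF sp]])
    then show ?thesis by (simp add: p_def)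
  qed
  show ?thesis
  proof (rule borel_measurable_I01_LIMSEQ[OF m])
    show "AE t in I01. (\<lambda>n. \<integral>x. s n t x * \<phi> t x * r n t x \<partial>I01) \<longlonglongrightarrow> (\<integral>x. f t x * \<phi> t x * w t x \<partial>I01)"
      using s(3) r(3) L2_measurable_curve_AE_L2[OF f] L2_measurable_curve_AE_L2[OF w] AE_space[of I01]
    proof eventually_elim
      case (elim t)
      then have t: "t \<in> {0<..<1}" by simp
      have c: "continuous_on {0..1} (\<phi> t)" using t by (intro cont_square_slice(1)[OF \<phi>]) auto
      have Bt: "\<And>x. x \<in> {0..1} \<Longrightarrow> \<bar>\<phi> t x\<bar> \<le> B" using B(2) t by auto
      define S where "S n = L2_norm (\<lambda>x. s n t x - f t x)" for n
      define R where "R n = L2_norm (\<lambda>x. r n t x - w t x)" for n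
      note L = s(2)[OF t] r(2)[OF t] elim(3) elim(4)
      have le: "\<bar>(\<integral>x. s n t x * \<phi> t x * r n t x \<partial>I01) - (\<integral>x. f t x * \<phi> t x * w t x \<partial>I01)\<bar>
         \<le> B * (S n * (L2_norm (w t) + R n)) + B * (L2_norm (f t) * R n)" for n
      proof -
        have i: "integrable I01 (\<lambda>x. (s n t x - f t x) * \<phi> t x * r n t x)" "integrable I01 (\<lambda>x. f t x * \<phi> t x * (r n t x - w t x))"
          "integrable I01 (\<lambda>x. s n t x * \<phi> t x * r n t x)" "integrable I01 (\<lambda>x. f t x * \<phi> t x * w t x)"
          by (intro L2_triple_integrable c L L2_diff)+
        have "(\<integral>x. s n t x * \<phi> t x * r n t x \<partial>I01) - (\<integral>x. f t x * \<phi> t x * w t x \<partial>I01)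
          = (\<integral>x. (s n t x - f t x) * \<phi> t x * r n t x \<partial>I01) + (\<integral>x. f t x * \<phi> t x * (r n t x - w t x) \<partial>I01)"
          using i by (subst Bochner_Integration.integral_diff[symmetric], simp, simp, subst Bochner_Integration.integral_add[symmetric], simp, simp)
            (simp add: algebra_simps)
        moreover have "\<bar>\<integral>x. (s n t x - f t x) * \<phi> t x * r n t x \<partial>I01\<bar> \<le> B * (S n * L2_norm (r n t))"
          unfolding S_def by (intro triple_le L2_diff L c B(1) Bt)
        moreover have "\<bar>\<integral>x. f t x * \<phi> t x * (r n t x - w t x) \<partial>I01\<bar> \<le> B * (L2_norm (f t) * R n)"
          unfolding R_def by (intro triple_le L2_diff L c B(1) Bt)
        moreover have "B * (S n * L2_norm (r n t)) \<le> B * (S n * (L2_norm (w t) + R n))"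
          using L2_norm_triangle_diff[OF L(2) L(4), of n] B(1) unfolding R_def
          by (intro mult_left_mono) (auto simp: S_def)
        ultimately show ?thesis by linarith
      qed
      have "(\<lambda>n. B * (S n * (L2_norm (w t) + R n)) + B * (L2_norm (f t) * R n)) \<longlonglongrightarrow> B * (0 * (L2_norm (w t) + 0)) + B * (L2_norm (f t) * 0)"
        unfolding S_def R_def by (intro tendsto_add tendsto_mult tendsto_const elim)
      then have z: "(\<lambda>n. B * (S n * (L2_norm (w t) + R n)) + B * (L2_norm (f t) * R n)) \<longlonglongrightarrow> 0" by simp
      show ?case
        by (rule LIM_zero_cancel, rule Lim_null_comparison[OF _ z]) (use le in \<open>auto intro: always_eventually\<close>)
    qed
  qed
qed

lemma L2_measurable_curve_norm_measurable:
  assumes u: "L2_measurable_curve u" shows "(\<lambda>t. L2_norm (u t)) \<in> borel_measurable I01"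
proof -
  have "(\<lambda>t. \<integral>x. u t x * 1 * u t x \<partial>I01) \<in> borel_measurable I01"
    by (rule triple_measurable[OF u u]) (auto intro: continuous_intros)
  then have "(\<lambda>t. sqrt (\<integral>x. u t x * 1 * u t x \<partial>I01)) \<in> borel_measurable I01" by measurable
  then show ?thesis by (simp add: L2_norm_def power2_eq_square)
qed

lemma triple_integrable:
  assumes f: "L2_measurable_curve f" "integrable I01 (\<lambda>t. (L2_norm (f t))\<^sup>2)" and w: "L2_measurable_curve w" "integrable I01 (\<lambda>t. (L2_norm (w t))\<^sup>2)"
    and \<phi>: "cont_square \<phi>"
  shows "integrable I01 (\<lambda>t. \<integral>x. f t x * \<phi> t x * w t x \<partial>I01)"
proof -
  obtain B where B: "0 \<le> B" "\<And>t x. t \<in> {0..1} \<Longrightarrow> x \<in> {0..1} \<Longrightarrow> \<bar>\<phi> t x\<bar> \<le> B" by (rule cont_square_bound[OF \<phi>]) blast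
  show ?thesis
  proof (rule Bochner_Integration.integrable_bound)
    show "integrable I01 (\<lambda>t. B * ((L2_norm (f t))\<^sup>2 + (L2_norm (w t))\<^sup>2))"
      using f(2) w(2) by simp
    show "AE t in I01. norm (\<integral>x. f t x * \<phi> t x * w t x \<partial>I01) \<le> norm (B * ((L2_norm (f t))\<^sup>2 + (L2_norm (w t))\<^sup>2))"
      using L2_measurable_curve_AE_L2[OF f(1)] L2_measurable_curve_AE_L2[OF w(1)] AE_space[of I01]
    proof eventually_elim
      case (elim t)
      have "\<bar>\<integral>x. f t x * \<phi> t x * w t x \<partial>I01\<bar> \<le> B * (L2_norm (f t) * L2_norm (w t))"
        using elim(3) by (intro triple_le elim cont_square_slice(1)[OF \<phi>] B) (auto intro!: B(2))
      also have "\<dots> \<le> B * ((L2_norm (f t))\<^sup>2 + (L2_norm (w t))\<^sup>2)"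
      proof (rule mult_left_mono[OF _ B(1)])
        have "2 * (L2_norm (f t) * L2_norm (w t)) \<le> (L2_norm (f t))\<^sup>2 + (L2_norm (w t))\<^sup>2"
          using sum_squares_bound[of "L2_norm (f t)" "L2_norm (w t)"] by simp
        moreover have "0 \<le> L2_norm (f t) * L2_norm (w t)" by simp
        ultimately show "L2_norm (f t) * L2_norm (w t) \<le> (L2_norm (f t))\<^sup>2 + (L2_norm (w t))\<^sup>2"
          by linarith
      qed
      finally show ?case using B(1) by simp
    qed
  qed (rule triple_measurable[OF f(1) w(1) \<phi>])
qed

lemma bochner_L2_L2:
  assumes "f \<in> bochner_L2 L2 L2_norm"
  shows "L2_measurable_curve f" "integrable I01 (\<lambda>t. (L2_norm (f t))\<^sup>2)"
  using assms by (auto simp: bochner_L2_def L2_measurable_curve_def)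

lemma bochner_L2_H2:
  assumes v: "v \<in> bochner_L2 (H2 \<inter> H10) H2_norm"
  shows "AE t in I01. v t \<in> H2 \<inter> H10"
    "L2_measurable_curve v" "L2_measurable_curve (\<lambda>t. wderiv (v t))" "L2_measurable_curve (\<lambda>t. wderiv (wderiv (v t)))"
    "integrable I01 (\<lambda>t. (L2_norm (v t))\<^sup>2)" "integrable I01 (\<lambda>t. (L2_norm (wderiv (v t)))\<^sup>2)"
    "integrable I01 (\<lambda>t. (L2_norm (wderiv (wderiv (v t))))\<^sup>2)"
proof -
  have b: "bochner_measurable (H2 \<inter> H10) H2_norm v" and i: "integrable I01 (\<lambda>t. (H2_norm (v t))\<^sup>2)"
    using v by (auto simp: bochner_L2_def)
  show "AE t in I01. v t \<in> H2 \<inter> H10" using b by (simp add: bochner_measurable_def)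
  show L2_measurable_curve: "L2_measurable_curve v" "L2_measurable_curve (\<lambda>t. wderiv (v t))" "L2_measurable_curve (\<lambda>t. wderiv (wderiv (v t)))" by (rule L2_measurable_curve_H2[OF b])+
  have "integrable I01 (\<lambda>t. (L2_norm (w t))\<^sup>2)" if "L2_measurable_curve w" "\<And>t. L2_norm (w t) \<le> H2_norm (v t)" for w
  proof (rule Bochner_Integration.integrable_bound[OF i])
    show "(\<lambda>t. (L2_norm (w t))\<^sup>2) \<in> borel_measurable I01" using L2_measurable_curve_norm_measurable[OF that(1)] by measurable
    show "AE t in I01. norm ((L2_norm (w t))\<^sup>2) \<le> norm ((H2_norm (v t))\<^sup>2)"
      using that(2) by (intro AE_I2) (auto intro: power_mono)
  qed
  from this[OF L2_measurable_curve(1) H2_norm_ge(1)] this[OF L2_measurable_curve(2) H2_norm_ge(2)] this[OF L2_measurable_curve(3) H2_norm_ge(3)]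
  show "integrable I01 (\<lambda>t. (L2_norm (v t))\<^sup>2)" "integrable I01 (\<lambda>t. (L2_norm (wderiv (v t)))\<^sup>2)"
    "integrable I01 (\<lambda>t. (L2_norm (wderiv (wderiv (v t))))\<^sup>2)" .
qed

lemma L2_measurable_curve_norm_L2:
  assumes "L2_measurable_curve u" "integrable I01 (\<lambda>t. (L2_norm (u t))\<^sup>2)" shows "(\<lambda>t. L2_norm (u t)) \<in> L2"
  using assms L2_measurable_curve_norm_measurable by (simp add: L2_def)

section \<open>Fourier coefficients and energies along admissible paths\<close>

text \<open>With six free coefficients the family is closed under both partial derivatives, so that
  the induction on the order goes through for all its members at once.\<close>

lemma Ck_square_trig:
  "Ck_square n (\<lambda>t x. (a + b * t + c * sin (j * pi * t) + d * cos (j * pi * t)) * (e * cos (k * pi * x) + g * sin (k * pi * x)))"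
proof (induction n arbitrary: a b c d e g)
  case 0
  show ?case by (auto intro!: continuous_intros simp: split_beta')
next
  case (Suc n)
  let ?T = "\<lambda>a b c d t. a + b * t + c * sin (j * pi * t) + d * cos (j * pi * t)"
  let ?X = "\<lambda>e g x. e * cos (k * pi * x) + g * sin (k * pi * x)"
  have t: "((\<lambda>s. ?T a b c d s * ?X e g x) has_real_derivative ?T b 0 (- (d * (j * pi))) (c * (j * pi)) t * ?X e g x) (at t within {0..1})" for t x
    by (auto intro!: derivative_eq_intros simp: algebra_simps)
  have x: "((\<lambda>y. ?T a b c d t * ?X e g y) has_real_derivative ?T a b c d t * ?X (g * (k * pi)) (- (e * (k * pi))) x) (at x within {0..1})" for t x
    by (auto intro!: derivative_eq_intros simp: algebra_simps)
  show ?case unfolding Ck_square.simps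
  proof (intro conjI exI ballI)
    show "continuous_on ({0..1} \<times> {0..1}) (\<lambda>(t, x). ?T a b c d t * ?X e g x)"
      by (auto intro!: continuous_intros simp: split_beta')
    show "Ck_square n (\<lambda>t x. ?T b 0 (- (d * (j * pi))) (c * (j * pi)) t * ?X e g x)"
      "Ck_square n (\<lambda>t x. ?T a b c d t * ?X (g * (k * pi)) (- (e * (k * pi))) x)"
      by (rule Suc.IH)+
  qed (rule t x)+
qed

lemma smooth_square_trig_cos_basis:
  "(\<lambda>t x. (a + b * t + c * sin (j * pi * t)) * cos_basis k x) \<in> smooth_square"
  using Ck_square_trig[of _ a b c j 0 "cos_factor k" "real k" 0] by (simp add: smooth_square_def cos_basis_def)

lemma admissibleD:
  assumes "(f, v, z) \<in> admissible f0 f1"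
  shows "f \<in> bochner_L2 L2 L2_norm" "v \<in> bochner_L2 (H2 \<inter> H10) H2_norm" "z \<in> bochner_L2 L2 L2_norm"
    "weak_solution f0 f1 f v z"
  using assms by (auto simp: admissible_def)

lemma L2_measurable_curve_const: "g \<in> L2 \<Longrightarrow> L2_measurable_curve (\<lambda>t. g)"
  unfolding L2_measurable_curve_def bochner_measurable_def by (auto intro!: exI[of _ "\<lambda>_ _. g"] simp: L2_norm_def)

lemma L2_norm_cos_basis: "L2_norm (cos_basis k) = 1"
  using cos_basis_orthonormal[of k k] by (simp add: L2_norm_def power2_eq_square)

lemma coef_le: "f \<in> L2 \<Longrightarrow> \<bar>coef k f\<bar> \<le> L2_norm f"
  using L2_Cauchy_Schwarz[OF _ cos_basis_L2, of f k] by (simp add: coef_def L2_norm_cos_basis)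

lemma cont_square_space: "continuous_on {0..1} w \<Longrightarrow> cont_square (\<lambda>t. w)"
  using continuous_on_compose2[of "{0..1}" w "{0..1::real} \<times> {0..1}" snd] continuous_on_snd[OF continuous_on_id]
  by (auto simp: split_beta')

lemma coef_L2:
  assumes f: "L2_measurable_curve f" "integrable I01 (\<lambda>t. (L2_norm (f t))\<^sup>2)"
  shows "(\<lambda>t. coef k (f t)) \<in> L2"
proof -
  have m: "(\<lambda>t. coef k (f t)) \<in> borel_measurable I01"
    using triple_measurable[OF f(1) L2_measurable_curve_const[OF L2_const[of 1]] cont_square_space[OF cos_basis_continuous[of _ k]]] by (simp add: coef_def)
  have "integrable I01 (\<lambda>t. (coef k (f t))\<^sup>2)"
  proof (rule Bochner_Integration.integrable_bound[OF f(2)])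
    show "AE t in I01. norm ((coef k (f t))\<^sup>2) \<le> norm ((L2_norm (f t))\<^sup>2)"
      using L2_measurable_curve_AE_L2[OF f(1)] by eventually_elim (simp add: abs_le_square_iff[symmetric] coef_le)
  qed (use m in measurable)
  then show ?thesis using m by (simp add: L2_def)
qed

lemma flux_parts_integrable:
  assumes P: "(f, v, z) \<in> admissible f0 f1"
  shows "integrable I01 (\<lambda>t. \<integral>x. f t x * cos_basis k x * wderiv (v t) x \<partial>I01)"
    "integrable I01 (\<lambda>t. \<integral>x. f t x * cos_basis_deriv k x * v t x \<partial>I01)"
    "integrable I01 (\<lambda>t. \<integral>x. cos_basis k x * z t x \<partial>I01)"
proof -
  note F = bochner_L2_L2[OF admissibleD(1)[OF P]] and Z = bochner_L2_L2[OF admissibleD(3)[OF P]] and V = bochner_L2_H2[OF admissibleD(2)[OF P]]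
  show "integrable I01 (\<lambda>t. \<integral>x. f t x * cos_basis k x * wderiv (v t) x \<partial>I01)"
    by (rule triple_integrable[OF F V(3,6) cont_square_space[OF cos_basis_continuous]])
  show "integrable I01 (\<lambda>t. \<integral>x. f t x * cos_basis_deriv k x * v t x \<partial>I01)"
    by (rule triple_integrable[OF F V(2,5) cont_square_space[OF cos_basis_deriv_continuous]])
  have "integrable I01 (\<lambda>t. \<integral>x. z t x * cos_basis k x * 1 \<partial>I01)"
    by (rule triple_integrable[OF Z L2_measurable_curve_const[OF L2_const] _ cont_square_space[OF cos_basis_continuous]]) simp
  then show "integrable I01 (\<lambda>t. \<integral>x. cos_basis k x * z t x \<partial>I01)" by (simp add: mult.commute)
qed

lemma flux_integrable:
  "(f, v, z) \<in> admissible f0 f1 \<Longrightarrow> integrable I01 (\<lambda>t. flux (f t) (v t) (z t) k)"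
  unfolding flux_def by (intro Bochner_Integration.integrable_add flux_parts_integrable)

text \<open>Separation of variables. Affine functions and sines suffice as factors in time, because
  their derivatives are the constants and the cosines, a complete system in L2(0,1).\<close>

lemma weak_solution_coef:
  assumes P: "(f, v, z) \<in> admissible f0 f1"
    and hh: "hh = (\<lambda>t. a + b * t + c * sin (j * pi * t))" and hh': "hh' = (\<lambda>t. b + c * (j * pi) * cos (j * pi * t))"
  shows "- (\<integral>t. hh' t * coef k (f t) \<partial>I01) + hh 1 * coef k f1 - hh 0 * coef k f0 = (\<integral>t. flux (f t) (v t) (z t) k * hh t \<partial>I01)"
proof -
  define \<phi> where "\<phi> t x = hh t * cos_basis k x" for t x
  have sm: "\<phi> \<in> smooth_square" unfolding \<phi>_def[abs_def] hh by (rule smooth_square_trig_cos_basis)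
  have dt: "deriv (\<lambda>s. \<phi> s x) t = hh' t * cos_basis k x" for t x
    unfolding \<phi>_def hh hh' by (rule DERIV_imp_deriv) (auto intro!: derivative_eq_intros)
  have dx: "deriv (\<lambda>y. \<phi> t y) x = hh t * cos_basis_deriv k x" for t x
    unfolding \<phi>_def by (rule DERIV_imp_deriv, rule DERIV_cmult, rule cos_basis_DERIV)
  have hhc: "continuous_on {0..1} hh" unfolding hh by (intro continuous_intros)
  obtain B where B: "\<And>x. x \<in> {0..1} \<Longrightarrow> \<bar>hh x\<bar> \<le> B"
    using compact_imp_bounded[OF compact_continuous_image[OF hhc compact_Icc]] unfolding bounded_iff by fastforce
  have hhi: "integrable I01 (\<lambda>t. g t * hh t)" if "integrable I01 g" for g
    by (rule integrable_mult_bounded_I01[OF that L2_measurable[OF L2_continuous[OF hhc]], of B]) (use B in auto)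
  have W: "- (\<integral>t. (\<integral>x. f t x * deriv (\<lambda>s. \<phi> s x) t \<partial>I01) \<partial>I01)
       + (\<integral>x. f1 x * \<phi> 1 x \<partial>I01) - (\<integral>x. f0 x * \<phi> 0 x \<partial>I01)
     = (\<integral>t. (\<integral>x. f t x * \<phi> t x * wderiv (v t) x \<partial>I01) \<partial>I01)
       + (\<integral>t. (\<integral>x. f t x * deriv (\<lambda>y. \<phi> t y) x * v t x \<partial>I01) \<partial>I01)
       + (\<integral>t. (\<integral>x. \<phi> t x * z t x \<partial>I01) \<partial>I01)"
    using admissibleD(4)[OF P] sm unfolding weak_solution_def by blast
  have 1: "(\<integral>x. f t x * deriv (\<lambda>s. \<phi> s x) t \<partial>I01) = hh' t * coef k (f t)" for t
    unfolding dt coef_def by (subst integral_mult_right_zero[symmetric]) (simp add: mult_ac)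
  have 2: "(\<integral>x. g x * \<phi> t x \<partial>I01) = hh t * coef k g" for g t
    unfolding \<phi>_def coef_def by (subst integral_mult_right_zero[symmetric]) (simp add: mult_ac)
  have 3: "(\<integral>x. f t x * \<phi> t x * wderiv (v t) x \<partial>I01) = (\<integral>x. f t x * cos_basis k x * wderiv (v t) x \<partial>I01) * hh t" for t
    unfolding \<phi>_def by (subst integral_mult_left_zero[symmetric]) (simp add: mult_ac)
  have 4: "(\<integral>x. f t x * deriv (\<lambda>y. \<phi> t y) x * v t x \<partial>I01) = (\<integral>x. f t x * cos_basis_deriv k x * v t x \<partial>I01) * hh t" for t
    unfolding dx by (subst integral_mult_left_zero[symmetric]) (simp add: mult_ac)
  have 5: "(\<integral>x. \<phi> t x * z t x \<partial>I01) = (\<integral>x. cos_basis k x * z t x \<partial>I01) * hh t" for t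
    unfolding \<phi>_def by (subst integral_mult_left_zero[symmetric]) (simp add: mult_ac)
  note i = flux_parts_integrable[OF P, THEN hhi]
  show ?thesis
    using W unfolding 1 2 3 4 5 flux_def distrib_right using i by simp
qed

text \<open>The candidate \<open>A\<close> and the coefficient differ by a function of time whose
  pairing with every derivative \<open>hh'\<close> is the mismatch at time 1 multiplied by
  \<open>hh 1\<close>. The mismatch vanishes, and Parseval in the time variable makes the difference
  zero.\<close>

theorem coef_evolution:
  assumes P: "(f, v, z) \<in> admissible f0 f1"
  shows "AE t in I01. coef k (f t) = coef k f0 + prim (\<lambda>t. flux (f t) (v t) (z t) k) t"
    "coef k f1 = coef k f0 + prim (\<lambda>t. flux (f t) (v t) (z t) k) 1"
proof -
  define b where "b t = flux (f t) (v t) (z t) k" for t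
  define A where "A t = coef k f0 + prim b t" for t
  have bi: "integrable I01 b" unfolding b_def[abs_def] by (rule flux_integrable[OF P])
  have Ac: "continuous_on {0..1} A" unfolding A_def[abs_def] by (intro continuous_intros prim_continuous bi)
  note F = bochner_L2_L2[OF admissibleD(1)[OF P]]
  have aL: "(\<lambda>t. coef k (f t)) \<in> L2" by (rule coef_L2[OF F])
  have AL: "A \<in> L2" by (rule L2_continuous[OF Ac])
  have key: "(\<integral>t. (A t - coef k (f t)) * hh' t \<partial>I01) = (coef k f0 + prim b 1 - coef k f1) * hh 1"
    if hh: "hh = (\<lambda>t. a + a' * t + c * sin (j * pi * t))" and hh': "hh' = (\<lambda>t. a' + c * (j * pi) * cos (j * pi * t))" for hh hh' a a' c j
  proof -
    have c: "continuous_on {0..1} hh'" unfolding hh' by (intro continuous_intros)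
    have "(\<integral>t. A t * hh' t \<partial>I01) + (\<integral>t. b t * hh t \<partial>I01) = (coef k f0 + prim b 1) * hh 1 - coef k f0 * hh 0"
      by (rule by_parts_C1[OF bi _ L2_measurable[OF AL] c]) (auto simp: A_def hh hh' intro!: derivative_eq_intros)
    moreover have "- (\<integral>t. hh' t * coef k (f t) \<partial>I01) + hh 1 * coef k f1 - hh 0 * coef k f0 = (\<integral>t. b t * hh t \<partial>I01)"
      unfolding b_def by (rule weak_solution_coef[OF P hh hh'])
    moreover have "(\<integral>t. (A t - coef k (f t)) * hh' t \<partial>I01) = (\<integral>t. A t * hh' t \<partial>I01) - (\<integral>t. hh' t * coef k (f t) \<partial>I01)"
      using L2_mult_integrable[OF AL L2_continuous[OF c]] L2_mult_integrable[OF aL L2_continuous[OF c]]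
      by (simp add: algebra_simps)
    ultimately show ?thesis by (simp add: algebra_simps)
  qed
  \<comment> \<open>The profile 1 has derivative 0 and isolates the value at time 1.\<close>
  have "(\<integral>t. (A t - coef k (f t)) * 0 \<partial>I01) = (coef k f0 + prim b 1 - coef k f1) * 1"
    using key[of "\<lambda>t. 1" 1 0 0 0 "\<lambda>t. 0"] by simp
  then have end1: "coef k f1 = coef k f0 + prim b 1" by simp
  then show "coef k f1 = coef k f0 + prim (\<lambda>t. flux (f t) (v t) (z t) k) 1" by (simp add: b_def[abs_def])
  define D where "D t = A t - coef k (f t)" for t
  have DL: "D \<in> L2" unfolding D_def[abs_def] by (intro L2_diff AL aL)
  have "coef j D = 0" for j
  proof (cases "j = 0")
    case True
    then show ?thesis using key[of "\<lambda>t. t" 0 1 0 0 "\<lambda>t. 1"] end1 by (simp add: coef_def D_def cos_basis_def cos_factor_def)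
  next
    case False
    \<comment> \<open>A primitive of \<open>cos_basis j\<close>, written in the shape that
      \<open>key\<close> asks for.\<close>
    define hh where "hh t = 0 + 0 * t + cos_factor j / (real j * pi) * sin (real j * pi * t)" for t
    have "cos_basis j = (\<lambda>t. 0 + cos_factor j / (real j * pi) * (real j * pi) * cos (real j * pi * t))"
      using False by (simp add: cos_basis_def[abs_def])
    then show ?thesis using key[of hh 0 0 "cos_factor j / (real j * pi)" "real j" "cos_basis j"] end1
      by (simp add: coef_def D_def hh_def[abs_def])
  qed
  then have "(\<lambda>k. 0::real) sums (L2_norm D)\<^sup>2" using parseval[OF DL] by simp
  then have "L2_norm D = 0" using sums_unique2[OF _ sums_zero] by fastforce
  then have "AE t in I01. D t = 0" using L2_norm_eq_0_iff[OF DL] by simp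
  then show "AE t in I01. coef k (f t) = coef k f0 + prim (\<lambda>t. flux (f t) (v t) (z t) k) t"
    by eventually_elim (simp add: D_def A_def b_def[abs_def])
qed

lemma prim_sum:
  assumes "\<And>k. k \<in> K \<Longrightarrow> integrable I01 (g k)"
  shows "prim (\<lambda>x. \<Sum>k\<in>K. g k x) t = (\<Sum>k\<in>K. prim (g k) t)"
  unfolding prim_def sum_distrib_right
  by (rule Bochner_Integration.integral_sum) (intro integrable_mult_indicator_I01 assms, auto)

text \<open>Since \<open>6 W \<le> 1/4\<close>, the supremum of the smoothed energy can be absorbed, and no Gronwall argument is needed.\<close>

lemma finite_energy:
  fixes N :: nat
  assumes P: "(f, v, z) \<in> admissible f0 f1" and f0: "f0 \<in> L2" and s: "0 < s" "s \<le> 1"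
  defines "w \<equiv> \<lambda>t. L2_norm (wderiv (wderiv (v t)))"
    and "A \<equiv> \<lambda>k t. coef k f0 + prim (\<lambda>t. flux (f t) (v t) (z t) k) t"
  defines "\<delta> \<equiv> (\<integral>t. L2_norm (z t) \<partial>I01) + 2 / s * (\<integral>t. w t * L2_norm (\<lambda>x. f t x - partial N (f t) x) \<partial>I01)"
  defines "S \<equiv> 2 * (L2_norm f0)\<^sup>2 + 8 * \<delta>\<^sup>2"
  assumes small: "24 * (\<integral>t. w t \<partial>I01) \<le> 1"
  shows "\<And>t. t \<in> {0..1} \<Longrightarrow> (\<Sum>k<N. smooth_weight s k * (A k t)\<^sup>2) \<le> S"
    "\<bar>(\<Sum>k<N. smooth_weight s k * (A k 1)\<^sup>2) - (\<Sum>k<N. smooth_weight s k * (coef k f0)\<^sup>2)\<bar> \<le> 6 * S * (\<integral>t. w t \<partial>I01) + 2 * sqrt S * \<delta>"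
proof -
  note F = bochner_L2_L2[OF admissibleD(1)[OF P]] and Z = bochner_L2_L2[OF admissibleD(3)[OF P]] and V = bochner_L2_H2[OF admissibleD(2)[OF P]]
  define b where "b k t = flux (f t) (v t) (z t) k" for k t
  \<comment> \<open>Built on the continuous versions \<open>A\<close>; the coefficients of
    \<open>f t\<close> match them only almost everywhere. Thus q is continuous and attains its
    maximum, \<open>S0\<close> below.\<close>
  define q where "q t = (\<Sum>k<N. smooth_weight s k * (A k t)\<^sup>2)" for t
  define e where "e t = L2_norm (\<lambda>x. f t x - partial N (f t) x)" for t
  have bi: "integrable I01 (b k)" for k unfolding b_def[abs_def] by (rule flux_integrable[OF P])
  have A: "A k t = coef k f0 + prim (b k) t" for k t by (simp add: A_def b_def[abs_def])
  have Ac: "continuous_on {0..1} (A k)" for k unfolding A by (intro continuous_intros prim_continuous bi)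
  have qc: "continuous_on {0..1} q" unfolding q_def[abs_def] by (intro continuous_intros Ac)
  have q0: "0 \<le> q t" for t unfolding q_def by (intro sum_nonneg mult_nonneg_nonneg) (auto intro: less_imp_le smooth_weight_pos)
  obtain tm where tm: "tm \<in> {0..1}" "\<And>t. t \<in> {0..1} \<Longrightarrow> q t \<le> q tm"
    using continuous_attains_sup[OF compact_Icc _ qc] by auto
  define S0 where "S0 = q tm"
  have wL: "w \<in> L2" unfolding w_def by (rule L2_measurable_curve_norm_L2[OF V(4,7)])
  have zL: "(\<lambda>t. L2_norm (z t)) \<in> L2" by (rule L2_measurable_curve_norm_L2[OF Z])
  have fL: "(\<lambda>t. L2_norm (f t)) \<in> L2" by (rule L2_measurable_curve_norm_L2[OF F])
  have eL: "e \<in> L2"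
  proof -
    \<comment> \<open>By Pythagoras the norm of the remainder is a function of the norm and finitely
      many coefficients, all measurable in time. The identity needs \<open>f t\<close> in L2 and so
      holds almost everywhere.\<close>
    have "(\<lambda>t. sqrt ((L2_norm (f t))\<^sup>2 - (\<Sum>k<N. (coef k (f t))\<^sup>2))) \<in> borel_measurable I01"
      using L2_measurable[OF fL] L2_measurable[OF coef_L2[OF F]] by measurable
    moreover have "AE t in I01. sqrt ((L2_norm (f t))\<^sup>2 - (\<Sum>k<N. (coef k (f t))\<^sup>2)) = e t"
      using L2_measurable_curve_AE_L2[OF F(1)] by eventually_elim (simp add: e_def flip: pythagoras)
    ultimately have m: "e \<in> borel_measurable I01" by (rule borel_measurable_I01_AE)
    have "integrable I01 (\<lambda>t. (e t)\<^sup>2)"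
    proof (rule Bochner_Integration.integrable_bound[OF F(2)])
      show "AE t in I01. norm ((e t)\<^sup>2) \<le> norm ((L2_norm (f t))\<^sup>2)"
        using L2_measurable_curve_AE_L2[OF F(1)] by eventually_elim (auto simp: e_def intro!: power_mono L2_norm_minus_partial_le)
    qed (use m in measurable)
    then show ?thesis using m by (simp add: L2_def)
  qed
  define G where "G t = (\<Sum>k<N. smooth_weight s k * (b k t * A k t + A k t * b k t))" for t
  have i: "integrable I01 (\<lambda>t. smooth_weight s k * (b k t * A k t + A k t * b k t))" for k
  proof -
    obtain B where B: "\<And>x. x \<in> {0..1} \<Longrightarrow> \<bar>A k x\<bar> \<le> B"
      using compact_imp_bounded[OF compact_continuous_image[OF Ac[of k] compact_Icc]] unfolding bounded_iff by fastforce
    have "integrable I01 (\<lambda>t. b k t * A k t)"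
      by (rule integrable_mult_bounded_I01[OF bi L2_measurable[OF L2_continuous[OF Ac[of k]]], of B]) (use B in auto)
    then show ?thesis by (simp add: mult.commute)
  qed
  have qG: "q t - q 0 = prim G t" for t
  proof -
    have "prim G t = (\<Sum>k<N. smooth_weight s k * prim (\<lambda>t. b k t * A k t + A k t * b k t) t)"
      unfolding G_def[abs_def] by (subst prim_sum[OF i]) (simp add: prim_cmult)
    also have "\<dots> = (\<Sum>k<N. smooth_weight s k * (A k t * A k t - coef k f0 * coef k f0))"
      unfolding A by (simp only: prim_by_parts[OF bi bi])
    also have "\<dots> = q t - q 0"
      by (simp add: q_def A prim_le_0 power2_eq_square sum_subtractf right_diff_distrib)
    finally show ?thesis by simp
  qed
  have Gi: "integrable I01 G" unfolding G_def[abs_def] by (intro Bochner_Integration.integrable_sum i)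
  \<comment> \<open>Twice the bound of \<open>flux_estimate\<close>, with q replaced by its
    maximum.\<close>
  define H where "H t = 6 * S0 * w t + 2 * sqrt S0 * (L2_norm (z t) + 2 / s * (w t * e t))" for t
  have we: "integrable I01 (\<lambda>t. w t * e t)" by (rule L2_mult_integrable[OF wL eL])
  have Hi: "integrable I01 H" unfolding H_def[abs_def]
    using we L2_integrable[OF wL] L2_integrable[OF zL] by simp
  have HI: "(\<integral>t. H t \<partial>I01) = 6 * S0 * (\<integral>t. w t \<partial>I01) + 2 * sqrt S0 * \<delta>"
    unfolding H_def[abs_def] \<delta>_def e_def[symmetric] using we L2_integrable[OF wL] L2_integrable[OF zL] by simp
  have AEA: "AE t in I01. \<forall>k. coef k (f t) = A k t"
    unfolding A_def AE_all_countable using coef_evolution(1)[OF P] by blast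
  have GH: "AE t in I01. \<bar>G t\<bar> \<le> H t"
    using AEA L2_measurable_curve_AE_L2[OF F(1)] L2_measurable_curve_AE_L2[OF Z(1)] V(1) AE_space[of I01]
  proof eventually_elim
    case (elim t)
    have "G t = 2 * (\<Sum>k<N. smooth_weight s k * coef k (f t) * flux (f t) (v t) (z t) k)"
      unfolding G_def sum_distrib_left using elim(1) by (intro sum.cong) (simp_all add: b_def mult_ac)
    moreover have "(\<Sum>k<N. smooth_weight s k * (coef k (f t))\<^sup>2) = q t" using elim(1) by (simp add: q_def)
    ultimately have "\<bar>G t\<bar> \<le> 2 * (3 * w t * q t + sqrt (q t) * (L2_norm (z t) + 2 / s * w t * e t))"
      using flux_estimate[OF elim(2,4,3) s, of N] by (simp add: w_def e_def abs_mult)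
    also have "\<dots> \<le> 2 * (3 * w t * S0 + sqrt S0 * (L2_norm (z t) + 2 / s * w t * e t))"
    proof -
      have "q t \<le> S0" using elim(5) tm(2)[of t] by (auto simp: S0_def)
      moreover have "0 \<le> w t" "0 \<le> e t" by (simp_all add: w_def e_def)
      ultimately show ?thesis using s by (intro mult_left_mono add_mono mult_right_mono) auto
    qed
    finally show ?case by (simp add: H_def algebra_simps)
  qed
  have diff: "\<bar>q t - q 0\<bar> \<le> 6 * S0 * (\<integral>t. w t \<partial>I01) + 2 * sqrt S0 * \<delta>" for t
  proof -
    have "\<bar>q t - q 0\<bar> \<le> (\<integral>t. \<bar>G t\<bar> \<partial>I01)" unfolding qG by (rule prim_abs_le[OF Gi])
    also have "\<dots> \<le> (\<integral>t. H t \<partial>I01)" using GH by (intro integral_mono_AE integrable_abs Gi Hi)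
    finally show ?thesis unfolding HI .
  qed
  have q00: "q 0 = (\<Sum>k<N. smooth_weight s k * (coef k f0)\<^sup>2)" by (simp add: q_def A prim_le_0)
  also have "\<dots> \<le> (\<Sum>k<N. 1 * (coef k f0)\<^sup>2)" by (intro sum_mono mult_right_mono smooth_weight_le_1) auto
  also have "\<dots> \<le> (L2_norm f0)\<^sup>2" using bessel[OF f0] by simp
  finally have q0f: "q 0 \<le> (L2_norm f0)\<^sup>2" .
  have S00: "0 \<le> S0" by (simp add: S0_def q0)
  \<comment> \<open>The transport term is at most S0 / 4 by \<open>small\<close>, and Young's
    inequality bounds the other term by S0 / 4 + 4 \<delta>^2. Hence S0 / 2 \<le> q 0 + 4
    \<delta>^2, and doubling gives the 2 and the 8 in \<open>S\<close>.\<close>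
  have S0S: "S0 \<le> S"
  proof -
    have "6 * S0 * (\<integral>t. w t \<partial>I01) \<le> S0 / 4" using mult_left_mono[OF small S00] by (simp add: mult_ac)
    moreover have "2 * sqrt S0 * \<delta> \<le> S0 / 4 + 4 * \<delta>\<^sup>2"
    proof -
      have "0 \<le> (sqrt S0 / 2 - 2 * \<delta>)\<^sup>2" by simp
      also have "\<dots> = S0 / 4 + 4 * \<delta>\<^sup>2 - 2 * sqrt S0 * \<delta>"
        using S00 by (simp add: power2_diff power_divide power_mult_distrib)
      finally show ?thesis by simp
    qed
    ultimately have "S0 - q 0 \<le> S0 / 2 + 4 * \<delta>\<^sup>2" using diff[of tm] by (simp add: S0_def)
    then show ?thesis using q0f unfolding S_def by linarith
  qed
  show "(\<Sum>k<N. smooth_weight s k * (A k t)\<^sup>2) \<le> S" if "t \<in> {0..1}" for t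
    using tm(2)[OF that] S0S by (simp add: q_def S0_def)
  have "0 \<le> \<delta>" unfolding \<delta>_def using s by (intro add_nonneg_nonneg mult_nonneg_nonneg integral_nonneg_AE) (auto simp: w_def)
  then have "6 * S0 * (\<integral>t. w t \<partial>I01) + 2 * sqrt S0 * \<delta> \<le> 6 * S * (\<integral>t. w t \<partial>I01) + 2 * sqrt S * \<delta>"
    using S0S by (intro add_mono mult_right_mono mult_left_mono integral_nonneg_AE) (auto simp: w_def)
  then show "\<bar>(\<Sum>k<N. smooth_weight s k * (A k 1)\<^sup>2) - (\<Sum>k<N. smooth_weight s k * (coef k f0)\<^sup>2)\<bar> \<le> 6 * S * (\<integral>t. w t \<partial>I01) + 2 * sqrt S * \<delta>"
    using diff[of 1] q00 by (simp add: q_def)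
qed

text \<open>\<open>Q\<^sub>s f = \<langle>f, (1 - s\<^sup>2 \<partial>\<^sub>x\<^sup>2)\<^sup>-\<^sup>1 f\<rangle>\<close> with Neumann boundary conditions.\<close>

definition smooth_energy :: "real \<Rightarrow> (real \<Rightarrow> real) \<Rightarrow> real" where
  "smooth_energy s f = (\<Sum>k. smooth_weight s k * (coef k f)\<^sup>2)"

lemma smooth_energy_sums:
  assumes f: "f \<in> L2" shows "(\<lambda>k. smooth_weight s k * (coef k f)\<^sup>2) sums smooth_energy s f"
proof -
  have "summable (\<lambda>k. (coef k f)\<^sup>2)" using parseval[OF f] by (rule sums_summable)
  then have "summable (\<lambda>k. smooth_weight s k * (coef k f)\<^sup>2)"
    by (rule summable_comparison_test'[of _ 0])
      (auto simp: abs_mult less_imp_le[OF smooth_weight_pos] intro: mult_right_mono[OF smooth_weight_le_1, of "(coef _ f)\<^sup>2", simplified])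
  then show ?thesis unfolding smooth_energy_def by (rule summable_sums)
qed

text \<open>The order of the limits is forced: for fixed s the truncation defect, with its factor 2
  / s, disappears as N grows, and the bound that remains does not involve s. Then s can tend to 0,
  which turns smoothed energies into norms.\<close>

theorem energy_estimate:
  assumes P: "(f, v, z) \<in> admissible f0 f1" and f0: "f0 \<in> L2" and f1: "f1 \<in> L2"
  defines "Wb \<equiv> (\<integral>t. L2_norm (wderiv (wderiv (v t))) \<partial>I01)" and "Zb \<equiv> (\<integral>t. L2_norm (z t) \<partial>I01)"
  assumes small: "24 * Wb \<le> 1"
  defines "M \<equiv> 2 * (L2_norm f0)\<^sup>2 + 8 * Zb\<^sup>2"
  shows "AE t in I01. (L2_norm (f t))\<^sup>2 \<le> M"
    "\<And>s. 0 < s \<Longrightarrow> s \<le> 1 \<Longrightarrow> \<bar>smooth_energy s f1 - smooth_energy s f0\<bar> \<le> 6 * M * Wb + 2 * sqrt M * Zb"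
    "(L2_norm f1)\<^sup>2 \<le> M"
proof -
  note F = bochner_L2_L2[OF admissibleD(1)[OF P]] and Z = bochner_L2_L2[OF admissibleD(3)[OF P]] and V = bochner_L2_H2[OF admissibleD(2)[OF P]]
  define w where "w t = L2_norm (wderiv (wderiv (v t)))" for t
  define A where "A k t = coef k f0 + prim (\<lambda>t. flux (f t) (v t) (z t) k) t" for k t
  define err where "err N = (\<integral>t. w t * L2_norm (\<lambda>x. f t x - partial N (f t) x) \<partial>I01)" for N
  have wL: "w \<in> L2" unfolding w_def[abs_def] by (rule L2_measurable_curve_norm_L2[OF V(4,7)])
  have fL: "(\<lambda>t. L2_norm (f t)) \<in> L2" by (rule L2_measurable_curve_norm_L2[OF F])
  have em: "(\<lambda>t. L2_norm (\<lambda>x. f t x - partial N (f t) x)) \<in> borel_measurable I01" for N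
  proof (rule borel_measurable_I01_AE)
    show "(\<lambda>t. sqrt ((L2_norm (f t))\<^sup>2 - (\<Sum>k<N. (coef k (f t))\<^sup>2))) \<in> borel_measurable I01"
      using L2_measurable[OF fL] L2_measurable[OF coef_L2[OF F]] by measurable
    show "AE t in I01. sqrt ((L2_norm (f t))\<^sup>2 - (\<Sum>k<N. (coef k (f t))\<^sup>2)) = L2_norm (\<lambda>x. f t x - partial N (f t) x)"
      using L2_measurable_curve_AE_L2[OF F(1)] by eventually_elim (simp flip: pythagoras)
  qed
  \<comment> \<open>At almost every time the remainder tends to 0 and is dominated by the norm of
    \<open>f t\<close>; both this norm and w are square integrable in time, so their product is an
    integrable bound.\<close>
  have err: "err \<longlonglongrightarrow> 0"
  proof -
    have "err \<longlonglongrightarrow> (\<integral>t. 0 \<partial>I01)" unfolding err_def[abs_def]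
    proof (rule integral_dominated_convergence[where w="\<lambda>t. w t * L2_norm (f t)"])
      show "integrable I01 (\<lambda>t. w t * L2_norm (f t))" by (rule L2_mult_integrable[OF wL fL])
      show "(\<lambda>t. w t * L2_norm (\<lambda>x. f t x - partial N (f t) x)) \<in> borel_measurable I01" for N
        using L2_measurable[OF wL] em[of N] by measurable
      show "AE t in I01. (\<lambda>N. w t * L2_norm (\<lambda>x. f t x - partial N (f t) x)) \<longlonglongrightarrow> 0"
        using L2_measurable_curve_AE_L2[OF F(1)]
      proof eventually_elim
        case (elim t)
        then show ?case using tendsto_mult_left[OF partial_tendsto[OF elim], of "w t"] by simp
      qed
      show "AE t in I01. norm (w t * L2_norm (\<lambda>x. f t x - partial N (f t) x)) \<le> w t * L2_norm (f t)" for N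
        using L2_measurable_curve_AE_L2[OF F(1)] by eventually_elim (auto simp: w_def abs_mult intro!: mult_left_mono L2_norm_minus_partial_le)
    qed simp
    then show ?thesis by simp
  qed
  define \<delta> where "\<delta> s N = Zb + 2 / s * err N" for s N
  define S where "S s N = 2 * (L2_norm f0)\<^sup>2 + 8 * (\<delta> s N)\<^sup>2" for s N
  have fin: "(\<Sum>k<N. smooth_weight s k * (A k t)\<^sup>2) \<le> S s N" if "0 < s" "s \<le> 1" "t \<in> {0..1}" for s N t
    using finite_energy(1)[OF P f0 that(1,2) _ that(3), of N] small
    unfolding S_def \<delta>_def err_def Wb_def Zb_def w_def A_def by blast
  have fin2: "\<bar>(\<Sum>k<N. smooth_weight s k * (coef k f1)\<^sup>2) - (\<Sum>k<N. smooth_weight s k * (coef k f0)\<^sup>2)\<bar> \<le> 6 * S s N * Wb + 2 * sqrt (S s N) * \<delta> s N"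
    if "0 < s" "s \<le> 1" for s N
    using finite_energy(2)[OF P f0 that, of N] small
    unfolding S_def \<delta>_def err_def Wb_def Zb_def w_def coef_evolution(2)[OF P] by blast
  have \<delta>_lim: "\<delta> s \<longlonglongrightarrow> Zb" for s
  proof -
    have "(\<lambda>N. Zb + 2 / s * err N) \<longlonglongrightarrow> Zb + 2 / s * 0" by (intro tendsto_add tendsto_mult tendsto_const err)
    then show ?thesis by (simp add: \<delta>_def[abs_def])
  qed
  have S_lim: "S s \<longlonglongrightarrow> M" for s
    unfolding S_def[abs_def] M_def by (intro tendsto_add tendsto_mult tendsto_power tendsto_const \<delta>_lim)
  \<comment> \<open>Only K modes are kept while the truncation N of the estimate goes to
    infinity.\<close>
  have cwM: "(\<Sum>k<K. smooth_weight s k * (A k t)\<^sup>2) \<le> M" if "0 < s" "s \<le> 1" "t \<in> {0..1}" for s K t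
  proof (rule LIMSEQ_le_const[OF S_lim[of s]], intro exI[of _ K] allI impI)
    fix N assume "K \<le> N"
    then have "(\<Sum>k<K. smooth_weight s k * (A k t)\<^sup>2) \<le> (\<Sum>k<N. smooth_weight s k * (A k t)\<^sup>2)"
      by (intro sum_mono2) (auto intro: mult_nonneg_nonneg less_imp_le[OF smooth_weight_pos])
    then show "(\<Sum>k<K. smooth_weight s k * (A k t)\<^sup>2) \<le> S s N" using fin[OF that, of N] by linarith
  qed
  \<comment> \<open>For fixed K the weights tend to 1 as s tends to 0.\<close>
  have AM: "(\<Sum>k<K. (A k t)\<^sup>2) \<le> M" if "t \<in> {0..1}" for K t
  proof -
    have c: "(\<lambda>n. smooth_weight (1 / real (Suc n)) k) \<longlonglongrightarrow> 1" for k
    proof -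
      have "(\<lambda>n. 1 / (1 + (1 / real (Suc n))\<^sup>2 * (real k * pi)\<^sup>2)) \<longlonglongrightarrow> 1 / (1 + 0\<^sup>2 * (real k * pi)\<^sup>2)"
        by (intro tendsto_divide tendsto_add tendsto_mult tendsto_power tendsto_const LIMSEQ_Suc[OF lim_1_over_n]) simp
      then show ?thesis by (simp add: smooth_weight_def)
    qed
    have "(\<lambda>n. \<Sum>k<K. smooth_weight (1 / real (Suc n)) k * (A k t)\<^sup>2) \<longlonglongrightarrow> (\<Sum>k<K. 1 * (A k t)\<^sup>2)"
      by (intro tendsto_sum tendsto_mult tendsto_const c)
    then have "(\<Sum>k<K. 1 * (A k t)\<^sup>2) \<le> M"
      by (rule LIMSEQ_le_const2) (use that in \<open>auto intro!: exI[of _ 0] cwM\<close>)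
    then show ?thesis by simp
  qed
  have norm: "(L2_norm g)\<^sup>2 \<le> M" if "g \<in> L2" "\<And>k. coef k g = A k t" "t \<in> {0..1}" for g t
    using parseval[OF that(1)] unfolding that(2) sums_def by (rule LIMSEQ_le_const2) (use AM[OF that(3)] in auto)
  have "AE t in I01. \<forall>k. coef k (f t) = A k t"
    unfolding A_def AE_all_countable using coef_evolution(1)[OF P] by blast
  then show "AE t in I01. (L2_norm (f t))\<^sup>2 \<le> M"
    using L2_measurable_curve_AE_L2[OF F(1)] AE_space[of I01]
  proof eventually_elim
    case (elim t)
    then show ?case by (intro norm[of _ t]) auto
  qed
  show "(L2_norm f1)\<^sup>2 \<le> M"
    by (rule norm[OF f1, of 1]) (auto simp: A_def coef_evolution(2)[OF P])
  fix s :: real assume s: "0 < s" "s \<le> 1"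
  show "\<bar>smooth_energy s f1 - smooth_energy s f0\<bar> \<le> 6 * M * Wb + 2 * sqrt M * Zb"
  proof (rule LIMSEQ_le)
    show "(\<lambda>N. \<bar>(\<Sum>k<N. smooth_weight s k * (coef k f1)\<^sup>2) - (\<Sum>k<N. smooth_weight s k * (coef k f0)\<^sup>2)\<bar>) \<longlonglongrightarrow> \<bar>smooth_energy s f1 - smooth_energy s f0\<bar>"
      using smooth_energy_sums[OF f0, of s] smooth_energy_sums[OF f1, of s] unfolding sums_def by (intro tendsto_rabs tendsto_diff)
    show "(\<lambda>N. 6 * S s N * Wb + 2 * sqrt (S s N) * \<delta> s N) \<longlonglongrightarrow> 6 * M * Wb + 2 * sqrt M * Zb"
      by (intro tendsto_add tendsto_mult tendsto_const tendsto_real_sqrt S_lim \<delta>_lim)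
  qed (use fin2[OF s] in auto)
qed

text \<open>Up to a small error the norm sits in finitely many coefficients, whose weights tend to
  1; that no weight exceeds 1 gives the bound from above.\<close>

lemma smooth_energy_tendsto:
  assumes f: "f \<in> L2" shows "(\<lambda>n. smooth_energy (1 / real (Suc n)) f) \<longlonglongrightarrow> (L2_norm f)\<^sup>2"
proof -
  have le: "smooth_energy s f \<le> (L2_norm f)\<^sup>2" for s
    by (rule sums_le[OF _ smooth_energy_sums[OF f] parseval[OF f]])
      (use mult_right_mono[OF smooth_weight_le_1, of "(coef _ f)\<^sup>2"] in auto)
  show ?thesis
  proof (rule LIMSEQ_I)
    fix r :: real assume "r > 0"
    then obtain K where K: "norm ((\<Sum>k<K. (coef k f)\<^sup>2) - (L2_norm f)\<^sup>2) < r / 2"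
      using LIMSEQ_D[OF parseval[OF f, unfolded sums_def], of "r/2"] by auto
    have "(\<lambda>n. \<Sum>k<K. smooth_weight (1 / real (Suc n)) k * (coef k f)\<^sup>2) \<longlonglongrightarrow> (\<Sum>k<K. 1 / (1 + 0\<^sup>2 * (real k * pi)\<^sup>2) * (coef k f)\<^sup>2)"
      unfolding smooth_weight_def
      by (intro tendsto_sum tendsto_mult tendsto_divide tendsto_add tendsto_power tendsto_const LIMSEQ_Suc[OF lim_1_over_n]) simp
    then have "(\<lambda>n. \<Sum>k<K. smooth_weight (1 / real (Suc n)) k * (coef k f)\<^sup>2) \<longlonglongrightarrow> (\<Sum>k<K. (coef k f)\<^sup>2)" by simp
    from LIMSEQ_D[OF this, of "r/2"] \<open>r > 0\<close> obtain n0 where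
      n0: "\<And>n. n \<ge> n0 \<Longrightarrow> norm ((\<Sum>k<K. smooth_weight (1 / real (Suc n)) k * (coef k f)\<^sup>2) - (\<Sum>k<K. (coef k f)\<^sup>2)) < r / 2" by auto
    have "norm (smooth_energy (1 / real (Suc n)) f - (L2_norm f)\<^sup>2) < r" if "n \<ge> n0" for n
    proof -
      have "(\<Sum>k<K. smooth_weight (1 / real (Suc n)) k * (coef k f)\<^sup>2) \<le> smooth_energy (1 / real (Suc n)) f"
        unfolding smooth_energy_def by (rule sum_le_suminf[OF sums_summable[OF smooth_energy_sums[OF f]]])
          (auto intro: mult_nonneg_nonneg less_imp_le[OF smooth_weight_pos])
      then show ?thesis using n0[OF that] K le[of "1 / real (Suc n)"] unfolding real_norm_def by linarith
    qed
    then show "\<exists>no. \<forall>n\<ge>no. norm (smooth_energy (1 / real (Suc n)) f - (L2_norm f)\<^sup>2) < r" by blast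
  qed
qed

text \<open>The bound on the change of the smoothed energies is the same for all s, so it passes to
  the limit.\<close>

lemma energy_difference:
  assumes P: "(f, v, z) \<in> admissible f0 f1" and f0: "f0 \<in> L2" and f1: "f1 \<in> L2"
  defines "Wb \<equiv> (\<integral>t. L2_norm (wderiv (wderiv (v t))) \<partial>I01)" and "Zb \<equiv> (\<integral>t. L2_norm (z t) \<partial>I01)"
  assumes small: "24 * Wb \<le> 1"
  defines "M \<equiv> 2 * (L2_norm f0)\<^sup>2 + 8 * Zb\<^sup>2"
  shows "\<bar>(L2_norm f1)\<^sup>2 - (L2_norm f0)\<^sup>2\<bar> \<le> 6 * M * Wb + 2 * sqrt M * Zb"
proof (rule LIMSEQ_le_const2)
  show "(\<lambda>n. \<bar>smooth_energy (1 / real (Suc n)) f1 - smooth_energy (1 / real (Suc n)) f0\<bar>) \<longlonglongrightarrow> \<bar>(L2_norm f1)\<^sup>2 - (L2_norm f0)\<^sup>2\<bar>"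
    by (intro tendsto_rabs tendsto_diff smooth_energy_tendsto f0 f1)
  show "\<exists>N. \<forall>n\<ge>N. \<bar>smooth_energy (1 / real (Suc n)) f1 - smooth_energy (1 / real (Suc n)) f0\<bar> \<le> 6 * M * Wb + 2 * sqrt M * Zb"
    using energy_estimate(2)[OF P f0 f1 small[unfolded Wb_def]] unfolding Wb_def Zb_def M_def by auto
qed

text \<open>The bound \<open>flux_le\<close> contains the norm of \<open>f t\<close>, which
  \<open>energy_estimate\<close> keeps below \<open>sqrt M\<close> along the whole path and not only
  at its ends.\<close>

lemma coef_difference:
  assumes P: "(f, v, z) \<in> admissible f0 f1" and f0: "f0 \<in> L2" and f1: "f1 \<in> L2"
  defines "Wb \<equiv> (\<integral>t. L2_norm (wderiv (wderiv (v t))) \<partial>I01)" and "Zb \<equiv> (\<integral>t. L2_norm (z t) \<partial>I01)"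
  assumes small: "24 * Wb \<le> 1"
  defines "M \<equiv> 2 * (L2_norm f0)\<^sup>2 + 8 * Zb\<^sup>2"
  shows "\<bar>coef k f1 - coef k f0\<bar> \<le> 2 * (1 + real k * pi) * (2 * sqrt M * Wb + Zb)"
proof -
  note F = bochner_L2_L2[OF admissibleD(1)[OF P]] and Z = bochner_L2_L2[OF admissibleD(3)[OF P]] and V = bochner_L2_H2[OF admissibleD(2)[OF P]]
  define w where "w t = L2_norm (wderiv (wderiv (v t)))" for t
  have wi: "integrable I01 w" unfolding w_def[abs_def] by (rule L2_integrable[OF L2_measurable_curve_norm_L2[OF V(4,7)]])
  have zi: "integrable I01 (\<lambda>t. L2_norm (z t))" by (rule L2_integrable[OF L2_measurable_curve_norm_L2[OF Z]])
  have fb: "AE t in I01. (L2_norm (f t))\<^sup>2 \<le> M"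
    using energy_estimate(1)[OF P f0 f1 small[unfolded Wb_def]] unfolding M_def Zb_def .
  let ?H = "\<lambda>t. 2 * (1 + real k * pi) * (2 * sqrt M * w t + L2_norm (z t))"
  have "\<bar>coef k f1 - coef k f0\<bar> \<le> (\<integral>t. \<bar>flux (f t) (v t) (z t) k\<bar> \<partial>I01)"
    unfolding coef_evolution(2)[OF P] using prim_abs_le[OF flux_integrable[OF P], of k 1] by simp
  also have "\<dots> \<le> (\<integral>t. ?H t \<partial>I01)"
  proof (rule integral_mono_AE)
    show "AE t in I01. \<bar>flux (f t) (v t) (z t) k\<bar> \<le> ?H t"
      using fb L2_measurable_curve_AE_L2[OF F(1)] L2_measurable_curve_AE_L2[OF Z(1)] V(1)
    proof eventually_elim
      case (elim t)
      have "L2_norm (f t) \<le> sqrt M" using elim(1) by (rule real_le_rsqrt)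
      then have "2 * w t * L2_norm (f t) \<le> 2 * sqrt M * w t"
        using mult_left_mono[of "L2_norm (f t)" "sqrt M" "2 * w t"] by (simp add: w_def mult_ac)
      then have "2 * (1 + real k * pi) * (2 * w t * L2_norm (f t) + L2_norm (z t)) \<le> ?H t"
        by (intro mult_left_mono) auto
      then show ?case using flux_le[OF elim(2,4,3), of k] unfolding w_def by linarith
    qed
  qed (use wi zi flux_integrable[OF P] in auto)
  also have "\<dots> = 2 * (1 + real k * pi) * (2 * sqrt M * Wb + Zb)"
    unfolding Wb_def Zb_def w_def[symmetric] using wi zi by simp
  finally show ?thesis .
qed

text \<open>At each time the speed dominates each of its terms. It is first rewritten as a function
  of norms, whose measurability in time is known; this agrees with the integrand of the length
  almost everywhere.\<close>

lemma HV_length_bounds: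
  assumes P: "(f, v, z) \<in> admissible f0 f1" and k: "\<kappa> > 0" "l \<ge> 0" "\<epsilon> > 0"
  shows "(\<integral>t. L2_norm (wderiv (wderiv (v t))) \<partial>I01) \<le> sqrt (2 / \<epsilon>) * HV_length \<kappa> l \<epsilon> v z"
    "(\<integral>t. L2_norm (z t) \<partial>I01) \<le> sqrt 2 * HV_length \<kappa> l \<epsilon> v z"
    "integrable I01 (\<lambda>t. sqrt (1/2 * (\<integral>x. \<kappa> * (v t x)\<^sup>2 + l * (wderiv (v t) x)\<^sup>2 + \<epsilon> * (wderiv (wderiv (v t)) x)\<^sup>2 + (z t x)\<^sup>2 \<partial>I01)))"
proof -
  note Z = bochner_L2_L2[OF admissibleD(3)[OF P]] and V = bochner_L2_H2[OF admissibleD(2)[OF P]]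
  define L where "L t = sqrt (1/2 * (\<integral>x. \<kappa> * (v t x)\<^sup>2 + l * (wderiv (v t) x)\<^sup>2 + \<epsilon> * (wderiv (wderiv (v t)) x)\<^sup>2 + (z t x)\<^sup>2 \<partial>I01))" for t
  define K where "K t = sqrt (1/2 * (\<kappa> * (L2_norm (v t))\<^sup>2 + l * (L2_norm (wderiv (v t)))\<^sup>2 + \<epsilon> * (L2_norm (wderiv (wderiv (v t))))\<^sup>2 + (L2_norm (z t))\<^sup>2))" for t
  have LK: "AE t in I01. K t = L t"
    using L2_measurable_curve_AE_L2[OF Z(1)] V(1)
  proof eventually_elim
    case (elim t)
    then have "v t \<in> H2" by simp
    note s = H2_L2[OF this, THEN L2_square_integrable] L2_square_integrable[OF elim(1)]
    show ?case unfolding K_def L_def L2_norm_sq using s by simp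
  qed
  have "K \<in> borel_measurable I01" unfolding K_def[abs_def]
    using L2_measurable_curve_norm_measurable[OF V(2)] L2_measurable_curve_norm_measurable[OF V(3)] L2_measurable_curve_norm_measurable[OF V(4)] L2_measurable_curve_norm_measurable[OF Z(1)] by measurable
  moreover have "integrable I01 (\<lambda>t. (K t)\<^sup>2)"
    unfolding K_def using k V(5,6,7) Z(2) by simp
  ultimately have KL: "K \<in> L2" by (simp add: L2_def)
  have Ki: "integrable I01 K" by (rule L2_integrable[OF KL])
  have Lm: "L \<in> borel_measurable I01" by (rule borel_measurable_I01_AE[OF L2_measurable[OF KL] LK])
  show "integrable I01 (\<lambda>t. sqrt (1/2 * (\<integral>x. \<kappa> * (v t x)\<^sup>2 + l * (wderiv (v t) x)\<^sup>2 + \<epsilon> * (wderiv (wderiv (v t)) x)\<^sup>2 + (z t x)\<^sup>2 \<partial>I01)))"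
    using Ki integrable_cong_AE[OF L2_measurable[OF KL] Lm LK] unfolding L_def by simp
  have LI: "HV_length \<kappa> l \<epsilon> v z = (\<integral>t. K t \<partial>I01)"
    unfolding HV_length_def L_def[symmetric] by (rule integral_cong_AE[OF Lm L2_measurable[OF KL]]) (use LK in auto)
  have wi: "integrable I01 (\<lambda>t. L2_norm (wderiv (wderiv (v t))))" by (rule L2_integrable[OF L2_measurable_curve_norm_L2[OF V(4,7)]])
  have zi: "integrable I01 (\<lambda>t. L2_norm (z t))" by (rule L2_integrable[OF L2_measurable_curve_norm_L2[OF Z]])
  have "L2_norm (wderiv (wderiv (v t))) \<le> sqrt (2 / \<epsilon>) * K t" for t
  proof -
    have "(L2_norm (wderiv (wderiv (v t))))\<^sup>2 \<le> 2 / \<epsilon> * (1/2 * (\<kappa> * (L2_norm (v t))\<^sup>2 + l * (L2_norm (wderiv (v t)))\<^sup>2 + \<epsilon> * (L2_norm (wderiv (wderiv (v t))))\<^sup>2 + (L2_norm (z t))\<^sup>2))"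
      using k by (simp add: field_simps)
    then show ?thesis unfolding K_def real_sqrt_mult[symmetric] by (rule real_le_rsqrt)
  qed
  then have "(\<integral>t. L2_norm (wderiv (wderiv (v t))) \<partial>I01) \<le> (\<integral>t. sqrt (2 / \<epsilon>) * K t \<partial>I01)"
    using wi Ki by (intro integral_mono) auto
  then show "(\<integral>t. L2_norm (wderiv (wderiv (v t))) \<partial>I01) \<le> sqrt (2 / \<epsilon>) * HV_length \<kappa> l \<epsilon> v z" by (simp add: LI)
  have "L2_norm (z t) \<le> sqrt 2 * K t" for t
  proof -
    have "(L2_norm (z t))\<^sup>2 \<le> 2 * (1/2 * (\<kappa> * (L2_norm (v t))\<^sup>2 + l * (L2_norm (wderiv (v t)))\<^sup>2 + \<epsilon> * (L2_norm (wderiv (wderiv (v t))))\<^sup>2 + (L2_norm (z t))\<^sup>2))"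
      using k by simp
    then show ?thesis unfolding K_def real_sqrt_mult[symmetric] by (rule real_le_rsqrt)
  qed
  then have "(\<integral>t. L2_norm (z t) \<partial>I01) \<le> (\<integral>t. sqrt 2 * K t \<partial>I01)"
    using zi Ki by (intro integral_mono) auto
  then show "(\<integral>t. L2_norm (z t) \<partial>I01) \<le> sqrt 2 * HV_length \<kappa> l \<epsilon> v z" by (simp add: LI)
qed

section \<open>Reversal and concatenation of paths\<close>

text \<open>What the pullback of a Bochner space along m requires: on S, properties that hold almost
  everywhere and integrability both survive composition.\<close>

definition reparam :: "real set \<Rightarrow> (real \<Rightarrow> real) \<Rightarrow> bool" where
  "reparam S m \<longleftrightarrow> S \<in> sets borel \<and> m \<in> measurable I01 I01 \<and>
     (\<forall>P. (AE t in I01. P t) \<longrightarrow> (AE t in I01. t \<in> S \<longrightarrow> P (m t))) \<and>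
     (\<forall>g :: real \<Rightarrow> real. integrable I01 g \<longrightarrow> integrable I01 (\<lambda>t. indicator S t * g (m t)))"

text \<open>On \<open>S\<close>, \<open>m\<close> is inverse to the affine map \<open>t \<mapsto> p + c t\<close> of the unit interval onto \<open>S\<close>.\<close>

definition seg :: "real set \<Rightarrow> (real \<Rightarrow> real) \<Rightarrow> real \<Rightarrow> real \<Rightarrow> bool" where
  "seg S m p c \<longleftrightarrow> S \<in> sets borel \<and> m \<in> measurable I01 I01 \<and> c \<noteq> 0 \<and>
     (\<forall>t\<in>{0..1}. p + c * t \<in> {0..1}) \<and> (AE t in I01. t \<in> S \<longrightarrow> t = p + c * m t) \<and>
     (\<forall>g :: real \<Rightarrow> real. integrable I01 g \<longrightarrow> integrable I01 (\<lambda>t. indicator S t * g (m t)) \<and>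
        (\<integral>t. indicator S t * g (m t) \<partial>I01) = \<bar>c\<bar> * (\<integral>t. g t \<partial>I01))"

text \<open>Lets a gluing have an empty second piece, as in the reversal of a path; 1/2 is an
  arbitrary point of the interval.\<close>

lemma reparam_empty: "reparam {} (\<lambda>_. 1/2)"
  by (simp add: reparam_def measurable_restrict_space2_iff)

text \<open>Where the inverse affine map leaves (0,1), it is replaced by the dummy value 1/2,
  because m has to map the interval to itself. S is described only almost everywhere since it may
  contain an end point that the open interval omits.\<close>

lemma seg_affine:
  assumes S [measurable]: "S \<in> sets borel" and c: "c \<noteq> 0" and pc: "p \<in> {0..1}" "p + c \<in> {0..1}"
    and S_eq: "AE t in I01. t \<in> S \<longleftrightarrow> - (p / c) + (1 / c) * t \<in> {0<..<1}"
  defines "m \<equiv> \<lambda>t. if - (p / c) + (1 / c) * t \<in> {0<..<1} then - (p / c) + (1 / c) * t else 1/2"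
  shows "seg S m p c"
  unfolding seg_def
proof (intro conjI allI impI ballI)
  define T where "T t = - (p / c) + (1 / c) * t" for t
  have Tinv: "t = p + c * T t" for t using c by (simp add: T_def field_simps)
  have "(\<lambda>x. - (p / c) + 1 / c * x) \<in> lebesgue \<rightarrow>\<^sub>M lebesgue"
    using lebesgue_affine_measurable[where c="\<lambda>x::real. 1 / c" and t="- (p / c)"] c by simp
  then have Tm: "T \<in> lebesgue \<rightarrow>\<^sub>M lebesgue" by (simp add: T_def[abs_def])
  have conv: "p + c * u \<in> {0<..<1}" if "u \<in> {0<..<1}" for u
  proof -
    have e: "p + c * u = (1 - u) * p + u * (p + c)" by (simp add: algebra_simps)
    have "p \<noteq> p + c" using c by simp
    then consider "p < p + c" | "p + c < p" by linarith
    then show ?thesis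
    proof cases
      case 1
      then have "p < p + c * u" "p + c * u < p + c" using that by auto
      then show ?thesis using pc by auto
    next
      case 2
      then have "c < 0" by simp
      then have "p + c < p + c * u" "p + c * u < p" using that by (auto simp: mult_neg_pos)
      then show ?thesis using pc by auto
    qed
  qed
  show "S \<in> sets borel" by fact
  show "c \<noteq> 0" by fact
  have "(\<lambda>t. if T t \<in> {0<..<1} then T t else 1/2) \<in> lebesgue \<rightarrow>\<^sub>M lebesgue"
  proof (rule measurable_If[OF Tm])
    have "T -` {0<..<1} \<inter> space lebesgue \<in> sets lebesgue" by (rule measurable_sets[OF Tm]) simp
    then show "{t \<in> space lebesgue. T t \<in> {0<..<1}} \<in> sets lebesgue" by (simp add: vimage_def)
  qed simp
  then have "m \<in> lebesgue \<rightarrow>\<^sub>M lebesgue" unfolding m_def T_def .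
  then have "m \<in> I01 \<rightarrow>\<^sub>M lebesgue" by (rule measurable_restrict_space1)
  then show mm: "m \<in> I01 \<rightarrow>\<^sub>M I01" by (rule measurable_restrict_space2[rotated]) (auto simp: m_def)
  show "p + c * t \<in> {0..1}" if "t \<in> {0..1}" for t
  proof (cases "t = 0 \<or> t = 1")
    case False
    then have "t \<in> {0<..<1}" using that by auto
    from conv[OF this] show ?thesis by auto
  qed (use pc in auto)
  show "AE t in I01. t \<in> S \<longrightarrow> t = p + c * m t"
    using S_eq by eventually_elim (use Tinv in \<open>simp add: m_def T_def\<close>)
  fix g :: "real \<Rightarrow> real" assume g: "integrable I01 g"
  define G where "G t = indicator {0<..<1} t *\<^sub>R g t" for t
  have s: "{0<..<1} \<inter> space lebesgue \<in> sets (lebesgue :: real measure)" by simp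
  have Gi: "integrable lebesgue G" unfolding G_def[abs_def]
    using integrable_restrict_space[OF s, of g] g by simp
  have GI: "(\<integral>t. g t \<partial>I01) = (\<integral>t. G t \<partial>lebesgue)" unfolding G_def[abs_def]
    using integral_restrict_space[OF s, of g] by simp
  \<comment> \<open>As G is extended by 0, its composition with T vanishes outside (0,1), and the
    substitution can be carried out on the whole line.\<close>
  have ind: "indicator {0<..<1} t *\<^sub>R G (T t) = G (T t)" for t
    using conv[of "T t"] Tinv[of t] by (auto simp: G_def indicator_def)
  have T': "T = (\<lambda>x. - (p / c) + (1 / c) * x)" by (simp add: T_def[abs_def])
  have GTi: "integrable lebesgue (\<lambda>t. G (T t))"
    unfolding T' by (rule lebesgue_integrable_real_affine[OF Gi]) (use c in simp)
  have GTi': "integrable I01 (\<lambda>t. G (T t))"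
    using integrable_restrict_space[OF s, of "\<lambda>t. G (T t)", unfolded ind] GTi by blast
  have "(\<integral>t. G (T t) \<partial>I01) = (\<integral>t. G (T t) \<partial>lebesgue)"
    by (rule integral_restrict_space[OF s, of "\<lambda>t. G (T t)", unfolded ind])
  also have "\<dots> = \<bar>c\<bar> * (\<integral>t. G t \<partial>lebesgue)"
    using lebesgue_integral_real_affine[of "1 / c" G "- (p / c)"] c unfolding T' by simp
  finally have GTI: "(\<integral>t. G (T t) \<partial>I01) = \<bar>c\<bar> * (\<integral>t. g t \<partial>I01)" unfolding GI .
  have ae: "AE t in I01. G (T t) = indicator S t * g (m t)"
    using S_eq by eventually_elim (auto simp: G_def m_def T_def indicator_def)
  have gm: "(\<lambda>t. g (m t)) \<in> borel_measurable I01"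
    using measurable_compose[OF mm borel_measurable_integrable[OF g]] .
  have hm: "(\<lambda>t. indicator S t * g (m t)) \<in> borel_measurable I01" using gm by measurable
  show "integrable I01 (\<lambda>t. indicator S t * g (m t))"
    using GTi' integrable_cong_AE[OF borel_measurable_integrable[OF GTi'] hm ae] by simp
  show "(\<integral>t. indicator S t * g (m t) \<partial>I01) = \<bar>c\<bar> * (\<integral>t. g t \<partial>I01)"
    using integral_cong_AE[OF borel_measurable_integrable[OF GTi'] hm ae] GTI by simp
qed

text \<open>The substitution rule, applied to the indicator of a null set, shows that the part of
  the preimage inside S is null.\<close>

lemma seg_reparam:
  assumes "seg S m p c" shows "reparam S m"
  unfolding reparam_def
proof (intro conjI allI impI)
  show S [measurable]: "S \<in> sets borel" and m: "m \<in> I01 \<rightarrow>\<^sub>M I01" using assms by (auto simp: seg_def)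
  show "integrable I01 (\<lambda>t. indicator S t * g (m t))" if "integrable I01 g" for g :: "real \<Rightarrow> real"
    using assms that by (auto simp: seg_def)
  fix P assume "AE t in I01. P t"
  then obtain N where N: "{t \<in> space I01. \<not> P t} \<subseteq> N" "emeasure I01 N = 0" "N \<in> sets I01" by (rule AE_E)
  have gi: "integrable I01 (\<lambda>t. indicator N t :: real)" using N by (intro integrable_real_indicator) auto
  have "(\<integral>t. indicator N t \<partial>I01) = (0::real)"
    using N(2) sets.Int_space_eq2[OF N(3)] by (simp add: measure_def)
  then have z: "(\<integral>t. indicator S t * indicator N (m t) \<partial>I01) = (0::real)"
    and i: "integrable I01 (\<lambda>t. indicator S t * indicator N (m t) :: real)"
    using assms gi by (auto simp: seg_def)
  have "AE t in I01. indicator S t * indicator N (m t) = (0::real)"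
    using z integral_nonneg_eq_0_iff_AE[OF i] by simp
  then show "AE t in I01. t \<in> S \<longrightarrow> P (m t)"
    using AE_space[of I01]
  proof eventually_elim
    case (elim t)
    have "m t \<in> space I01" using measurable_space[OF m elim(2)] .
    then show ?case using elim(1) N(1) by (auto simp: indicator_def split: if_splits)
  qed
qed

text \<open>The factors belong to the change of time: the density keeps its values, with factor 1,
  while velocity and source are multiplied by the rate at which the original path is traversed,
  which is negative for a reversal.\<close>

definition glue :: "real set \<Rightarrow> (real \<Rightarrow> real) \<Rightarrow> (real \<Rightarrow> real) \<Rightarrow> real \<Rightarrow> real \<Rightarrow>
    (real \<Rightarrow> real \<Rightarrow> real) \<Rightarrow> (real \<Rightarrow> real \<Rightarrow> real) \<Rightarrow> real \<Rightarrow> real \<Rightarrow> real" where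
  "glue S m1 m2 k1 k2 u1 u2 t x = (if t \<in> S then k1 * u1 (m1 t) x else k2 * u2 (m2 t) x)"

lemma glue_simps:
  "t \<in> S \<Longrightarrow> glue S m1 m2 k1 k2 u1 u2 t = (\<lambda>x. k1 * u1 (m1 t) x)"
  "t \<notin> S \<Longrightarrow> glue S m1 m2 k1 k2 u1 u2 t = (\<lambda>x. k2 * u2 (m2 t) x)"
  by (auto simp: glue_def)

text \<open>The abstract X and N serve L2 and the intersection of H2 and H10 alike. Homogeneity on
  differences is listed separately because convergence of the approximations is a statement about
  differences.\<close>

lemma bochner_glue:
  assumes r1: "reparam S m1" and r2: "reparam (- S) m2"
    and u1: "u1 \<in> bochner_L2 X N" and u2: "u2 \<in> bochner_L2 X N"
    and X: "\<And>a k. a \<in> X \<Longrightarrow> (\<lambda>x. k * a x) \<in> X"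
    and N: "\<And>a k. a \<in> X \<Longrightarrow> N (\<lambda>x. k * a x) = \<bar>k\<bar> * N a"
    and Nd: "\<And>a b k. a \<in> X \<Longrightarrow> b \<in> X \<Longrightarrow> N (\<lambda>x. k * a x - k * b x) = \<bar>k\<bar> * N (\<lambda>x. a x - b x)"
  shows "glue S m1 m2 k1 k2 u1 u2 \<in> bochner_L2 X N"
proof -
  let ?u = "glue S m1 m2 k1 k2 u1 u2"
  obtain s1 where s1: "\<And>n::nat. simple_function I01 (s1 n)" "\<And>n t. t \<in> {0<..<1} \<Longrightarrow> s1 n t \<in> X"
    "AE t in I01. (\<lambda>n. N (\<lambda>x. s1 n t x - u1 t x)) \<longlonglongrightarrow> 0" and X1: "AE t in I01. u1 t \<in> X"
    using u1 unfolding bochner_L2_def bochner_measurable_def by blast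
  obtain s2 where s2: "\<And>n::nat. simple_function I01 (s2 n)" "\<And>n t. t \<in> {0<..<1} \<Longrightarrow> s2 n t \<in> X"
    "AE t in I01. (\<lambda>n. N (\<lambda>x. s2 n t x - u2 t x)) \<longlonglongrightarrow> 0" and X2: "AE t in I01. u2 t \<in> X"
    using u2 unfolding bochner_L2_def bochner_measurable_def by blast
  have m: "m1 \<in> I01 \<rightarrow>\<^sub>M I01" "m2 \<in> I01 \<rightarrow>\<^sub>M I01" and S [measurable]: "S \<in> sets borel"
    using r1 r2 by (auto simp: reparam_def)
  have mr: "m1 t \<in> {0<..<1}" "m2 t \<in> {0<..<1}" if "t \<in> {0<..<1}" for t
    using measurable_space[OF m(1), of t] measurable_space[OF m(2), of t] that by auto
  have P1: "AE t in I01. t \<in> S \<longrightarrow> P (m1 t)" if "AE t in I01. P t" for P using r1 that by (auto simp: reparam_def)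
  have P2: "AE t in I01. t \<in> - S \<longrightarrow> P (m2 t)" if "AE t in I01. P t" for P using r2 that by (auto simp: reparam_def)
  have "bochner_measurable X N ?u"
    unfolding bochner_measurable_def
  proof (intro conjI exI allI ballI)
    show "AE t in I01. ?u t \<in> X"
      using P1[OF X1] P2[OF X2]
    proof eventually_elim
      case (elim t)
      then show ?case using X by (cases "t \<in> S") (simp_all add: glue_simps)
    qed
    let ?s = "\<lambda>n. glue S m1 m2 k1 k2 (s1 n) (s2 n)"
    show "simple_function I01 (?s n)" for n
    proof -
      have "simple_function I01 (\<lambda>t. if t \<in> S then (\<lambda>a x. k1 * a x) (s1 n (m1 t)) else (\<lambda>a x. k2 * a x) (s2 n (m2 t)))"
      proof (rule simple_function_If)
        show "simple_function I01 (\<lambda>t. (\<lambda>a x. k1 * a x) (s1 n (m1 t)))"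
          using simple_function_compose[OF simple_function_comp[OF m(1) s1(1)[of n]], of "\<lambda>a x. k1 * a x"] by (simp add: o_def)
        show "simple_function I01 (\<lambda>t. (\<lambda>a x. k2 * a x) (s2 n (m2 t)))"
          using simple_function_compose[OF simple_function_comp[OF m(2) s2(1)[of n]], of "\<lambda>a x. k2 * a x"] by (simp add: o_def)
        show "{t \<in> space I01. t \<in> S} \<in> sets I01" by measurable
      qed
      also have "(\<lambda>t. if t \<in> S then (\<lambda>a x. k1 * a x) (s1 n (m1 t)) else (\<lambda>a x. k2 * a x) (s2 n (m2 t))) = ?s n"
        by (auto simp: fun_eq_iff glue_def)
      finally show ?thesis .
    qed
    show "?s n t \<in> X" if "t \<in> {0<..<1}" for n t
      using X[OF s1(2)[OF mr(1)[OF that]]] X[OF s2(2)[OF mr(2)[OF that]]] by (cases "t \<in> S") (simp_all add: glue_simps)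
    show "AE t in I01. (\<lambda>n. N (\<lambda>x. ?s n t x - ?u t x)) \<longlonglongrightarrow> 0"
      using P1[OF X1] P2[OF X2] P1[OF s1(3)] P2[OF s2(3)] AE_space[of I01]
    proof eventually_elim
      case (elim t)
      then have t: "t \<in> {0<..<1}" by simp
      show ?case
      proof (cases "t \<in> S")
        case True
        have "N (\<lambda>x. ?s n t x - ?u t x) = \<bar>k1\<bar> * N (\<lambda>x. s1 n (m1 t) x - u1 (m1 t) x)" for n
          using True elim(1) Nd[OF s1(2)[OF mr(1)[OF t]]] by (simp add: glue_simps)
        then show ?thesis using tendsto_mult_left[of "\<lambda>n. N (\<lambda>x. s1 n (m1 t) x - u1 (m1 t) x)" 0 _ "\<bar>k1\<bar>"] elim(3) True by simp
      next
        case False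
        have "N (\<lambda>x. ?s n t x - ?u t x) = \<bar>k2\<bar> * N (\<lambda>x. s2 n (m2 t) x - u2 (m2 t) x)" for n
          using False elim(2) Nd[OF s2(2)[OF mr(2)[OF t]]] by (simp add: glue_simps)
        then show ?thesis using tendsto_mult_left[of "\<lambda>n. N (\<lambda>x. s2 n (m2 t) x - u2 (m2 t) x)" 0 _ "\<bar>k2\<bar>"] elim(4) False by simp
      qed
    qed
  qed
  moreover have "integrable I01 (\<lambda>t. (N (?u t))\<^sup>2)"
  proof -
    have "integrable I01 (\<lambda>t. (N (u1 t))\<^sup>2)" "integrable I01 (\<lambda>t. (N (u2 t))\<^sup>2)" using u1 u2 by (auto simp: bochner_L2_def)
    then have i: "integrable I01 (\<lambda>t. indicator S t * (N (u1 (m1 t)))\<^sup>2)" "integrable I01 (\<lambda>t. indicator (- S) t * (N (u2 (m2 t)))\<^sup>2)"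
      using r1 r2 unfolding reparam_def by blast+
    let ?h = "\<lambda>t. k1\<^sup>2 * (indicator S t * (N (u1 (m1 t)))\<^sup>2) + k2\<^sup>2 * (indicator (- S) t * (N (u2 (m2 t)))\<^sup>2)"
    have hi: "integrable I01 ?h" by (intro Bochner_Integration.integrable_add integrable_mult_right i)
    have ae: "AE t in I01. ?h t = (N (?u t))\<^sup>2"
      using P1[OF X1] P2[OF X2]
    proof eventually_elim
      case (elim t)
      then show ?case by (cases "t \<in> S") (simp_all add: glue_simps N power_mult_distrib)
    qed
    show ?thesis
      using hi integrable_cong_AE[OF borel_measurable_integrable[OF hi] borel_measurable_I01_AE[OF borel_measurable_integrable[OF hi] ae] ae] by simp
  qed
  ultimately show ?thesis by (simp add: bochner_L2_def)
qed

lemma bochner_glue_L2: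
  assumes "reparam S m1" "reparam (- S) m2" "u1 \<in> bochner_L2 L2 L2_norm" "u2 \<in> bochner_L2 L2 L2_norm"
  shows "glue S m1 m2 k1 k2 u1 u2 \<in> bochner_L2 L2 L2_norm"
  by (rule bochner_glue[OF assms]) (auto simp flip: right_diff_distrib)

lemma bochner_glue_H2:
  assumes "reparam S m1" "reparam (- S) m2" "u1 \<in> bochner_L2 (H2 \<inter> H10) H2_norm" "u2 \<in> bochner_L2 (H2 \<inter> H10) H2_norm"
  shows "glue S m1 m2 k1 k2 u1 u2 \<in> bochner_L2 (H2 \<inter> H10) H2_norm"
proof (rule bochner_glue[OF assms])
  show "H2_norm (\<lambda>x. k * a x - k * b x) = \<bar>k\<bar> * H2_norm (\<lambda>x. a x - b x)" if "a \<in> H2 \<inter> H10" "b \<in> H2 \<inter> H10" for a b k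
    using H2_norm_cmult[OF H2_diff(1)[of a b], of k] that by (simp add: right_diff_distrib)
qed (auto intro: H2_cmult(1) H10_cmult H2_norm_cmult)

lemma reparam_AE:
  assumes "reparam S m" "AE t in I01. P t"
  shows "AE t in I01. t \<in> S \<longrightarrow> P (m t)"
  by (rule assms(1)[unfolded reparam_def, THEN conjunct2, THEN conjunct2, THEN conjunct1, rule_format, OF assms(2)])

lemma segD:
  assumes "seg S m p c"
  shows "S \<in> sets borel" "m \<in> I01 \<rightarrow>\<^sub>M I01" "c \<noteq> 0" "\<And>t. t \<in> {0..1} \<Longrightarrow> p + c * t \<in> {0..1}"
    "AE t in I01. t \<in> S \<longrightarrow> t = p + c * m t"
    "\<And>g :: real \<Rightarrow> real. integrable I01 g \<Longrightarrow> integrable I01 (\<lambda>t. indicator S t * g (m t)) \<and>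
        (\<integral>t. indicator S t * g (m t) \<partial>I01) = \<bar>c\<bar> * (\<integral>t. g t \<partial>I01)"
proof -
  note c2 = conjunct2[OF assms[unfolded seg_def]]
  note c3 = conjunct2[OF c2] note c4 = conjunct2[OF c3] note c5 = conjunct2[OF c4] note c6 = conjunct2[OF c5]
  show "S \<in> sets borel" by (rule conjunct1[OF assms[unfolded seg_def]])
  show "m \<in> I01 \<rightarrow>\<^sub>M I01" by (rule conjunct1[OF c2])
  show "c \<noteq> 0" by (rule conjunct1[OF c3])
  show "p + c * t \<in> {0..1}" if "t \<in> {0..1}" for t by (rule bspec[OF conjunct1[OF c4] that])
  show "AE t in I01. t \<in> S \<longrightarrow> t = p + c * m t" by (rule conjunct1[OF c5])
  show "integrable I01 (\<lambda>t. indicator S t * g (m t)) \<and>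
        (\<integral>t. indicator S t * g (m t) \<partial>I01) = \<bar>c\<bar> * (\<integral>t. g t \<partial>I01)"
    if "integrable I01 g" for g :: "real \<Rightarrow> real"
    by (rule mp[OF spec[OF c6] that])
qed

section \<open>Test functions under an affine change of time\<close>

lemma smooth_square_derivs:
  assumes "\<phi> \<in> smooth_square"
  obtains \<phi>t \<phi>x where "cont_square \<phi>" "cont_square \<phi>t" "cont_square \<phi>x"
    "\<And>t x. t \<in> {0..1} \<Longrightarrow> x \<in> {0..1} \<Longrightarrow> ((\<lambda>s. \<phi> s x) has_real_derivative \<phi>t t x) (at t within {0..1})"
    "\<And>t x. t \<in> {0<..<1} \<Longrightarrow> x \<in> {0<..<1} \<Longrightarrow> deriv (\<lambda>s. \<phi> s x) t = \<phi>t t x"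
    "\<And>t x. t \<in> {0<..<1} \<Longrightarrow> x \<in> {0<..<1} \<Longrightarrow> deriv (\<lambda>y. \<phi> t y) x = \<phi>x t x"
proof -
  have "Ck_square (Suc 0) \<phi>" using assms unfolding smooth_square_def by blast
  then obtain \<phi>t \<phi>x where c: "cont_square \<phi>" "cont_square \<phi>t" "cont_square \<phi>x"
    and d: "\<And>t x. t \<in> {0..1} \<Longrightarrow> x \<in> {0..1} \<Longrightarrow>
          ((\<lambda>s. \<phi> s x) has_real_derivative \<phi>t t x) (at t within {0..1}) \<and>
          ((\<lambda>y. \<phi> t y) has_real_derivative \<phi>x t x) (at x within {0..1})"
    by auto
  have "deriv (\<lambda>s. \<phi> s x) t = \<phi>t t x \<and> deriv (\<lambda>y. \<phi> t y) x = \<phi>x t x" if "t \<in> {0<..<1}" "x \<in> {0<..<1}" for t x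
    using d[of t x] that by (auto simp: at_within_Icc_at intro!: DERIV_imp_deriv)
  then show ?thesis using d by (intro that[OF c]) auto
qed

lemma cont_square_affine:
  assumes "cont_square \<phi>" and "\<And>t. t \<in> {0..1} \<Longrightarrow> p + c * t \<in> {0..1}"
  shows "cont_square (\<lambda>t. \<phi> (p + c * t))"
proof -
  have "continuous_on ({0..1} \<times> {0..1}) ((\<lambda>(t, x). \<phi> t x) \<circ> (\<lambda>q. (p + c * fst q, snd q)))"
  proof (rule continuous_on_compose)
    show "continuous_on ({0..1} \<times> {0..1}) (\<lambda>q. (p + c * fst q, snd q :: real))"
      by (intro continuous_intros)
    show "continuous_on ((\<lambda>q. (p + c * fst q, snd q)) ` ({0..1} \<times> {0..1})) (\<lambda>(t, x). \<phi> t x)"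
      by (rule continuous_on_subset[OF assms(1)]) (use assms(2) in force)
  qed
  then show ?thesis by (simp add: o_def split_beta')
qed

lemma Ck_square_cmult: "Ck_square n \<phi> \<Longrightarrow> Ck_square n (\<lambda>t x. c * \<phi> t x)"
proof (induction n arbitrary: \<phi>)
  case 0
  then show ?case using continuous_on_mult_left[of _ "\<lambda>(t, x). \<phi> t x" c] by (simp add: split_beta')
next
  case (Suc n)
  then obtain \<phi>t \<phi>x where c: "cont_square \<phi>" and k: "Ck_square n \<phi>t" "Ck_square n \<phi>x"
    and d: "\<forall>t\<in>{0..1}. \<forall>x\<in>{0..1}.
          ((\<lambda>s. \<phi> s x) has_real_derivative \<phi>t t x) (at t within {0..1}) \<and>
          ((\<lambda>y. \<phi> t y) has_real_derivative \<phi>x t x) (at x within {0..1})"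
    by auto
  have "cont_square (\<lambda>t x. c * \<phi> t x)" using continuous_on_mult_left[OF c, of c] by (simp add: split_beta')
  moreover have "\<forall>t\<in>{0..1}. \<forall>x\<in>{0..1}.
          ((\<lambda>s. c * \<phi> s x) has_real_derivative c * \<phi>t t x) (at t within {0..1}) \<and>
          ((\<lambda>y. c * \<phi> t y) has_real_derivative c * \<phi>x t x) (at x within {0..1})"
    by (intro ballI conjI DERIV_cmult) (use d in auto)
  ultimately show ?case unfolding Ck_square.simps
    by (intro conjI exI[of _ "\<lambda>t x. c * \<phi>t t x"] exI[of _ "\<lambda>t x. c * \<phi>x t x"] Suc.IH k)
qed

text \<open>The chain rule multiplies the time derivative by c, so the induction also uses closure
  under constant multiples.\<close>

lemma Ck_square_affine:
  assumes "\<And>t. t \<in> {0..1} \<Longrightarrow> p + c * t \<in> {0..1}"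
  shows "Ck_square n \<phi> \<Longrightarrow> Ck_square n (\<lambda>t. \<phi> (p + c * t))"
proof (induction n arbitrary: \<phi>)
  case 0
  then show ?case using cont_square_affine[OF _ assms] by simp
next
  case (Suc n)
  then obtain \<phi>t \<phi>x where c: "cont_square \<phi>" and k: "Ck_square n \<phi>t" "Ck_square n \<phi>x"
    and d: "\<And>t x. t\<in>{0..1} \<Longrightarrow> x\<in>{0..1} \<Longrightarrow>
          ((\<lambda>s. \<phi> s x) has_real_derivative \<phi>t t x) (at t within {0..1})"
       "\<And>t x. t\<in>{0..1} \<Longrightarrow> x\<in>{0..1} \<Longrightarrow> ((\<lambda>y. \<phi> t y) has_real_derivative \<phi>x t x) (at x within {0..1})"
    by auto
  have "((\<lambda>s. \<phi> (p + c * s) x) has_real_derivative c * \<phi>t (p + c * t) x) (at t within {0..1})"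
    if t: "t \<in> {0..1}" and x: "x \<in> {0..1}" for t x
  proof -
    have "((\<lambda>s. \<phi> s x) \<circ> (\<lambda>s. p + c * s) has_real_derivative \<phi>t (p + c * t) x * c) (at t within {0..1})"
    proof (rule DERIV_image_chain)
      show "((\<lambda>s. \<phi> s x) has_real_derivative \<phi>t (p + c * t) x) (at (p + c * t) within (\<lambda>s. p + c * s) ` {0..1})"
        by (rule DERIV_subset[OF d(1)[OF assms[OF t] x]]) (use assms in auto)
    qed (auto intro!: derivative_eq_intros)
    then show ?thesis by (simp add: o_def mult.commute)
  qed
  then have "\<forall>t\<in>{0..1}. \<forall>x\<in>{0..1}.
          ((\<lambda>s. \<phi> (p + c * s) x) has_real_derivative c * \<phi>t (p + c * t) x) (at t within {0..1}) \<and>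
          ((\<lambda>y. \<phi> (p + c * t) y) has_real_derivative \<phi>x (p + c * t) x) (at x within {0..1})"
    using d(2)[OF assms] by (intro ballI conjI) auto
  then show ?case unfolding Ck_square.simps
    by (intro conjI exI[of _ "\<lambda>t x. c * \<phi>t (p + c * t) x"] exI[of _ "\<lambda>t. \<phi>x (p + c * t)"]
        cont_square_affine[OF c assms] Ck_square_cmult[OF Suc.IH[OF k(1)]] Suc.IH[OF k(2)])
qed

lemma smooth_square_affine:
  assumes "\<phi> \<in> smooth_square" "\<And>t. t \<in> {0..1} \<Longrightarrow> p + c * t \<in> {0..1}"
  shows "(\<lambda>t. \<phi> (p + c * t)) \<in> smooth_square"
  using assms Ck_square_affine[of p c] by (auto simp: smooth_square_def)

section \<open>The weak equation as an integral over time slices\<close>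

definition weak_form_time :: "(real \<Rightarrow> real) \<Rightarrow> (real \<Rightarrow> real \<Rightarrow> real) \<Rightarrow> real \<Rightarrow> real" where
  "weak_form_time f \<phi> t = (\<integral>x. f x * deriv (\<lambda>s. \<phi> s x) t \<partial>I01)"

text \<open>With the slices separated, each side of the equation is a single integral in time, to
  which the substitution rule of \<open>seg\<close> applies.\<close>

definition weak_form_rhs :: "(real \<Rightarrow> real) \<Rightarrow> (real \<Rightarrow> real) \<Rightarrow> (real \<Rightarrow> real) \<Rightarrow> (real \<Rightarrow> real) \<Rightarrow> real" where
  "weak_form_rhs f v z \<phi> = (\<integral>x. f x * \<phi> x * wderiv v x \<partial>I01) + (\<integral>x. f x * deriv \<phi> x * v x \<partial>I01) + (\<integral>x. \<phi> x * z x \<partial>I01)"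

lemma weak_form_integrable:
  assumes f: "f \<in> bochner_L2 L2 L2_norm" and v: "v \<in> bochner_L2 (H2 \<inter> H10) H2_norm" and z: "z \<in> bochner_L2 L2 L2_norm"
    and \<phi>: "\<phi> \<in> smooth_square"
  shows "integrable I01 (\<lambda>t. weak_form_time (f t) \<phi> t)"
    "integrable I01 (\<lambda>t. \<integral>x. f t x * \<phi> t x * wderiv (v t) x \<partial>I01)"
    "integrable I01 (\<lambda>t. \<integral>x. f t x * deriv (\<lambda>y. \<phi> t y) x * v t x \<partial>I01)"
    "integrable I01 (\<lambda>t. \<integral>x. \<phi> t x * z t x \<partial>I01)"
proof -
  obtain \<phi>t \<phi>x where \<phi>': "cont_square \<phi>" "cont_square \<phi>t" "cont_square \<phi>x"
    "\<And>t x. t \<in> {0<..<1} \<Longrightarrow> x \<in> {0<..<1} \<Longrightarrow> deriv (\<lambda>s. \<phi> s x) t = \<phi>t t x"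
    "\<And>t x. t \<in> {0<..<1} \<Longrightarrow> x \<in> {0<..<1} \<Longrightarrow> deriv (\<lambda>y. \<phi> t y) x = \<phi>x t x"
    by (rule smooth_square_derivs[OF \<phi>]) blast
  note F = bochner_L2_L2[OF f] and Z = bochner_L2_L2[OF z] and V = bochner_L2_H2[OF v]
  note C = L2_measurable_curve_const[OF L2_const[of 1]]
  have one: "integrable I01 (\<lambda>t::real. (L2_norm (\<lambda>x. 1))\<^sup>2)" by simp
  have "integrable I01 (\<lambda>t. \<integral>x. f t x * \<phi>t t x * 1 \<partial>I01)" by (rule triple_integrable[OF F C one \<phi>'(2)])
  moreover have e1: "weak_form_time (f t) \<phi> t = (\<integral>x. f t x * \<phi>t t x * 1 \<partial>I01)" if "t \<in> space I01" for t
    unfolding weak_form_time_def using that \<phi>'(4) by (intro Bochner_Integration.integral_cong) auto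
  ultimately show "integrable I01 (\<lambda>t. weak_form_time (f t) \<phi> t)"
    by (subst Bochner_Integration.integrable_cong[OF refl]) (rule e1, assumption)
  show "integrable I01 (\<lambda>t. \<integral>x. f t x * \<phi> t x * wderiv (v t) x \<partial>I01)"
    by (rule triple_integrable[OF F V(3,6) \<phi>'(1)])
  have "integrable I01 (\<lambda>t. \<integral>x. f t x * \<phi>x t x * v t x \<partial>I01)" by (rule triple_integrable[OF F V(2,5) \<phi>'(3)])
  moreover have e2: "(\<integral>x. f t x * deriv (\<lambda>y. \<phi> t y) x * v t x \<partial>I01) = (\<integral>x. f t x * \<phi>x t x * v t x \<partial>I01)" if "t \<in> space I01" for t
    using that \<phi>'(5) by (intro Bochner_Integration.integral_cong) auto
  ultimately show "integrable I01 (\<lambda>t. \<integral>x. f t x * deriv (\<lambda>y. \<phi> t y) x * v t x \<partial>I01)"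
    by (subst Bochner_Integration.integrable_cong[OF refl]) (rule e2, assumption)
  have "integrable I01 (\<lambda>t. \<integral>x. z t x * \<phi> t x * 1 \<partial>I01)" by (rule triple_integrable[OF Z C one \<phi>'(1)])
  then show "integrable I01 (\<lambda>t. \<integral>x. \<phi> t x * z t x \<partial>I01)" by (simp add: mult.commute)
qed

lemma weak_form_rhs_integrable:
  assumes "f \<in> bochner_L2 L2 L2_norm" "v \<in> bochner_L2 (H2 \<inter> H10) H2_norm" "z \<in> bochner_L2 L2 L2_norm" "\<phi> \<in> smooth_square"
  shows "integrable I01 (\<lambda>t. weak_form_rhs (f t) (v t) (z t) (\<phi> t))"
  unfolding weak_form_rhs_def using weak_form_integrable[OF assms] by simp

lemma weak_solution_iff:
  assumes "f \<in> bochner_L2 L2 L2_norm" "v \<in> bochner_L2 (H2 \<inter> H10) H2_norm" "z \<in> bochner_L2 L2 L2_norm"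
  shows "weak_solution f0 f1 f v z \<longleftrightarrow> (\<forall>\<phi>\<in>smooth_square.
     - (\<integral>t. weak_form_time (f t) \<phi> t \<partial>I01) + (\<integral>x. f1 x * \<phi> 1 x \<partial>I01) - (\<integral>x. f0 x * \<phi> 0 x \<partial>I01)
     = (\<integral>t. weak_form_rhs (f t) (v t) (z t) (\<phi> t) \<partial>I01))"
  unfolding weak_solution_def
proof (rule ball_cong[OF refl])
  fix \<phi> assume "\<phi> \<in> smooth_square"
  note i = weak_form_integrable[OF assms this]
  show "(- (\<integral>t. (\<integral>x. f t x * deriv (\<lambda>s. \<phi> s x) t \<partial>I01) \<partial>I01)
       + (\<integral>x. f1 x * \<phi> 1 x \<partial>I01) - (\<integral>x. f0 x * \<phi> 0 x \<partial>I01)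
     = (\<integral>t. (\<integral>x. f t x * \<phi> t x * wderiv (v t) x \<partial>I01) \<partial>I01)
       + (\<integral>t. (\<integral>x. f t x * deriv (\<lambda>y. \<phi> t y) x * v t x \<partial>I01) \<partial>I01)
       + (\<integral>t. (\<integral>x. \<phi> t x * z t x \<partial>I01) \<partial>I01)) \<longleftrightarrow>
     (- (\<integral>t. weak_form_time (f t) \<phi> t \<partial>I01) + (\<integral>x. f1 x * \<phi> 1 x \<partial>I01) - (\<integral>x. f0 x * \<phi> 0 x \<partial>I01)
     = (\<integral>t. weak_form_rhs (f t) (v t) (z t) (\<phi> t) \<partial>I01))"
    unfolding weak_form_rhs_def weak_form_time_def using i(2,3,4) by simp
qed

text \<open>Joint homogeneity in v and z is what makes the equation compatible with a change of
  time.\<close>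

lemma weak_form_rhs_scale:
  assumes v: "v \<in> H2 \<inter> H10" and f: "f \<in> L2" and \<phi>: "continuous_on {0..1} \<phi>"
  shows "weak_form_rhs f (\<lambda>x. k * v x) (\<lambda>x. k * z x) \<phi> = k * weak_form_rhs f v z \<phi>"
proof -
  have m: "(\<lambda>x. f x * \<phi> x) \<in> borel_measurable I01" by (rule L2_measurable[OF L2_mult_continuous[OF f \<phi>]])
  have vH: "v \<in> H2" using v by simp
  have [measurable]: "wderiv v \<in> borel_measurable I01" "wderiv (\<lambda>x. k * v x) \<in> borel_measurable I01"
    using H2_L2(2)[OF vH] H2_L2(2)[OF H2_cmult(1)[OF vH]] by (auto intro: L2_measurable)
  have "(\<integral>x. f x * \<phi> x * wderiv (\<lambda>x. k * v x) x \<partial>I01) = (\<integral>x. k * (f x * \<phi> x * wderiv v x) \<partial>I01)"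
  proof (rule integral_cong_AE)
    show "AE x in I01. f x * \<phi> x * wderiv (\<lambda>x. k * v x) x = k * (f x * \<phi> x * wderiv v x)"
      using H2_cmult(2)[OF vH, of k] by eventually_elim simp
  qed (use m in measurable)
  moreover have "(\<integral>x. f x * deriv \<phi> x * (k * v x) \<partial>I01) = (\<integral>x. k * (f x * deriv \<phi> x * v x) \<partial>I01)"
    "(\<integral>x. \<phi> x * (k * z x) \<partial>I01) = (\<integral>x. k * (\<phi> x * z x) \<partial>I01)" by (simp_all add: mult_ac)
  ultimately show ?thesis by (simp add: weak_form_rhs_def distrib_left)
qed

text \<open>Substitution of t = p + c u in the equation tested with \<psi> u = \<phi> (p + c u). The
  time derivative of \<psi> produces a factor c, which r compensates; on the right-hand side r goes
  into velocity and source. Together with the Jacobian there remains r |c| = sgn c, the orientation,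
  so a reversal exchanges the end points.\<close>

lemma seg_weak:
  assumes sg: "seg S m p c" and rc: "r * c = 1" and f: "f \<in> bochner_L2 L2 L2_norm" and v: "v \<in> bochner_L2 (H2 \<inter> H10) H2_norm" and z: "z \<in> bochner_L2 L2 L2_norm"
    and w: "weak_solution a b f v z" and \<phi>: "\<phi> \<in> smooth_square"
  defines "T \<equiv> \<lambda>t. indicator S t * weak_form_time (f (m t)) \<phi> t"
    and "R \<equiv> \<lambda>t. indicator S t * weak_form_rhs (f (m t)) (\<lambda>x. r * v (m t) x) (\<lambda>x. r * z (m t) x) (\<phi> t)"
  shows "integrable I01 T" "integrable I01 R"
    "- (\<integral>t. T t \<partial>I01) + sgn c * ((\<integral>x. b x * \<phi> (p + c) x \<partial>I01) - (\<integral>x. a x * \<phi> p x \<partial>I01)) = (\<integral>t. R t \<partial>I01)"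
proof -
  have c: "c \<noteq> 0" and mm: "m \<in> I01 \<rightarrow>\<^sub>M I01" and S: "S \<in> sets borel" and pc: "\<And>t. t \<in> {0..1} \<Longrightarrow> p + c * t \<in> {0..1}"
    and mt: "AE t in I01. t \<in> S \<longrightarrow> t = p + c * m t"
    and I: "\<And>g :: real \<Rightarrow> real. integrable I01 g \<Longrightarrow> integrable I01 (\<lambda>t. indicator S t * g (m t)) \<and>
        (\<integral>t. indicator S t * g (m t) \<partial>I01) = \<bar>c\<bar> * (\<integral>t. g t \<partial>I01)"
    by (fact segD[OF sg])+
  have P: "AE t in I01. t \<in> S \<longrightarrow> Q (m t)" if "AE t in I01. Q t" for Q
    by (rule reparam_AE[OF seg_reparam[OF sg] that])
  define \<psi> where "\<psi> t = \<phi> (p + c * t)" for t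
  have \<psi>: "\<psi> \<in> smooth_square" unfolding \<psi>_def[abs_def] by (rule smooth_square_affine[OF \<phi> pc])
  note wi = weak_form_integrable(1)[OF f v z \<psi>] and ri = weak_form_rhs_integrable[OF f v z \<psi>]
  obtain \<phi>t \<phi>x where \<phi>': "cont_square \<phi>" "cont_square \<phi>t"
    "\<And>t x. t \<in> {0..1} \<Longrightarrow> x \<in> {0..1} \<Longrightarrow> ((\<lambda>s. \<phi> s x) has_real_derivative \<phi>t t x) (at t within {0..1})"
    "\<And>t x. t \<in> {0<..<1} \<Longrightarrow> x \<in> {0<..<1} \<Longrightarrow> deriv (\<lambda>s. \<phi> s x) t = \<phi>t t x"
    by (rule smooth_square_derivs[OF \<phi>]) blast
  have mr: "m t \<in> {0<..<1}" if "t \<in> {0<..<1}" for t using measurable_space[OF mm, of t] that by auto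
  have d\<psi>: "deriv (\<lambda>s. \<psi> s x) u = c * \<phi>t (p + c * u) x" if u: "u \<in> {0<..<1}" and "p + c * u \<in> {0<..<1}" and x: "x \<in> {0<..<1}" for u x
  proof (rule DERIV_imp_deriv)
    have "((\<lambda>s. \<phi> s x) has_real_derivative \<phi>t (p + c * u) x) (at (p + c * u))"
      using \<phi>'(3)[of "p + c * u" x] that by (simp add: at_within_Icc_at)
    then have "((\<lambda>s. \<phi> s x) \<circ> (\<lambda>s. p + c * s) has_real_derivative \<phi>t (p + c * u) x * c) (at u)"
      by (rule DERIV_chain) (auto intro!: derivative_eq_intros)
    then show "((\<lambda>s. \<psi> s x) has_real_derivative c * \<phi>t (p + c * u) x) (at u)" by (simp add: o_def \<psi>_def mult.commute)
  qed
  have rc': "r * (c * i) = i" for i by (simp only: mult.assoc[symmetric] rc mult_1_left)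
  have T_eq: "AE t in I01. r * (indicator S t * weak_form_time (f (m t)) \<psi> (m t)) = T t"
    using mt AE_space[of I01]
  proof eventually_elim
    case (elim t)
    show ?case
    proof (cases "t \<in> S")
      case True
      then have t: "p + c * m t = t" using elim by simp
      have "weak_form_time (f (m t)) \<psi> (m t) = (\<integral>x. c * (f (m t) x * deriv (\<lambda>s. \<phi> s x) t) \<partial>I01)"
        unfolding weak_form_time_def
        using d\<psi>[of "m t"] mr[of t] \<phi>'(4)[of t] elim(2) t by (intro Bochner_Integration.integral_cong) auto
      also have "\<dots> = c * weak_form_time (f (m t)) \<phi> t" by (simp add: weak_form_time_def)
      finally show ?thesis by (simp add: T_def rc')
    qed (simp add: T_def)
  qed
  have R_eq: "AE t in I01. r * (indicator S t * weak_form_rhs (f (m t)) (v (m t)) (z (m t)) (\<psi> (m t))) = R t"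
    using mt P[OF bochner_L2_H2(1)[OF v]] P[OF L2_measurable_curve_AE_L2[OF bochner_L2_L2(1)[OF f]]] AE_space[of I01]
  proof eventually_elim
    case (elim t)
    show ?case
    proof (cases "t \<in> S")
      case True
      then have "\<psi> (m t) = \<phi> t" using elim by (simp add: \<psi>_def)
      moreover have "continuous_on {0..1} (\<phi> t)" using elim(4) by (intro cont_square_slice(1)[OF \<phi>'(1)]) auto
      ultimately show ?thesis using True elim by (simp add: R_def weak_form_rhs_scale)
    qed (simp add: R_def)
  qed
  have Ti: "integrable I01 (\<lambda>t. r * (indicator S t * weak_form_time (f (m t)) \<psi> (m t)))"
    using I[OF wi] by (intro integrable_mult_right) simp
  have Ri: "integrable I01 (\<lambda>t. r * (indicator S t * weak_form_rhs (f (m t)) (v (m t)) (z (m t)) (\<psi> (m t))))"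
    using I[OF ri] by (intro integrable_mult_right) simp
  have Tm: "T \<in> borel_measurable I01" by (rule borel_measurable_I01_AE[OF borel_measurable_integrable[OF Ti] T_eq])
  have Rm: "R \<in> borel_measurable I01" by (rule borel_measurable_I01_AE[OF borel_measurable_integrable[OF Ri] R_eq])
  show "integrable I01 T" using Ti integrable_cong_AE[OF borel_measurable_integrable[OF Ti] Tm T_eq] by simp
  show "integrable I01 R" using Ri integrable_cong_AE[OF borel_measurable_integrable[OF Ri] Rm R_eq] by simp
  have sg': "r * (\<bar>c\<bar> * i) = sgn c * i" for i
  proof -
    have "r * \<bar>c\<bar> = sgn c" using rc c by (cases "c > 0") (auto simp: sgn_if)
    then show ?thesis by (simp only: mult.assoc[symmetric])
  qed
  have "(\<integral>t. T t \<partial>I01) = r * (\<bar>c\<bar> * (\<integral>t. weak_form_time (f t) \<psi> t \<partial>I01))"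
    using integral_cong_AE[OF borel_measurable_integrable[OF Ti] Tm T_eq] conjunct2[OF I[OF wi]] by simp
  then have TI: "(\<integral>t. T t \<partial>I01) = sgn c * (\<integral>t. weak_form_time (f t) \<psi> t \<partial>I01)" using sg' by simp
  have "(\<integral>t. R t \<partial>I01) = r * (\<bar>c\<bar> * (\<integral>t. weak_form_rhs (f t) (v t) (z t) (\<psi> t) \<partial>I01))"
    using integral_cong_AE[OF borel_measurable_integrable[OF Ri] Rm R_eq] conjunct2[OF I[OF ri]] by simp
  then have RI: "(\<integral>t. R t \<partial>I01) = sgn c * (\<integral>t. weak_form_rhs (f t) (v t) (z t) (\<psi> t) \<partial>I01)" using sg' by simp
  have "- (\<integral>t. weak_form_time (f t) \<psi> t \<partial>I01) + (\<integral>x. b x * \<psi> 1 x \<partial>I01) - (\<integral>x. a x * \<psi> 0 x \<partial>I01)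
     = (\<integral>t. weak_form_rhs (f t) (v t) (z t) (\<psi> t) \<partial>I01)"
    using w \<psi> unfolding weak_solution_iff[OF f v z] by blast
  then have "sgn c * (- (\<integral>t. weak_form_time (f t) \<psi> t \<partial>I01) + (\<integral>x. b x * \<psi> 1 x \<partial>I01) - (\<integral>x. a x * \<psi> 0 x \<partial>I01))
     = sgn c * (\<integral>t. weak_form_rhs (f t) (v t) (z t) (\<psi> t) \<partial>I01)" by simp
  then show "- (\<integral>t. T t \<partial>I01) + sgn c * ((\<integral>x. b x * \<phi> (p + c) x \<partial>I01) - (\<integral>x. a x * \<phi> p x \<partial>I01)) = (\<integral>t. R t \<partial>I01)"
    unfolding TI RI by (simp add: \<psi>_def algebra_simps)
qed

definition HV_speed :: "real \<Rightarrow> real \<Rightarrow> real \<Rightarrow> (real \<Rightarrow> real) \<Rightarrow> (real \<Rightarrow> real) \<Rightarrow> real" where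
  "HV_speed \<kappa> l \<epsilon> v z = sqrt (1/2 * (\<integral>x. \<kappa> * (v x)\<^sup>2 + l * (wderiv v x)\<^sup>2 + \<epsilon> * (wderiv (wderiv v) x)\<^sup>2 + (z x)\<^sup>2 \<partial>I01))"

lemma HV_length_speed: "HV_length \<kappa> l \<epsilon> v z = (\<integral>t. HV_speed \<kappa> l \<epsilon> (v t) (z t) \<partial>I01)"
  by (simp add: HV_length_def HV_speed_def)

lemma HV_speed_scale:
  assumes v: "v \<in> H2" and z: "z \<in> L2"
  shows "HV_speed \<kappa> l \<epsilon> (\<lambda>x. k * v x) (\<lambda>x. k * z x) = \<bar>k\<bar> * HV_speed \<kappa> l \<epsilon> v z"
proof -
  note m1 = H2_L2[OF v, THEN L2_measurable] and m2 = H2_L2[OF H2_cmult(1)[OF v, of k], THEN L2_measurable] and m3 = L2_measurable[OF z]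
  have "(\<integral>x. \<kappa> * (k * v x)\<^sup>2 + l * (wderiv (\<lambda>x. k * v x) x)\<^sup>2 + \<epsilon> * (wderiv (wderiv (\<lambda>x. k * v x)) x)\<^sup>2 + (k * z x)\<^sup>2 \<partial>I01)
    = (\<integral>x. k\<^sup>2 * (\<kappa> * (v x)\<^sup>2 + l * (wderiv v x)\<^sup>2 + \<epsilon> * (wderiv (wderiv v) x)\<^sup>2 + (z x)\<^sup>2) \<partial>I01)"
  proof (rule integral_cong_AE)
    show "AE x in I01. \<kappa> * (k * v x)\<^sup>2 + l * (wderiv (\<lambda>x. k * v x) x)\<^sup>2 + \<epsilon> * (wderiv (wderiv (\<lambda>x. k * v x)) x)\<^sup>2 + (k * z x)\<^sup>2
       = k\<^sup>2 * (\<kappa> * (v x)\<^sup>2 + l * (wderiv v x)\<^sup>2 + \<epsilon> * (wderiv (wderiv v) x)\<^sup>2 + (z x)\<^sup>2)"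
      using H2_cmult(2,3)[OF v, of k] by eventually_elim (simp add: algebra_simps power_mult_distrib)
  qed (use m1 m2 m3 in measurable)
  moreover have "sqrt (1/2 * (k\<^sup>2 * i)) = \<bar>k\<bar> * sqrt (1/2 * i)" for i
  proof -
    have "1/2 * (k\<^sup>2 * i) = k\<^sup>2 * (1/2 * i)" by simp
    then show ?thesis by (simp only: real_sqrt_mult real_sqrt_abs)
  qed
  ultimately show ?thesis by (simp only: HV_speed_def integral_mult_right_zero)
qed

text \<open>The speed is homogeneous of degree one, so |r| cancels the |c| of the substitution: the
  length does not depend on the parametrisation.\<close>

lemma seg_length:
  assumes sg: "seg S m p c" and rc: "r * c = 1" and P: "(f, v, z) \<in> admissible a b" and k: "\<kappa> > 0" "l \<ge> 0" "\<epsilon> > 0"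
  defines "L \<equiv> \<lambda>t. indicator S t * HV_speed \<kappa> l \<epsilon> (\<lambda>x. r * v (m t) x) (\<lambda>x. r * z (m t) x)"
  shows "integrable I01 L" "(\<integral>t. L t \<partial>I01) = HV_length \<kappa> l \<epsilon> v z"
proof -
  have c: "c \<noteq> 0" 
    and I: "\<And>g :: real \<Rightarrow> real. integrable I01 g \<Longrightarrow> integrable I01 (\<lambda>t. indicator S t * g (m t)) \<and>
        (\<integral>t. indicator S t * g (m t) \<partial>I01) = \<bar>c\<bar> * (\<integral>t. g t \<partial>I01)"
    by (fact segD[OF sg])+
  have Q: "AE t in I01. t \<in> S \<longrightarrow> Q (m t)" if "AE t in I01. Q t" for Q
    by (rule reparam_AE[OF seg_reparam[OF sg] that])
  have i: "integrable I01 (\<lambda>t. HV_speed \<kappa> l \<epsilon> (v t) (z t))"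
    using HV_length_bounds(3)[OF P k] by (simp add: HV_speed_def)
  have rc': "\<bar>r\<bar> * (\<bar>c\<bar> * i) = i" for i by (simp only: mult.assoc[symmetric] abs_mult[symmetric] rc abs_one mult_1_left)
  have ae: "AE t in I01. \<bar>r\<bar> * (indicator S t * HV_speed \<kappa> l \<epsilon> (v (m t)) (z (m t))) = L t"
    using Q[OF bochner_L2_H2(1)[OF admissibleD(2)[OF P]]] Q[OF L2_measurable_curve_AE_L2[OF bochner_L2_L2(1)[OF admissibleD(3)[OF P]]]]
  proof eventually_elim
    case (elim t)
    then show ?case by (cases "t \<in> S") (simp_all add: L_def HV_speed_scale)
  qed
  have Li: "integrable I01 (\<lambda>t. \<bar>r\<bar> * (indicator S t * HV_speed \<kappa> l \<epsilon> (v (m t)) (z (m t))))"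
    by (intro integrable_mult_right conjunct1[OF I[OF i]])
  have Lm: "L \<in> borel_measurable I01" by (rule borel_measurable_I01_AE[OF borel_measurable_integrable[OF Li] ae])
  show "integrable I01 L" using Li integrable_cong_AE[OF borel_measurable_integrable[OF Li] Lm ae] by simp
  show "(\<integral>t. L t \<partial>I01) = HV_length \<kappa> l \<epsilon> v z"
    using integral_cong_AE[OF borel_measurable_integrable[OF Li] Lm ae] conjunct2[OF I[OF i]] rc' by (simp add: HV_length_speed)
qed

section \<open>Curves in the dual of H10\<close>

lemma zero_H10: "(\<lambda>_. 0) \<in> H10" "H1_norm (\<lambda>_. 0) = 0"
proof -
  show "(\<lambda>_. 0) \<in> H10" using zero_H2_H10 by simp
  show "H1_norm (\<lambda>_. 0) = 0" using H1_norm_cmult[OF zero_H1(1), of 0] by simp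
qed

text \<open>The zero function provides a nonnegative element of the set, which makes the supremum
  meaningful and nonnegative. The absolute value fits the comparison arguments for limits in which
  this is used.\<close>

lemma Hm1_norm_abs_le:
  assumes "\<And>g. g \<in> H10 \<Longrightarrow> H1_norm g \<le> 1 \<Longrightarrow> \<bar>F g\<bar> \<le> C"
  shows "\<bar>Hm1_norm F\<bar> \<le> C"
proof -
  let ?A = "{\<bar>F g\<bar> | g. g \<in> H10 \<and> H1_norm g \<le> 1}"
  have ne: "\<bar>F (\<lambda>_. 0)\<bar> \<in> ?A" using zero_H10 by force
  have ub: "\<And>y. y \<in> ?A \<Longrightarrow> y \<le> C" using assms by blast
  have "Sup ?A \<le> C" by (rule cSup_least) (use ne ub in blast)+
  moreover have "\<bar>F (\<lambda>_. 0)\<bar> \<le> Sup ?A" by (rule cSup_upper[OF ne]) (use ub in \<open>auto simp: bdd_above_def\<close>)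
  ultimately show ?thesis by (simp add: Hm1_norm_def)
qed

lemma Hm1_lin:
  assumes F: "F \<in> Hm1" and G: "G \<in> Hm1" shows "(\<lambda>g. a * F g + b * G g) \<in> Hm1"
proof -
  obtain C where C: "\<And>g. g \<in> H10 \<Longrightarrow> \<bar>F g\<bar> \<le> C * H1_norm g" using F unfolding Hm1_def by blast
  obtain D where D: "\<And>g. g \<in> H10 \<Longrightarrow> \<bar>G g\<bar> \<le> D * H1_norm g" using G unfolding Hm1_def by blast
  have "\<bar>a * F g + b * G g\<bar> \<le> (\<bar>a\<bar> * C + \<bar>b\<bar> * D) * H1_norm g" if g: "g \<in> H10" for g
  proof -
    have "\<bar>a * F g + b * G g\<bar> \<le> \<bar>a\<bar> * \<bar>F g\<bar> + \<bar>b\<bar> * \<bar>G g\<bar>"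
      using abs_triangle_ineq[of "a * F g" "b * G g"] by (simp add: abs_mult)
    also have "\<dots> \<le> \<bar>a\<bar> * (C * H1_norm g) + \<bar>b\<bar> * (D * H1_norm g)"
      by (intro add_mono mult_left_mono C D g) auto
    finally show ?thesis by (simp add: algebra_simps)
  qed
  moreover have "a * F (\<lambda>x. c * g x + d * h x) + b * G (\<lambda>x. c * g x + d * h x) = c * (a * F g + b * G g) + d * (a * F h + b * G h)"
    if "g \<in> H10" "h \<in> H10" for g h c d
    using F G that by (simp add: Hm1_def algebra_simps)
  ultimately show ?thesis unfolding Hm1_def by blast
qed

lemma Hm1_le_norm:
  assumes F: "F \<in> Hm1" and g: "g \<in> H10" "H1_norm g \<le> 1"
  shows "\<bar>F g\<bar> \<le> Hm1_norm F"
proof -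
  obtain C where C: "\<And>g. g \<in> H10 \<Longrightarrow> \<bar>F g\<bar> \<le> C * H1_norm g" using F unfolding Hm1_def by blast
  have "\<bar>F g\<bar> \<le> \<bar>C\<bar>" if "g \<in> H10" "H1_norm g \<le> 1" for g
  proof -
    have "0 \<le> H1_norm g" by (simp add: H1_norm_def)
    then have "C * H1_norm g \<le> \<bar>C\<bar> * 1" using that(2) by (intro mult_mono) auto
    then show ?thesis using C[OF that(1)] by simp
  qed
  then show ?thesis unfolding Hm1_norm_def
    by (intro cSup_upper) (use g in \<open>auto simp: bdd_above_def\<close>)
qed

text \<open>The concatenation of two curves will be a linear combination of reparametrised ones, so
  that linearity and composition replace an argument at the junction.\<close>

lemma continuous_Hm1_lin:
  assumes F: "continuous_Hm1 F" and G: "continuous_Hm1 G"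
  shows "continuous_Hm1 (\<lambda>t g. a * F t g + b * G t g)"
  unfolding continuous_Hm1_def
proof (intro ballI conjI)
  fix t :: real assume t: "t \<in> {0..1}"
  have Fm: "F s \<in> Hm1" and Gm: "G s \<in> Hm1" if "s \<in> {0..1}" for s using F G that by (auto simp: continuous_Hm1_def)
  show "(\<lambda>g. a * F t g + b * G t g) \<in> Hm1" by (rule Hm1_lin[OF Fm[OF t] Gm[OF t]])
  have FL: "((\<lambda>s. Hm1_norm (\<lambda>g. F s g - F t g)) \<longlongrightarrow> 0) (at t within {0..1})"
    and GL: "((\<lambda>s. Hm1_norm (\<lambda>g. G s g - G t g)) \<longlongrightarrow> 0) (at t within {0..1})"
    using F G t by (auto simp: continuous_Hm1_def)
  have le: "\<bar>Hm1_norm (\<lambda>g. a * F s g + b * G s g - (a * F t g + b * G t g))\<bar>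
      \<le> \<bar>a\<bar> * Hm1_norm (\<lambda>g. F s g - F t g) + \<bar>b\<bar> * Hm1_norm (\<lambda>g. G s g - G t g)" if s: "s \<in> {0..1}" for s
  proof (rule Hm1_norm_abs_le)
    fix g assume g: "g \<in> H10" "H1_norm g \<le> 1"
    have d: "(\<lambda>g. F s g - F t g) \<in> Hm1" "(\<lambda>g. G s g - G t g) \<in> Hm1"
      using Hm1_lin[OF Fm[OF s] Fm[OF t], of 1 "-1"] Hm1_lin[OF Gm[OF s] Gm[OF t], of 1 "-1"] by simp_all
    have "a * F s g + b * G s g - (a * F t g + b * G t g) = a * (F s g - F t g) + b * (G s g - G t g)"
      by (simp add: algebra_simps)
    also have "\<bar>\<dots>\<bar> \<le> \<bar>a\<bar> * \<bar>F s g - F t g\<bar> + \<bar>b\<bar> * \<bar>G s g - G t g\<bar>"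
      using abs_triangle_ineq[of "a * (F s g - F t g)" "b * (G s g - G t g)"] by (simp add: abs_mult)
    also have "\<dots> \<le> \<bar>a\<bar> * Hm1_norm (\<lambda>g. F s g - F t g) + \<bar>b\<bar> * Hm1_norm (\<lambda>g. G s g - G t g)"
      using Hm1_le_norm[OF d(1) g] Hm1_le_norm[OF d(2) g] by (intro add_mono mult_left_mono) auto
    finally show "\<bar>a * F s g + b * G s g - (a * F t g + b * G t g)\<bar> \<le> \<bar>a\<bar> * Hm1_norm (\<lambda>g. F s g - F t g) + \<bar>b\<bar> * Hm1_norm (\<lambda>g. G s g - G t g)" .
  qed
  have "((\<lambda>s. \<bar>a\<bar> * Hm1_norm (\<lambda>g. F s g - F t g) + \<bar>b\<bar> * Hm1_norm (\<lambda>g. G s g - G t g)) \<longlongrightarrow> \<bar>a\<bar> * 0 + \<bar>b\<bar> * 0) (at t within {0..1})"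
    by (rule tendsto_add[OF tendsto_mult[OF tendsto_const FL] tendsto_mult[OF tendsto_const GL]])
  then have "((\<lambda>s. \<bar>a\<bar> * Hm1_norm (\<lambda>g. F s g - F t g) + \<bar>b\<bar> * Hm1_norm (\<lambda>g. G s g - G t g)) \<longlongrightarrow> 0) (at t within {0..1})" by simp
  then show "((\<lambda>s. Hm1_norm (\<lambda>g. a * F s g + b * G s g - (a * F t g + b * G t g))) \<longlongrightarrow> 0) (at t within {0..1})"
    by (rule Lim_null_comparison[rotated]) (use le in \<open>simp add: eventually_at_filter\<close>)
qed

lemma continuous_Hm1_compose:
  assumes F: "continuous_Hm1 F" and a: "continuous_on {0..1} a" and a01: "\<And>t. t \<in> {0..1} \<Longrightarrow> a t \<in> {0..1}"
  shows "continuous_Hm1 (\<lambda>t. F (a t))"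
  unfolding continuous_Hm1_def
proof (intro ballI conjI)
  fix t :: real assume t: "t \<in> {0..1}"
  show "F (a t) \<in> Hm1" using F a01[OF t] by (simp add: continuous_Hm1_def)
  define h where "h s = Hm1_norm (\<lambda>g. F s g - F (a t) g)" for s
  have "Hm1_norm (\<lambda>g. 0) = 0" using Hm1_norm_abs_le[of "\<lambda>_. 0" 0] by simp
  then have h0: "h (a t) = 0" by (simp add: h_def)
  have "continuous (at (a t) within {0..1}) h"
    using F a01[OF t] unfolding continuous_within h0 unfolding h_def continuous_Hm1_def by blast
  then have "continuous (at (a t) within a ` {0..1}) h"
    by (rule continuous_within_subset) (use a01 in blast)
  moreover have "continuous (at t within {0..1}) a" using a t by (simp add: continuous_on_eq_continuous_within)
  ultimately have "continuous (at t within {0..1}) (h \<circ> a)" by (intro continuous_within_compose)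
  then show "((\<lambda>s. Hm1_norm (\<lambda>g. F (a s) g - F (a t) g)) \<longlongrightarrow> 0) (at t within {0..1})"
    by (simp add: continuous_within o_def h0) (simp add: h_def)
qed

lemma admissibleI:
  assumes "f \<in> bochner_L2 L2 L2_norm" "v \<in> bochner_L2 (H2 \<inter> H10) H2_norm" "z \<in> bochner_L2 L2 L2_norm"
    "continuous_Hm1 F" "AE t in I01. represents_Hm1 (F t) (f t)" "represents_Hm1 (F 0) f0" "represents_Hm1 (F 1) f1"
    "weak_solution f0 f1 f v z"
  shows "(f, v, z) \<in> admissible f0 f1"
  using assms by (auto simp: admissible_def)

section \<open>Reversed and concatenated admissible paths\<close>

lemma admissible_reverse:
  assumes P: "(f, v, z) \<in> admissible a b" and k: "\<kappa> > 0" "l \<ge> 0" "\<epsilon> > 0"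
  obtains f' v' z' where "(f', v', z') \<in> admissible b a" "HV_length \<kappa> l \<epsilon> v' z' = HV_length \<kappa> l \<epsilon> v z"
proof -
  \<comment> \<open>Reversal is a single segment with p = 1 and c = -1, so the second piece of each
    gluing below is empty.\<close>
  obtain m where sg: "seg UNIV m 1 (-1)"
    using seg_affine[of UNIV "-1" 1] AE_space[of I01] by (auto elim!: eventually_mono)
  note r = seg_reparam[OF sg] and e = reparam_empty
  have e': "reparam (- UNIV) (\<lambda>_. 1/2)" using e by simp
  define f' where "f' = glue UNIV m (\<lambda>_. 1/2) 1 1 f f"
  define v' where "v' = glue UNIV m (\<lambda>_. 1/2) (-1) (-1) v v"
  define z' where "z' = glue UNIV m (\<lambda>_. 1/2) (-1) (-1) z z"
  note D = admissibleD[OF P]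
  have B: "f' \<in> bochner_L2 L2 L2_norm" "v' \<in> bochner_L2 (H2 \<inter> H10) H2_norm" "z' \<in> bochner_L2 L2 L2_norm"
    unfolding f'_def v'_def z'_def by (intro bochner_glue_L2 bochner_glue_H2 r e' D)+
  have eq: "f' t = f (m t)" "v' t = (\<lambda>x. -1 * v (m t) x)" "z' t = (\<lambda>x. -1 * z (m t) x)" for t
    by (simp_all add: f'_def v'_def z'_def glue_def fun_eq_iff)
  obtain F where F: "continuous_Hm1 F" "AE t in I01. represents_Hm1 (F t) (f t)" "represents_Hm1 (F 0) a" "represents_Hm1 (F 1) b"
    using P by (auto simp: admissible_def)
  have "(f', v', z') \<in> admissible b a"
  proof (rule admissibleI[OF B])
    show "continuous_Hm1 (\<lambda>t. F (1 - t))" by (rule continuous_Hm1_compose[OF F(1)]) (auto intro!: continuous_intros)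
    show "represents_Hm1 (F (1 - 0)) b" "represents_Hm1 (F (1 - 1)) a" using F by simp_all
    show "AE t in I01. represents_Hm1 (F (1 - t)) (f' t)"
      using reparam_AE[OF r F(2)] segD(5)[OF sg] unfolding eq
    proof eventually_elim
      case (elim t)
      have "1 - t = m t" using elim(2) by simp
      then show ?case using elim(1) by simp
    qed
    show "weak_solution b a f' v' z'"
      unfolding weak_solution_iff[OF B]
    proof
      fix \<phi> assume \<phi>: "\<phi> \<in> smooth_square"
      show "- (\<integral>t. weak_form_time (f' t) \<phi> t \<partial>I01) + (\<integral>x. a x * \<phi> 1 x \<partial>I01) - (\<integral>x. b x * \<phi> 0 x \<partial>I01)
        = (\<integral>t. weak_form_rhs (f' t) (v' t) (z' t) (\<phi> t) \<partial>I01)"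
        unfolding eq using seg_weak(3)[OF sg _ D \<phi>, of "-1"] by simp
    qed
  qed
  moreover have "HV_length \<kappa> l \<epsilon> v' z' = HV_length \<kappa> l \<epsilon> v z"
    using seg_length(2)[OF sg _ P k, of "-1"] unfolding HV_length_speed[of _ _ _ v' z'] eq by simp
  ultimately show ?thesis by (rule that)
qed

lemma admissible_concat:
  assumes P1: "(f1, v1, z1) \<in> admissible a b" and P2: "(f2, v2, z2) \<in> admissible b d" and k: "\<kappa> > 0" "l \<ge> 0" "\<epsilon> > 0"
  obtains f v z where "(f, v, z) \<in> admissible a d" "HV_length \<kappa> l \<epsilon> v z = HV_length \<kappa> l \<epsilon> v1 z1 + HV_length \<kappa> l \<epsilon> v2 z2"
proof -
  define S where "S = {..<1/2::real}"
  have "AE t in I01. t \<in> S \<longleftrightarrow> - (0 / (1/2)) + (1 / (1/2)) * t \<in> {0<..<1}"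
    using AE_space[of I01] by eventually_elim (auto simp: S_def)
  then obtain m1 where s1: "seg S m1 0 (1/2)"
    using seg_affine[of S "1/2" 0] by (auto simp: S_def)
  \<comment> \<open>At t = 1/2, which belongs to \<open>- S\<close>, the affine map takes the value
    0, which the open interval omits.\<close>
  have "AE t in I01. t \<in> - S \<longleftrightarrow> - ((1/2) / (1/2)) + (1 / (1/2)) * t \<in> {0<..<1}"
    using AE_I01_neq[of "1/2"] AE_space[of I01] by eventually_elim (auto simp: S_def)
  then obtain m2 where s2: "seg (- S) m2 (1/2) (1/2)"
    using seg_affine[of "- S" "1/2" "1/2"] by (auto simp: S_def)
  note r1 = seg_reparam[OF s1] and r2 = seg_reparam[OF s2]
  define f where "f = glue S m1 m2 1 1 f1 f2"
  define v where "v = glue S m1 m2 2 2 v1 v2"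
  define z where "z = glue S m1 m2 2 2 z1 z2"
  note D1 = admissibleD[OF P1] and D2 = admissibleD[OF P2]
  have B: "f \<in> bochner_L2 L2 L2_norm" "v \<in> bochner_L2 (H2 \<inter> H10) H2_norm" "z \<in> bochner_L2 L2 L2_norm"
    unfolding f_def v_def z_def by (intro bochner_glue_L2 bochner_glue_H2 r1 r2 D1 D2)+
  have eq1: "f t = f1 (m1 t)" "v t = (\<lambda>x. 2 * v1 (m1 t) x)" "z t = (\<lambda>x. 2 * z1 (m1 t) x)" if "t \<in> S" for t
    using that by (simp_all add: f_def v_def z_def glue_def fun_eq_iff)
  have eq2: "f t = f2 (m2 t)" "v t = (\<lambda>x. 2 * v2 (m2 t) x)" "z t = (\<lambda>x. 2 * z2 (m2 t) x)" if "t \<notin> S" for t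
    using that by (simp_all add: f_def v_def z_def glue_def fun_eq_iff)
  obtain F where F: "continuous_Hm1 F" "AE t in I01. represents_Hm1 (F t) (f1 t)" "represents_Hm1 (F 0) a" "represents_Hm1 (F 1) b"
    using P1 by (auto simp: admissible_def)
  obtain G where G: "continuous_Hm1 G" "AE t in I01. represents_Hm1 (G t) (f2 t)" "represents_Hm1 (G 0) b" "represents_Hm1 (G 1) d"
    using P2 by (auto simp: admissible_def)
  \<comment> \<open>On the first half the two G terms cancel. On the second half F rests at
    \<open>F 1\<close>, which represents b like \<open>G 0\<close> and therefore cancels it on
    \<open>H10\<close>.\<close>
  define H where "H t g = 1 * (1 * F (min 1 (2 * t)) g + 1 * G (max 0 (2 * t - 1)) g) + (-1) * G 0 g" for t g
  have FG: "F 1 g = G 0 g" if "g \<in> H10" for g using F(4) G(3) that by (simp add: represents_Hm1_def)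
  have "(f, v, z) \<in> admissible a d"
  proof (rule admissibleI[OF B])
    have "continuous_Hm1 (\<lambda>t. F (min 1 (2 * t)))" by (rule continuous_Hm1_compose[OF F(1)]) (auto intro!: continuous_intros)
    moreover have "continuous_Hm1 (\<lambda>t. G (max 0 (2 * t - 1)))" by (rule continuous_Hm1_compose[OF G(1)]) (auto intro!: continuous_intros)
    moreover have "continuous_Hm1 (\<lambda>t. G 0)" by (rule continuous_Hm1_compose[OF G(1)]) (auto intro!: continuous_intros)
    ultimately show "continuous_Hm1 H" unfolding H_def[abs_def] by (intro continuous_Hm1_lin)
    show "represents_Hm1 (H 0) a" using F(3) by (simp add: represents_Hm1_def H_def)
    show "represents_Hm1 (H 1) d" using G(4) FG by (simp add: represents_Hm1_def H_def)
    show "AE t in I01. represents_Hm1 (H t) (f t)"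
      using reparam_AE[OF r1 F(2)] segD(5)[OF s1] reparam_AE[OF r2 G(2)] segD(5)[OF s2]
    proof eventually_elim
      case (elim t)
      show ?case
      proof (cases "t \<in> S")
        case True
        then have "m1 t = 2 * t" using elim(2) by simp
        then have "H t g = F (m1 t) g" for g using True by (simp add: H_def S_def)
        then show ?thesis using elim(1) True by (simp add: eq1 represents_Hm1_def)
      next
        case False
        then have "t = 1/2 + 1/2 * m2 t" using elim(4) by simp
        then have "m2 t = 2 * t - 1" by simp
        then have "H t g = G (m2 t) g" if "g \<in> H10" for g using False FG[OF that] by (simp add: H_def S_def)
        then show ?thesis using elim(3) False by (simp add: eq2 represents_Hm1_def)
      qed
    qed
    show "weak_solution a d f v z"
      unfolding weak_solution_iff[OF B]
    proof
      fix \<phi> assume \<phi>: "\<phi> \<in> smooth_square"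
      \<comment> \<open>Each half satisfies its equation at double rate; in the sum the two terms
        with b at time 1/2 cancel.\<close>
      note w1 = seg_weak[OF s1 _ D1 \<phi>, of 2] and w2 = seg_weak[OF s2 _ D2 \<phi>, of 2]
      have T: "weak_form_time (f t) \<phi> t = indicator S t * weak_form_time (f1 (m1 t)) \<phi> t + indicator (- S) t * weak_form_time (f2 (m2 t)) \<phi> t" for t
        by (cases "t \<in> S") (simp_all add: eq1 eq2)
      have R: "weak_form_rhs (f t) (v t) (z t) (\<phi> t) =
         indicator S t * weak_form_rhs (f1 (m1 t)) (\<lambda>x. 2 * v1 (m1 t) x) (\<lambda>x. 2 * z1 (m1 t) x) (\<phi> t) +
         indicator (- S) t * weak_form_rhs (f2 (m2 t)) (\<lambda>x. 2 * v2 (m2 t) x) (\<lambda>x. 2 * z2 (m2 t) x) (\<phi> t)" for t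
        by (cases "t \<in> S") (simp_all add: eq1 eq2)
      show "- (\<integral>t. weak_form_time (f t) \<phi> t \<partial>I01) + (\<integral>x. d x * \<phi> 1 x \<partial>I01) - (\<integral>x. a x * \<phi> 0 x \<partial>I01)
        = (\<integral>t. weak_form_rhs (f t) (v t) (z t) (\<phi> t) \<partial>I01)"
        unfolding T R using w1 w2 by simp
    qed
  qed
  moreover have "HV_length \<kappa> l \<epsilon> v z = HV_length \<kappa> l \<epsilon> v1 z1 + HV_length \<kappa> l \<epsilon> v2 z2"
  proof -
    note l1 = seg_length[OF s1 _ P1 k, of 2] and l2 = seg_length[OF s2 _ P2 k, of 2]
    have L: "HV_speed \<kappa> l \<epsilon> (v t) (z t) = indicator S t * HV_speed \<kappa> l \<epsilon> (\<lambda>x. 2 * v1 (m1 t) x) (\<lambda>x. 2 * z1 (m1 t) x) +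
        indicator (- S) t * HV_speed \<kappa> l \<epsilon> (\<lambda>x. 2 * v2 (m2 t) x) (\<lambda>x. 2 * z2 (m2 t) x)" for t
      by (cases "t \<in> S") (simp_all add: eq1 eq2)
    show ?thesis unfolding HV_length_speed[of _ _ _ v z] L using l1 l2 by simp
  qed
  ultimately show ?thesis by (rule that)
qed

section \<open>The distance\<close>

lemma HV_speed_zero:
  assumes z: "z \<in> L2" shows "HV_speed \<kappa> l \<epsilon> (\<lambda>_. 0) z = L2_norm z / sqrt 2"
proof -
  have H: "(\<lambda>_. 0) \<in> H2" using zero_H2_H10 by simp
  note m1 = H2_L2[OF H, THEN L2_measurable] and m3 = L2_measurable[OF z]
  have "(\<integral>x. \<kappa> * 0\<^sup>2 + l * (wderiv (\<lambda>_. 0) x)\<^sup>2 + \<epsilon> * (wderiv (wderiv (\<lambda>_. 0)) x)\<^sup>2 + (z x)\<^sup>2 \<partial>I01) = (\<integral>x. (z x)\<^sup>2 \<partial>I01)"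
  proof (rule integral_cong_AE)
    show "AE x in I01. \<kappa> * 0\<^sup>2 + l * (wderiv (\<lambda>_. 0) x)\<^sup>2 + \<epsilon> * (wderiv (wderiv (\<lambda>_. 0)) x)\<^sup>2 + (z x)\<^sup>2 = (z x)\<^sup>2"
      using H2_cmult(2,3)[OF H, of 0] by (simp, eventually_elim) simp
  qed (use m1 m3 in measurable)
  then show ?thesis by (simp add: HV_speed_def L2_norm_def real_sqrt_divide)
qed

section \<open>The straight path between two functions\<close>

lemma spatial_integral_DERIV:
  assumes g: "g \<in> L2" and \<phi>: "cont_square \<phi>" "cont_square \<phi>t"
    and d: "\<And>t x. t \<in> {0..1} \<Longrightarrow> x \<in> {0..1} \<Longrightarrow> ((\<lambda>s. \<phi> s x) has_real_derivative \<phi>t t x) (at t within {0..1})"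
    and t: "t \<in> {0..1}"
  shows "((\<lambda>t. \<integral>x. g x * \<phi> t x \<partial>I01) has_real_derivative (\<integral>x. g x * \<phi>t t x \<partial>I01)) (at t within {0..1})"
proof -
  obtain B where B: "0 \<le> B" "\<And>t x. t \<in> {0..1} \<Longrightarrow> x \<in> {0..1} \<Longrightarrow> \<bar>\<phi>t t x\<bar> \<le> B" by (rule cont_square_bound[OF \<phi>(2)]) blast
  have i: "integrable I01 (\<lambda>x. g x * \<phi> s x)" if "s \<in> {0..1}" for s
    by (intro L2_mult_integrable g L2_continuous cont_square_slice(1)[OF \<phi>(1) that])
  have it: "integrable I01 (\<lambda>x. g x * \<phi>t t x)"
    by (intro L2_mult_integrable g L2_continuous cont_square_slice(1)[OF \<phi>(2) t])
  \<comment> \<open>The Lipschitz bound in time dominates the difference quotients.\<close>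
  have lip: "\<bar>\<phi> s x - \<phi> t x\<bar> \<le> B * \<bar>s - t\<bar>" if "s \<in> {0..1}" "x \<in> {0..1}" for s x
    using field_differentiable_bound[of "{0..1}" "\<lambda>s. \<phi> s x" "\<lambda>s. \<phi>t s x" B s t] d B that t by auto
  show ?thesis
    unfolding has_field_derivative_iff tendsto_at_iff_sequentially
  proof (intro allI impI)
    fix X :: "nat \<Rightarrow> real" assume X: "\<forall>i. X i \<in> {0..1} - {t}" "X \<longlonglongrightarrow> t"
    have Xi: "X i \<in> {0..1}" "X i \<noteq> t" for i using X(1) by auto
    have q: "((\<integral>x. g x * \<phi> (X i) x \<partial>I01) - (\<integral>x. g x * \<phi> t x \<partial>I01)) / (X i - t) = (\<integral>x. g x * ((\<phi> (X i) x - \<phi> t x) / (X i - t)) \<partial>I01)" for i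
    proof -
      have "((\<integral>x. g x * \<phi> (X i) x \<partial>I01) - (\<integral>x. g x * \<phi> t x \<partial>I01)) / (X i - t) = (\<integral>x. (g x * \<phi> (X i) x - g x * \<phi> t x) / (X i - t) \<partial>I01)"
        using i[OF Xi(1)] i[OF t] by simp
      then show ?thesis by (simp add: right_diff_distrib)
    qed
    have "(\<lambda>i. \<integral>x. g x * ((\<phi> (X i) x - \<phi> t x) / (X i - t)) \<partial>I01) \<longlonglongrightarrow> (\<integral>x. g x * \<phi>t t x \<partial>I01)"
    proof (rule integral_dominated_convergence[where w="\<lambda>x. \<bar>g x\<bar> * B"])
      show "(\<lambda>x. g x * \<phi>t t x) \<in> borel_measurable I01" using it by simp
      show "(\<lambda>x. g x * ((\<phi> (X i) x - \<phi> t x) / (X i - t))) \<in> borel_measurable I01" for i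
        using L2_measurable[OF g] L2_measurable[OF L2_continuous[OF cont_square_slice(1)[OF \<phi>(1) t]]]
          L2_measurable[OF L2_continuous[OF cont_square_slice(1)[OF \<phi>(1) Xi(1)]], of i] by (intro borel_measurable_times borel_measurable_divide borel_measurable_diff) auto
      show "integrable I01 (\<lambda>x. \<bar>g x\<bar> * B)" using L2_integrable[OF g] by simp
      show "AE x in I01. (\<lambda>i. g x * ((\<phi> (X i) x - \<phi> t x) / (X i - t))) \<longlonglongrightarrow> g x * \<phi>t t x"
      proof (rule AE_I2)
        fix x :: real assume "x \<in> space I01"
        then have x: "x \<in> {0..1}" by auto
        have "(\<lambda>i. (\<phi> (X i) x - \<phi> t x) / (X i - t)) \<longlonglongrightarrow> \<phi>t t x"
          using d[OF t x] X unfolding has_field_derivative_iff tendsto_at_iff_sequentially o_def by blast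
        then show "(\<lambda>i. g x * ((\<phi> (X i) x - \<phi> t x) / (X i - t))) \<longlonglongrightarrow> g x * \<phi>t t x" by (rule tendsto_mult_left)
      qed
      show "AE x in I01. norm (g x * ((\<phi> (X i) x - \<phi> t x) / (X i - t))) \<le> \<bar>g x\<bar> * B" for i
      proof (rule AE_I2)
        fix x :: real assume "x \<in> space I01"
        then have "\<bar>\<phi> (X i) x - \<phi> t x\<bar> / \<bar>X i - t\<bar> \<le> B"
          using lip[OF Xi(1), of x i] Xi(2)[of i] by (simp add: divide_le_eq)
        from mult_left_mono[OF this, of "\<bar>g x\<bar>"]
        show "norm (g x * ((\<phi> (X i) x - \<phi> t x) / (X i - t))) \<le> \<bar>g x\<bar> * B"
          by (simp add: abs_mult)
      qed
    qed
    then show "((\<lambda>y. ((\<integral>x. g x * \<phi> y x \<partial>I01) - (\<integral>x. g x * \<phi> t x \<partial>I01)) / (y - t)) \<circ> X) \<longlonglongrightarrow> (\<integral>x. g x * \<phi>t t x \<partial>I01)"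
      by (simp add: o_def q)
  qed
qed

lemma spatial_integral_continuous:
  assumes g: "g \<in> L2" and \<phi>: "cont_square \<phi>"
  shows "continuous_on {0..1} (\<lambda>t. \<integral>x. g x * \<phi> t x \<partial>I01)"
  unfolding continuous_on_sequentially
proof (intro allI ballI impI)
  fix X t assume t: "t \<in> {0..1}" and X: "(\<forall>n. X n \<in> {0..1}) \<and> X \<longlonglongrightarrow> (t::real)"
  obtain B where B: "0 \<le> B" "\<And>t x. t \<in> {0..1} \<Longrightarrow> x \<in> {0..1} \<Longrightarrow> \<bar>\<phi> t x\<bar> \<le> B" by (rule cont_square_bound[OF \<phi>]) blast
  have i: "integrable I01 (\<lambda>x. g x * \<phi> s x)" if "s \<in> {0..1}" for s
    by (intro L2_mult_integrable g L2_continuous cont_square_slice(1)[OF \<phi> that])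
  show "((\<lambda>t. \<integral>x. g x * \<phi> t x \<partial>I01) \<circ> X) \<longlonglongrightarrow> (\<integral>x. g x * \<phi> t x \<partial>I01)"
    unfolding o_def
  proof (rule integral_dominated_convergence[where w="\<lambda>x. \<bar>g x\<bar> * B"])
    show "(\<lambda>x. g x * \<phi> t x) \<in> borel_measurable I01" using i[OF t] by simp
    show "(\<lambda>x. g x * \<phi> (X n) x) \<in> borel_measurable I01" for n using i[of "X n"] X by simp
    show "integrable I01 (\<lambda>x. \<bar>g x\<bar> * B)" using L2_integrable[OF g] by simp
    show "AE x in I01. (\<lambda>n. g x * \<phi> (X n) x) \<longlonglongrightarrow> g x * \<phi> t x"
    proof (rule AE_I2)
      fix x :: real assume "x \<in> space I01"
      then have "(\<lambda>n. \<phi> (X n) x) \<longlonglongrightarrow> \<phi> t x"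
        using cont_square_slice(2)[OF \<phi>, of x] X t unfolding continuous_on_sequentially o_def by auto
      then show "(\<lambda>n. g x * \<phi> (X n) x) \<longlonglongrightarrow> g x * \<phi> t x" by (rule tendsto_mult_left)
    qed
    show "AE x in I01. norm (g x * \<phi> (X n) x) \<le> \<bar>g x\<bar> * B" for n
      using B(2)[of "X n"] X by (intro AE_I2) (auto simp: abs_mult intro!: mult_left_mono)
  qed
qed

lemma bochner_L2_linear:
  assumes f0: "f0 \<in> L2" and g: "g \<in> L2"
  shows "(\<lambda>t x. f0 x + t * g x) \<in> bochner_L2 L2 L2_norm"
proof -
  have L: "(\<lambda>x. f0 x + t * g x) \<in> L2" for t by (intro L2_add L2_cmult f0 g)
  \<comment> \<open>Simple functions that approximate t; inserted into the formula of the path they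
    give simple curves.\<close>
  obtain \<tau> where \<tau>: "\<And>i. simple_function I01 (\<tau> i)" "\<And>t. t \<in> space I01 \<Longrightarrow> (\<lambda>i. \<tau> i t) \<longlonglongrightarrow> (t::real)"
    using borel_measurable_implies_sequence_metric[OF borel_measurable_I01_id, of 0] by metis
  have "simple_function I01 (\<lambda>t x. f0 x + \<tau> n t * g x)" for n
    using simple_function_compose[OF \<tau>(1)[of n], of "\<lambda>r x. f0 x + r * g x"] by (simp add: o_def)
  moreover have "AE t in I01. (\<lambda>n. L2_norm (\<lambda>x. (f0 x + \<tau> n t * g x) - (f0 x + t * g x))) \<longlonglongrightarrow> 0"
  proof (rule AE_I2)
    fix t :: real assume "t \<in> space I01"
    from \<tau>(2)[OF this] have "(\<lambda>n. \<bar>\<tau> n t - t\<bar> * L2_norm g) \<longlonglongrightarrow> \<bar>t - t\<bar> * L2_norm g"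
      by (intro tendsto_intros)
    then show "(\<lambda>n. L2_norm (\<lambda>x. (f0 x + \<tau> n t * g x) - (f0 x + t * g x))) \<longlonglongrightarrow> 0"
      by (simp flip: left_diff_distrib)
  qed
  ultimately have b: "L2_measurable_curve (\<lambda>t x. f0 x + t * g x)"
    unfolding L2_measurable_curve_def bochner_measurable_def using L by (intro conjI exI[of _ "\<lambda>n t x. f0 x + \<tau> n t * g x"]) auto
  have "integrable I01 (\<lambda>t. (L2_norm (\<lambda>x. f0 x + t * g x))\<^sup>2)"
  proof (rule integrable_bounded_I01)
    show "(\<lambda>t. (L2_norm (\<lambda>x. f0 x + t * g x))\<^sup>2) \<in> borel_measurable I01"
      using L2_measurable_curve_norm_measurable[OF b] by measurable
    fix t :: real assume t: "t \<in> {0<..<1}"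
    have "L2_norm (\<lambda>x. f0 x + t * g x) \<le> L2_norm f0 + L2_norm (\<lambda>x. t * g x)" by (intro L2_norm_triangle L2_cmult f0 g)
    also have "\<dots> \<le> L2_norm f0 + L2_norm g" using t by (simp add: mult_left_le_one_le)
    finally show "\<bar>(L2_norm (\<lambda>x. f0 x + t * g x))\<^sup>2\<bar> \<le> (L2_norm f0 + L2_norm g)\<^sup>2"
      by (simp add: power_mono)
  qed
  then show ?thesis using b by (simp add: bochner_L2_def L2_measurable_curve_def)
qed

lemma bochner_L2_const:
  assumes "a \<in> X" "N (\<lambda>x. 0) = 0" shows "(\<lambda>t. a) \<in> bochner_L2 X N"
  using assms by (auto simp: bochner_L2_def bochner_measurable_def intro!: exI[of _ "\<lambda>_ _. a"])

text \<open>Serves twice: the infimum in the distance is taken over a nonempty set, and the length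
  of this path compares the distance with the L2 norm.\<close>

lemma linear_path:
  assumes f0: "f0 \<in> L2" and f1: "f1 \<in> L2"
  shows "(\<lambda>t x. f0 x + t * (f1 x - f0 x), \<lambda>t x. 0, \<lambda>t x. f1 x - f0 x) \<in> admissible f0 f1"
proof -
  define g where "g x = f1 x - f0 x" for x
  have g: "g \<in> L2" unfolding g_def[abs_def] by (intro L2_diff f0 f1)
  have z: "H2_norm (\<lambda>_. 0) = 0" using H2_norm_cmult[of "\<lambda>_. 0" 0] zero_H2_H10 by simp
  have B: "(\<lambda>t x. f0 x + t * g x) \<in> bochner_L2 L2 L2_norm" "(\<lambda>t x. 0) \<in> bochner_L2 (H2 \<inter> H10) H2_norm" "(\<lambda>t. g) \<in> bochner_L2 L2 L2_norm"
    by (intro bochner_L2_linear f0 g bochner_L2_const zero_H2_H10 z; simp)+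
  define F where "F t h = (\<integral>x. (f0 x + t * g x) * h x \<partial>I01)" for t and h :: "real \<Rightarrow> real"
  have HL: "h \<in> L2" if "h \<in> H10" for h using that wderiv_H1(1) by (simp add: H10_def)
  have fL: "(\<lambda>x. f0 x + t * g x) \<in> L2" for t by (intro L2_add L2_cmult f0 g)
  have Fm: "F t \<in> Hm1" for t
    unfolding Hm1_def mem_Collect_eq
  proof (intro conjI ballI allI exI)
    fix h k a b assume "h \<in> H10" "k \<in> H10"
    then have i: "integrable I01 (\<lambda>x. (f0 x + t * g x) * h x)" "integrable I01 (\<lambda>x. (f0 x + t * g x) * k x)"
      using L2_mult_integrable[OF fL HL] by simp_all
    have "F t (\<lambda>x. a * h x + b * k x) = (\<integral>x. a * ((f0 x + t * g x) * h x) + b * ((f0 x + t * g x) * k x) \<partial>I01)"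
      unfolding F_def by (rule arg_cong[where f="integral\<^sup>L I01"], rule ext) (simp add: algebra_simps)
    also have "\<dots> = a * F t h + b * F t k"
      unfolding F_def using i by (simp only: Bochner_Integration.integral_add[OF integrable_mult_right integrable_mult_right] integral_mult_right_zero)
    finally show "F t (\<lambda>x. a * h x + b * k x) = a * F t h + b * F t k" .
  next
    fix h assume h: "h \<in> H10"
    show "\<bar>F t h\<bar> \<le> L2_norm (\<lambda>x. f0 x + t * g x) * H1_norm h"
      unfolding F_def
      by (rule order_trans[OF L2_Cauchy_Schwarz[OF fL HL[OF h]] mult_left_mono[OF H1_norm_ge(1) L2_norm_nonneg]])
  qed
  have Fd: "\<bar>Hm1_norm (\<lambda>h. F s h - F t h)\<bar> \<le> \<bar>s - t\<bar> * L2_norm g" for s t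
  proof (rule Hm1_norm_abs_le)
    fix h assume h: "h \<in> H10" "H1_norm h \<le> 1"
    have hn: "L2_norm h \<le> 1" using H1_norm_ge(1)[of h] h(2) by linarith
    have "F s h - F t h = (\<integral>x. (f0 x + s * g x) * h x - (f0 x + t * g x) * h x \<partial>I01)"
      unfolding F_def by (intro Bochner_Integration.integral_diff[symmetric] L2_mult_integrable fL HL h)
    also have "\<dots> = (s - t) * (\<integral>x. g x * h x \<partial>I01)" by (subst integral_mult_right_zero[symmetric]) (simp add: algebra_simps)
    finally have "\<bar>F s h - F t h\<bar> = \<bar>s - t\<bar> * \<bar>\<integral>x. g x * h x \<partial>I01\<bar>" by (simp add: abs_mult)
    also have "\<dots> \<le> \<bar>s - t\<bar> * L2_norm g"
    proof (rule mult_left_mono)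
      show "\<bar>\<integral>x. g x * h x \<partial>I01\<bar> \<le> L2_norm g"
        using L2_Cauchy_Schwarz[OF g HL[OF h(1)]] mult_left_mono[OF hn L2_norm_nonneg[of g]] by linarith
    qed simp
    finally show "\<bar>F s h - F t h\<bar> \<le> \<bar>s - t\<bar> * L2_norm g" .
  qed
  have "(\<lambda>t x. f0 x + t * g x, \<lambda>t x. 0, \<lambda>t. g) \<in> admissible f0 f1"
  proof (rule admissibleI[OF B])
    show "continuous_Hm1 F" unfolding continuous_Hm1_def
    proof (intro ballI conjI Fm)
      fix t :: real assume "t \<in> {0..1}"
      have "((\<lambda>s. \<bar>s - t\<bar> * L2_norm g) \<longlongrightarrow> \<bar>t - t\<bar> * L2_norm g) (at t within {0..1})" by (intro tendsto_intros)
      then have "((\<lambda>s. \<bar>s - t\<bar> * L2_norm g) \<longlongrightarrow> 0) (at t within {0..1})" by simp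
      then show "((\<lambda>s. Hm1_norm (\<lambda>g. F s g - F t g)) \<longlongrightarrow> 0) (at t within {0..1})"
        by (rule Lim_null_comparison[rotated]) (use Fd in \<open>auto intro!: always_eventually\<close>)
    qed
    show "AE t in I01. represents_Hm1 (F t) (\<lambda>x. f0 x + t * g x)" by (simp add: represents_Hm1_def F_def)
    show "represents_Hm1 (F 0) f0" "represents_Hm1 (F 1) f1" by (simp_all add: represents_Hm1_def F_def g_def)
    show "weak_solution f0 f1 (\<lambda>t x. f0 x + t * g x) (\<lambda>t x. 0) (\<lambda>t. g)"
      unfolding weak_solution_iff[OF B]
    proof
      fix \<phi> assume \<phi>: "\<phi> \<in> smooth_square"
      obtain \<phi>t \<phi>x where \<phi>': "cont_square \<phi>" "cont_square \<phi>t"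
        "\<And>t x. t \<in> {0..1} \<Longrightarrow> x \<in> {0..1} \<Longrightarrow> ((\<lambda>s. \<phi> s x) has_real_derivative \<phi>t t x) (at t within {0..1})"
        "\<And>t x. t \<in> {0<..<1} \<Longrightarrow> x \<in> {0<..<1} \<Longrightarrow> deriv (\<lambda>s. \<phi> s x) t = \<phi>t t x"
        by (rule smooth_square_derivs[OF \<phi>]) blast
      define P where "P h t = (\<integral>x. h x * \<phi> t x \<partial>I01)" for h :: "real \<Rightarrow> real" and t
      define Q where "Q h t = (\<integral>x. h x * \<phi>t t x \<partial>I01)" for h :: "real \<Rightarrow> real" and t
      have D: "(P h has_real_derivative Q h t) (at t within {0..1})" if "h \<in> L2" "t \<in> {0..1}" for h t
        unfolding P_def[abs_def] Q_def by (rule spatial_integral_DERIV[OF that(1) \<phi>'(1,2,3) that(2)])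
      have c: "continuous_on {0..1} (P h)" "continuous_on {0..1} (Q h)" if "h \<in> L2" for h
        unfolding P_def[abs_def] Q_def[abs_def] by (intro spatial_integral_continuous that \<phi>')+
      \<comment> \<open>The pairing of the path with \<phi> and its derivative by the product rule;
        the integral of the derivative over time is the weak equation for v = 0.\<close>
      let ?W = "\<lambda>t. P f0 t + t * P g t" and ?W' = "\<lambda>t. (Q f0 t + t * Q g t) + P g t"
      have "?W 1 = ?W 0 + prim ?W' 1"
        by (rule prim_deriv[where w="?W"])
          (auto intro!: continuous_intros c f0 g derivative_eq_intros D)
      moreover have "prim ?W' 1 = (\<integral>t. (Q f0 t + t * Q g t) \<partial>I01) + (\<integral>t. P g t \<partial>I01)"
        unfolding prim_ge_1[OF order_refl]
        by (intro Bochner_Integration.integral_add L2_integrable L2_continuous continuous_intros c f0 g)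
      moreover have "(\<integral>t. weak_form_time (\<lambda>x. f0 x + t * g x) \<phi> t \<partial>I01) = (\<integral>t. (Q f0 t + t * Q g t) \<partial>I01)"
      proof (rule Bochner_Integration.integral_cong[OF refl])
        fix t :: real assume t: "t \<in> space I01"
        then have t': "t \<in> {0..1}" by auto
        have i: "integrable I01 (\<lambda>x. h x * \<phi>t t x)" if "h \<in> L2" for h
          by (intro L2_mult_integrable that L2_continuous cont_square_slice(1)[OF \<phi>'(2) t'])
        have "weak_form_time (\<lambda>x. f0 x + t * g x) \<phi> t = (\<integral>x. f0 x * \<phi>t t x + t * (g x * \<phi>t t x) \<partial>I01)"
          unfolding weak_form_time_def using t \<phi>'(4) by (intro Bochner_Integration.integral_cong) (auto simp: algebra_simps)
        also have "\<dots> = Q f0 t + t * Q g t" unfolding Q_def using i[OF f0] i[OF g] by simp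
        finally show "weak_form_time (\<lambda>x. f0 x + t * g x) \<phi> t = Q f0 t + t * Q g t" .
      qed
      moreover have "(\<integral>t. weak_form_rhs (\<lambda>x. f0 x + t * g x) (\<lambda>x. 0) g (\<phi> t) \<partial>I01) = (\<integral>t. P g t \<partial>I01)"
      proof (rule Bochner_Integration.integral_cong[OF refl])
        fix t :: real
        assume t: "t \<in> space I01"
        \<comment> \<open>Scaling by 0 disposes of \<open>wderiv\<close> of the zero function, which
          is known to be zero only almost everywhere.\<close>
        have "weak_form_rhs (\<lambda>x. f0 x + t * g x) (\<lambda>x. 0 * 0) (\<lambda>x. 0 * g x) (\<phi> t) = 0 * weak_form_rhs (\<lambda>x. f0 x + t * g x) (\<lambda>x. 0) g (\<phi> t)"
          using t by (intro weak_form_rhs_scale[where v="\<lambda>x. 0"] zero_H2_H10 fL cont_square_slice(1)[OF \<phi>'(1)]) auto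
        then have "(\<integral>x. (f0 x + t * g x) * \<phi> t x * wderiv (\<lambda>x. 0) x \<partial>I01) = 0"
          by (simp add: weak_form_rhs_def)
        then show "weak_form_rhs (\<lambda>x. f0 x + t * g x) (\<lambda>x. 0) g (\<phi> t) = P g t"
          by (simp add: weak_form_rhs_def P_def mult.commute)
      qed
      moreover have "(\<integral>x. f1 x * \<phi> 1 x \<partial>I01) = P f0 1 + P g 1"
      proof -
        have i: "integrable I01 (\<lambda>x. h x * \<phi> 1 x)" if "h \<in> L2" for h
          by (intro L2_mult_integrable that L2_continuous cont_square_slice(1)[OF \<phi>'(1)]) simp
        have "(\<integral>x. f1 x * \<phi> 1 x \<partial>I01) = (\<integral>x. f0 x * \<phi> 1 x + g x * \<phi> 1 x \<partial>I01)"
          by (simp add: g_def algebra_simps)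
        then show ?thesis unfolding P_def using i[OF f0] i[OF g] by simp
      qed
      ultimately show "- (\<integral>t. weak_form_time (\<lambda>x. f0 x + t * g x) \<phi> t \<partial>I01) + (\<integral>x. f1 x * \<phi> 1 x \<partial>I01) - (\<integral>x. f0 x * \<phi> 0 x \<partial>I01)
        = (\<integral>t. weak_form_rhs (\<lambda>x. f0 x + t * g x) (\<lambda>x. 0) g (\<phi> t) \<partial>I01)"
        by (simp add: P_def[of f0 0])
    qed
  qed
  then show ?thesis by (simp add: g_def[abs_def])
qed

section \<open>The infimum of lengths\<close>

lemma HV_length_nonneg: "\<kappa> > 0 \<Longrightarrow> l \<ge> 0 \<Longrightarrow> \<epsilon> > 0 \<Longrightarrow> 0 \<le> HV_length \<kappa> l \<epsilon> v z"
  unfolding HV_length_def by (intro integral_nonneg_AE AE_I2 real_sqrt_ge_zero mult_nonneg_nonneg integral_nonneg_AE) auto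

lemma d_HV_le:
  assumes "\<kappa> > 0" "l \<ge> 0" "\<epsilon> > 0" "(f, v, z) \<in> admissible f0 f1"
  shows "d_HV \<kappa> l \<epsilon> f0 f1 \<le> HV_length \<kappa> l \<epsilon> v z"
  unfolding d_HV_def using HV_length_nonneg[OF assms(1-3)]
  by (intro cINF_lower2[OF _ assms(4)]) (auto simp: bdd_below_def intro!: exI[of _ 0])

lemma d_HV_nonneg:
  assumes "\<kappa> > 0" "l \<ge> 0" "\<epsilon> > 0" "f0 \<in> L2" "f1 \<in> L2"
  shows "0 \<le> d_HV \<kappa> l \<epsilon> f0 f1"
  unfolding d_HV_def using HV_length_nonneg[OF assms(1-3)] linear_path[OF assms(4,5)]
  by (intro cINF_greatest) auto

lemma d_HV_less:
  assumes "f0 \<in> L2" "f1 \<in> L2" "d_HV \<kappa> l \<epsilon> f0 f1 < e"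
  obtains f v z where "(f, v, z) \<in> admissible f0 f1" "HV_length \<kappa> l \<epsilon> v z < e"
proof -
  have ne: "admissible f0 f1 \<noteq> {}" using linear_path[OF assms(1,2)] by blast
  have "\<exists>p\<in>(\<lambda>(f, v, z). HV_length \<kappa> l \<epsilon> v z) ` admissible f0 f1. p < e"
    using cInf_lessD[of "(\<lambda>(f, v, z). HV_length \<kappa> l \<epsilon> v z) ` admissible f0 f1" e] assms(3) ne unfolding d_HV_def by blast
  then show ?thesis using that by auto
qed

lemma d_HV_le_L2_norm:
  assumes "\<kappa> > 0" "l \<ge> 0" "\<epsilon> > 0" and f: "f0 \<in> L2" "f1 \<in> L2"
  shows "d_HV \<kappa> l \<epsilon> f0 f1 \<le> L2_norm (\<lambda>x. f1 x - f0 x)"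
proof -
  have "HV_length \<kappa> l \<epsilon> (\<lambda>t x. 0) (\<lambda>t x. f1 x - f0 x) = L2_norm (\<lambda>x. f1 x - f0 x) / sqrt 2"
    unfolding HV_length_speed using HV_speed_zero[OF L2_diff[OF f(2,1)], of \<kappa> l \<epsilon>] by simp
  also have "\<dots> \<le> L2_norm (\<lambda>x. f1 x - f0 x)"
    using mult_left_mono[of 1 "sqrt 2" "L2_norm (\<lambda>x. f1 x - f0 x)"] by (simp add: divide_le_eq)
  finally show ?thesis using d_HV_le[OF assms(1-3) linear_path[OF f]] by linarith
qed

lemma d_HV_commute_le:
  assumes k: "\<kappa> > 0" "l \<ge> 0" "\<epsilon> > 0" and f: "f0 \<in> L2" "f1 \<in> L2"
  shows "d_HV \<kappa> l \<epsilon> f1 f0 \<le> d_HV \<kappa> l \<epsilon> f0 f1"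
proof (rule field_le_epsilon)
  fix e :: real assume "0 < e"
  then obtain f v z where P: "(f, v, z) \<in> admissible f0 f1" "HV_length \<kappa> l \<epsilon> v z < d_HV \<kappa> l \<epsilon> f0 f1 + e"
    using d_HV_less[OF f, of \<kappa> l \<epsilon> "d_HV \<kappa> l \<epsilon> f0 f1 + e"] by auto
  obtain f' v' z' where "(f', v', z') \<in> admissible f1 f0" "HV_length \<kappa> l \<epsilon> v' z' = HV_length \<kappa> l \<epsilon> v z"
    by (rule admissible_reverse[OF P(1) k])
  then show "d_HV \<kappa> l \<epsilon> f1 f0 \<le> d_HV \<kappa> l \<epsilon> f0 f1 + e" using d_HV_le[OF k] P(2) by fastforce
qed

lemma d_HV_triangle:
  assumes k: "\<kappa> > 0" "l \<ge> 0" "\<epsilon> > 0" and f: "a \<in> L2" "b \<in> L2" "d \<in> L2"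
  shows "d_HV \<kappa> l \<epsilon> a d \<le> d_HV \<kappa> l \<epsilon> a b + d_HV \<kappa> l \<epsilon> b d"
proof (rule field_le_epsilon)
  fix e :: real assume "0 < e"
  obtain f1 v1 z1 where P1: "(f1, v1, z1) \<in> admissible a b" "HV_length \<kappa> l \<epsilon> v1 z1 < d_HV \<kappa> l \<epsilon> a b + e/2"
    using d_HV_less[OF f(1,2), of \<kappa> l \<epsilon> "d_HV \<kappa> l \<epsilon> a b + e/2"] \<open>0 < e\<close> by auto
  obtain f2 v2 z2 where P2: "(f2, v2, z2) \<in> admissible b d" "HV_length \<kappa> l \<epsilon> v2 z2 < d_HV \<kappa> l \<epsilon> b d + e/2"
    using d_HV_less[OF f(2,3), of \<kappa> l \<epsilon> "d_HV \<kappa> l \<epsilon> b d + e/2"] \<open>0 < e\<close> by auto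
  obtain f v z where "(f, v, z) \<in> admissible a d" "HV_length \<kappa> l \<epsilon> v z = HV_length \<kappa> l \<epsilon> v1 z1 + HV_length \<kappa> l \<epsilon> v2 z2"
    by (rule admissible_concat[OF P1(1) P2(1) k])
  then show "d_HV \<kappa> l \<epsilon> a d \<le> d_HV \<kappa> l \<epsilon> a b + d_HV \<kappa> l \<epsilon> b d + e"
    using d_HV_le[OF k, of f v z a d] P1(2) P2(2) by linarith
qed

text \<open>The point of the last estimate is that \<open>K\<close> does not depend on \<open>s\<close>; letting \<open>s \<rightarrow> 0\<close> only keeps high
  frequencies of \<open>f\<close> in the difference of the two energies.\<close>

lemma d_HV_estimates:
  assumes k: "\<kappa> > 0" "l \<ge> 0" "\<epsilon> > 0"
  defines "L0 \<equiv> min 1 (1 / (24 * sqrt (2 / \<epsilon>)))"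
  obtains K where "0 \<le> K"
    "\<And>f0 f1 L. f0 \<in> L2 \<Longrightarrow> f1 \<in> L2 \<Longrightarrow> (L2_norm f0)\<^sup>2 \<le> B \<Longrightarrow> d_HV \<kappa> l \<epsilon> f0 f1 < L \<Longrightarrow> L \<le> L0 \<Longrightarrow>
      (L2_norm f1)\<^sup>2 \<le> 2 * B + 16 \<and> (\<forall>j. \<bar>coef j f1 - coef j f0\<bar> \<le> (1 + real j * pi) * K * L) \<and>
      (\<forall>s. 0 < s \<longrightarrow> s \<le> 1 \<longrightarrow> ((L2_norm f1)\<^sup>2 - smooth_energy s f1) \<le> ((L2_norm f0)\<^sup>2 - smooth_energy s f0) + K * L)"
proof -
  define C where "C = sqrt (2 / \<epsilon>)"
  have C: "0 < C" using k by (simp add: C_def)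
  \<comment> \<open>An upper bound for \<open>M\<close>, in which 8 Zb^2 is at most 16 because Zb is
    at most \<open>sqrt 2\<close>. The absolute value keeps it nonnegative for every B.\<close>
  define M' where "M' = 2 * \<bar>B\<bar> + 16"
  define K1 where "K1 = 6 * M' * C + 2 * sqrt M' * sqrt 2"
  define K2 where "K2 = 2 * (2 * sqrt M' * C + sqrt 2)"
  have M': "0 \<le> M'" by (simp add: M'_def)
  have K0: "0 \<le> K1" "0 \<le> K2" using C M' by (auto simp: K1_def K2_def)
  have L0_def: "L0 = min 1 (1 / (24 * C))" by (simp add: L0_def C_def)
  show ?thesis
  \<comment> \<open>\<open>K1\<close> bounds the change of either energy and enters twice, for the
    norm and for its smoothing; \<open>K2\<close> belongs to the coefficients. Their combination
    covers both purposes.\<close>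
  proof (rule that[of "2 * K1 + K2"])
    show "0 \<le> 2 * K1 + K2" using K0 by simp
    fix f0 f1 L assume f: "f0 \<in> L2" "f1 \<in> L2" and B: "(L2_norm f0)\<^sup>2 \<le> B" and d: "d_HV \<kappa> l \<epsilon> f0 f1 < L" and L: "L \<le> L0"
    have L0: "0 < L" using d_HV_nonneg[OF k f] d by linarith
    obtain u v z where P: "(u, v, z) \<in> admissible f0 f1" and len: "HV_length \<kappa> l \<epsilon> v z < L" by (rule d_HV_less[OF f d])
    define Wb where "Wb = (\<integral>t. L2_norm (wderiv (wderiv (v t))) \<partial>I01)"
    define Zb where "Zb = (\<integral>t. L2_norm (z t) \<partial>I01)"
    have Wb: "Wb \<le> C * L"
      using HV_length_bounds(1)[OF P k] mult_left_mono[OF less_imp_le[OF len], of C] C unfolding Wb_def C_def by linarith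
    have Zb: "Zb \<le> sqrt 2 * L"
      unfolding Zb_def by (rule order_trans[OF HV_length_bounds(2)[OF P k] mult_left_mono[OF less_imp_le[OF len]]]) simp
    have nn: "0 \<le> Wb" "0 \<le> Zb" unfolding Wb_def Zb_def by (intro integral_nonneg_AE AE_I2 L2_norm_nonneg)+
    \<comment> \<open>The threshold \<open>L0\<close> is made for this smallness condition of
      \<open>energy_estimate\<close>; its other part, L \<le> 1, bounds \<open>Zb\<close>.\<close>
    have "C * L \<le> C * (1 / (24 * C))" using L C by (intro mult_left_mono) (auto simp: L0_def)
    then have small: "24 * Wb \<le> 1" using Wb C by simp
    have "sqrt 2 * L \<le> sqrt 2 * 1" using L by (intro mult_left_mono) (auto simp: L0_def)
    then have "Zb \<le> sqrt 2" using Zb by linarith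
    then have "Zb\<^sup>2 \<le> (sqrt 2)\<^sup>2" using nn by (intro power_mono)
    then have Z2: "8 * Zb\<^sup>2 \<le> 16" by simp
    define M where "M = 2 * (L2_norm f0)\<^sup>2 + 8 * Zb\<^sup>2"
    have M: "M \<le> M'" "0 \<le> M" using Z2 B by (auto simp: M_def M'_def)
    note e = energy_estimate[OF P f small[unfolded Wb_def], folded Wb_def Zb_def, folded M_def]
    note ed = energy_difference[OF P f small[unfolded Wb_def], folded Wb_def Zb_def, folded M_def]
    note cd = coef_difference[OF P f small[unfolded Wb_def], folded Wb_def Zb_def, folded M_def]
    have 1: "6 * M * Wb + 2 * sqrt M * Zb \<le> K1 * L"
    proof -
      have "6 * M * Wb \<le> 6 * M' * (C * L)" using M Wb nn by (intro mult_mono) auto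
      moreover have "2 * sqrt M * Zb \<le> 2 * sqrt M' * (sqrt 2 * L)" using M Zb nn by (intro mult_mono) auto
      ultimately show ?thesis by (simp add: K1_def algebra_simps)
    qed
    have 2: "2 * (2 * sqrt M * Wb + Zb) \<le> K2 * L"
    proof -
      have "2 * sqrt M * Wb \<le> 2 * sqrt M' * (C * L)" using M Wb nn by (intro mult_mono) auto
      then show ?thesis using Zb by (simp add: K2_def algebra_simps)
    qed
    have a: "(L2_norm f1)\<^sup>2 \<le> 2 * B + 16" using e(3) Z2 B unfolding M_def by linarith
    have b: "\<bar>coef j f1 - coef j f0\<bar> \<le> (1 + real j * pi) * (2 * K1 + K2) * L" for j
    proof -
      have "\<bar>coef j f1 - coef j f0\<bar> \<le> (1 + real j * pi) * (2 * (2 * sqrt M * Wb + Zb))"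
        using cd[of j] by (simp only: mult.assoc mult.left_commute[of "1 + real j * pi" 2])
      also have "\<dots> \<le> (1 + real j * pi) * ((2 * K1 + K2) * L)"
        using 2 mult_nonneg_nonneg[OF K0(1) less_imp_le[OF L0]] by (intro mult_left_mono) (auto simp: distrib_right)
      finally show ?thesis by (simp add: mult.assoc)
    qed
    have c: "((L2_norm f1)\<^sup>2 - smooth_energy s f1) \<le> ((L2_norm f0)\<^sup>2 - smooth_energy s f0) + (2 * K1 + K2) * L" if "0 < s" "s \<le> 1" for s
      using e(2)[OF that] ed 1 mult_nonneg_nonneg[OF K0(2) less_imp_le[OF L0]] by (simp add: distrib_right)
    show "(L2_norm f1)\<^sup>2 \<le> 2 * B + 16 \<and> (\<forall>j. \<bar>coef j f1 - coef j f0\<bar> \<le> (1 + real j * pi) * (2 * K1 + K2) * L) \<and>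
      (\<forall>s. 0 < s \<longrightarrow> s \<le> 1 \<longrightarrow> ((L2_norm f1)\<^sup>2 - smooth_energy s f1) \<le> ((L2_norm f0)\<^sup>2 - smooth_energy s f0) + (2 * K1 + K2) * L)"
      using a b c by blast
  qed
qed

text \<open>The norm bound by itself: it supplies a common B for the members of a Cauchy sequence
  before the constant K, which depends on B, is fixed.\<close>

lemma d_HV_ball:
  assumes k: "\<kappa> > 0" "l \<ge> 0" "\<epsilon> > 0" and f: "f0 \<in> L2" "f1 \<in> L2"
    and d: "d_HV \<kappa> l \<epsilon> f0 f1 < min 1 (1 / (24 * sqrt (2 / \<epsilon>)))"
  shows "(L2_norm f1)\<^sup>2 \<le> 2 * (L2_norm f0)\<^sup>2 + 16"
proof (rule d_HV_estimates[OF k, of "(L2_norm f0)\<^sup>2"])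
  fix K
  assume "\<And>g0 g1 L. g0 \<in> L2 \<Longrightarrow> g1 \<in> L2 \<Longrightarrow> (L2_norm g0)\<^sup>2 \<le> (L2_norm f0)\<^sup>2 \<Longrightarrow> d_HV \<kappa> l \<epsilon> g0 g1 < L \<Longrightarrow>
      L \<le> min 1 (1 / (24 * sqrt (2 / \<epsilon>))) \<Longrightarrow> (L2_norm g1)\<^sup>2 \<le> 2 * (L2_norm f0)\<^sup>2 + 16 \<and>
      (\<forall>j. \<bar>coef j g1 - coef j g0\<bar> \<le> (1 + real j * pi) * K * L) \<and>
      (\<forall>s. 0 < s \<longrightarrow> s \<le> 1 \<longrightarrow> (L2_norm g1)\<^sup>2 - smooth_energy s g1 \<le> (L2_norm g0)\<^sup>2 - smooth_energy s g0 + K * L)"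
  from this[OF f order_refl d order_refl] show ?thesis by (rule conjunct1)
qed

section \<open>Separation of points and Cauchy sequences\<close>

lemma coef_eq_imp_AE_eq:
  assumes f: "f \<in> L2" and g: "g \<in> L2" and "\<And>j. coef j f = coef j g"
  shows "AE x in I01. f x = g x"
proof -
  have D: "(\<lambda>x. f x - g x) \<in> L2" by (intro L2_diff f g)
  have "(\<lambda>k. 0::real) sums (L2_norm (\<lambda>x. f x - g x))\<^sup>2" using parseval[OF D] assms(3) by (simp add: coef_diff[OF f g])
  then have "(L2_norm (\<lambda>x. f x - g x))\<^sup>2 = 0" using sums_unique2 sums_zero by blast
  then have "AE x in I01. f x - g x = 0" using L2_norm_eq_0_iff[OF D] by simp
  then show ?thesis by eventually_elim simp
qed

text \<open>At distance 0 every small L > 0 may be inserted into \<open>d_HV_estimates\<close>, so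
  the difference of the j-th coefficients is at most a constant times arbitrarily small
  numbers.\<close>

lemma d_HV_eq_0_imp:
  assumes k: "\<kappa> > 0" "l \<ge> 0" "\<epsilon> > 0" and f: "f0 \<in> L2" "f1 \<in> L2" and d: "d_HV \<kappa> l \<epsilon> f0 f1 = 0"
  shows "AE x in I01. f0 x = f1 x"
proof (rule coef_eq_imp_AE_eq[OF f])
  fix j
  define L0 where "L0 = min 1 (1 / (24 * sqrt (2 / \<epsilon>)))"
  have L0: "0 < L0" using k by (simp add: L0_def)
  obtain K where K: "0 \<le> K" and est: "\<And>L. 0 < L \<Longrightarrow> L \<le> L0 \<Longrightarrow> \<bar>coef j f1 - coef j f0\<bar> \<le> (1 + real j * pi) * K * L"
    by (rule d_HV_estimates[OF k, folded L0_def, of "(L2_norm f0)\<^sup>2"]) (use f d in auto)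
  have "\<bar>coef j f1 - coef j f0\<bar> \<le> 0 + e" if "0 < e" for e
  proof -
    define c where "c = (1 + real j * pi) * K"
    have c: "0 \<le> c" using K by (simp add: c_def)
    define L where "L = min L0 (e / (c + 1))"
    have "0 < L" "L \<le> L0" using L0 that c by (auto simp: L_def)
    then have "\<bar>coef j f1 - coef j f0\<bar> \<le> c * L" unfolding c_def by (rule est)
    also have "c * L \<le> c * (e / (c + 1))" using c by (intro mult_left_mono) (auto simp: L_def)
    also have "\<dots> \<le> e" using c that by (simp add: divide_le_eq field_simps)
    finally show ?thesis by simp
  qed
  then have "\<bar>coef j f1 - coef j f0\<bar> \<le> 0" by (rule field_le_epsilon)
  then show "coef j f0 = coef j f1" by simp
qed

lemma tail_le_smooth_energy:
  assumes f: "f \<in> L2" and J: "1 \<le> s * (real J * pi)" and s: "0 < s"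
  shows "(L2_norm f)\<^sup>2 - (\<Sum>k<J. (coef k f)\<^sup>2) \<le> 2 * ((L2_norm f)\<^sup>2 - smooth_energy s f)"
proof -
  define t where "t k = (if k < J then (coef k f)\<^sup>2 else 0)" for k
  have t: "t sums (\<Sum>k<J. (coef k f)\<^sup>2)"
    using sums_If_finite[of "\<lambda>k. k < J" "\<lambda>k. (coef k f)\<^sup>2"] by (simp add: t_def[abs_def] lessThan_def)
  have le: "(coef k f)\<^sup>2 - t k \<le> 2 * ((coef k f)\<^sup>2 - smooth_weight s k * (coef k f)\<^sup>2)" for k
  proof (cases "k < J")
    case True
    have "smooth_weight s k * (coef k f)\<^sup>2 \<le> 1 * (coef k f)\<^sup>2" by (intro mult_right_mono smooth_weight_le_1) simp
    then show ?thesis using True by (simp add: t_def)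
  next
    case False
    have "s * (real J * pi) \<le> s * (real k * pi)" using False s by (intro mult_left_mono mult_right_mono) auto
    then have "1\<^sup>2 \<le> (s * (real k * pi))\<^sup>2" using J by (intro power_mono) auto
    then have "smooth_weight s k \<le> 1 / 2" unfolding smooth_weight_def by (intro divide_left_mono) (auto simp: power_mult_distrib)
    then have "smooth_weight s k * (coef k f)\<^sup>2 \<le> 1 / 2 * (coef k f)\<^sup>2" by (intro mult_right_mono) simp_all
    then show ?thesis using False by (simp add: t_def)
  qed
  show ?thesis
    by (rule sums_le[OF le sums_diff[OF parseval[OF f] t] sums_mult[OF sums_diff[OF parseval[OF f] smooth_energy_sums[OF f]]]])
qed

lemma d_HV_Cauchy_imp_L2_Cauchy:
  fixes f :: "nat \<Rightarrow> real \<Rightarrow> real"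
  assumes k: "\<kappa> > 0" "l \<ge> 0" "\<epsilon> > 0" and f: "\<And>n. f n \<in> L2"
    and C: "\<And>\<delta>. 0 < \<delta> \<Longrightarrow> \<exists>N. \<forall>m\<ge>N. \<forall>n\<ge>N. d_HV \<kappa> l \<epsilon> (f m) (f n) < \<delta>" and e: "0 < e"
  shows "\<exists>N. \<forall>m\<ge>N. \<forall>n\<ge>N. L2_norm (\<lambda>x. f m x - f n x) < e"
proof -
  define L0 where "L0 = min 1 (1 / (24 * sqrt (2 / \<epsilon>)))"
  have L0: "0 < L0" using k by (simp add: L0_def)
  obtain N0 where N0: "\<And>m n. m \<ge> N0 \<Longrightarrow> n \<ge> N0 \<Longrightarrow> d_HV \<kappa> l \<epsilon> (f m) (f n) < L0" using C[OF L0] by blast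
  define B where "B = 2 * (L2_norm (f N0))\<^sup>2 + 16"
  have B: "(L2_norm (f m))\<^sup>2 \<le> B" if "m \<ge> N0" for m
  proof -
    have "d_HV \<kappa> l \<epsilon> (f N0) (f m) < L0" by (rule N0) (use that in auto)
    then show ?thesis unfolding B_def L0_def by (rule d_HV_ball[OF k f f])
  qed
  obtain K where K: "0 \<le> K" and est: "\<And>f0 f1 L. f0 \<in> L2 \<Longrightarrow> f1 \<in> L2 \<Longrightarrow> (L2_norm f0)\<^sup>2 \<le> B \<Longrightarrow> d_HV \<kappa> l \<epsilon> f0 f1 < L \<Longrightarrow> L \<le> L0 \<Longrightarrow>
      (L2_norm f1)\<^sup>2 \<le> 2 * B + 16 \<and> (\<forall>j. \<bar>coef j f1 - coef j f0\<bar> \<le> (1 + real j * pi) * K * L) \<and>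
      (\<forall>s. 0 < s \<longrightarrow> s \<le> 1 \<longrightarrow> ((L2_norm f1)\<^sup>2 - smooth_energy s f1) \<le> ((L2_norm f0)\<^sup>2 - smooth_energy s f0) + K * L)"
    by (rule d_HV_estimates[OF k, folded L0_def, of B]) (rule that)
  \<comment> \<open>The final bound is 17 \<eta>: \<eta> from the low modes and 16 \<eta> from two
    remainders of norm at most \<open>sqrt (4 * \<eta>)\<close> each.\<close>
  define \<eta> where "\<eta> = e\<^sup>2 / 32"
  have \<eta>: "0 < \<eta>" using e by (simp add: \<eta>_def)
  define \<delta> where "\<delta> = min L0 (\<eta> / (K + 1))"
  have \<delta>: "0 < \<delta>" "\<delta> \<le> L0" using L0 \<eta> K by (auto simp: \<delta>_def)
  have "K * \<delta> \<le> K * (\<eta> / (K + 1))" using K by (intro mult_left_mono) (auto simp: \<delta>_def)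
  also have "\<dots> \<le> \<eta>" using K \<eta> by (simp add: divide_le_eq field_simps)
  finally have K\<delta>: "K * \<delta> \<le> \<eta>" .
  obtain N1 where N1: "\<And>m n. m \<ge> N1 \<Longrightarrow> n \<ge> N1 \<Longrightarrow> d_HV \<kappa> l \<epsilon> (f m) (f n) < \<delta>" using C[OF \<delta>(1)] by blast
  define N2 where "N2 = max N0 N1"
  \<comment> \<open>The scale s is chosen for the single function \<open>f N2\<close>; the estimate,
    uniform in s, hands its small high-frequency energy on to all later members.\<close>
  obtain i where i: "\<bar>smooth_energy (1 / real (Suc i)) (f N2) - (L2_norm (f N2))\<^sup>2\<bar> < \<eta>"
    using LIMSEQ_D[OF smooth_energy_tendsto[OF f[of N2]] \<eta>] by auto
  define s where "s = 1 / real (Suc i)"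
  have s: "0 < s" "s \<le> 1" by (auto simp: s_def)
  have high: "(L2_norm (f m))\<^sup>2 - smooth_energy s (f m) \<le> 2 * \<eta>" if "m \<ge> N2" for m
  proof -
    have "(L2_norm (f m))\<^sup>2 - smooth_energy s (f m) \<le> (L2_norm (f N2))\<^sup>2 - smooth_energy s (f N2) + K * \<delta>"
      using est[OF f[of N2] f[of m] B N1 \<delta>(2)] that s by (auto simp: N2_def)
    then show ?thesis using i K\<delta> unfolding s_def by linarith
  qed
  \<comment> \<open>This is 1 / s, so that s J \<pi> = \<pi> exceeds 1.\<close>
  define J where "J = Suc i"
  have J: "1 \<le> s * (real J * pi)" using pi_gt3 by (simp add: s_def J_def)
  have tail: "L2_norm (\<lambda>x. f m x - partial J (f m) x) \<le> sqrt (4 * \<eta>)" if "m \<ge> N2" for m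
    using tail_le_smooth_energy[OF f J s(1), of m] high[OF that] by (intro real_le_rsqrt) (simp add: pythagoras[OF f])
  define c where "c = (1 + real J * pi) * K"
  have c: "0 \<le> c" using K by (simp add: c_def)
  \<comment> \<open>With J fixed, the low modes can be made small: J squared coefficients of at most
    \<eta> / J each.\<close>
  define \<delta>' where "\<delta>' = min L0 (sqrt (\<eta> / real J) / (c + 1))"
  have \<delta>': "0 < \<delta>'" "\<delta>' \<le> L0" using L0 \<eta> c by (auto simp: \<delta>'_def J_def)
  have "c * \<delta>' \<le> c * (sqrt (\<eta> / real J) / (c + 1))" using c by (intro mult_left_mono) (auto simp: \<delta>'_def)
  also have "\<dots> = c / (c + 1) * sqrt (\<eta> / real J)" by simp
  also have "\<dots> \<le> 1 * sqrt (\<eta> / real J)" using c \<eta> by (intro mult_right_mono) (auto simp: divide_le_eq)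
  finally have c\<delta>: "c * \<delta>' \<le> sqrt (\<eta> / real J)" by simp
  obtain N3 where N3: "\<And>m n. m \<ge> N3 \<Longrightarrow> n \<ge> N3 \<Longrightarrow> d_HV \<kappa> l \<epsilon> (f m) (f n) < \<delta>'" using C[OF \<delta>'(1)] by blast
  have "L2_norm (\<lambda>x. f m x - f n x) < e" if mn: "m \<ge> max N2 N3" "n \<ge> max N2 N3" for m n
  proof -
    have mn': "m \<ge> N2" "n \<ge> N2" "m \<ge> N3" "n \<ge> N3" "n \<ge> N0" using mn by (auto simp: N2_def)
    define g where "g x = f m x - f n x" for x
    have g: "g \<in> L2" unfolding g_def[abs_def] by (intro L2_diff f)
    have "(coef j g)\<^sup>2 \<le> \<eta> / real J" if "j < J" for j
    proof -
      have "\<bar>coef j (f m) - coef j (f n)\<bar> \<le> (1 + real j * pi) * K * \<delta>'"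
        using est[OF f[of n] f[of m] B[OF mn'(5)] N3[OF mn'(4,3)] \<delta>'(2)] by blast
      also have "\<dots> \<le> c * \<delta>'"
        using that K \<delta>'(1) unfolding c_def by (intro mult_right_mono add_left_mono) auto
      finally have "\<bar>coef j g\<bar> \<le> sqrt (\<eta> / real J)" using c\<delta> by (simp add: g_def[abs_def] coef_diff[OF f f])
      then have "\<bar>coef j g\<bar>\<^sup>2 \<le> (sqrt (\<eta> / real J))\<^sup>2" by (intro power_mono) auto
      then show ?thesis using \<eta> by simp
    qed
    then have "(\<Sum>j<J. (coef j g)\<^sup>2) \<le> (\<Sum>j<J. \<eta> / real J)" by (intro sum_mono) auto
    also have "\<dots> = \<eta>" by (simp add: J_def)
    finally have low: "(\<Sum>j<J. (coef j g)\<^sup>2) \<le> \<eta>" .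
    define a where "a k x = f k x - partial J (f k) x" for k x
    have a: "a k \<in> L2" for k unfolding a_def[abs_def] by (intro L2_diff f partial_L2)
    have ta: "L2_norm (a k) \<le> sqrt (4 * \<eta>)" if "k \<ge> N2" for k
      using tail[OF that] by (simp only: a_def[abs_def])
    \<comment> \<open>Partial sums are linear, so the remainder of the difference is the difference
      of the remainders.\<close>
    have "(\<lambda>x. g x - partial J g x) = (\<lambda>x. a m x + (- 1) * a n x)"
      by (simp add: g_def[abs_def] a_def partial_def coef_diff[OF f f] left_diff_distrib sum_subtractf fun_eq_iff)
    then have "L2_norm (\<lambda>x. g x - partial J g x) \<le> L2_norm (a m) + L2_norm (\<lambda>x. (- 1) * a n x)"
      using L2_norm_triangle[OF a[of m] L2_cmult[OF a[of n], of "-1"]] by (simp only:)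
    also have "\<dots> \<le> sqrt (4 * \<eta>) + sqrt (4 * \<eta>)"
      using ta[OF mn'(1)] ta[OF mn'(2)] by simp
    finally have "(L2_norm (\<lambda>x. g x - partial J g x))\<^sup>2 \<le> (2 * sqrt (4 * \<eta>))\<^sup>2" by (intro power_mono) auto
    then have "(L2_norm (\<lambda>x. g x - partial J g x))\<^sup>2 \<le> 16 * \<eta>" using \<eta> by (simp add: power_mult_distrib)
    then have "(L2_norm g)\<^sup>2 \<le> 17 * \<eta>" using pythagoras[OF g, of J] low by linarith
    also have "\<dots> < e\<^sup>2" using e by (simp add: \<eta>_def)
    finally have "L2_norm g < e" by (rule power2_less_imp_less) (use e in simp)
    then show ?thesis by (simp add: g_def[abs_def])
  qed
  then show ?thesis by blast
qed

section \<open>Classes modulo null sets and completeness\<close>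

lemma L2_class_eq_iff:
  assumes f: "f \<in> L2" and g: "g \<in> L2"
  shows "L2_class f = L2_class g \<longleftrightarrow> (AE x in I01. f x = g x)"
proof
  assume "L2_class f = L2_class g"
  then have "f \<in> L2_class g" using f by (auto simp: L2_class_def)
  then show "AE x in I01. f x = g x" by (simp add: L2_class_def)
next
  assume fg: "AE x in I01. f x = g x"
  have "(AE x in I01. h x = f x) \<longleftrightarrow> (AE x in I01. h x = g x)" for h
  proof
    assume "AE x in I01. h x = f x"
    with fg show "AE x in I01. h x = g x" by eventually_elim simp
  next
    assume "AE x in I01. h x = g x"
    with fg show "AE x in I01. h x = f x" by eventually_elim simp
  qed
  then show "L2_class f = L2_class g" by (simp add: L2_class_def)
qed

theorem Metric_space_dist_HV:
  assumes k: "\<kappa> > 0" "l \<ge> 0" "\<epsilon> > 0"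
  shows "Metric_space L2_space (dist_HV \<kappa> l \<epsilon>)"
proof
  have comm: "d_HV \<kappa> l \<epsilon> f g = d_HV \<kappa> l \<epsilon> g f" if "f \<in> L2" "g \<in> L2" for f g
    using d_HV_commute_le[OF k that] d_HV_commute_le[OF k that(2,1)] by simp
  show "0 \<le> dist_HV \<kappa> l \<epsilon> x y" for x y
  proof (cases "x \<in> L2_space \<and> y \<in> L2_space")
    case True
    then obtain f g where "x = L2_class f" "f \<in> L2" "y = L2_class g" "g \<in> L2" by (auto simp: L2_space_def)
    then show ?thesis using d_HV_nonneg[OF k] by (simp add: dist_HV_L2_class)
  next
    case False
    then show ?thesis by (auto simp: dist_HV_def)
  qed
  show "dist_HV \<kappa> l \<epsilon> x y = dist_HV \<kappa> l \<epsilon> y x" for x y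
  proof (cases "x \<in> L2_space \<and> y \<in> L2_space")
    case True
    then obtain f g where "x = L2_class f" "f \<in> L2" "y = L2_class g" "g \<in> L2" by (auto simp: L2_space_def)
    then show ?thesis using comm by (simp add: dist_HV_L2_class)
  next
    case False
    then show ?thesis unfolding dist_HV_def by auto
  qed
  show "dist_HV \<kappa> l \<epsilon> x y = 0 \<longleftrightarrow> x = y" if xy: "x \<in> L2_space" "y \<in> L2_space" for x y
  proof -
    obtain f g where fg: "x = L2_class f" "f \<in> L2" "y = L2_class g" "g \<in> L2" using xy by (auto simp: L2_space_def)
    have "d_HV \<kappa> l \<epsilon> f g = 0 \<longleftrightarrow> (AE x in I01. f x = g x)"
    proof
      assume "AE x in I01. f x = g x"
      then have "AE x in I01. g x - f x = 0" by eventually_elim simp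
      then have "L2_norm (\<lambda>x. g x - f x) = 0" using L2_norm_eq_0_iff[OF L2_diff[OF fg(4,2)]] by simp
      then show "d_HV \<kappa> l \<epsilon> f g = 0" using d_HV_le_L2_norm[OF k fg(2,4)] d_HV_nonneg[OF k fg(2,4)] by simp
    qed (rule d_HV_eq_0_imp[OF k fg(2,4)])
    then show ?thesis using fg by (simp add: dist_HV_L2_class L2_class_eq_iff)
  qed
  show "dist_HV \<kappa> l \<epsilon> x z \<le> dist_HV \<kappa> l \<epsilon> x y + dist_HV \<kappa> l \<epsilon> y z"
    if xyz: "x \<in> L2_space" "y \<in> L2_space" "z \<in> L2_space" for x y z
  proof -
    obtain f g h where "x = L2_class f" "f \<in> L2" "y = L2_class g" "g \<in> L2" "z = L2_class h" "h \<in> L2"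
      using xyz by (auto simp: L2_space_def)
    then show ?thesis using d_HV_triangle[OF k] by (simp add: dist_HV_L2_class)
  qed
qed

theorem proposition2p14:
  fixes \<kappa> l \<epsilon> :: real
  assumes "\<kappa> > 0" and "l \<ge> 0" and "\<epsilon> > 0"
  shows "Metric_space L2_space (dist_HV \<kappa> l \<epsilon>) \<and>
         Metric_space.mcomplete L2_space (dist_HV \<kappa> l \<epsilon>)"
proof
  show M: "Metric_space L2_space (dist_HV \<kappa> l \<epsilon>)" by (rule Metric_space_dist_HV[OF assms])
  interpret Metric_space L2_space "dist_HV \<kappa> l \<epsilon>" by (rule M)
  show mcomplete
    unfolding mcomplete_def
  proof (intro allI impI)
    fix \<sigma> assume \<sigma>: "MCauchy \<sigma>"
    then have "\<sigma> n \<in> L2_space" for n by (auto simp: MCauchy_def)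
    then have "\<exists>g\<in>L2. \<sigma> n = L2_class g" for n by (auto simp: L2_space_def)
    then obtain f where f: "\<And>n. f n \<in> L2" "\<And>n. \<sigma> n = L2_class (f n)" by metis
    have C: "\<exists>N. \<forall>m\<ge>N. \<forall>n\<ge>N. d_HV \<kappa> l \<epsilon> (f m) (f n) < \<delta>" if "0 < \<delta>" for \<delta>
      using \<sigma> that f(2) by (simp add: MCauchy_def dist_HV_L2_class[OF f(1) f(1)])
    obtain g where g: "g \<in> L2" "(\<lambda>n. L2_norm (\<lambda>x. f n x - g x)) \<longlonglongrightarrow> 0"
      by (rule L2_complete[OF f(1) d_HV_Cauchy_imp_L2_Cauchy[OF assms f(1) C]])
    have gS: "L2_class g \<in> L2_space" using g(1) by (simp add: L2_space_def)
    have "(\<lambda>n. dist_HV \<kappa> l \<epsilon> (\<sigma> n) (L2_class g)) \<longlonglongrightarrow> 0"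
    proof (rule tendsto_sandwich[OF _ _ tendsto_const g(2)])
      show "eventually (\<lambda>n. dist_HV \<kappa> l \<epsilon> (\<sigma> n) (L2_class g) \<le> L2_norm (\<lambda>x. f n x - g x)) sequentially"
        using d_HV_le_L2_norm[OF assms f(1) g(1)]
        by (simp add: f(2) dist_HV_L2_class[OF f(1) g(1)] L2_norm_diff_commute[of "f _" g])
    qed simp
    then have "limitin mtopology \<sigma> (L2_class g) sequentially"
      unfolding limitin_metric_dist_null using gS f by (auto simp: L2_space_def)
    then show "\<exists>x. limitin mtopology \<sigma> x sequentially" by blast
  qed
qed

end
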